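(* Let $c:[0,L]\to\mathbb{S}^2$ be a rectifiable and open curve in $\mathbb{S}^2$ parametrized by arc length, and let $p>1$. Then $$\mathcal{F}_p(c)<\infty \iff c\in W^{2,p}([0,L],\mathbb{S}^2),$$ and in this case $$\mathcal{F}_p(c)=\int_c|k_{\mathbb{S}^2}|^p\,ds=\int_0^L\|\ddot{c}^\top(s)\|^p\,ds,$$ where $\mathcal{F}_p(c)$ is the $p$-curvature functional of $c$.
   Context: $\mathbb{S}^2$ is the unit sphere in $\mathbb{R}^3$, with geodesic distance $d_{\mathbb{S}^2}$; $\|\cdot\|$ is the Euclidean norm in $\mathbb{R}^3$. **Curves and inscribed polygonals.** A curve is a continuous map $c:[0,L]\to\mathbb{S}^2$; it is open if it is not closed, i.e. $c(0)\neq c(L)$. A polygonal $P$ inscribed in $c$, written $P\ll c$, is obtained from a finite partition $0=t_0<t_1<\dots<t_h=L$ such that consecutive points $c(t_i),c(t_{i+1})$ are distinct and not antipodal: $P(t_i)=c(t_i)$ for all $i$, and $P|_{[t_i,t_{i+1}]}$ is the minimal geodesic (great circle) arc from $c(t_i)$ to $c(t_{i+1})$. Its length is $\mathcal{L}(P)=\sum_{i=0}^{h-1}d_{\mathbb{S}^2}(c(t_i),c(t_{i+1}))$. The length of $c$ is $\mathcal{L}(c)=\sup\{\mathcal{L}(P): P\ll c\}$, and $c$ is rectifiable if $\mathcal{L}(c)<\infty$. Parametrized by arc length means that the length of $c|_{[s,t]}$ equals $t-s$ for all $0\le s\le t\le L$ (so $L=\mathcal{L}(c)$). **Modulus.** For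 $P\ll c$ with partition $0=t_0<\dots<t_h=L$, the modulus $\mu_c(P)$ is the maximum over $i=0,\dots,h-1$ of the geodesic diameter (diameter with respect to $d_{\mathbb{S}^2}$) of the arc $c([t_i,t_{i+1}])$. **$p$-rotation.** Let $P\ll c$ have vertices $P(t_0),\dots,P(t_h)$. Let $\bar\ell_i$ be the length of the edge $P|_{[t_i,t_{i+1}]}$, $i=0,\dots,h-1$; for each interior vertex $i=1,\dots,h-1$ let $\theta_i\in[0,\pi]$ be the turning angle at $P(t_i)$ (the angle between the incoming and the outgoing unit tangent vectors of the two edges at $P(t_i)$), and let $\ell_i=\min\{\bar\ell_{i-1},\bar\ell_i\}$. The curve $\gamma(P)$ is obtained from $P$ by replacing, near each interior vertex $P(t_i)$, the two sub-arcs of edges joining $P(t_i)$ to the points of the two adjacent edges at distance $\ell_i/2$ from $P(t_i)$ with the arc of constant geodesic curvature (an arc of a circle in $\mathbb{S}^2$, on the side of the corner) that is tangent to the two edges at those two points; if $\theta_i=0$ nothing is changed. The curve $\gamma(P)$ is $C^1$ and piecewise smooth. The $p$-rotation of $P$ is $$\mathbf{k}_p(P)=\int_{\gamma(P)}|k_{\mathbb{S}^2}(\gamma(P))|^p\,ds ,$$ the integral, with respect to arc length, of the $p$-th power of the absolute geodesic curvature of $\gamma(P)$. Explicitly, with $\Psi(\ell,\theta)=\sqrt{\sin^2(\ell/2)+\sin^2(\theta/2)\cos^2(\ell/2)}$, $$\mathbf{k}_p(P)=\sum_{i=1}^{h-1}2\arctan\!\left(\frac{\Psi(\ell_i,\theta_i)}{\cos(\theta_i/2)\cos(\ell_i/2)}\right)\cdot\frac{1}{\Psi(\ell_i,\theta_i)}\cdot\frac{\sin^p(\theta_i/2)}{(\cos(\theta_i/2)\sin(\ell_i/2))^{p-1}},$$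 where a term with $\theta_i=\pi$ is read as $+\infty$. **$p$-curvature functional.** For $p>1$, $$\mathcal{F}_p(c)=\inf\Bigl\{\liminf_{h\to\infty}\mathbf{k}_p(P_h)\ :\ \{P_h\}_h \text{ a sequence of polygonals inscribed in } c,\ \mu_c(P_h)\to 0\Bigr\}\in[0,+\infty].$$ **Sobolev class and geodesic curvature.** $W^{2,p}([0,L],\mathbb{S}^2)=\{u\in W^{2,p}([0,L],\mathbb{R}^3): \|u\|=1 \text{ a.e.}\}$. For $c\in W^{2,p}([0,L],\mathbb{S}^2)$ parametrized by arc length, $\ddot{c}^\top$ is the orthogonal projection of the second derivative $\ddot c$ onto the tangent plane $T_{c(s)}\mathbb{S}^2$, i.e. $\ddot c^\top=\ddot c+c$. The geodesic curvature is $k_{\mathbb{S}^2}=\ddot c\cdot \mathbf{u}$, where $\mathbf{u}=c\times\dot c$ is the unit conormal, and $|k_{\mathbb{S}^2}|=\|\ddot c^\top\|$ a.e.; $\int_c |k_{\mathbb{S}^2}|^p\,ds$ denotes $\int_0^L|k_{\mathbb{S}^2}(c(s))|^p\,ds$. *)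

theory Defs
  imports "HOL-Analysis.Analysis"
begin

unbundle cross3_syntax

text \<open>The unit sphere is \<open>sphere 0 1 :: (real^3) set\<close>.\<close>

definition sphere_dist :: "real^3 \<Rightarrow> real^3 \<Rightarrow> real" where
  "sphere_dist x y = arccos (x \<bullet> y)"

definition sphere_diameter :: "(real^3) set \<Rightarrow> real" where
  "sphere_diameter A = Sup {sphere_dist x y |x y. x \<in> A \<and> y \<in> A}"

text \<open>
  The geodesic curvature \<open>c'' \<bullet> (c \<times> c')\<close> at a point, for position \<open>x\<close>, unit velocity \<open>x'\<close> and
  acceleration \<open>x''\<close>.
\<close>
definition geod_curv :: "real^3 \<Rightarrow> real^3 \<Rightarrow> real^3 \<Rightarrow> real" where
  "geod_curv x x' x'' = x'' \<bullet> (x \<times> x')"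

definition tangent_proj :: "real^3 \<Rightarrow> real^3 \<Rightarrow> real^3" where
  "tangent_proj x v = v - (v \<bullet> x) *\<^sub>R x"


section \<open>Inscribed polygonals, length, modulus\<close>

text \<open>
  A polygonal inscribed in \<open>c : [a,b] \<rightarrow> S\<^sup>2\<close> is represented by its list of parameters
  \<open>a = t\<^sub>0 < \<dots> < t\<^sub>h = b\<close>; its list of vertices is \<open>map c ts\<close>, and consecutive vertices being
  distinct and not antipodal, the edges are determined by the vertices.
\<close>
definition inscribed :: "(real \<Rightarrow> real^3) \<Rightarrow> real \<Rightarrow> real \<Rightarrow> real list \<Rightarrow> bool" where
  "inscribed c a b ts \<longleftrightarrow>
     ts \<noteq> [] \<and> hd ts = a \<and> last ts = b \<and> sorted_wrt (<) ts \<and>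
     (\<forall>i. Suc i < length ts \<longrightarrow> c (ts ! Suc i) \<noteq> c (ts ! i) \<and> c (ts ! Suc i) \<noteq> - c (ts ! i))"

definition edge_len :: "(real^3) list \<Rightarrow> nat \<Rightarrow> real" where
  "edge_len V i = sphere_dist (V ! i) (V ! Suc i)"

definition polygon_length :: "(real^3) list \<Rightarrow> real" where
  "polygon_length V = (\<Sum>i<length V - 1. edge_len V i)"

definition curve_length :: "(real \<Rightarrow> real^3) \<Rightarrow> real \<Rightarrow> real \<Rightarrow> ennreal" where
  "curve_length c a b = (SUP ts \<in> {ts. inscribed c a b ts}. ennreal (polygon_length (map c ts)))"

definition rectifiable :: "(real \<Rightarrow> real^3) \<Rightarrow> real \<Rightarrow> real \<Rightarrow> bool" where
  "rectifiable c a b \<longleftrightarrow> curve_length c a b < \<infinity>"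

definition arc_length_parametrized :: "(real \<Rightarrow> real^3) \<Rightarrow> real \<Rightarrow> bool" where
  "arc_length_parametrized c L \<longleftrightarrow>
     (\<forall>s t. 0 \<le> s \<longrightarrow> s \<le> t \<longrightarrow> t \<le> L \<longrightarrow> curve_length c s t = ennreal (t - s))"

definition modulus :: "(real \<Rightarrow> real^3) \<Rightarrow> real list \<Rightarrow> real" where
  "modulus c ts = (MAX i \<in> {..<length ts - 1}. sphere_diameter (c ` {ts ! i .. ts ! Suc i}))"


section \<open>The smoothed curve and the p-rotation of a polygonal\<close>

text \<open>
  The arc-length parametrisation of the circle of constant (signed) geodesic curvature \<open>\<kappa>\<close> that
  starts at \<open>x\<close> with unit tangent \<open>u\<close>: the solution of \<open>g'' = - g + \<kappa> (g \<times> g')\<close> with \<open>g 0 = x\<close>,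
  \<open>g' 0 = u\<close> (see \<open>circle_arc_initial\<close> and \<open>geod_curv_circle_arc\<close> below).  For \<open>\<kappa> = 0\<close> it is the
  great circle \<open>cos s x + sin s u\<close>.  The circle closes up at \<open>s = 2 pi / sqrt (1 + \<kappa>\<^sup>2)\<close>.
\<close>
definition circle_arc :: "real^3 \<Rightarrow> real^3 \<Rightarrow> real \<Rightarrow> real \<Rightarrow> real^3" where
  "circle_arc x u \<kappa> s =
     (let \<omega> = sqrt (1 + \<kappa>\<^sup>2) in
        cos (\<omega> * s) *\<^sub>R x + (sin (\<omega> * s) / \<omega>) *\<^sub>R u +
        (\<kappa> * (1 - cos (\<omega> * s)) / \<omega>\<^sup>2) *\<^sub>R (\<kappa> *\<^sub>R x + x \<times> u))"

text \<open>Unit tangent at \<open>x\<close> of the minimal geodesic from \<open>x\<close> to \<open>y\<close>.\<close>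
definition geod_dir :: "real^3 \<Rightarrow> real^3 \<Rightarrow> real^3" where
  "geod_dir x y = sgn (tangent_proj x y)"

text \<open>The \<open>i\<close>-th edge, parametrised by arc length on \<open>{0..edge_len V i}\<close>.\<close>
definition edge :: "(real^3) list \<Rightarrow> nat \<Rightarrow> real \<Rightarrow> real^3" where
  "edge V i = circle_arc (V ! i) (geod_dir (V ! i) (V ! Suc i)) 0"

definition edge_tangent :: "(real^3) list \<Rightarrow> nat \<Rightarrow> real \<Rightarrow> real^3" where
  "edge_tangent V i s = vector_derivative (edge V i) (at s)"

definition turning_angle :: "(real^3) list \<Rightarrow> nat \<Rightarrow> real" where
  "turning_angle V i = arccos (edge_tangent V (i - 1) (edge_len V (i - 1)) \<bullet> edge_tangent V i 0)"

definition corner_len :: "(real^3) list \<Rightarrow> nat \<Rightarrow> real" where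
  "corner_len V i = min (edge_len V (i - 1)) (edge_len V i)"

text \<open>
  A smooth arc is a pair \<open>(g, \<rho>)\<close> of a unit speed curve \<open>g\<close> and its length \<open>\<rho>\<close>; only the restriction
  of \<open>g\<close> to \<open>{0..\<rho>}\<close> matters.

  The arc at the interior vertex \<open>i\<close> is given by the curvature \<open>\<kappa>\<close> and the length \<open>\<rho>\<close> of the unique arc of
  constant geodesic curvature, shorter than a full circle, that leaves edge \<open>i - 1\<close> tangentially at
  distance \<open>corner_len V i / 2\<close> before the vertex and joins edge \<open>i\<close> tangentially at the same distance
  after the vertex.  If the turning angle is zero this is the piece of geodesic it replaces
  (\<open>\<kappa> = 0\<close>).  No such arc exists if the turning angle is \<open>pi\<close>.
\<close>
definition corner_arc_start :: "(real^3) list \<Rightarrow> nat \<Rightarrow> real \<Rightarrow> real \<Rightarrow> real^3" where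
  "corner_arc_start V i =
     (let s = edge_len V (i - 1) - corner_len V i / 2
      in circle_arc (edge V (i - 1) s) (edge_tangent V (i - 1) s))"

definition is_corner_arc :: "(real^3) list \<Rightarrow> nat \<Rightarrow> real \<times> real \<Rightarrow> bool" where
  "is_corner_arc V i = (\<lambda>(\<kappa>, \<rho>).
     0 < \<rho> \<and> \<rho> < 2 * pi / sqrt (1 + \<kappa>\<^sup>2) \<and>
     corner_arc_start V i \<kappa> \<rho> = edge V i (corner_len V i / 2) \<and>
     vector_derivative (corner_arc_start V i \<kappa>) (at \<rho>) = edge_tangent V i (corner_len V i / 2))"

definition corner_piece :: "(real^3) list \<Rightarrow> nat \<Rightarrow> (real \<Rightarrow> real^3) \<times> real" where
  "corner_piece V i = (let (\<kappa>, \<rho>) = (THE a. is_corner_arc V i a) in (corner_arc_start V i \<kappa>, \<rho>))"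

text \<open>What is left of the \<open>i\<close>-th edge after the corners at its ends have been replaced.\<close>
definition edge_piece :: "(real^3) list \<Rightarrow> nat \<Rightarrow> (real \<Rightarrow> real^3) \<times> real" where
  "edge_piece V i =
     (let a = (if i = 0 then 0 else corner_len V i / 2);
          b = (if Suc (Suc i) = length V then 0 else corner_len V (Suc i) / 2)
      in (\<lambda>s. edge V i (a + s), edge_len V i - a - b))"

text \<open>The curve \<open>\<gamma>(P)\<close>, as the list of its smooth arcs in the order in which they are traversed.\<close>
definition smoothing :: "(real^3) list \<Rightarrow> ((real \<Rightarrow> real^3) \<times> real) list" where
  "smoothing V =
     edge_piece V 0 # concat (map (\<lambda>i. [corner_piece V i, edge_piece V i]) [1..<length V - 1])"

definition arc_energy :: "real \<Rightarrow> (real \<Rightarrow> real^3) \<times> real \<Rightarrow> ennreal" where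
  "arc_energy p = (\<lambda>(g, \<rho>).
     \<integral>\<^sup>+ s \<in> {0..\<rho>}. ennreal (\<bar>geod_curv (g s) (vector_derivative g (at s))
        (vector_derivative (\<lambda>t. vector_derivative g (at t)) (at s))\<bar> powr p) \<partial>lborel)"

text \<open>A corner with turning angle \<open>pi\<close> contributes \<open>\<infinity>\<close>.\<close>
definition p_rotation :: "real \<Rightarrow> (real^3) list \<Rightarrow> ennreal" where
  "p_rotation p V =
     (if \<exists>i. 1 \<le> i \<and> i < length V - 1 \<and> turning_angle V i = pi then \<infinity>
      else \<Sum>a\<leftarrow>smoothing V. arc_energy p a)"

definition p_curvature :: "real \<Rightarrow> (real \<Rightarrow> real^3) \<Rightarrow> real \<Rightarrow> ennreal" where
  "p_curvature p c L =
     (INF P \<in> {P :: nat \<Rightarrow> real list. (\<forall>h. inscribed c 0 L (P h)) \<and> (\<lambda>h. modulus c (P h)) \<longlonglongrightarrow> 0}.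
        liminf (\<lambda>h. p_rotation p (map c (P h))))"


section \<open>Sobolev maps into the sphere\<close>

definition test_functions :: "real \<Rightarrow> real \<Rightarrow> (real \<Rightarrow> real) set" where
  "test_functions a b =
     {\<phi>. (\<forall>n x. (deriv ^^ n) \<phi> differentiable (at x)) \<and>
         (\<exists>x y. a < x \<and> y < b \<and> (\<forall>s. s \<notin> {x..y} \<longrightarrow> \<phi> s = 0))}"

definition locally_integrable :: "real \<Rightarrow> real \<Rightarrow> (real \<Rightarrow> real^'n) \<Rightarrow> bool" where
  "locally_integrable a b u \<longleftrightarrow> (\<forall>x y. a < x \<longrightarrow> y < b \<longrightarrow> integrable (lebesgue_on {x..y}) u)"

text \<open>\<open>v\<close> is a \<open>k\<close>-th weak (distributional) derivative of \<open>u\<close> on the interval \<open>]a,b[\<close>.\<close>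
definition has_weak_derivative ::
  "real \<Rightarrow> real \<Rightarrow> nat \<Rightarrow> (real \<Rightarrow> real^'n) \<Rightarrow> (real \<Rightarrow> real^'n) \<Rightarrow> bool" where
  "has_weak_derivative a b k u v \<longleftrightarrow>
     locally_integrable a b u \<and> locally_integrable a b v \<and>
     (\<forall>\<phi> \<in> test_functions a b.
        (LINT s|lebesgue_on {a..b}. (deriv ^^ k) \<phi> s *\<^sub>R u s) =
        (-1) ^ k *\<^sub>R (LINT s|lebesgue_on {a..b}. \<phi> s *\<^sub>R v s))"

definition Lp_space :: "real \<Rightarrow> real \<Rightarrow> real \<Rightarrow> (real \<Rightarrow> real^'n) set" where
  "Lp_space p a b =
     {u. u \<in> borel_measurable (lebesgue_on {a..b}) \<and>
         integrable (lebesgue_on {a..b}) (\<lambda>s. norm (u s) powr p)}"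

definition Sobolev :: "nat \<Rightarrow> real \<Rightarrow> real \<Rightarrow> real \<Rightarrow> (real \<Rightarrow> real^'n) set" where
  "Sobolev k p a b =
     {u \<in> Lp_space p a b. \<forall>j\<in>{1..k}. \<exists>v\<in>Lp_space p a b. has_weak_derivative a b j u v}"

definition Sobolev_sphere :: "nat \<Rightarrow> real \<Rightarrow> real \<Rightarrow> real \<Rightarrow> (real \<Rightarrow> real^3) set" where
  "Sobolev_sphere k p a b =
     {u \<in> Sobolev k p a b. AE s in lebesgue_on {a..b}. norm (u s) = 1}"


section \<open>The smoothing arcs exist, and the explicit form of the p-rotation\<close>

lemma circle_arc_derivs:
  fixes x u :: "real^3" and \<kappa> :: real
  defines "\<omega> \<equiv> sqrt (1 + \<kappa>\<^sup>2)"
  shows "(circle_arc x u \<kappa> has_vector_derivative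
           (- \<omega> * sin (\<omega> * s)) *\<^sub>R x + cos (\<omega> * s) *\<^sub>R u +
           (\<kappa> * sin (\<omega> * s) / \<omega>) *\<^sub>R (\<kappa> *\<^sub>R x + x \<times> u)) (at s)"
    and "((\<lambda>t. vector_derivative (circle_arc x u \<kappa>) (at t)) has_vector_derivative
           (- \<omega>\<^sup>2 * cos (\<omega> * s)) *\<^sub>R x - (\<omega> * sin (\<omega> * s)) *\<^sub>R u +
           (\<kappa> * cos (\<omega> * s)) *\<^sub>R (\<kappa> *\<^sub>R x + x \<times> u)) (at s)"
proof -
  have w: "\<omega> > 0" by (simp add: \<omega>_def add_pos_nonneg)
  have 1: "(circle_arc x u \<kappa> has_vector_derivative
           (- \<omega> * sin (\<omega> * s)) *\<^sub>R x + cos (\<omega> * s) *\<^sub>R u +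
           (\<kappa> * sin (\<omega> * s) / \<omega>) *\<^sub>R (\<kappa> *\<^sub>R x + x \<times> u)) (at s)" for s
    unfolding circle_arc_def Let_def \<omega>_def[symmetric]
    by (rule has_vector_derivative_eq_rhs)
       (use w in \<open>auto intro!: derivative_eq_intros has_vector_derivative_scaleR simp: has_real_derivative_iff_has_vector_derivative[symmetric] power2_eq_square field_simps\<close>)
  show "(circle_arc x u \<kappa> has_vector_derivative
           (- \<omega> * sin (\<omega> * s)) *\<^sub>R x + cos (\<omega> * s) *\<^sub>R u +
           (\<kappa> * sin (\<omega> * s) / \<omega>) *\<^sub>R (\<kappa> *\<^sub>R x + x \<times> u)) (at s)" by (rule 1)
  show "((\<lambda>t. vector_derivative (circle_arc x u \<kappa>) (at t)) has_vector_derivative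
           (- \<omega>\<^sup>2 * cos (\<omega> * s)) *\<^sub>R x - (\<omega> * sin (\<omega> * s)) *\<^sub>R u +
           (\<kappa> * cos (\<omega> * s)) *\<^sub>R (\<kappa> *\<^sub>R x + x \<times> u)) (at s)"
    unfolding vector_derivative_at[OF 1]
    by (rule has_vector_derivative_eq_rhs)
       (use w in \<open>auto intro!: derivative_eq_intros has_vector_derivative_scaleR simp: has_real_derivative_iff_has_vector_derivative[symmetric] power2_eq_square field_simps\<close>)
qed

lemma cross_frame:
  fixes x u :: "real^3"
  assumes "norm x = 1" "norm u = 1" "x \<bullet> u = 0"
  shows "u \<times> (x \<times> u) = x" "(x \<times> u) \<times> x = u" "norm (x \<times> u) = 1"
        "x \<bullet> (x \<times> u) = 0" "u \<bullet> (x \<times> u) = 0"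
        "(x \<times> u) \<times> u = - x" "x \<times> (x \<times> u) = - u" "u \<times> x = - (x \<times> u)"
proof -
  have nx: "x \<bullet> x = 1" "u \<bullet> u = 1" using assms by (simp_all add: dot_square_norm)
  have L: "a \<times> (b \<times> c) = (a \<bullet> c) *\<^sub>R b - (a \<bullet> b) *\<^sub>R c" for a b c :: "real^3"
    by (rule Lagrange)
  show a: "u \<times> (x \<times> u) = x" using L nx assms by (simp add: inner_commute)
  show b: "x \<times> (x \<times> u) = - u" using L nx assms by (simp add: inner_commute)
  show "(x \<times> u) \<times> x = u" using b cross_skew[of "x \<times> u" x] by simp
  show "(x \<times> u) \<times> u = - x" using a cross_skew[of "x \<times> u" u] by simp
  show "x \<bullet> (x \<times> u) = 0" "u \<bullet> (x \<times> u) = 0" by (rule dot_cross_self)+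
  show "u \<times> x = - (x \<times> u)" by (rule cross_skew)
  have "(norm (x \<times> u))\<^sup>2 = 1" using norm_cross_dot[of x u] assms by simp
  then show "norm (x \<times> u) = 1" by (simp add: power2_eq_1_iff) (smt norm_ge_zero)
qed

lemma circle_arc_frame:
  fixes x u :: "real^3" and \<kappa> s :: real
  defines "\<omega> \<equiv> sqrt (1 + \<kappa>\<^sup>2)"
  defines "C \<equiv> cos (\<omega> * s)" and "S \<equiv> sin (\<omega> * s)"
  shows "circle_arc x u \<kappa> s =
           (1 - (1 - C) / \<omega>\<^sup>2) *\<^sub>R x + (S / \<omega>) *\<^sub>R u + (\<kappa> * ((1 - C) / \<omega>\<^sup>2)) *\<^sub>R (x \<times> u)"
    and "vector_derivative (circle_arc x u \<kappa>) (at s) =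
           (- (S / \<omega>)) *\<^sub>R x + C *\<^sub>R u + (\<kappa> * (S / \<omega>)) *\<^sub>R (x \<times> u)"
    and "vector_derivative (\<lambda>t. vector_derivative (circle_arc x u \<kappa>) (at t)) (at s) =
           (- C) *\<^sub>R x + (- (\<omega> * S)) *\<^sub>R u + (\<kappa> * C) *\<^sub>R (x \<times> u)"
proof -
  have w: "\<omega> > 0" "\<omega>\<^sup>2 = 1 + \<kappa>\<^sup>2" by (simp_all add: \<omega>_def add_pos_nonneg)
  then have kk: "\<kappa> * \<kappa> = \<omega> * \<omega> - 1" by (simp add: power2_eq_square)
  have 1: "1 - (1 - C) / \<omega>\<^sup>2 = C + \<kappa> * (1 - C) / \<omega>\<^sup>2 * \<kappa>"
  proof -
    have "\<kappa> * (1 - C) / \<omega>\<^sup>2 * \<kappa> = (\<kappa> * \<kappa>) * (1 - C) / \<omega>\<^sup>2" by simp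
    then have "\<kappa> * (1 - C) / \<omega>\<^sup>2 * \<kappa> = (\<omega> * \<omega> - 1) * (1 - C) / \<omega>\<^sup>2" unfolding kk .
    then show ?thesis using w(1) by (simp add: field_simps power2_eq_square)
  qed
  show "circle_arc x u \<kappa> s =
           (1 - (1 - C) / \<omega>\<^sup>2) *\<^sub>R x + (S / \<omega>) *\<^sub>R u + (\<kappa> * ((1 - C) / \<omega>\<^sup>2)) *\<^sub>R (x \<times> u)"
    unfolding 1 circle_arc_def Let_def \<omega>_def[symmetric] C_def[symmetric] S_def[symmetric]
    by (simp add: scaleR_add_right scaleR_add_left)
  have 2: "- (S / \<omega>) = - \<omega> * S + \<kappa> * S / \<omega> * \<kappa>"
  proof -
    have "\<kappa> * S / \<omega> * \<kappa> = (\<kappa> * \<kappa>) * S / \<omega>" by simp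
    then have "\<kappa> * S / \<omega> * \<kappa> = (\<omega> * \<omega> - 1) * S / \<omega>" unfolding kk .
    then show ?thesis using w(1) by (simp add: field_simps)
  qed
  show "vector_derivative (circle_arc x u \<kappa>) (at s) =
           (- (S / \<omega>)) *\<^sub>R x + C *\<^sub>R u + (\<kappa> * (S / \<omega>)) *\<^sub>R (x \<times> u)"
    unfolding 2 vector_derivative_at[OF circle_arc_derivs(1)]
      \<omega>_def[symmetric] C_def[symmetric] S_def[symmetric]
    by (simp add: scaleR_add_right scaleR_left_diff_distrib)
  have 3: "- C = - \<omega>\<^sup>2 * C + \<kappa> * C * \<kappa>"
    using w(2) by (simp add: algebra_simps power2_eq_square)
  show "vector_derivative (\<lambda>t. vector_derivative (circle_arc x u \<kappa>) (at t)) (at s) =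
           (- C) *\<^sub>R x + (- (\<omega> * S)) *\<^sub>R u + (\<kappa> * C) *\<^sub>R (x \<times> u)"
    unfolding 3 vector_derivative_at[OF circle_arc_derivs(2)]
      \<omega>_def[symmetric] C_def[symmetric] S_def[symmetric]
    by (simp add: scaleR_add_right scaleR_left_diff_distrib)
qed

lemma geod_curv_circle_arc:
  assumes "norm x = 1" "norm u = 1" "x \<bullet> u = 0"
  shows "geod_curv (circle_arc x u \<kappa> s) (vector_derivative (circle_arc x u \<kappa>) (at s))
           (vector_derivative (\<lambda>t. vector_derivative (circle_arc x u \<kappa>) (at t)) (at s)) = \<kappa>"
proof -
  define \<omega> where "\<omega> = sqrt (1 + \<kappa>\<^sup>2)"
  have w: "\<omega> > 0" "\<omega>\<^sup>2 = 1 + \<kappa>\<^sup>2" by (simp_all add: \<omega>_def add_pos_nonneg)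
  define C where "C = cos (\<omega> * s)"
  define S where "S = sin (\<omega> * s)"
  define n where "n = x \<times> u"
  define D where "D = (1 - C) / \<omega>\<^sup>2"
  have D: "D * \<omega>\<^sup>2 = 1 - C" using w(1) by (simp add: D_def)
  note F = cross_frame[OF assms, folded n_def]
  have nx: "x \<bullet> x = 1" "u \<bullet> u = 1" "n \<bullet> n = 1" "x \<bullet> u = 0" "x \<bullet> n = 0" "u \<bullet> n = 0"
    "u \<bullet> x = 0" "n \<bullet> x = 0" "n \<bullet> u = 0"
    using assms F by (simp_all add: dot_square_norm inner_commute)
  have cross_coords: "(a1 *\<^sub>R x + a2 *\<^sub>R u + a3 *\<^sub>R n) \<times> (b1 *\<^sub>R x + b2 *\<^sub>R u + b3 *\<^sub>R n) =
      (a2 * b3 - a3 * b2) *\<^sub>R x + (a3 * b1 - a1 * b3) *\<^sub>R u + (a1 * b2 - a2 * b1) *\<^sub>R n"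
    for a1 a2 a3 b1 b2 b3
    by (simp add: cross_add_left cross_add_right cross_mult_left cross_mult_right F n_def[symmetric]
        algebra_simps)
  note fr = circle_arc_frame[of x u \<kappa> s, folded \<omega>_def, folded C_def S_def n_def, folded D_def]
  have "geod_curv (circle_arc x u \<kappa> s) (vector_derivative (circle_arc x u \<kappa>) (at s))
      (vector_derivative (\<lambda>t. vector_derivative (circle_arc x u \<kappa>) (at t)) (at s)) =
      - C * ((S/\<omega>) * (\<kappa> * (S/\<omega>)) - (\<kappa> * D) * C) +
      (-(\<omega>*S)) * ((\<kappa>*D) * (-(S/\<omega>)) - (1 - D) * (\<kappa> * (S/\<omega>))) +
      (\<kappa>*C) * ((1 - D) * C - (S/\<omega>) * (-(S/\<omega>)))" (is "_ = ?E")
    unfolding fr geod_curv_def cross_coords by (simp add: inner_add_left inner_add_right inner_diff_left nx)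
  also have "?E = \<kappa> * (C\<^sup>2 + S\<^sup>2)"
    using w(1) by (simp add: field_simps power2_eq_square)
  also have "\<dots> = \<kappa>" by (simp add: C_def S_def)
  finally show ?thesis .
qed

lemma circle_arc_initial:
  "circle_arc x u \<kappa> 0 = x" "vector_derivative (circle_arc x u \<kappa>) (at 0) = u"
  unfolding vector_derivative_at[OF circle_arc_derivs(1)]
  by (simp_all add: circle_arc_def Let_def)

lemma frame_eqI:
  fixes A T n :: "real^3"
  assumes "norm A = 1" "norm T = 1" "A \<bullet> T = 0"
  shows "a *\<^sub>R A + b *\<^sub>R T + c *\<^sub>R (A \<times> T) = a' *\<^sub>R A + b' *\<^sub>R T + c' *\<^sub>R (A \<times> T) \<longleftrightarrow>
         a = a' \<and> b = b' \<and> c = c'"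
proof
  define n where "n = A \<times> T"
  note F = cross_frame[OF assms, folded n_def]
  have nx: "A \<bullet> A = 1" "T \<bullet> T = 1" "n \<bullet> n = 1" "A \<bullet> T = 0" "A \<bullet> n = 0" "T \<bullet> n = 0"
    "T \<bullet> A = 0" "n \<bullet> A = 0" "n \<bullet> T = 0"
    using assms F by (simp_all add: dot_square_norm inner_commute)
  assume "a *\<^sub>R A + b *\<^sub>R T + c *\<^sub>R (A \<times> T) = a' *\<^sub>R A + b' *\<^sub>R T + c' *\<^sub>R (A \<times> T)"
  then have "(a *\<^sub>R A + b *\<^sub>R T + c *\<^sub>R n) \<bullet> z = (a' *\<^sub>R A + b' *\<^sub>R T + c' *\<^sub>R n) \<bullet> z" for z
    by (simp add: n_def)
  from this[of A] this[of T] this[of n] show "a = a' \<and> b = b' \<and> c = c'"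
    by (simp add: inner_add_left nx)
qed simp

lemma frame_expand:
  fixes v u w :: "real^3"
  assumes "norm v = 1" "norm u = 1" "v \<bullet> u = 0" "norm w = 1" "v \<bullet> w = 0"
  shows "w = (u \<bullet> w) *\<^sub>R u + (w \<bullet> (v \<times> u)) *\<^sub>R (v \<times> u)"
    and "(w \<bullet> (v \<times> u))\<^sup>2 = 1 - (u \<bullet> w)\<^sup>2"
proof -
  note F = cross_frame[OF assms(1-3)]
  have W: "w \<times> v = (w \<bullet> (v \<times> u)) *\<^sub>R u - (u \<bullet> w) *\<^sub>R (v \<times> u)"
  proof -
    have "w \<times> v = w \<times> (u \<times> (v \<times> u))" by (simp add: F)
    also have "\<dots> = (w \<bullet> (v \<times> u)) *\<^sub>R u - (w \<bullet> u) *\<^sub>R (v \<times> u)" by (rule Lagrange)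
    finally show ?thesis by (simp add: inner_commute)
  qed
  have "w = v \<times> (w \<times> v)" using assms by (simp add: Lagrange dot_square_norm)
  also have "\<dots> = (u \<bullet> w) *\<^sub>R u + (w \<bullet> (v \<times> u)) *\<^sub>R (v \<times> u)"
    by (simp add: W Cross3.right_diff_distrib cross_mult_right F)
  finally show w: "w = (u \<bullet> w) *\<^sub>R u + (w \<bullet> (v \<times> u)) *\<^sub>R (v \<times> u)" .
  have "w \<bullet> w = 1" using assms by (simp add: dot_square_norm)
  also have "w \<bullet> w = (u \<bullet> w) * (u \<bullet> w) + (w \<bullet> (v \<times> u)) * (w \<bullet> (v \<times> u))"
    by (subst (2) w) (simp add: inner_add_right inner_commute)
  finally show "(w \<bullet> (v \<times> u))\<^sup>2 = 1 - (u \<bullet> w)\<^sup>2" by (simp add: power2_eq_square)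
qed

lemma tangent_circle_arc_unique:
  fixes v u w :: "real^3" and a :: real
  assumes frame: "norm v = 1" "norm u = 1" "v \<bullet> u = 0" "norm w = 1" "v \<bullet> w = 0"
    and a: "0 < a" "a < pi / 2" and q: "u \<bullet> w \<noteq> - 1"
  defines "\<kappa>0 \<equiv> (w \<bullet> (v \<times> u)) / (sin a * (1 + u \<bullet> w))"
  defines "\<omega>0 \<equiv> sqrt (1 + \<kappa>0\<^sup>2)"
  defines "A \<equiv> cos a *\<^sub>R v - sin a *\<^sub>R u" and "T \<equiv> sin a *\<^sub>R v + cos a *\<^sub>R u"
  shows "(0 < \<rho> \<and> \<rho> < 2 * pi / sqrt (1 + \<kappa>\<^sup>2) \<and>
      circle_arc A T \<kappa> \<rho> = cos a *\<^sub>R v + sin a *\<^sub>R w \<and>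
      vector_derivative (circle_arc A T \<kappa>) (at \<rho>) = - sin a *\<^sub>R v + cos a *\<^sub>R w) \<longleftrightarrow>
     \<kappa> = \<kappa>0 \<and> \<rho> = 2 * arctan (\<omega>0 * tan a) / \<omega>0" (is "?L \<longleftrightarrow> ?R")
proof -
  define n where "n = v \<times> u"
  define q where "q = u \<bullet> w"
  define y where "y = w \<bullet> n"
  define \<rho>0 where "\<rho>0 = 2 * arctan (\<omega>0 * tan a) / \<omega>0"
  define c where "c = cos a"
  define s where "s = sin a"
  note F = cross_frame[OF frame(1-3), folded n_def]
  have nx: "v \<bullet> v = 1" "u \<bullet> u = 1" "n \<bullet> n = 1" "v \<bullet> u = 0" "v \<bullet> n = 0" "u \<bullet> n = 0"
    "u \<bullet> v = 0" "n \<bullet> v = 0" "n \<bullet> u = 0"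
    using frame F by (simp_all add: dot_square_norm inner_commute)
  have w: "w = q *\<^sub>R u + y *\<^sub>R n" and qy: "y\<^sup>2 = 1 - q\<^sup>2"
    using frame_expand[OF frame] by (simp_all add: n_def q_def y_def)
  have sc: "s > 0" "c > 0" "s * s + c * c = 1"
    using a sin_gt_zero cos_gt_zero sin_cos_squared_add[of a]
    by (auto simp: s_def c_def power2_eq_square)
  have AT: "A = c *\<^sub>R v - s *\<^sub>R u" "T = s *\<^sub>R v + c *\<^sub>R u" by (simp_all add: A_def T_def c_def s_def)
  have "A \<bullet> A = 1" "T \<bullet> T = 1" "A \<bullet> T = 0"
    using sc by (simp_all add: AT nx algebra_simps)
  then have nAT: "norm A = 1" "norm T = 1" "A \<bullet> T = 0" by (simp_all add: norm_eq_1)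
  have ATn: "A \<times> T = n"
  proof -
    have "A \<times> T = (c * c + s * s) *\<^sub>R n"
      by (simp add: AT cross_add_left cross_add_right cross_mult_left cross_mult_right
          Cross3.left_diff_distrib Cross3.right_diff_distrib F n_def[symmetric] scaleR_add_left)
    then show ?thesis using sc by (simp add: add.commute)
  qed
  have v: "v = c *\<^sub>R A + s *\<^sub>R T"
  proof -
    have "c *\<^sub>R A + s *\<^sub>R T = (s * s + c * c) *\<^sub>R v" by (simp add: AT algebra_simps)
    then show ?thesis using sc by simp
  qed
  have u: "u = c *\<^sub>R T - s *\<^sub>R A"
  proof -
    have "c *\<^sub>R T - s *\<^sub>R A = (s * s + c * c) *\<^sub>R u" by (simp add: AT algebra_simps)
    then show ?thesis using sc by simp
  qed
  have q1: "1 + q > 0"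
  proof -
    have "\<bar>q\<bar> \<le> 1" using Cauchy_Schwarz_ineq2[of u w] frame by (simp add: q_def)
    then show ?thesis using assms(8) by (simp add: q_def)
  qed
  have B: "cos a *\<^sub>R v + sin a *\<^sub>R w =
     (1 - s * s * (1 + q)) *\<^sub>R A + (s * c * (1 + q)) *\<^sub>R T + (s * y) *\<^sub>R (A \<times> T)"
  proof -
    have "1 - s * s * (1 + q) = c * c - s * s * q" using sc(3) by (simp add: algebra_simps)
    then show ?thesis
      unfolding w ATn c_def[symmetric] s_def[symmetric]
      by (simp only:) (subst v, subst u, simp add: algebra_simps)
  qed
  have TB: "- sin a *\<^sub>R v + cos a *\<^sub>R w =
     (- (s * c * (1 + q))) *\<^sub>R A + (q - s * s * (1 + q)) *\<^sub>R T + (c * y) *\<^sub>R (A \<times> T)"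
  proof -
    have "q - s * s * (1 + q) = c * c * q - s * s" using sc(3) by algebra
    then show ?thesis
      unfolding w ATn c_def[symmetric] s_def[symmetric]
      by (simp only:) (subst v, subst u, simp add: algebra_simps)
  qed
  have k0: "\<kappa>0 = y / (s * (1 + q))" by (simp add: \<kappa>0_def y_def s_def q_def n_def)
  have k0s: "\<kappa>0 * (s * (1 + q)) = y" using sc q1 by (simp add: k0)
  have w0: "\<omega>0 > 0" "\<omega>0\<^sup>2 = 1 + \<kappa>0\<^sup>2" by (simp_all add: \<omega>0_def add_pos_nonneg)
  have w0s: "\<omega>0\<^sup>2 * (s * s * (1 + q)) = s * s * (1 + q) + 1 - q"
  proof -
    have "\<kappa>0\<^sup>2 * (s * s * (1 + q)) * (1 + q) = (\<kappa>0 * (s * (1 + q)))\<^sup>2"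
      by (simp add: power2_eq_square)
    also have "\<dots> = (1 - q) * (1 + q)"
      unfolding k0s qy by (simp add: power2_eq_square algebra_simps)
    finally have "\<kappa>0\<^sup>2 * (s * s * (1 + q)) * (1 + q) = (1 - q) * (1 + q)" .
    then have "\<kappa>0\<^sup>2 * (s * s * (1 + q)) = 1 - q" using q1 by simp
    then show ?thesis using w0 by (simp add: algebra_simps)
  qed
  define \<tau> where "\<tau> = \<omega>0 * tan a"
  have \<tau>: "\<tau> > 0" using w0 a tan_gt_zero by (simp add: \<tau>_def)
  have \<tau>c: "\<tau> * c = \<omega>0 * s" using sc by (simp add: \<tau>_def tan_def c_def s_def)
  have t2: "(1 + \<tau>\<^sup>2) * (c * c * (1 + q)) = 2"
  proof -
    have "(1 + \<tau>\<^sup>2) * (c * c * (1 + q)) = c * c * (1 + q) + (\<tau> * c)\<^sup>2 * (1 + q)"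
      by (simp add: power2_eq_square algebra_simps)
    also have "(\<tau> * c)\<^sup>2 * (1 + q) = \<omega>0\<^sup>2 * (s * s * (1 + q))"
      by (simp add: \<tau>c power2_eq_square)
    also have "c * c * (1 + q) + \<dots> = (s * s + c * c) * (1 + q) + 1 - q"
      unfolding w0s by (simp add: algebra_simps)
    finally show ?thesis using sc by simp
  qed
  have t2z: "2 * z = z * (c * c * (1 + q)) * (1 + \<tau>\<^sup>2)" for z
    unfolding t2[symmetric] by (simp only: mult.assoc mult.commute mult.left_commute)
  have ph: "\<omega>0 * \<rho>0 = 2 * arctan \<tau>" using w0 by (simp add: \<rho>0_def \<tau>_def)
  have S0: "sin (\<omega>0 * \<rho>0) = \<omega>0 * (s * c * (1 + q))"
  proof -
    have "sin (\<omega>0 * \<rho>0) = 2 * \<tau> / (1 + \<tau>\<^sup>2)"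
      unfolding ph sin_double sin_arctan cos_arctan
      using real_sqrt_pow2[of "1 + \<tau>\<^sup>2"] by (simp add: power2_eq_square)
    also have "\<dots> = \<tau> * (c * c * (1 + q))"
    proof -
      have "1 + \<tau>\<^sup>2 \<noteq> 0" using \<tau> by (simp add: add_nonneg_eq_0_iff)
      then show ?thesis using t2z[of \<tau>] by (simp only: divide_eq_eq) simp
    qed
    also have "\<dots> = (\<tau> * c) * (c * (1 + q))" by simp
    also have "\<dots> = \<omega>0 * (s * c * (1 + q))" unfolding \<tau>c by simp
    finally show ?thesis .
  qed
  have C0: "1 - cos (\<omega>0 * \<rho>0) = \<omega>0\<^sup>2 * (s * s * (1 + q))"
  proof -
    have "1 - cos (\<omega>0 * \<rho>0) = 2 * (sin (arctan \<tau>))\<^sup>2"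
      unfolding ph cos_double_sin by simp
    also have "\<dots> = 2 * \<tau>\<^sup>2 / (1 + \<tau>\<^sup>2)"
      unfolding sin_arctan by (simp add: power_divide add_nonneg_nonneg)
    also have "\<dots> = \<tau>\<^sup>2 * (c * c * (1 + q))"
    proof -
      have "1 + \<tau>\<^sup>2 \<noteq> 0" using \<tau> by (simp add: add_nonneg_eq_0_iff)
      then show ?thesis using t2z[of "\<tau>\<^sup>2"] by (simp only: divide_eq_eq) simp
    qed
    also have "\<dots> = (\<tau> * c)\<^sup>2 * (1 + q)" by (simp add: power2_eq_square)
    finally show ?thesis unfolding \<tau>c by (simp add: power2_eq_square)
  qed
  have ph0: "0 < \<omega>0 * \<rho>0" "\<omega>0 * \<rho>0 < pi" unfolding ph using \<tau> arctan_ubound[of \<tau>] by simp_all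
  show ?thesis unfolding \<rho>0_def[symmetric]
  proof
    assume R: "\<kappa> = \<kappa>0 \<and> \<rho> = \<rho>0"
    have 1: "(1 - cos (\<omega>0 * \<rho>0)) / \<omega>0\<^sup>2 = s * s * (1 + q)" using C0 w0(1) by simp
    have 2: "sin (\<omega>0 * \<rho>0) / \<omega>0 = s * c * (1 + q)" using S0 w0(1) by simp
    have 3: "cos (\<omega>0 * \<rho>0) = q - s * s * (1 + q)" using C0 w0s by simp
    have 4: "\<kappa>0 * (s * s * (1 + q)) = s * y" "\<kappa>0 * (s * c * (1 + q)) = c * y"
      unfolding k0s[symmetric] by simp_all
    have "circle_arc A T \<kappa>0 \<rho>0 = cos a *\<^sub>R v + sin a *\<^sub>R w"
      unfolding B circle_arc_frame[of A T \<kappa>0 \<rho>0, folded \<omega>0_def] 1 2 4 ..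
    moreover have "vector_derivative (circle_arc A T \<kappa>0) (at \<rho>0) = - sin a *\<^sub>R v + cos a *\<^sub>R w"
      unfolding TB circle_arc_frame[of A T \<kappa>0 \<rho>0, folded \<omega>0_def] 2 3 4 ..
    moreover have "\<omega>0 * \<rho>0 < 2 * pi" using ph0 by linarith
    then have "0 < \<rho>0" "\<rho>0 < 2 * pi / \<omega>0"
      using ph0(1) w0(1) by (simp_all add: zero_less_mult_iff pos_less_divide_eq mult.commute)
    ultimately show ?L using R by (simp add: \<omega>0_def)
  next
    assume L: ?L
    define \<omega> where "\<omega> = sqrt (1 + \<kappa>\<^sup>2)"
    have w: "\<omega> > 0" by (simp add: \<omega>_def add_pos_nonneg)
    from L have "1 - (1 - cos (\<omega> * \<rho>)) / \<omega>\<^sup>2 = 1 - s * s * (1 + q) \<and> sin (\<omega> * \<rho>) / \<omega> = s * c * (1 + q) \<and>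
        \<kappa> * ((1 - cos (\<omega> * \<rho>)) / \<omega>\<^sup>2) = s * y"
      unfolding B circle_arc_frame[of A T \<kappa> \<rho>, folded \<omega>_def] frame_eqI[OF nAT] by blast
    then have E: "(1 - cos (\<omega> * \<rho>)) / \<omega>\<^sup>2 = s * s * (1 + q)" "sin (\<omega> * \<rho>) / \<omega> = s * c * (1 + q)"
       "\<kappa> * ((1 - cos (\<omega> * \<rho>)) / \<omega>\<^sup>2) = s * y" by linarith+
    have "s * (\<kappa> * (s * (1 + q))) = s * y" using E(3) unfolding E(1) by simp
    then have "\<kappa> * (s * (1 + q)) = y" using sc(1) by simp
    then have k: "\<kappa> = \<kappa>0" using sc q1 by (simp add: k0 eq_divide_eq)
    then have ww: "\<omega> = \<omega>0" by (simp add: \<omega>_def \<omega>0_def)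
    have cc: "cos (\<omega>0 * \<rho>) = cos (\<omega>0 * \<rho>0)" using E(1) C0 w0(1) by (simp add: ww field_simps)
    have ss: "sin (\<omega>0 * \<rho>) > 0"
    proof -
      have "sin (\<omega>0 * \<rho>) = \<omega>0 * (s * c * (1 + q))" using E(2) w0(1) by (simp add: ww field_simps)
      then show ?thesis using w0 sc q1 by simp
    qed
    have "0 < \<omega>0 * \<rho>" "\<omega>0 * \<rho> < 2 * pi"
      using L w0 by (simp_all add: k \<omega>0_def[symmetric] pos_less_divide_eq mult.commute)
    then have "\<omega>0 * \<rho> < pi" using ss sin_le_zero[of "\<omega>0 * \<rho>"] by linarith
    then have "\<omega>0 * \<rho> = \<omega>0 * \<rho>0"
      using cc ph0 \<open>0 < \<omega>0 * \<rho>\<close> cos_inj_pi[of "\<omega>0 * \<rho>" "\<omega>0 * \<rho>0"] by simp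
    then show "\<kappa> = \<kappa>0 \<and> \<rho> = \<rho>0" using k w0 by simp
  qed
qed

lemma geod_dir_props:
  assumes "norm x = 1" "norm y = 1" "y \<noteq> x" "y \<noteq> - x"
  shows "norm (geod_dir x y) = 1" "x \<bullet> geod_dir x y = 0"
    "y = cos (sphere_dist x y) *\<^sub>R x + sin (sphere_dist x y) *\<^sub>R geod_dir x y"
    "0 < sphere_dist x y" "sphere_dist x y < pi"
proof -
  define z where "z = tangent_proj x y"
  define t where "t = x \<bullet> y"
  have xx: "x \<bullet> x = 1" "y \<bullet> y = 1" using assms by (simp_all add: dot_square_norm)
  have z: "z = y - t *\<^sub>R x" by (simp add: z_def tangent_proj_def t_def inner_commute)
  have "z \<bullet> z = 1 - t\<^sup>2"
    by (simp add: z inner_diff_left inner_diff_right xx t_def inner_commute power2_eq_square)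
  then have nz: "norm z = sqrt (1 - t\<^sup>2)" by (simp add: norm_eq_sqrt_inner)
  have t1: "t \<noteq> 1"
  proof
    assume "t = 1"
    then have "(y - x) \<bullet> (y - x) = 0"
      by (simp add: inner_diff_left inner_diff_right xx t_def inner_commute)
    then show False using assms by simp
  qed
  have t2: "t \<noteq> - 1"
  proof
    assume "t = - 1"
    then have "(y + x) \<bullet> (y + x) = 0"
      by (simp add: inner_add_left inner_add_right xx t_def inner_commute)
    then show False using assms by (simp add: eq_neg_iff_add_eq_0)
  qed
  have "\<bar>t\<bar> \<le> 1" using Cauchy_Schwarz_ineq2[of x y] assms by (simp add: t_def)
  then have t: "- 1 < t" "t < 1" using t1 t2 by auto
  then have "t\<^sup>2 < 1" by (simp add: abs_square_less_1 abs_less_iff)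
  then have nz0: "norm z > 0" by (simp add: nz)
  then have z0: "z \<noteq> 0" by auto
  show "norm (geod_dir x y) = 1" using z0 by (simp add: geod_dir_def z_def[symmetric] norm_sgn)
  show "x \<bullet> geod_dir x y = 0"
    by (simp add: geod_dir_def z_def[symmetric] sgn_div_norm) (simp add: z inner_diff_right xx t_def)
  show "0 < sphere_dist x y" "sphere_dist x y < pi"
    using t arccos_lt_bounded[of t] by (simp_all add: sphere_dist_def t_def[symmetric])
  have "cos (sphere_dist x y) = t" "sin (sphere_dist x y) = norm z"
    using t by (simp_all add: sphere_dist_def t_def[symmetric] nz sin_arccos)
  moreover have "norm z *\<^sub>R geod_dir x y = z"
    using z0 by (simp add: geod_dir_def z_def[symmetric] sgn_div_norm)
  ultimately show "y = cos (sphere_dist x y) *\<^sub>R x + sin (sphere_dist x y) *\<^sub>R geod_dir x y"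
    by (simp add: z)
qed

lemma edge_eq:
  "edge V i s = cos s *\<^sub>R (V ! i) + sin s *\<^sub>R geod_dir (V ! i) (V ! Suc i)"
  "edge_tangent V i s = - sin s *\<^sub>R (V ! i) + cos s *\<^sub>R geod_dir (V ! i) (V ! Suc i)"
  unfolding edge_tangent_def edge_def circle_arc_frame by simp_all

lemma arc_energy_circle_arc:
  assumes "norm x = 1" "norm u = 1" "x \<bullet> u = 0" "0 \<le> \<rho>"
  shows "arc_energy p (circle_arc x u \<kappa>, \<rho>) = ennreal (\<bar>\<kappa>\<bar> powr p * \<rho>)"
  using assms by (simp add: arc_energy_def geod_curv_circle_arc nn_integral_cmult_indicator ennreal_mult)

lemma arc_energy_edge_piece:
  assumes "norm (V ! i) = 1" "norm (V ! Suc i) = 1" "V ! Suc i \<noteq> V ! i" "V ! Suc i \<noteq> - V ! i"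
  shows "arc_energy p (edge_piece V i) = 0"
proof -
  note D = geod_dir_props[OF assms]
  have vd: "vector_derivative (\<lambda>s. g (a + s)) (at s) = g' (a + s)"
    if "\<And>s. (g has_vector_derivative g' s) (at s)" for g g' :: "real \<Rightarrow> real^3" and a s
  proof -
    have "((\<lambda>s. a + s) has_vector_derivative 1) (at s)" by (auto intro!: derivative_eq_intros)
    from vector_diff_chain_at[OF this, of g "g' (a + s)"] that show ?thesis
      by (intro vector_derivative_at) (simp add: o_def)
  qed
  have E: "(edge V i has_vector_derivative edge_tangent V i s) (at s)" for s
    unfolding edge_tangent_def
    by (metis edge_def circle_arc_derivs(1) vector_derivative_at)
  have E': "(edge_tangent V i has_vector_derivative vector_derivative (edge_tangent V i) (at s)) (at s)" for s
    unfolding edge_tangent_def[abs_def]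
    by (metis edge_def circle_arc_derivs(2) vector_derivative_at)
  have "geod_curv (edge V i (a + s)) (vector_derivative (\<lambda>s. edge V i (a + s)) (at s))
     (vector_derivative (\<lambda>t. vector_derivative (\<lambda>s. edge V i (a + s)) (at t)) (at s)) = 0" for a s
    using geod_curv_circle_arc[OF assms(1) D(1,2), of 0 "a + s"]
    unfolding vd[OF E] vd[OF E'] edge_def[symmetric] edge_tangent_def[symmetric] .
  then show ?thesis by (simp add: arc_energy_def edge_piece_def Let_def)
qed

text \<open>
  The explicit form of the \<open>p\<close>-rotation; in particular the arcs used in the definition exist and are
  unique.
\<close>
lemma arc_energy_corner_piece:
  fixes V :: "(real^3) list"
  assumes i: "1 \<le> i" "i < length V - 1"
    and V: "\<And>j. j < length V \<Longrightarrow> norm (V ! j) = 1"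
      "\<And>j. Suc j < length V \<Longrightarrow> V ! Suc j \<noteq> V ! j \<and> V ! Suc j \<noteq> - V ! j"
    and pi: "turning_angle V i \<noteq> pi"
  defines "\<theta> \<equiv> turning_angle V i" and "l \<equiv> corner_len V i"
  defines "\<Psi> \<equiv> sqrt ((sin (l / 2))\<^sup>2 + (sin (\<theta> / 2))\<^sup>2 * (cos (l / 2))\<^sup>2)"
  shows "\<exists>!a. is_corner_arc V i a"
    and "arc_energy p (corner_piece V i) =
      ennreal (2 * arctan (\<Psi> / (cos (\<theta> / 2) * cos (l / 2))) * (1 / \<Psi>) *
        (sin (\<theta> / 2) powr p / (cos (\<theta> / 2) * sin (l / 2)) powr (p - 1)))"
proof -
  define k where "k = i - 1"
  have ik: "i = Suc k" using i by (simp add: k_def)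
  define u where "u = edge_tangent V k (edge_len V k)"
  define w where "w = geod_dir (V ! i) (V ! Suc i)"
  define v where "v = V ! i"
  define a where "a = l / 2"
  define t where "t = geod_dir (V ! k) (V ! i)"
  define q where "q = u \<bullet> w"
  have P: "norm (V ! k) = 1" "norm (V ! i) = 1" "V ! i \<noteq> V ! k" "V ! i \<noteq> - V ! k"
    using V i by (auto simp: ik)
  have Q: "norm (V ! i) = 1" "norm (V ! Suc i) = 1" "V ! Suc i \<noteq> V ! i" "V ! Suc i \<noteq> - V ! i"
    using V i by (auto simp: ik)
  note Dk = geod_dir_props[OF P, folded t_def]
  note Di = geod_dir_props[OF Q, folded w_def]
  define d where "d = edge_len V k"
  have d: "d = sphere_dist (V ! k) (V ! i)" by (simp add: d_def edge_len_def ik)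
  have v: "v = cos d *\<^sub>R (V ! k) + sin d *\<^sub>R t" using Dk(3) by (simp add: v_def d)
  have u: "u = - sin d *\<^sub>R (V ! k) + cos d *\<^sub>R t"
    by (simp add: u_def edge_eq d_def[symmetric] t_def ik)
  have kk: "V ! k \<bullet> V ! k = 1" "t \<bullet> t = 1" "V ! k \<bullet> t = 0" "t \<bullet> V ! k = 0"
    using P Dk by (simp_all add: dot_square_norm inner_commute)
  have "u \<bullet> u = 1" "v \<bullet> u = 0"
    using sin_cos_squared_add3[of d]
    by (simp_all add: u v inner_add_left inner_add_right inner_diff_left inner_diff_right kk algebra_simps)
  then have frame: "norm v = 1" "norm u = 1" "v \<bullet> u = 0" "norm w = 1" "v \<bullet> w = 0"
    using Q Di by (simp_all add: norm_eq_1 v_def)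
  have a: "0 < a" "a < pi / 2"
    using Dk(4,5) Di(4,5) by (auto simp: a_def l_def corner_len_def edge_len_def k_def[symmetric] ik)
  have w0: "edge_tangent V i 0 = w" by (simp add: edge_eq w_def)
  have \<theta>: "\<theta> = arccos q"
    unfolding \<theta>_def turning_angle_def k_def[symmetric] w0 u_def[symmetric] q_def ..
  have q: "\<bar>q\<bar> \<le> 1" using Cauchy_Schwarz_ineq2[of u w] frame by (simp add: q_def)
  have qn: "q \<noteq> - 1" using pi by (auto simp: \<theta>_def[symmetric] \<theta>)
  define A where "A = cos a *\<^sub>R v - sin a *\<^sub>R u"
  define T where "T = sin a *\<^sub>R v + cos a *\<^sub>R u"
  define \<kappa>0 where "\<kappa>0 = (w \<bullet> (v \<times> u)) / (sin a * (1 + u \<bullet> w))"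
  define \<omega>0 where "\<omega>0 = sqrt (1 + \<kappa>0\<^sup>2)"
  define \<rho>0 where "\<rho>0 = 2 * arctan (\<omega>0 * tan a) / \<omega>0"
  have AE: "edge V k (d - a) = A" "edge_tangent V k (d - a) = T"
    unfolding edge_eq ik[symmetric] t_def[symmetric] A_def T_def u v
    by (simp_all add: cos_diff sin_diff algebra_simps)
  have st: "corner_arc_start V i = circle_arc A T"
    unfolding corner_arc_start_def Let_def k_def[symmetric] l_def[symmetric] a_def[symmetric]
      d_def[symmetric] AE ..
  have ic: "is_corner_arc V i (\<kappa>, \<rho>) \<longleftrightarrow> \<kappa> = \<kappa>0 \<and> \<rho> = \<rho>0" for \<kappa> \<rho>
    using tangent_circle_arc_unique[OF frame a qn[unfolded q_def], of \<rho> \<kappa>,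
      folded A_def T_def \<kappa>0_def, folded \<omega>0_def, folded \<rho>0_def]
    by (simp add: is_corner_arc_def st l_def[symmetric] a_def[symmetric] edge_eq w_def v_def)
  then have ica: "is_corner_arc V i b \<longleftrightarrow> b = (\<kappa>0, \<rho>0)" for b by (cases b) simp
  then show "\<exists>!a. is_corner_arc V i a" by simp
  have cp: "corner_piece V i = (circle_arc A T \<kappa>0, \<rho>0)"
    unfolding corner_piece_def ica by (simp add: st)
  have vu: "v \<bullet> v = 1" "u \<bullet> u = 1" "v \<bullet> u = 0" "u \<bullet> v = 0"
    using frame by (simp_all add: dot_square_norm inner_commute)
  have AT: "A \<bullet> A = 1" "T \<bullet> T = 1" "A \<bullet> T = 0"
    using sin_cos_squared_add3[of a] vu
    by (simp_all add: A_def T_def inner_add_left inner_add_right inner_diff_left inner_diff_right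
        add.commute)
  have \<omega>0: "\<omega>0 > 0" by (simp add: \<omega>0_def add_pos_nonneg)
  have ta: "tan a > 0" using a tan_gt_zero by simp
  have \<rho>0: "\<rho>0 \<ge> 0" using \<omega>0 ta by (simp add: \<rho>0_def)
  have en: "arc_energy p (corner_piece V i) = ennreal (\<bar>\<kappa>0\<bar> powr p * \<rho>0)"
    unfolding cp using AT \<rho>0 by (intro arc_energy_circle_arc) (simp_all add: norm_eq_1)
  define sa where "sa = sin a" define ca where "ca = cos a"
  define st where "st = sin (\<theta> / 2)" define ct where "ct = cos (\<theta> / 2)"
  have th: "0 \<le> \<theta>" "\<theta> < pi" "cos \<theta> = q"
    using q qn arccos_lbound arccos_ubound[of q] arccos_cos pi
    by (auto simp: \<theta> abs_le_iff \<theta>_def[symmetric] less_le)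
  have pos: "sa > 0" "ca > 0" "st \<ge> 0" "ct > 0"
    using a th by (auto simp: sa_def ca_def st_def ct_def intro!: sin_gt_zero cos_gt_zero_pi sin_ge_zero)
  have sq: "sa\<^sup>2 + ca\<^sup>2 = 1" "st\<^sup>2 + ct\<^sup>2 = 1" by (simp_all add: sa_def ca_def st_def ct_def)
  have q2: "q = 2 * ct\<^sup>2 - 1" using th cos_double_cos[of "\<theta> / 2"] by (simp add: ct_def)
  have "(w \<bullet> (v \<times> u))\<^sup>2 = (2 * st * ct)\<^sup>2"
  proof -
    have "(w \<bullet> (v \<times> u))\<^sup>2 = 1 - q\<^sup>2" unfolding q_def by (rule frame_expand(2)[OF frame])
    also have "\<dots> = (2 * st * ct)\<^sup>2" using sq(2) unfolding q2 by algebra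
    finally show ?thesis .
  qed
  then have "\<bar>w \<bullet> (v \<times> u)\<bar> = \<bar>2 * st * ct\<bar>" unfolding power2_eq_iff by (elim disjE) simp_all
  then have "\<bar>w \<bullet> (v \<times> u)\<bar> = 2 * st * ct" using pos by simp
  moreover have "\<bar>\<kappa>0\<bar> = \<bar>w \<bullet> (v \<times> u)\<bar> / (sa * (2 * ct\<^sup>2))"
    using pos by (simp add: \<kappa>0_def q_def[symmetric] q2 abs_mult sa_def)
  ultimately have k: "\<bar>\<kappa>0\<bar> = st / (ct * sa)" using pos by (simp add: field_simps power2_eq_square)
  have Psi: "\<Psi> = sqrt (sa\<^sup>2 + st\<^sup>2 * ca\<^sup>2)"
    by (simp add: \<Psi>_def sa_def ca_def st_def a_def)
  have Psi0: "\<Psi> > 0" using pos by (simp add: Psi add_pos_nonneg)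
  have "\<omega>0\<^sup>2 = (\<Psi> / (ct * sa))\<^sup>2"
  proof -
    have "\<omega>0\<^sup>2 = 1 + \<bar>\<kappa>0\<bar>\<^sup>2" by (simp add: \<omega>0_def)
    also have "\<dots> = ((ct * sa)\<^sup>2 + st\<^sup>2) / (ct * sa)\<^sup>2"
      using pos by (simp add: k power_divide add_divide_distrib)
    also have "(ct * sa)\<^sup>2 + st\<^sup>2 = \<Psi>\<^sup>2"
    proof -
      have "\<Psi>\<^sup>2 = sa\<^sup>2 + st\<^sup>2 * ca\<^sup>2" by (simp add: Psi)
      then show ?thesis using sq by algebra
    qed
    finally show ?thesis by (simp add: power_divide)
  qed
  then have om: "\<omega>0 = \<Psi> / (ct * sa)" using \<omega>0 Psi0 pos by (simp add: power2_eq_iff_nonneg)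
  have "\<omega>0 * tan a = \<Psi> / (ct * ca)"
    using pos by (simp add: om tan_def sa_def[symmetric] ca_def[symmetric])
  then have r: "\<rho>0 = 2 * arctan (\<Psi> / (ct * ca)) * (1 / \<Psi>) * (ct * sa)"
    by (simp add: \<rho>0_def om)
  have pw: "(st / (ct * sa)) powr p * (ct * sa) = st powr p / (ct * sa) powr (p - 1)"
    using pos by (simp add: powr_divide powr_diff)
  have "\<bar>\<kappa>0\<bar> powr p * \<rho>0 =
      2 * arctan (\<Psi> / (ct * ca)) * (1 / \<Psi>) * ((st / (ct * sa)) powr p * (ct * sa))"
    unfolding k r by (simp only: mult.assoc mult.commute mult.left_commute)
  then have "\<bar>\<kappa>0\<bar> powr p * \<rho>0 =
      2 * arctan (\<Psi> / (ct * ca)) * (1 / \<Psi>) * (st powr p / (ct * sa) powr (p - 1))"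
    unfolding pw .
  then show "arc_energy p (corner_piece V i) =
      ennreal (2 * arctan (\<Psi> / (cos (\<theta> / 2) * cos (l / 2))) * (1 / \<Psi>) *
        (sin (\<theta> / 2) powr p / (cos (\<theta> / 2) * sin (l / 2)) powr (p - 1)))"
    unfolding en by (simp add: ct_def ca_def st_def sa_def a_def)
qed

lemma p_rotation_eq:
  fixes V :: "(real^3) list" and p :: real
  assumes "2 \<le> length V"
    and V: "\<And>j. j < length V \<Longrightarrow> norm (V ! j) = 1"
      "\<And>j. Suc j < length V \<Longrightarrow> V ! Suc j \<noteq> V ! j \<and> V ! Suc j \<noteq> - V ! j"
  defines "\<Psi> \<equiv> \<lambda>l \<theta>. sqrt ((sin (l / 2))\<^sup>2 + (sin (\<theta> / 2))\<^sup>2 * (cos (l / 2))\<^sup>2)"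
  shows "p_rotation p V = (\<Sum>i = 1..<length V - 1.
      let \<theta> = turning_angle V i; l = corner_len V i in
      if \<theta> = pi then \<infinity> else
      ennreal (2 * arctan (\<Psi> l \<theta> / (cos (\<theta> / 2) * cos (l / 2))) * (1 / \<Psi> l \<theta>) *
        (sin (\<theta> / 2) powr p / (cos (\<theta> / 2) * sin (l / 2)) powr (p - 1))))" (is "_ = sum ?f _")
proof (cases "\<exists>i. 1 \<le> i \<and> i < length V - 1 \<and> turning_angle V i = pi")
  case True
  then obtain i where i: "i \<in> {1..<length V - 1}" "turning_angle V i = pi" by auto
  have "?f i = \<infinity>" using i by (simp add: Let_def)
  moreover have "?f i \<le> sum ?f {1..<length V - 1}" using i by (intro member_le_sum) auto
  ultimately have "sum ?f {1..<length V - 1} = \<infinity>" by (simp add: top.extremum_unique)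
  moreover have "p_rotation p V = \<infinity>" using True by (simp add: p_rotation_def)
  ultimately show ?thesis by (simp only:)
next
  case False
  have E: "arc_energy p (edge_piece V j) = 0" if "Suc j < length V" for j
    using V that by (intro arc_energy_edge_piece) auto
  have C: "arc_energy p (corner_piece V i) = ?f i" if "i \<in> {1..<length V - 1}" for i
    using False that arc_energy_corner_piece(2)[OF _ _ V, of i p]
    by (auto simp: Let_def \<Psi>_def)
  have "(\<Sum>a\<leftarrow>concat (map (\<lambda>i. [corner_piece V i, edge_piece V i]) xs). arc_energy p a) =
      (\<Sum>i\<leftarrow>xs. arc_energy p (corner_piece V i))" if "set xs \<subseteq> {1..<length V - 1}" for xs
    using that by (induction xs) (auto simp: E)
  then have "(\<Sum>a\<leftarrow>smoothing V. arc_energy p a) = (\<Sum>i\<leftarrow>[1..<length V - 1]. arc_energy p (corner_piece V i))"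
    using assms(1) E[of 0] by (simp add: smoothing_def)
  also have "\<dots> = (\<Sum>i = 1..<length V - 1. arc_energy p (corner_piece V i))"
    by (simp only: interv_sum_list_conv_sum_set_nat set_upt)
  also have "\<dots> = sum ?f {1..<length V - 1}" by (rule sum.cong[OF refl C])
  finally show ?thesis unfolding p_rotation_def if_not_P[OF False] .
qed

end

theory Submission
  imports Defs
begin

text \<open>
  Write \<open>k = c'' + c\<close>; along a unit speed curve on the sphere this is the tangential part of the
  acceleration, and its norm is the absolute geodesic curvature.  The bridge between polygonals,
  weak derivatives and pointwise statements is the representation
  \<open>c t = A + t B + \<integral> (t - s)\<^sup>+ v s ds\<close> on \<open>{0..L}\<close> with an integrable \<open>v\<close>: for a
  continuous \<open>c\<close> it holds exactly if \<open>v\<close> is a second weak derivative of \<open>c\<close>.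

  \<^emph>\<open>Lower bound.\<close>  At a vertex with turning angle \<open>\<theta>\<close> and corner length \<open>l\<close> the unit tangent of a
  polygonal jumps by a vector of norm \<open>2 sin (\<theta>/2)\<close>, and the smoothing arc costs at least
  \<open>(2 sin (\<theta>/2))\<^sup>p / l\<^sup>p\<^sup>-\<^sup>1\<close> (\<open>corner_energy_lower\<close>).  Let \<open>f\<close> be the step function that spreads each
  jump evenly over the parameter interval before its vertex; as \<open>l\<close> is at most the length of that
  interval, \<open>\<integral> |f|\<^sup>p\<close> is at most the \<open>p\<close>-rotation.  Along an edge the tangent turns by minus the
  integral of the position, up to second order.  Hence \<open>c\<close> is uniformly close to
  \<open>c 0 + t B + \<integral> (t - s)\<^sup>+ (f s - c s) ds\<close> (\<open>polygon_approximant\<close>).  The error tends to zero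
  because a small modulus forces a small mesh, and then the length of the polygonal is close to
  \<open>L\<close>.

  For a fixed tolerance the functions \<open>f\<close> with \<open>\<integral> |f|\<^sup>p \<le> K\<close> that satisfy this approximate identity
  form a convex set, and these sets shrink with the tolerance.  Weak compactness of balls in \<open>L\<^sup>p\<close>
  can therefore be replaced by a minimization: near-minimizers of the strictly convex functional
  \<open>\<integral> sqrt (1 + |f|\<^sup>2)\<close> over the sets converge in \<open>L\<^sup>1\<close> (\<open>L1_limit_of_near_minimizers\<close>).  Their limit
  is \<open>k\<close>, and Fatou's lemma gives \<open>\<integral> |k|\<^sup>p \<le> K\<close>.

  \<^emph>\<open>Upper bound.\<close>  Subdivide \<open>{0..L}\<close> into pieces of length \<open>d\<close>.  As \<open>c\<close> is continuously
  differentiable with unit speed, all edges have length close to \<open>d\<close>.  The jump at a vertex is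
  bounded by the tangential part of the second difference of \<open>c\<close>, which is \<open>\<integral> h v\<close> for the hat
  function \<open>h\<close> of width \<open>d\<close> at the vertex.  Jensen's inequality bounds the cost of the corner by
  \<open>(1/d) \<integral> h (|k| + d)\<^sup>p\<close> up to a factor close to one, and the hats add up to at most \<open>d\<close>
  (\<open>subdivision_p_rotation_le\<close>).

  \<^emph>\<open>Regularity.\<close>  Testing the definition of the second weak derivative with smoothed piecewise linear
  hats gives the representation, and integration by parts for absolutely continuous functions gives
  the converse.  The same product rule, applied to \<open>c' \<bullet> c = 0\<close> and \<open>c' \<bullet> c' = 1\<close>, yields
  \<open>c'' \<bullet> c = - 1\<close> and \<open>c'' \<bullet> c' = 0\<close> almost everywhere, so that both integrands of the theorem equal
  \<open>|k|\<^sup>p\<close>.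
\<close>

section \<open>Integration on an interval and double primitives\<close>

lemma norm_diff_mono:
  fixes x y :: "'a::real_normed_vector"
  shows "norm x \<le> a \<Longrightarrow> norm y \<le> b \<Longrightarrow> norm (x - y) \<le> a + b"
  using norm_triangle_ineq4[of x y] by linarith

lemma finite_measure_lebesgue_on_interval: "finite_measure (lebesgue_on {a..b::real})"
  by (rule finite_measureI) (simp add: space_restrict_space emeasure_restrict_space emeasure_lborel_Icc_eq)

lemma continuous_imp_integrable_lebesgue_on:
  fixes f :: "real \<Rightarrow> 'b::euclidean_space"
  assumes "continuous_on {a..b} f"
  shows "integrable (lebesgue_on {a..b}) f"
  using absolutely_integrable_continuous[of a b f] assms
  by (simp add: absolutely_integrable_on_def integrable_restrict_space set_integrable_def cbox_interval)

lemma integrable_subinterval_lebesgue_on: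
  fixes v :: "real \<Rightarrow> 'b::euclidean_space"
  assumes "integrable (lebesgue_on {0..L}) v" "0 \<le> a" "b \<le> L"
  shows "v absolutely_integrable_on {a..b}" "v integrable_on {a..b}" "(\<lambda>s. norm (v s)) integrable_on {a..b}"
proof -
  have "v absolutely_integrable_on {0..L}"
    using assms(1) by (simp add: absolutely_integrable_on_def integrable_restrict_space set_integrable_def)
  moreover have "{a..b} \<subseteq> {0..L}" using assms by auto
  ultimately show "v absolutely_integrable_on {a..b}"
    by (metis absolutely_integrable_on_subinterval)
  then show "v integrable_on {a..b}" "(\<lambda>s. norm (v s)) integrable_on {a..b}"
    by (auto simp: absolutely_integrable_on_def)
qed

lemma LINT_indicator_interval:
  fixes v :: "real \<Rightarrow> 'b::euclidean_space"
  assumes "integrable (lebesgue_on {0..L}) v" "0 \<le> a" "b \<le> L"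
  shows "integrable (lebesgue_on {0..L}) (\<lambda>s. indicat_real {a..b} s *\<^sub>R v s)"
    "(LINT s|lebesgue_on {0..L}. indicat_real {a..b} s *\<^sub>R v s) = integral {a..b} v"
proof -
  show i: "integrable (lebesgue_on {0..L}) (\<lambda>s. indicat_real {a..b} s *\<^sub>R v s)"
  proof (rule Bochner_Integration.integrable_bound[OF assms(1)])
    have [measurable]: "v \<in> borel_measurable (lebesgue_on {0..L})" using assms by simp
    have [measurable]: "(\<lambda>s. indicat_real {a..b} s) \<in> borel_measurable (lebesgue_on {0..L})"
      by (intro measurable_restrict_space1 borel_measurable_indicator) auto
    show "(\<lambda>s. indicat_real {a..b} s *\<^sub>R v s) \<in> borel_measurable (lebesgue_on {0..L})" by measurable
  qed (auto simp: indicator_def)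
  have "(LINT s|lebesgue_on {0..L}. indicat_real {a..b} s *\<^sub>R v s) = integral {0..L} (\<lambda>s. indicat_real {a..b} s *\<^sub>R v s)"
    by (rule lebesgue_integral_eq_integral[OF i]) auto
  also have "\<dots> = integral {0..L} (\<lambda>s. if s \<in> {a..b} then v s else 0)"
    by (intro integral_cong) (auto simp: indicator_def)
  also have "\<dots> = integral ({a..b} \<inter> {0..L}) v" by (rule integral_restrict_Int)
  also have "{a..b} \<inter> {0..L} = {a..b}" using assms by auto
  finally show "(LINT s|lebesgue_on {0..L}. indicat_real {a..b} s *\<^sub>R v s) = integral {a..b} v" .
qed

lemma integral_diff_eq:
  fixes v :: "real \<Rightarrow> 'b::euclidean_space"
  assumes "integrable (lebesgue_on {0..L}) v" "0 \<le> a" "a \<le> b" "b \<le> L"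
  shows "integral {0..b} v - integral {0..a} v = integral {a..b} v"
  using Henstock_Kurzweil_Integration.integral_combine[of 0 a b v] assms
    integrable_subinterval_lebesgue_on(2)[OF assms(1), of 0 b] by (simp add: algebra_simps)

lemma continuous_on_primitive:
  fixes v :: "real \<Rightarrow> 'b::euclidean_space"
  assumes "integrable (lebesgue_on {0..L}) v"
  shows "continuous_on {0..L} (\<lambda>t. integral {0..t} v)"
  by (rule indefinite_integral_continuous_1) (rule integrable_subinterval_lebesgue_on(2)[OF assms], auto)

lemma continuous_on_interval_bounded:
  fixes f :: "real \<Rightarrow> 'b::real_normed_vector"
  assumes "continuous_on {a..b} f"
  shows "\<exists>B. \<forall>s\<in>{a..b}. norm (f s) \<le> B"
proof -
  have "bounded (f ` {a..b})" by (rule compact_imp_bounded[OF compact_continuous_image[OF assms]]) simp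
  then show ?thesis unfolding bounded_iff by blast
qed

lemma integrable_continuous_scaleR:
  fixes v :: "real \<Rightarrow> 'b::euclidean_space" and k :: "real \<Rightarrow> real"
  assumes "integrable (lebesgue_on {0..L}) v" "continuous_on {0..L} k"
  shows "integrable (lebesgue_on {0..L}) (\<lambda>s. k s *\<^sub>R v s)"
proof -
  obtain B where B: "\<And>s. s \<in> {0..L} \<Longrightarrow> norm (k s) \<le> B"
    using continuous_on_interval_bounded[OF assms(2)] by blast
  have [measurable]: "v \<in> borel_measurable (lebesgue_on {0..L})" using assms by simp
  have [measurable]: "k \<in> borel_measurable (lebesgue_on {0..L})"
    by (rule continuous_imp_measurable_on_sets_lebesgue[OF assms(2)]) auto
  show ?thesis
  proof (rule Bochner_Integration.integrable_bound)
    show "integrable (lebesgue_on {0..L}) (\<lambda>s. B *\<^sub>R v s)" using assms by simp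
    show "AE s in lebesgue_on {0..L}. norm (k s *\<^sub>R v s) \<le> norm (B *\<^sub>R v s)"
    proof (rule AE_I2)
      fix s assume "s \<in> space (lebesgue_on {0..L})"
      then have "norm (k s) \<le> \<bar>B\<bar>" using B[of s] by (simp add: space_restrict_space)
      then show "norm (k s *\<^sub>R v s) \<le> norm (B *\<^sub>R v s)" by (simp add: mult_right_mono)
    qed
  qed measurable
qed

text \<open>
  The solution of \<open>g'' = v\<close> with \<open>g 0 = 0\<close> and \<open>g' 0 = 0\<close>, written with its Green kernel.  In this
  form second differences and dependence on \<open>v\<close> are visible without iterated integrals.
\<close>
definition double_primitive :: "real \<Rightarrow> (real \<Rightarrow> 'b::euclidean_space) \<Rightarrow> real \<Rightarrow> 'b" where
  "double_primitive L v t = (LINT s|lebesgue_on {0..L}. max 0 (t - s) *\<^sub>R v s)"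

text \<open>
  The kernel \<open>(b - s)\<^sup>+ - (a - s)\<^sup>+\<close> equals \<open>b - a\<close> for \<open>s\<close> before \<open>a\<close> and \<open>b\<close>, vanishes after both, and
  differs from \<open>(b - a)\<close> times the indicator of \<open>{0..a}\<close> by at most \<open>\<bar>b - a\<bar>\<close> in between.
\<close>
lemma double_primitive_diff_bound:
  fixes v :: "real \<Rightarrow> 'b::euclidean_space"
  assumes v: "integrable (lebesgue_on {0..L}) v" and ab: "0 \<le> a" "0 \<le> b" "a \<le> L" "b \<le> L"
  shows "norm (double_primitive L v b - double_primitive L v a - (b - a) *\<^sub>R integral {0..a} v)
    \<le> \<bar>b - a\<bar> * integral {min a b..max a b} (\<lambda>s. norm (v s))"
proof -
  let ?M = "lebesgue_on {0..L}"
  have i: "integrable ?M (\<lambda>s. max 0 (t - s) *\<^sub>R v s)" for t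
    by (intro integrable_continuous_scaleR[OF v] continuous_intros)
  have vn: "integrable ?M (\<lambda>s. norm (v s))" using v by simp
  have mm: "0 \<le> min a b" "max a b \<le> L" using ab by auto
  note I = LINT_indicator_interval[OF v order_refl ab(3)] LINT_indicator_interval[OF vn mm]
  have e: "double_primitive L v b - double_primitive L v a - (b - a) *\<^sub>R integral {0..a} v =
    (LINT s|?M. max 0 (b - s) *\<^sub>R v s - max 0 (a - s) *\<^sub>R v s - (b - a) *\<^sub>R indicat_real {0..a} s *\<^sub>R v s)"
    unfolding double_primitive_def I(2)[symmetric] using i I(1) by (simp del: scaleR_scaleR)
  show ?thesis unfolding e I(4)[symmetric] Bochner_Integration.integral_mult_right[OF I(3), symmetric]
  proof (rule Bochner_Integration.integral_norm_bound_integral)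
    show "integrable ?M (\<lambda>s. max 0 (b - s) *\<^sub>R v s - max 0 (a - s) *\<^sub>R v s - (b - a) *\<^sub>R indicat_real {0..a} s *\<^sub>R v s)"
      using i I(1) by (simp del: scaleR_scaleR)
    show "integrable ?M (\<lambda>s. \<bar>b - a\<bar> * (indicat_real {min a b..max a b} s *\<^sub>R norm (v s)))"
      using I(3) by (rule Bochner_Integration.integrable_mult_right)
    fix s assume "s \<in> space ?M"
    then have s: "0 \<le> s" "s \<le> L" by (auto simp: space_restrict_space)
    have "max 0 (b - s) *\<^sub>R v s - max 0 (a - s) *\<^sub>R v s - (b - a) *\<^sub>R indicat_real {0..a} s *\<^sub>R v s =
      (max 0 (b - s) - max 0 (a - s) - (b - a) * indicat_real {0..a} s) *\<^sub>R v s"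
      by (simp add: algebra_simps)
    also have "norm \<dots> \<le> (\<bar>b - a\<bar> * indicat_real {min a b..max a b} s) * norm (v s)"
      unfolding norm_scaleR
    proof (intro mult_right_mono norm_ge_zero)
      have "s \<le> min a b \<or> (min a b < s \<and> s \<le> max a b) \<or> max a b < s" by linarith
      then show "\<bar>max 0 (b - s) - max 0 (a - s) - (b - a) * indicat_real {0..a} s\<bar> \<le> \<bar>b - a\<bar> * indicat_real {min a b..max a b} s"
      proof (elim disjE conjE)
        assume "s \<le> min a b" then show ?thesis using s by simp
      next
        assume "max a b < s" then show ?thesis using s by simp
      next
        assume m: "min a b < s" "s \<le> max a b"
        then show ?thesis using s by (cases "a \<le> b") (simp_all add: min_def max_def split: if_splits)
      qed
    qed
    finally show "norm (max 0 (b - s) *\<^sub>R v s - max 0 (a - s) *\<^sub>R v s - (b - a) *\<^sub>R indicat_real {0..a} s *\<^sub>R v s)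
      \<le> \<bar>b - a\<bar> * (indicat_real {min a b..max a b} s *\<^sub>R norm (v s))" by (simp add: mult.assoc)
  qed
qed

lemma double_primitive_has_vector_derivative:
  fixes v :: "real \<Rightarrow> 'b::euclidean_space"
  assumes v: "integrable (lebesgue_on {0..L}) v" and a: "a \<in> {0..L}"
  shows "(double_primitive L v has_vector_derivative integral {0..a} v) (at a within {0..L})"
  unfolding has_vector_derivative_def has_derivative_within_alt
proof (intro conjI allI impI)
  show "bounded_linear (\<lambda>x. x *\<^sub>R integral {0..a} v)" by (rule bounded_linear_scaleR_left)
  fix e :: real assume e: "0 < e"
  have vn: "integrable (lebesgue_on {0..L}) (\<lambda>s. norm (v s))" using v by simp
  obtain d where d: "d > 0" "\<And>b. b \<in> {0..L} \<Longrightarrow> dist b a < d \<Longrightarrow>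
    dist (integral {0..b} (\<lambda>s. norm (v s))) (integral {0..a} (\<lambda>s. norm (v s))) < e"
    using continuous_on_primitive[OF vn] a e unfolding continuous_on_iff by blast
  show "\<exists>d>0. \<forall>y\<in>{0..L}. norm (y - a) < d \<longrightarrow>
      norm (double_primitive L v y - double_primitive L v a - (y - a) *\<^sub>R integral {0..a} v) \<le> e * norm (y - a)"
  proof (intro exI[of _ d] conjI d(1) ballI impI)
    fix y assume y: "y \<in> {0..L}" "norm (y - a) < d"
    have "integral {min a y..max a y} (\<lambda>s. norm (v s)) \<le> e"
    proof -
      have *: "\<bar>integral {0..y} (\<lambda>s. norm (v s)) - integral {0..a} (\<lambda>s. norm (v s))\<bar> < e"
        using d(2)[of y] y by (simp add: dist_real_def)
      show ?thesis
      proof (cases "a \<le> y")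
        case True
        then show ?thesis using * integral_diff_eq[OF vn, of a y] y a by (simp add: min_absorb1 max_absorb2)
      next
        case False
        then show ?thesis using * integral_diff_eq[OF vn, of y a] y a by (simp add: min_absorb2 max_absorb1)
      qed
    qed
    then have "\<bar>y - a\<bar> * integral {min a y..max a y} (\<lambda>s. norm (v s)) \<le> \<bar>y - a\<bar> * e"
      by (rule mult_left_mono) simp
    then have "\<bar>y - a\<bar> * integral {min a y..max a y} (\<lambda>s. norm (v s)) \<le> e * norm (y - a)"
      by (simp only: mult.commute[of e] real_norm_def)
    moreover have "norm (double_primitive L v y - double_primitive L v a - (y - a) *\<^sub>R integral {0..a} v) \<le>
      \<bar>y - a\<bar> * integral {min a y..max a y} (\<lambda>s. norm (v s))"
      using double_primitive_diff_bound[OF v, of a y] y a by auto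
    ultimately show "norm (double_primitive L v y - double_primitive L v a - (y - a) *\<^sub>R integral {0..a} v) \<le> e * norm (y - a)" by linarith
  qed
qed

text \<open>
  The second difference of \<open>x \<mapsto> x\<^sup>+\<close> is the hat function.
\<close>
lemma double_primitive_second_difference:
  fixes v :: "real \<Rightarrow> 'b::euclidean_space"
  assumes v: "integrable (lebesgue_on {0..L}) v" and "0 \<le> d"
  shows "double_primitive L v (t + d) - 2 *\<^sub>R double_primitive L v t + double_primitive L v (t - d) =
    (LINT s|lebesgue_on {0..L}. max 0 (d - \<bar>s - t\<bar>) *\<^sub>R v s)"
proof -
  let ?M = "lebesgue_on {0..L}"
  have i: "integrable ?M (\<lambda>s. max 0 (t - s) *\<^sub>R v s)" for t
    by (intro integrable_continuous_scaleR[OF v] continuous_intros)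
  have "double_primitive L v (t + d) - 2 *\<^sub>R double_primitive L v t + double_primitive L v (t - d) =
    (LINT s|?M. max 0 (t + d - s) *\<^sub>R v s - 2 *\<^sub>R max 0 (t - s) *\<^sub>R v s + max 0 (t - d - s) *\<^sub>R v s)"
    unfolding double_primitive_def using i by (simp del: scaleR_scaleR)
  also have "\<dots> = (LINT s|?M. max 0 (d - \<bar>s - t\<bar>) *\<^sub>R v s)"
  proof (rule Bochner_Integration.integral_cong[OF refl])
    fix s
    have "max 0 (t + d - s) - 2 * max 0 (t - s) + max 0 (t - d - s) = max 0 (d - \<bar>s - t\<bar>)"
    proof -
      consider "s \<le> t - d" | "t - d < s" "s \<le> t" | "t < s" "s < t + d" | "t + d \<le> s" by linarith
      then show ?thesis using assms(2) by cases simp_all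
    qed
    then show "max 0 (t + d - s) *\<^sub>R v s - 2 *\<^sub>R max 0 (t - s) *\<^sub>R v s + max 0 (t - d - s) *\<^sub>R v s = max 0 (d - \<bar>s - t\<bar>) *\<^sub>R v s"
      by (metis (no_types, lifting) scaleR_left_diff_distrib scaleR_left_distrib scaleR_scaleR)
  qed
  finally show ?thesis .
qed

lemma double_primitive_0: "double_primitive L v 0 = 0"
proof -
  have "double_primitive L v 0 = (LINT s|lebesgue_on {0..L}. 0)"
    unfolding double_primitive_def by (rule Bochner_Integration.integral_cong) (auto simp: space_restrict_space)
  then show ?thesis by simp
qed

lemma double_primitive_kernel_integrable:
  fixes v :: "real \<Rightarrow> 'b::euclidean_space"
  assumes "integrable (lebesgue_on {0..L}) v"
  shows "integrable (lebesgue_on {0..L}) (\<lambda>s. max 0 (t - s) *\<^sub>R v s)"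
  by (intro integrable_continuous_scaleR[OF assms] continuous_intros)

lemma double_primitive_add:
  fixes v w :: "real \<Rightarrow> 'b::euclidean_space"
  assumes "integrable (lebesgue_on {0..L}) v" "integrable (lebesgue_on {0..L}) w"
  shows "double_primitive L (\<lambda>s. v s + w s) t = double_primitive L v t + double_primitive L w t"
  unfolding double_primitive_def scaleR_add_right
  by (rule Bochner_Integration.integral_add[OF double_primitive_kernel_integrable[OF assms(1)] double_primitive_kernel_integrable[OF assms(2)]])

lemma double_primitive_scaleR: "double_primitive L (\<lambda>s. k *\<^sub>R v s) t = k *\<^sub>R double_primitive L v t"
proof -
  have "max 0 (t - s) *\<^sub>R k *\<^sub>R v s = k *\<^sub>R max 0 (t - s) *\<^sub>R v s" for s by (simp add: mult.commute)
  then show ?thesis unfolding double_primitive_def by (simp del: scaleR_scaleR)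
qed

lemma double_primitive_diff_le:
  fixes v w :: "real \<Rightarrow> 'b::euclidean_space"
  assumes v: "integrable (lebesgue_on {0..L}) v" and w: "integrable (lebesgue_on {0..L}) w" and t: "0 \<le> t" "t \<le> L"
  shows "norm (double_primitive L v t - double_primitive L w t) \<le> L * (LINT s|lebesgue_on {0..L}. norm (v s - w s))"
proof -
  let ?M = "lebesgue_on {0..L}"
  have e: "double_primitive L v t - double_primitive L w t = (LINT s|?M. max 0 (t - s) *\<^sub>R (v s - w s))"
    unfolding double_primitive_def scaleR_diff_right
    by (rule Bochner_Integration.integral_diff[symmetric, OF double_primitive_kernel_integrable[OF v] double_primitive_kernel_integrable[OF w]])
  have d: "integrable ?M (\<lambda>s. v s - w s)" using v w by (rule Bochner_Integration.integrable_diff)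
  have "norm (LINT s|?M. max 0 (t - s) *\<^sub>R (v s - w s)) \<le> (LINT s|?M. L * norm (v s - w s))"
  proof (rule Bochner_Integration.integral_norm_bound_integral[OF double_primitive_kernel_integrable[OF d]])
    show "integrable ?M (\<lambda>s. L * norm (v s - w s))" using d by simp
    fix s assume "s \<in> space ?M"
    then have "\<bar>max 0 (t - s)\<bar> \<le> L" using t by (auto simp: space_restrict_space)
    then show "norm (max 0 (t - s) *\<^sub>R (v s - w s)) \<le> L * norm (v s - w s)" unfolding norm_scaleR by (rule mult_right_mono) simp
  qed
  then show ?thesis unfolding e by simp
qed

text \<open>
  Summing the bound over a fine partition of \<open>{a..b}\<close> telescopes to \<open>e * (N b - N a)\<close> for every
  \<open>e > 0\<close>.
\<close>
lemma constant_if_increments_dominated: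
  fixes H :: "real \<Rightarrow> 'c::real_normed_vector" and N :: "real \<Rightarrow> real"
  assumes dom: "\<And>e. e > 0 \<Longrightarrow> \<exists>d>0. \<forall>x y. a \<le> x \<longrightarrow> x \<le> y \<longrightarrow> y \<le> b \<longrightarrow> y - x < d \<longrightarrow>
      norm (H y - H x) \<le> e * (N y - N x)"
    and ab: "a \<le> b"
  shows "H b = H a"
proof -
  have *: "norm (H b - H a) \<le> e * (N b - N a)" if e: "e > 0" for e
  proof -
    obtain d where d: "d > 0" "\<And>x y. a \<le> x \<Longrightarrow> x \<le> y \<Longrightarrow> y \<le> b \<Longrightarrow> y - x < d \<Longrightarrow>
      norm (H y - H x) \<le> e * (N y - N x)" using dom[OF e] by blast
    obtain n where n: "(b - a) / d < real n" using reals_Archimedean2 by blast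
    have n0: "real n > 0" using n ab d(1) by (smt (verit) divide_nonneg_pos)
    define t where "t k = a + real k * ((b - a) / real n)" for k
    have tb: "t k \<le> b" if "k \<le> n" for k
    proof -
      have "real k * ((b - a) / real n) \<le> real n * ((b - a) / real n)" using that ab by (intro mult_right_mono) auto
      then show ?thesis using n0 by (simp add: t_def)
    qed
    have "k \<le> n \<Longrightarrow> norm (H (t k) - H a) \<le> e * (N (t k) - N a)" for k
    proof (induction k)
      case (Suc k)
      have tt: "t (Suc k) - t k = (b - a) / real n" by (simp add: t_def distrib_right add_divide_distrib)
      have "(b - a) / real n < d" using n n0 d(1) by (simp add: field_simps)
      have "norm (H (t (Suc k)) - H (t k)) \<le> e * (N (t (Suc k)) - N (t k))"
      proof (intro d(2))
        have q: "0 \<le> (b - a) / real n" using ab by simp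
        then show "a \<le> t k" using mult_nonneg_nonneg[of "real k" "(b - a) / real n"] by (simp add: t_def)
        show "t k \<le> t (Suc k)" using q tt by linarith
        show "t (Suc k) \<le> b" using Suc tb[of "Suc k"] by simp
        show "t (Suc k) - t k < d" using tt \<open>(b - a) / real n < d\<close> by simp
      qed
      moreover have "norm (H (t k) - H a) \<le> e * (N (t k) - N a)" using Suc by simp
      moreover have "norm (H (t (Suc k)) - H a) \<le> norm (H (t (Suc k)) - H (t k)) + norm (H (t k) - H a)"
        by (metis diff_add_cancel add_diff_eq norm_triangle_ineq)
      ultimately show ?case by (simp add: algebra_simps)
    qed (simp add: t_def)
    from this[of n] show ?thesis using n0 by (simp add: t_def)
  qed
  have "norm (H b - H a) \<le> 0"
  proof (rule field_le_epsilon)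
    fix e :: real assume e: "e > 0"
    have "norm (H b - H a) \<le> (e / (\<bar>N b - N a\<bar> + 1)) * (N b - N a)" by (rule *) (use e in \<open>simp add: add_nonneg_pos\<close>)
    also have "\<dots> \<le> (e / (\<bar>N b - N a\<bar> + 1)) * (\<bar>N b - N a\<bar> + 1)" using e by (intro mult_left_mono) auto
    also have "\<dots> = e" by (simp add: add_nonneg_pos order_less_imp_not_eq2)
    finally show "norm (H b - H a) \<le> 0 + e" by simp
  qed
  then show ?thesis by simp
qed

text \<open>
  The derivatives are given only as densities, so the rule is proved on increments: over a short
  interval the increment of the product differs from the integral of \<open>f' g + f g'\<close> by the
  oscillation of \<open>f\<close> and \<open>g\<close> times \<open>\<integral> |f'| + |g'|\<close>, and such errors sum to something arbitrarily
  small.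
\<close>
lemma absolutely_continuous_product_rule:
  fixes f f' :: "real \<Rightarrow> 'a::euclidean_space" and g g' :: "real \<Rightarrow> 'b::euclidean_space"
    and pr :: "'a \<Rightarrow> 'b \<Rightarrow> 'c::euclidean_space"
  assumes pr: "bounded_bilinear pr"
    and f': "integrable (lebesgue_on {0..L}) f'" and g': "integrable (lebesgue_on {0..L}) g'"
    and f: "\<And>a b. 0 \<le> a \<Longrightarrow> a \<le> b \<Longrightarrow> b \<le> L \<Longrightarrow> f b - f a = integral {a..b} f'"
    and g: "\<And>a b. 0 \<le> a \<Longrightarrow> a \<le> b \<Longrightarrow> b \<le> L \<Longrightarrow> g b - g a = integral {a..b} g'"
    and ab: "0 \<le> a" "a \<le> b" "b \<le> L"
  shows "integrable (lebesgue_on {0..L}) (\<lambda>s. pr (f' s) (g s))"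
    "integrable (lebesgue_on {0..L}) (\<lambda>s. pr (f s) (g' s))"
    "pr (f b) (g b) - pr (f a) (g a) = integral {a..b} (\<lambda>s. pr (f' s) (g s) + pr (f s) (g' s))"
proof -
  interpret bounded_bilinear pr by fact
  let ?M = "lebesgue_on {0..L}"
  have cf: "continuous_on {0..L} f"
  proof (rule continuous_on_eq)
    show "continuous_on {0..L} (\<lambda>t. f 0 + integral {0..t} f')" by (intro continuous_intros continuous_on_primitive f')
    show "f 0 + integral {0..x} f' = f x" if "x \<in> {0..L}" for x using f[of 0 x] that by (simp add: algebra_simps)
  qed
  have cg: "continuous_on {0..L} g"
  proof (rule continuous_on_eq)
    show "continuous_on {0..L} (\<lambda>t. g 0 + integral {0..t} g')" by (intro continuous_intros continuous_on_primitive g')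
    show "g 0 + integral {0..x} g' = g x" if "x \<in> {0..L}" for x using g[of 0 x] that by (simp add: algebra_simps)
  qed
  obtain K where K: "K > 0" "\<And>x y. norm (pr x y) \<le> norm x * norm y * K" using pos_bounded by blast
  have [measurable]: "f \<in> borel_measurable ?M" "g \<in> borel_measurable ?M"
    by (rule continuous_imp_measurable_on_sets_lebesgue[OF cf] continuous_imp_measurable_on_sets_lebesgue[OF cg]; simp)+
  have [measurable]: "f' \<in> borel_measurable ?M" "g' \<in> borel_measurable ?M" using f' g' by auto
  have [measurable]: "(\<lambda>x. pr (h x) (k x)) \<in> borel_measurable ?M"
    if [measurable]: "h \<in> borel_measurable ?M" "k \<in> borel_measurable ?M" for h k
  proof -
    have "continuous_on UNIV (\<lambda>z. pr (fst z) (snd z))"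
      by (rule continuous_on) (auto intro!: continuous_intros)
    then have [measurable]: "(\<lambda>z. pr (fst z) (snd z)) \<in> borel_measurable (borel \<Otimes>\<^sub>M borel)"
      by (simp add: borel_measurable_continuous_onI borel_prod)
    have "(\<lambda>x. (h x, k x)) \<in> ?M \<rightarrow>\<^sub>M borel \<Otimes>\<^sub>M borel" by measurable
    from measurable_comp[OF this, of "\<lambda>z. pr (fst z) (snd z)" borel] show ?thesis by (simp add: o_def)
  qed
  obtain Bf where Bf: "\<And>s. s \<in> {0..L} \<Longrightarrow> norm (f s) \<le> Bf"
    using continuous_on_interval_bounded[OF cf] by blast
  obtain Bg where Bg: "\<And>s. s \<in> {0..L} \<Longrightarrow> norm (g s) \<le> Bg"
    using continuous_on_interval_bounded[OF cg] by blast
  have i1: "integrable ?M (\<lambda>s. pr (f' s) (k s))" if [measurable]: "k \<in> borel_measurable ?M"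
      and B: "\<And>s. s \<in> {0..L} \<Longrightarrow> norm (k s) \<le> B" for k B
  proof (rule Bochner_Integration.integrable_bound)
    show "integrable ?M (\<lambda>s. norm (f' s) * \<bar>B\<bar> * K)" using f' by simp
    show "AE s in ?M. norm (pr (f' s) (k s)) \<le> norm (norm (f' s) * \<bar>B\<bar> * K)"
    proof (rule AE_I2)
      fix s assume "s \<in> space ?M"
      then have "norm (k s) \<le> \<bar>B\<bar>" using B[of s] by (simp add: space_restrict_space)
      then have "norm (f' s) * norm (k s) * K \<le> norm (f' s) * \<bar>B\<bar> * K" using K by (intro mult_right_mono mult_left_mono) auto
      then show "norm (pr (f' s) (k s)) \<le> norm (norm (f' s) * \<bar>B\<bar> * K)" using K(1) K(2)[of "f' s" "k s"] by simp
    qed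
  qed measurable
  have i2: "integrable ?M (\<lambda>s. pr (k s) (g' s))" if [measurable]: "k \<in> borel_measurable ?M"
      and B: "\<And>s. s \<in> {0..L} \<Longrightarrow> norm (k s) \<le> B" for k B
  proof (rule Bochner_Integration.integrable_bound)
    show "integrable ?M (\<lambda>s. \<bar>B\<bar> * norm (g' s) * K)" using g' by simp
    show "AE s in ?M. norm (pr (k s) (g' s)) \<le> norm (\<bar>B\<bar> * norm (g' s) * K)"
    proof (rule AE_I2)
      fix s assume "s \<in> space ?M"
      then have "norm (k s) \<le> \<bar>B\<bar>" using B[of s] by (simp add: space_restrict_space)
      then have "norm (k s) * norm (g' s) * K \<le> \<bar>B\<bar> * norm (g' s) * K" using K by (intro mult_right_mono) auto
      then show "norm (pr (k s) (g' s)) \<le> norm (\<bar>B\<bar> * norm (g' s) * K)" using K(1) K(2)[of "k s" "g' s"] by simp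
    qed
  qed measurable
  show I1: "integrable ?M (\<lambda>s. pr (f' s) (g s))" by (rule i1[OF _ Bg]) measurable
  show I2: "integrable ?M (\<lambda>s. pr (f s) (g' s))" by (rule i2[OF _ Bf]) measurable
  have I: "integrable ?M (\<lambda>s. pr (f' s) (g s) + pr (f s) (g' s))" using I1 I2 by simp
  define H where "H x = pr (f x) (g x) - integral {0..x} (\<lambda>s. pr (f' s) (g s) + pr (f s) (g' s))" for x
  have nI: "integrable ?M (\<lambda>s. norm (f' s) + norm (g' s))" using f' g' by simp
  define N where "N x = integral {0..x} (\<lambda>s. norm (f' s) + norm (g' s))" for x
  have "H b = H a"
  proof (rule constant_if_increments_dominated[OF _ ab(2)])
    fix e :: real assume e: "e > 0"
    then have e': "e / K > 0" using K by simp
    have uf: "uniformly_continuous_on {0..L} f" "uniformly_continuous_on {0..L} g"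
      using cf cg by (auto intro: compact_uniformly_continuous)
    obtain d1 where d1: "d1 > 0" "\<And>x y. x \<in> {0..L} \<Longrightarrow> y \<in> {0..L} \<Longrightarrow> dist y x < d1 \<Longrightarrow> dist (f y) (f x) < e / K"
      using uf(1) e' unfolding uniformly_continuous_on_def by blast
    obtain d2 where d2: "d2 > 0" "\<And>x y. x \<in> {0..L} \<Longrightarrow> y \<in> {0..L} \<Longrightarrow> dist y x < d2 \<Longrightarrow> dist (g y) (g x) < e / K"
      using uf(2) e' unfolding uniformly_continuous_on_def by blast
    show "\<exists>d>0. \<forall>x y. a \<le> x \<longrightarrow> x \<le> y \<longrightarrow> y \<le> b \<longrightarrow> y - x < d \<longrightarrow> norm (H y - H x) \<le> e * (N y - N x)"
    proof (intro exI[of _ "min d1 d2"] conjI allI impI)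
      show "0 < min d1 d2" using d1 d2 by simp
      fix x y assume xy: "a \<le> x" "x \<le> y" "y \<le> b" "y - x < min d1 d2"
      then have x: "0 \<le> x" "y \<le> L" using ab by auto
      note sub = integrable_subinterval_lebesgue_on[OF _ x]
      have F: "pr (f y - f x) (g y) = integral {x..y} (\<lambda>s. pr (f' s) (g y))"
        unfolding f[OF x(1) xy(2) x(2)]
        using integral_linear[OF sub(2)[OF f'] bounded_linear_left[of "g y"]] by (simp add: o_def)
      have G: "pr (f x) (g y - g x) = integral {x..y} (\<lambda>s. pr (f x) (g' s))"
        unfolding g[OF x(1) xy(2) x(2)]
        using integral_linear[OF sub(2)[OF g'] bounded_linear_right[of "f x"]] by (simp add: o_def)
      have i1': "integrable ?M (\<lambda>s. pr (f' s) (g y))" by (rule i1[where B="norm (g y)"]) auto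
      have i2': "integrable ?M (\<lambda>s. pr (f x) (g' s))" by (rule i2[where B="norm (f x)"]) auto
      have "H y - H x = pr (f y - f x) (g y) + pr (f x) (g y - g x) - integral {x..y} (\<lambda>s. pr (f' s) (g s) + pr (f s) (g' s))"
        unfolding H_def integral_diff_eq[OF I x(1) xy(2) x(2), symmetric]
        by (simp add: diff_left diff_right)
      also have "\<dots> = integral {x..y} (\<lambda>s. pr (f' s) (g y) + pr (f x) (g' s) - (pr (f' s) (g s) + pr (f s) (g' s)))"
        unfolding F G Henstock_Kurzweil_Integration.integral_diff[OF integrable_add[OF sub(2)[OF i1'] sub(2)[OF i2']] sub(2)[OF I]]
          Henstock_Kurzweil_Integration.integral_add[OF sub(2)[OF i1'] sub(2)[OF i2']] ..
      also have "norm \<dots> \<le> integral {x..y} (\<lambda>s. e * (norm (f' s) + norm (g' s)))"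
      proof (rule Henstock_Kurzweil_Integration.integral_norm_bound_integral)
        show "(\<lambda>s. pr (f' s) (g y) + pr (f x) (g' s) - (pr (f' s) (g s) + pr (f s) (g' s))) integrable_on {x..y}"
          by (rule Henstock_Kurzweil_Integration.integrable_diff[OF integrable_add[OF sub(2)[OF i1'] sub(2)[OF i2']] sub(2)[OF I]])
        show "(\<lambda>s. e * (norm (f' s) + norm (g' s))) integrable_on {x..y}"
          using sub(2)[OF nI] by (intro integrable_on_mult_right)
        fix s assume s: "s \<in> {x..y}"
        have df: "norm (f x - f s) \<le> e / K" and dg: "norm (g y - g s) \<le> e / K"
          using d1(2)[of s x] d2(2)[of s y] s xy x by (auto simp: dist_norm)
        have "pr (f' s) (g y) + pr (f x) (g' s) - (pr (f' s) (g s) + pr (f s) (g' s)) =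
          pr (f' s) (g y - g s) + pr (f x - f s) (g' s)" by (simp add: diff_left diff_right)
        also have "norm \<dots> \<le> norm (f' s) * norm (g y - g s) * K + norm (f x - f s) * norm (g' s) * K"
          by (intro norm_triangle_le add_mono K(2))
        also have "\<dots> \<le> norm (f' s) * (e / K) * K + (e / K) * norm (g' s) * K"
          using df dg K(1) by (intro add_mono mult_right_mono mult_left_mono) auto
        also have "\<dots> = e * (norm (f' s) + norm (g' s))" using K(1) by (simp add: field_simps)
        finally show "norm (pr (f' s) (g y) + pr (f x) (g' s) - (pr (f' s) (g s) + pr (f s) (g' s))) \<le> e * (norm (f' s) + norm (g' s))" .
      qed
      also have "\<dots> = e * (N y - N x)"
        unfolding N_def integral_diff_eq[OF nI x(1) xy(2) x(2)] by simp
      finally show "norm (H y - H x) \<le> e * (N y - N x)" .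
    qed
  qed
  then show "pr (f b) (g b) - pr (f a) (g a) = integral {a..b} (\<lambda>s. pr (f' s) (g s) + pr (f s) (g' s))"
    unfolding H_def integral_diff_eq[OF I ab, symmetric] by (simp add: algebra_simps)
qed

section \<open>Limits of near-minimizers in decreasing convex sets\<close>

lemma midpoint_powr_le:
  assumes "0 \<le> (x::real)" "0 \<le> y" "1 \<le> p"
  shows "((x + y) / 2) powr p \<le> (x powr p + y powr p) / 2"
proof -
  have half: "(z / 2) powr p \<le> z powr p / 2" if "0 \<le> z" for z :: real
  proof -
    have "(z / 2) powr p = z powr p / 2 powr p" using that by (simp add: powr_divide)
    moreover have "(2::real) powr 1 \<le> 2 powr p" using assms(3) by (intro powr_mono) auto
    ultimately show ?thesis using divide_left_mono[of 2 "2 powr p" "z powr p"] by simp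
  qed
  show ?thesis
  proof (cases "x = 0 \<or> y = 0")
    case True
    then show ?thesis using half[of x] half[of y] assms by auto
  next
    case False
    then have "((1 - 1/2) *\<^sub>R x + (1/2) *\<^sub>R y) powr p \<le> (1 - 1/2) * x powr p + (1/2) * y powr p"
      using assms by (intro convex_onD[OF powr_convex[OF assms(3)]]) auto
    then show ?thesis by (simp add: field_simps)
  qed
qed

text \<open>
  A strictly convex function of linear growth.  Its integral is finite on \<open>L\<^sup>1\<close>, and its midpoint
  defect controls distances.
\<close>
definition japanese_bracket :: "'a::real_inner \<Rightarrow> real" where
  "japanese_bracket x = sqrt (1 + (norm x)\<^sup>2)"

lemma japanese_bracket_ge1: "1 \<le> japanese_bracket x"
  by (simp add: japanese_bracket_def)

lemma norm_le_japanese_bracket: "norm x \<le> japanese_bracket x"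
  by (simp add: japanese_bracket_def real_le_rsqrt)

lemma japanese_bracket_le: "japanese_bracket x \<le> 1 + norm x"
  unfolding japanese_bracket_def by (rule real_le_lsqrt) (auto simp: power2_eq_square algebra_simps)

lemma japanese_bracket_sq: "(japanese_bracket x)\<^sup>2 = 1 + (norm x)\<^sup>2"
  by (simp add: japanese_bracket_def)

text \<open>
  The difference of squares \<open>(1 + |x|\<^sup>2) (1 + |y|\<^sup>2) - (1 + x \<bullet> y)\<^sup>2\<close> is at least \<open>|x - y|\<^sup>2\<close> by the
  Cauchy-Schwarz inequality.
\<close>
lemma japanese_bracket_prod:
  "(norm (x - y))\<^sup>2 \<le> 2 * (japanese_bracket x * japanese_bracket y) *
     (japanese_bracket x * japanese_bracket y - 1 - x \<bullet> y)"
proof -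
  define a where "a = japanese_bracket x * japanese_bracket y"
  have a: "a > 0" using japanese_bracket_ge1[of x] japanese_bracket_ge1[of y] 
    by (simp add: a_def)
  have aa: "a\<^sup>2 = (1 + x \<bullet> x) * (1 + y \<bullet> y)"
    by (simp add: a_def power_mult_distrib japanese_bracket_sq dot_square_norm)
  have cs: "(x \<bullet> y)\<^sup>2 \<le> (x \<bullet> x) * (y \<bullet> y)" by (rule Cauchy_Schwarz_ineq)
  have n: "(norm (x - y))\<^sup>2 = x \<bullet> x + y \<bullet> y - 2 * (x \<bullet> y)"
    by (simp add: dot_square_norm[symmetric] inner_diff_left inner_diff_right inner_commute)
  have d: "(norm (x - y))\<^sup>2 \<le> a\<^sup>2 - (1 + x \<bullet> y)\<^sup>2"
    unfolding n aa using cs by (simp add: power2_eq_square algebra_simps)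
  then have "(1 + x \<bullet> y)\<^sup>2 \<le> a\<^sup>2" using zero_le_power2[of "norm (x - y)"] by linarith
  then have b: "\<bar>1 + x \<bullet> y\<bar> \<le> a" using a by (simp add: abs_le_square_iff[symmetric])
  have "a\<^sup>2 - (1 + x \<bullet> y)\<^sup>2 = (a + (1 + x \<bullet> y)) * (a - 1 - x \<bullet> y)"
    by (simp add: power2_eq_square algebra_simps)
  also have "\<dots> \<le> (2 * a) * (a - 1 - x \<bullet> y)"
    using b by (intro mult_right_mono) auto
  finally show ?thesis using d by (simp add: a_def)
qed

lemma japanese_bracket_midpoint:
  fixes x y :: "'a::real_inner"
  defines "D \<equiv> (japanese_bracket x + japanese_bracket y) / 2 - japanese_bracket ((1/2) *\<^sub>R (x + y))"
  shows "(norm (x - y))\<^sup>2 \<le> 4 * (japanese_bracket x * japanese_bracket y) *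
    (japanese_bracket x + japanese_bracket y) * D" and "0 \<le> D"
proof -
  define a b m where "a = japanese_bracket x" and "b = japanese_bracket y"
    and "m = japanese_bracket ((1/2) *\<^sub>R (x + y))"
  have pos: "a \<ge> 1" "b \<ge> 1" "m \<ge> 1" by (simp_all add: a_def b_def m_def japanese_bracket_ge1)
  have sq: "a\<^sup>2 = 1 + x \<bullet> x" "b\<^sup>2 = 1 + y \<bullet> y" by (simp_all add: a_def b_def japanese_bracket_sq dot_square_norm)
  have m2: "m\<^sup>2 = 1 + (x \<bullet> x + y \<bullet> y + 2 * (x \<bullet> y)) / 4"
    unfolding m_def japanese_bracket_sq dot_square_norm[symmetric]
    by (simp add: inner_add_left inner_add_right inner_commute field_simps)
  have e: "((a + b) / 2)\<^sup>2 - m\<^sup>2 = (a * b - 1 - x \<bullet> y) / 2"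
    unfolding m2 using sq by (simp add: power2_eq_square field_simps)
  have p: "(norm (x - y))\<^sup>2 \<le> 2 * (a * b) * (a * b - 1 - x \<bullet> y)"
    unfolding a_def b_def by (rule japanese_bracket_prod)
  have nn: "0 \<le> a * b - 1 - x \<bullet> y"
  proof (rule ccontr)
    assume "\<not> ?thesis"
    then have "2 * (a * b) * (a * b - 1 - x \<bullet> y) < 0" using pos by (intro mult_pos_neg) auto
    then show False using p zero_le_power2[of "norm (x - y)"] by linarith
  qed
  then have "m\<^sup>2 \<le> ((a + b) / 2)\<^sup>2" using e by simp
  then have mle: "m \<le> (a + b) / 2" using pos by (simp add: power2_le_iff_abs_le)
  then show D: "0 \<le> D" by (simp add: D_def a_def b_def m_def)
  have DD: "D = (a + b) / 2 - m" by (simp add: D_def a_def b_def m_def)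
  have "(a * b - 1 - x \<bullet> y) / 2 = ((a + b) / 2 + m) * D"
    unfolding e[symmetric] DD by (simp add: power2_eq_square algebra_simps)
  also have "\<dots> \<le> (a + b) * D"
  proof (rule mult_right_mono[OF _ D])
    have "m + m \<le> a + b" using mle by (simp add: field_simps)
    then show "(a + b) / 2 + m \<le> a + b" by (simp add: field_simps)
  qed
  finally have "2 * (a * b) * (a * b - 1 - x \<bullet> y) \<le> 2 * (a * b) * (2 * ((a + b) * D))"
    using pos by (intro mult_left_mono) auto
  with p show "(norm (x - y))\<^sup>2 \<le> 4 * (japanese_bracket x * japanese_bracket y) *
    (japanese_bracket x + japanese_bracket y) * D"
    unfolding a_def[symmetric] b_def[symmetric] by (simp add: algebra_simps)
qed

lemma powr_1_plus_le:
  assumes "0 \<le> (z::real)" "0 \<le> p" shows "(1 + z) powr p \<le> 2 powr p * (1 + z powr p)"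
proof -
  have "(1 + z) powr p \<le> (2 * max 1 z) powr p" using assms by (intro powr_mono2) auto
  also have "\<dots> = 2 powr p * (max 1 z) powr p" using assms by (simp add: powr_mult)
  also have "(max 1 z) powr p \<le> 1 + z powr p" by (auto simp: max_def)
  finally show ?thesis by simp
qed

text \<open>
  On bounded sets the square of the distance is at most a multiple of the midpoint defect; outside
  a large ball the distance is negligible against \<open>|x|\<^sup>p + |y|\<^sup>p\<close>, because \<open>p > 1\<close>.  After integration
  this turns a small defect into a small \<open>L\<^sup>1\<close> distance.
\<close>
lemma dist_le_midpoint_defect:
  fixes p \<eta> :: real
  assumes p: "1 < p" and \<eta>: "0 < \<eta>"
  shows "\<exists>C\<ge>0. \<forall>x y::'a::real_inner. norm (x - y) \<le> \<eta> * (2 + norm x powr p + norm y powr p) +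
    C * ((japanese_bracket x + japanese_bracket y) / 2 - japanese_bracket ((1/2) *\<^sub>R (x + y)))"
proof -
  have "((\<lambda>R. 2 * 2 powr p * R powr (1 - p)) \<longlongrightarrow> 2 * 2 powr p * 0) at_top"
    using p by (intro tendsto_mult tendsto_const tendsto_neg_powr filterlim_ident) auto
  then have "\<forall>\<^sub>F R in at_top. 2 * 2 powr p * R powr (1 - p) < \<eta>"
    using \<eta> by (intro order_tendstoD(2)) auto
  \<comment> \<open>Outside the ball of radius \<open>R\<close> the distance is at most \<open>\<eta>\<close> times the \<open>p\<close>-th powers.\<close>
  then obtain R where R: "R \<ge> 1" "2 * 2 powr p * R powr (1 - p) < \<eta>"
    by (metis (mono_tags, lifting) eventually_at_top_linorder linorder_linear)
  define C where "C = 2 * R ^ 3 / \<eta>"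
  have C: "C \<ge> 0" using R \<eta> by (simp add: C_def)
  show ?thesis
  proof (intro exI[of _ C] conjI allI C)
    fix x y :: 'a
    define a b D where "a = japanese_bracket x" and "b = japanese_bracket y"
      and "D = (japanese_bracket x + japanese_bracket y) / 2 - japanese_bracket ((1/2) *\<^sub>R (x + y))"
    have pos: "a \<ge> 1" "b \<ge> 1" "D \<ge> 0"
      unfolding a_def b_def D_def by (rule japanese_bracket_ge1 japanese_bracket_midpoint)+
    have sq: "(norm (x - y))\<^sup>2 \<le> 4 * (a * b) * (a + b) * D"
      unfolding a_def b_def D_def by (rule japanese_bracket_midpoint)
    have "norm (x - y) \<le> \<eta> * (2 + norm x powr p + norm y powr p) + C * D"
    proof (cases "a \<le> R \<and> b \<le> R")
      case True
      have "4 * (a * b) * (a + b) * D \<le> 4 * (R * R) * (R + R) * D"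
        using True pos by (intro mult_mono) auto
      moreover have "4 * (R * R) * (R + R) * D = 8 * R ^ 3 * D" by (simp add: power3_eq_cube)
      ultimately have s: "(norm (x - y))\<^sup>2 \<le> 8 * R ^ 3 * D" using sq by linarith
      have "norm (x - y) \<le> \<eta> + (norm (x - y))\<^sup>2 / (4 * \<eta>)"
      proof -
        have "0 \<le> (norm (x - y) - 2 * \<eta>)\<^sup>2" by simp
        then show ?thesis using \<eta> by (simp add: power2_eq_square field_simps)
      qed
      also have "\<dots> \<le> \<eta> + 8 * R ^ 3 * D / (4 * \<eta>)" using s \<eta> by (intro add_left_mono divide_right_mono) auto
      also have "8 * R ^ 3 * D / (4 * \<eta>) = C * D" by (simp add: C_def)
      also have "\<eta> \<le> \<eta> * (2 + norm x powr p + norm y powr p)"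
      proof -
        have "1 \<le> 2 + norm x powr p + norm y powr p" using powr_ge_zero[of "norm x" p] powr_ge_zero[of "norm y" p] by linarith
        then show ?thesis using \<eta> by simp
      qed
      finally show ?thesis by simp
    next
      case False
      define m where "m = max a b"
      have m: "m \<ge> R" "m > 0" using False R by (auto simp: m_def)
      have "norm (x - y) \<le> a + b" unfolding a_def b_def
        by (meson add_mono norm_le_japanese_bracket norm_triangle_ineq4 order_trans)
      also have "\<dots> \<le> 2 * m" by (simp add: m_def)
      also have "m = m powr p * m powr (1 - p)" using m by (simp add: powr_add[symmetric])
      also have "2 * \<dots> \<le> 2 * (m powr p * R powr (1 - p))"
        using m R p by (intro mult_left_mono powr_mono2') auto
      also have "m powr p \<le> 2 powr p * (2 + norm x powr p + norm y powr p)"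
      proof -
        have "a powr p \<le> 2 powr p * (1 + norm x powr p)"
          using powr_1_plus_le[of "norm x" p] powr_mono2[of p a "1 + norm x"] japanese_bracket_le[of x] pos p
          by (simp add: a_def)
        moreover have "b powr p \<le> 2 powr p * (1 + norm y powr p)"
          using powr_1_plus_le[of "norm y" p] powr_mono2[of p b "1 + norm y"] japanese_bracket_le[of y] pos p
          by (simp add: b_def)
        moreover have "m powr p \<le> a powr p + b powr p" by (simp add: m_def max_def)
        ultimately have "m powr p \<le> 2 powr p * (1 + norm x powr p) + 2 powr p * (1 + norm y powr p)" by linarith
        then show ?thesis by (simp add: algebra_simps)
      qed
      finally have "norm (x - y) \<le> 2 * (2 powr p * (2 + norm x powr p + norm y powr p) * R powr (1 - p))"
        by (simp add: mult_right_mono mult_left_mono)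
      also have "\<dots> = (2 * 2 powr p * R powr (1 - p)) * (2 + norm x powr p + norm y powr p)" by simp
      also have "\<dots> \<le> \<eta> * (2 + norm x powr p + norm y powr p)"
        using R by (intro mult_right_mono) (auto simp: add_nonneg_nonneg)
      finally show ?thesis using C pos by (simp add: add_increasing2)
    qed
    then show "norm (x - y) \<le> \<eta> * (2 + norm x powr p + norm y powr p) +
      C * ((japanese_bracket x + japanese_bracket y) / 2 - japanese_bracket ((1/2) *\<^sub>R (x + y)))"
      by (simp add: D_def)
  qed
qed


text \<open>
  This replaces weak compactness in \<open>L\<^sup>p\<close>.  The infima of \<open>\<integral> sqrt (1 + |g|\<^sup>2)\<close> over the decreasing
  sets increase to a finite limit.  If \<open>G i\<close> and \<open>G j\<close> nearly attain them, their midpoint lies in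
  the larger of the two sets, so that its value is not much smaller and the midpoint defect is small.
  By the previous estimate the sequence is Cauchy in \<open>L\<^sup>1\<close>.
\<close>
lemma L1_limit_of_near_minimizers:
  fixes A :: "nat \<Rightarrow> ('a \<Rightarrow> 'b::euclidean_space) set" and p K :: real
  assumes fin: "finite_measure M" and p: "1 < p"
    and ne: "\<And>n. A n \<noteq> {}" and dec: "\<And>n. A (Suc n) \<subseteq> A n"
    and conv: "\<And>n g h. g \<in> A n \<Longrightarrow> h \<in> A n \<Longrightarrow> (\<lambda>x. (1/2) *\<^sub>R (g x + h x)) \<in> A n"
    and int: "\<And>n g. g \<in> A n \<Longrightarrow> integrable M g"
    and intp: "\<And>n g. g \<in> A n \<Longrightarrow> integrable M (\<lambda>x. norm (g x) powr p)"
    and bd: "\<And>n g. g \<in> A n \<Longrightarrow> (LINT x|M. norm (g x) powr p) \<le> K"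
  obtains G v where "\<And>n. G n \<in> A n" "integrable M v" "(\<lambda>n. LINT x|M. norm (G n x - v x)) \<longlonglongrightarrow> 0"
    "integrable M (\<lambda>x. norm (v x) powr p)" "(LINT x|M. norm (v x) powr p) \<le> K"
proof -
  interpret finite_measure M by fact
  define E where "E g = (LINT x|M. japanese_bracket (g x))" for g :: "'a \<Rightarrow> 'b"
  define \<mu> where "\<mu> = measure M (space M)"
  have mono: "A m \<subseteq> A n" if "n \<le> m" for m n
    using that dec by (rule lift_Suc_antimono_le[rotated])
  have [measurable]: "japanese_bracket \<in> borel_measurable (borel :: 'b measure)"
    unfolding japanese_bracket_def[abs_def] by measurable
  have intE: "integrable M (\<lambda>x. japanese_bracket (g x))" if "g \<in> A n" for g n
  proof (rule Bochner_Integration.integrable_bound)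
    show "integrable M (\<lambda>x. 1 + norm (g x))" using int[OF that] by simp
    have [measurable]: "g \<in> borel_measurable M" using int[OF that] by simp
    show "(\<lambda>x. japanese_bracket (g x)) \<in> borel_measurable M" by measurable
    show "AE x in M. norm (japanese_bracket (g x)) \<le> norm (1 + norm (g x))"
    proof (intro always_eventually allI)
      fix x
      show "norm (japanese_bracket (g x)) \<le> norm (1 + norm (g x))"
        using japanese_bracket_le[of "g x"] japanese_bracket_ge1[of "g x"] by simp
    qed
  qed
  have E0: "0 \<le> E g" for g unfolding E_def
    by (intro integral_nonneg_AE always_eventually allI) (meson japanese_bracket_ge1 order_trans zero_le_one)
  have Eub: "E g \<le> 2 * \<mu> + K" if "g \<in> A n" for g n
  proof -
    have "E g \<le> (LINT x|M. 2 + norm (g x) powr p)" unfolding E_def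
    proof (rule integral_mono)
      fix x
      have "norm (g x) \<le> 1 + norm (g x) powr p"
      proof (cases "norm (g x) \<le> 1")
        case False
        then have "norm (g x) powr 1 \<le> norm (g x) powr p" using p by (intro powr_mono) auto
        then show ?thesis using False by simp
      qed (simp add: add_increasing2)
      then show "japanese_bracket (g x) \<le> 2 + norm (g x) powr p" using japanese_bracket_le[of "g x"] by simp
    qed (use intE[OF that] intp[OF that] in auto)
    also have "\<dots> \<le> 2 * \<mu> + K" using intp[OF that] bd[OF that] by (simp add: \<mu>_def)
    finally show ?thesis .
  qed
  define I where "I n = Inf (E ` A n)" for n
  have bdd: "bdd_below (E ` A n)" for n using E0 by (auto intro!: bdd_belowI)
  have I_le: "I n \<le> E g" if "g \<in> A n" for g n unfolding I_def using bdd that by (auto intro: cInf_lower)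
  have "incseq I" unfolding incseq_def I_def
    using ne mono bdd by (intro allI impI cInf_superset_mono image_mono) auto
  moreover have "I n \<le> 2 * \<mu> + K" for n using ne[of n] I_le Eub by (metis ex_in_conv order_trans)
  then have "bdd_above (range I)" by (intro bdd_aboveI2)
  ultimately have Iconv: "I \<longlonglongrightarrow> (SUP n. I n)" by (rule LIMSEQ_incseq_SUP[rotated])
  have "\<exists>g\<in>A n. E g < I n + inverse (Suc n)" for n
  proof -
    have "Inf (E ` A n) < I n + inverse (Suc n)" by (simp add: I_def)
    then show ?thesis using cInf_lessD[of "E ` A n"] ne by auto
  qed
  then obtain G where G: "\<And>n. G n \<in> A n" "\<And>n. E (G n) < I n + inverse (Suc n)" by metis
  have [measurable]: "G n \<in> borel_measurable M" for n using int[OF G(1)] by simp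
  define D where "D i j x = (japanese_bracket (G i x) + japanese_bracket (G j x)) / 2 - japanese_bracket ((1/2) *\<^sub>R (G i x + G j x))" for i j x
  have Dint: "integrable M (D i j)" and Dle: "(LINT x|M. D i j x) \<le> (E (G i) + E (G j)) / 2 - I (min i j)" for i j
  proof -
    have mem: "(\<lambda>x. (1/2) *\<^sub>R (G i x + G j x)) \<in> A (min i j)"
      by (rule conv; rule subsetD[OF mono G(1)]) auto
    note ii = intE[OF G(1)[of i]] intE[OF G(1)[of j]] intE[OF mem]
    show "integrable M (D i j)" unfolding D_def[abs_def] using ii by auto
    have "(LINT x|M. D i j x) = (E (G i) + E (G j)) / 2 - E (\<lambda>x. (1/2) *\<^sub>R (G i x + G j x))"
      unfolding D_def E_def using ii by simp
    then show "(LINT x|M. D i j x) \<le> (E (G i) + E (G j)) / 2 - I (min i j)" using I_le[OF mem] by simp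
  qed
  have K0: "0 \<le> K" using bd[OF G(1)[of 0]] by (rule order_trans[rotated]) (simp add: integral_nonneg_AE)
  have \<mu>0: "0 \<le> \<mu>" by (simp add: \<mu>_def)
  have cauchy: "\<exists>N. \<forall>i\<ge>N. \<forall>j\<ge>N. (LINT x|M. norm (G i x - G j x)) < e" if e: "e > 0" for e
  proof -
    define \<eta> where "\<eta> = e / (2 * (2 * \<mu> + 2 * K + 1))"
    have \<eta>: "\<eta> > 0" using e K0 \<mu>0 by (simp add: \<eta>_def)
    obtain C where C: "C \<ge> 0" "\<And>x y::'b. norm (x - y) \<le> \<eta> * (2 + norm x powr p + norm y powr p) +
      C * ((japanese_bracket x + japanese_bracket y) / 2 - japanese_bracket ((1/2) *\<^sub>R (x + y)))"
      using dist_le_midpoint_defect[OF p \<eta>, where 'a='b] by blast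
    have "(\<lambda>n. I n + inverse (real (Suc n))) \<longlonglongrightarrow> (SUP n. I n) + 0"
      by (intro tendsto_add Iconv LIMSEQ_inverse_real_of_nat)
    moreover define \<zeta> where "\<zeta> = e / (4 * (C + 1))"
    have \<zeta>: "\<zeta> > 0" using e C by (simp add: \<zeta>_def)
    ultimately have "\<forall>\<^sub>F n in sequentially. I n + inverse (real (Suc n)) < (SUP n. I n) + \<zeta>"
      by (intro order_tendstoD(2)) auto
    moreover have "\<forall>\<^sub>F n in sequentially. I n > (SUP n. I n) - \<zeta>"
      using Iconv \<zeta> by (intro order_tendstoD(1)) auto
    ultimately have "\<forall>\<^sub>F n in sequentially. I n + inverse (real (Suc n)) < (SUP n. I n) + \<zeta> \<and> I n > (SUP n. I n) - \<zeta>"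
      by (rule eventually_conj)
    then obtain N where N: "\<And>n. n \<ge> N \<Longrightarrow> I n + inverse (real (Suc n)) < (SUP n. I n) + \<zeta>"
      "\<And>n. n \<ge> N \<Longrightarrow> I n > (SUP n. I n) - \<zeta>"
      by (auto simp: eventually_sequentially)
    have "(LINT x|M. norm (G i x - G j x)) < e" if ij: "i \<ge> N" "j \<ge> N" for i j
    proof -
      have pw: "norm (G i x - G j x) \<le> \<eta> * (2 + norm (G i x) powr p + norm (G j x) powr p) + C * D i j x" for x
        unfolding D_def by (rule C(2))
      note ip = intp[OF G(1)[of i]] intp[OF G(1)[of j]] 
      have "(LINT x|M. norm (G i x - G j x)) \<le> 
         (LINT x|M. \<eta> * (2 + norm (G i x) powr p + norm (G j x) powr p) + C * D i j x)"
        using ip Dint[of i j] int[OF G(1)[of i]] int[OF G(1)[of j]] pw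
        by (intro integral_mono) auto
      also have "\<dots> = \<eta> * (2 * \<mu> + (LINT x|M. norm (G i x) powr p) + (LINT x|M. norm (G j x) powr p)) + C * (LINT x|M. D i j x)"
        using ip Dint[of i j] by (simp add: \<mu>_def)
      also have "\<dots> \<le> \<eta> * (2 * \<mu> + K + K) + C * (2 * \<zeta>)"
      proof (intro add_mono mult_left_mono bd[OF G(1)] order_refl)
        have "min i j \<ge> N" using ij by simp
        then have "I (min i j) > (SUP n. I n) - \<zeta>" by (rule N)
        with Dle[of i j] G(2)[of i] G(2)[of j] N(1)[OF ij(1)] N(1)[OF ij(2)]
        show "(LINT x|M. D i j x) \<le> 2 * \<zeta>" by argo
      qed (use \<eta> C in auto)
      also have "\<eta> * (2 * \<mu> + K + K) < \<eta> * (2 * \<mu> + 2 * K + 1)" using \<eta> by (intro mult_strict_left_mono) auto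
      also have "\<dots> = e / 2" using \<mu>0 K0 e by (simp add: \<eta>_def field_simps)
      also have "C * (2 * \<zeta>) \<le> (C + 1) * (2 * \<zeta>)" using \<zeta> by (intro mult_right_mono) auto
      also have "(C + 1) * (2 * \<zeta>) = e / 2" using C by (simp add: \<zeta>_def field_simps)
      finally show ?thesis by simp
    qed
    then show ?thesis by blast
  qed
  obtain r where r: "strict_mono r" "AE x in M. Cauchy (\<lambda>i. G (r i) x)"
    using cauchy_L1_AE_cauchy_subseq[OF int[OF G(1)], of "\<lambda>n. n"] cauchy by metis
  define v where "v x = lim (\<lambda>i. G (r i) x)" for x
  have [measurable]: "v \<in> borel_measurable M" unfolding v_def[abs_def] by measurable
  have lim: "AE x in M. (\<lambda>i. G (r i) x) \<longlonglongrightarrow> v x"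
    using r(2) by eventually_elim (simp add: v_def Cauchy_convergent_iff convergent_LIMSEQ_iff)
  have fatou: "integrable M f \<and> (LINT x|M. f x) \<le> B"
    if f: "AE x in M. (\<lambda>i. F i x) \<longlonglongrightarrow> f x" and F: "\<And>i. integrable M (F i)" "\<And>i x. 0 \<le> F i x" and
      B: "\<forall>\<^sub>F i in sequentially. (LINT x|M. F i x) \<le> B" and [measurable]: "f \<in> borel_measurable M" and f0: "\<And>x. 0 \<le> f x"
    for F :: "nat \<Rightarrow> 'a \<Rightarrow> real" and f B
  proof -
    have B0: "0 \<le> B" 
    proof -
      obtain i where "(LINT x|M. F i x) \<le> B" using B by (auto simp: eventually_sequentially)
      moreover have "0 \<le> (LINT x|M. F i x)" using F by simp
      ultimately show ?thesis by simp
    qed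
    have "(\<integral>\<^sup>+x. ennreal (f x) \<partial>M) = (\<integral>\<^sup>+x. liminf (\<lambda>i. ennreal (F i x)) \<partial>M)"
    proof (rule nn_integral_cong_AE)
      show "AE x in M. ennreal (f x) = liminf (\<lambda>i. ennreal (F i x))"
        using f by eventually_elim (metis lim_imp_Liminf sequentially_bot tendsto_ennrealI)
    qed
    also have "\<dots> \<le> liminf (\<lambda>i. \<integral>\<^sup>+x. ennreal (F i x) \<partial>M)"
      using F by (intro nn_integral_liminf) auto
    also have "\<dots> \<le> ennreal B"
      by (rule Liminf_le) (use B F in \<open>auto simp: nn_integral_eq_integral elim!: eventually_mono intro!: ennreal_leI\<close>)
    finally have le: "(\<integral>\<^sup>+x. ennreal (f x) \<partial>M) \<le> ennreal B" .
    have i: "integrable M f"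
      using le_less_trans[OF le ennreal_less_top] f0 by (intro integrableI_nonneg) auto
    then have "ennreal (LINT x|M. f x) \<le> ennreal B" using le f0 by (simp add: nn_integral_eq_integral)
    then show ?thesis using i B0 by simp
  qed
  have limp: "AE x in M. (\<lambda>i. norm (G (r i) x) powr p) \<longlonglongrightarrow> norm (v x) powr p"
    using lim by eventually_elim (use p in \<open>auto intro!: tendsto_powr' tendsto_norm\<close>)
  have vp: "integrable M (\<lambda>x. norm (v x) powr p) \<and> (LINT x|M. norm (v x) powr p) \<le> K"
    by (rule fatou[OF limp]) (use intp[OF G(1)] bd[OF G(1)] in auto)
  have diff: "integrable M (\<lambda>x. norm (G i x - v x)) \<and> (LINT x|M. norm (G i x - v x)) \<le> e"
    if "\<And>j. j \<ge> N \<Longrightarrow> (LINT x|M. norm (G i x - G j x)) \<le> e" for i e N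
  proof (rule fatou[where F = "\<lambda>k x. norm (G i x - G (r k) x)"])
    show "AE x in M. (\<lambda>k. norm (G i x - G (r k) x)) \<longlonglongrightarrow> norm (G i x - v x)"
      using lim by eventually_elim (intro tendsto_norm tendsto_diff tendsto_const)
    have "r k \<ge> N" if "k \<ge> N" for k using that seq_suble[OF r(1), of k] by linarith
    then show "\<forall>\<^sub>F k in sequentially. (LINT x|M. norm (G i x - G (r k) x)) \<le> e"
      using that unfolding eventually_sequentially by blast
  qed (use int[OF G(1)] in auto)
  have vint: "integrable M v"
  proof -
    obtain N where N: "\<forall>i\<ge>N. \<forall>j\<ge>N. (LINT x|M. norm (G i x - G j x)) < 1" using cauchy[of 1] by auto
    then have "integrable M (\<lambda>x. norm (G N x - v x))" using diff[of N N 1] by (simp add: less_imp_le)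
    then have "integrable M (\<lambda>x. G N x - v x)" by (subst (asm) integrable_norm_iff) auto
    from Bochner_Integration.integrable_diff[OF int[OF G(1)[of N]] this] show ?thesis by simp
  qed
  have "(\<lambda>n. LINT x|M. norm (G n x - v x)) \<longlonglongrightarrow> 0"
  proof (rule LIMSEQ_I)
    fix e :: real assume e: "e > 0"
    then obtain N where N: "\<forall>i\<ge>N. \<forall>j\<ge>N. (LINT x|M. norm (G i x - G j x)) < e / 2" using cauchy[of "e/2"] by auto
    have "norm ((LINT x|M. norm (G i x - v x)) - 0) < e" if "i \<ge> N" for i
    proof -
      have "(LINT x|M. norm (G i x - v x)) \<le> e / 2" using diff[of N i "e/2"] N that by (simp add: less_imp_le)
      then show ?thesis using e by (simp add: integral_nonneg_AE)
    qed
    then show "\<exists>N. \<forall>i\<ge>N. norm ((LINT x|M. norm (G i x - v x)) - 0) < e" by blast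
  qed
  then show ?thesis using that[OF G(1) vint] vp by blast
qed

section \<open>Smooth test functions\<close>

text \<open>
  The functions \<open>exp (- 1/x) / x\<^sup>k\<close>, extended by zero: their linear span contains the derivative of
  each of them.
\<close>
definition flat :: "nat \<Rightarrow> real \<Rightarrow> real" where
  "flat k x = (if x > 0 then exp (- inverse x) * inverse x ^ k else 0)"

lemma exp_minus_inverse_le:
  assumes "(x::real) > 0"
  shows "exp (- inverse x) * inverse x ^ n \<le> fact n"
proof -
  have "inverse x ^ n / fact n \<le> exp (inverse x)"
  proof -
    have "(\<Sum>i\<in>{n}. inverse x ^ i /\<^sub>R fact i) \<le> (\<Sum>i. inverse x ^ i /\<^sub>R fact i)"
      by (rule sum_le_suminf) (use assms summable_exp_generic[of "inverse x"] in auto)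
    then show ?thesis by (simp add: exp_def divide_inverse mult.commute)
  qed
  then have "inverse x ^ n \<le> exp (inverse x) * fact n"
    by (subst (asm) pos_divide_le_eq) auto
  then have "exp (- inverse x) * inverse x ^ n \<le> exp (- inverse x) * (exp (inverse x) * fact n)"
    by (rule mult_left_mono) simp
  also have "\<dots> = fact n" by (simp add: exp_minus mult.assoc[symmetric])
  finally show ?thesis .
qed

lemma flat_tendsto_0: "(flat k \<longlongrightarrow> 0) (at 0)"
proof (rule Lim_null_comparison)
  show "\<forall>\<^sub>F x in at 0. norm (flat k x) \<le> fact (Suc k) * \<bar>x\<bar>"
  proof (rule always_eventually, rule allI)
    fix x :: real
    show "norm (flat k x) \<le> fact (Suc k) * \<bar>x\<bar>"
    proof (cases "x > 0")
      case True
      then have "exp (- inverse x) * inverse x ^ k = x * (exp (- inverse x) * inverse x ^ Suc k)" by simp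
      also have "\<dots> \<le> x * fact (Suc k)" using True by (intro mult_left_mono exp_minus_inverse_le) auto
      finally show ?thesis using True by (simp add: flat_def abs_mult mult.commute)
    next
      case False
      then show ?thesis unfolding flat_def if_not_P[OF False] by (simp only: norm_zero mult_nonneg_nonneg fact_ge_zero abs_ge_zero)
    qed
  qed
  show "((\<lambda>x::real. fact (Suc k) * \<bar>x\<bar>) \<longlongrightarrow> 0) (at 0)" by (auto intro!: tendsto_eq_intros)
qed

lemma flat_DERIV: "(flat k has_real_derivative (- real k * flat (Suc k) x + flat (Suc (Suc k)) x)) (at x)"
proof -
  consider "x > 0" | "x < 0" | "x = 0" by linarith
  then show ?thesis
  proof cases
    case 1
    have "((\<lambda>x. exp (- inverse x) * inverse x ^ k) has_real_derivative (- real k * flat (Suc k) x + flat (Suc (Suc k)) x)) (at x)"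
    proof (cases k)
      case (Suc n)
      have e: "((\<lambda>x. exp (- inverse x)) has_real_derivative exp (- inverse x) * (inverse x * inverse x)) (at x)"
        using 1 by (auto intro!: derivative_eq_intros)
      have q: "((\<lambda>x. inverse x ^ Suc n) has_real_derivative real (Suc n) * (- (inverse x * inverse x)) * inverse x ^ n) (at x)"
        by (rule DERIV_cong[OF DERIV_power[OF DERIV_inverse]]) (use 1 in \<open>auto simp: algebra_simps\<close>)
      note DERIV_mult[OF e q]
      then show ?thesis using 1 by (simp add: Suc flat_def algebra_simps)
    qed (use 1 in \<open>auto intro!: derivative_eq_intros simp: flat_def\<close>)
    moreover have "\<forall>\<^sub>F y in nhds x. y > 0" using eventually_nhds_in_open[of "{0<..}" x] 1 by simp
    then have "\<forall>\<^sub>F y in nhds x. exp (- inverse y) * inverse y ^ k = flat k y"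
      by eventually_elim (simp add: flat_def)
    ultimately show ?thesis by (subst (asm) DERIV_cong_ev[OF refl _ refl])
  next
    case 2
    have "((\<lambda>x. 0) has_real_derivative (- real k * flat (Suc k) x + flat (Suc (Suc k)) x)) (at x)"
      using 2 by (auto simp: flat_def)
    moreover have "\<forall>\<^sub>F y in nhds x. y < 0" using eventually_nhds_in_open[of "{..<0}" x] 2 by simp
    then have "\<forall>\<^sub>F y in nhds x. 0 = flat k y" by eventually_elim (simp add: flat_def)
    ultimately show ?thesis by (subst (asm) DERIV_cong_ev[OF refl _ refl])
  next
    case 3
    have "(\<lambda>h. (flat k (0 + h) - flat k 0) / h) = flat (Suc k)" by (auto simp: flat_def field_simps fun_eq_iff)
    then show ?thesis using flat_tendsto_0[of "Suc k"] by (simp add: 3 DERIV_def) (simp add: flat_def)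
  qed
qed

definition bump :: "real \<Rightarrow> real" where "bump x = flat 0 x * flat 0 (1 - x)"

lemma bump_props: "0 \<le> bump x" "x \<le> 0 \<Longrightarrow> bump x = 0" "1 \<le> x \<Longrightarrow> bump x = 0" "0 < x \<Longrightarrow> x < 1 \<Longrightarrow> 0 < bump x"
  by (auto simp: bump_def flat_def)

lemma continuous_bump: "continuous_on UNIV bump"
proof -
  have f: "continuous_on UNIV (flat 0)" by (rule DERIV_continuous_on[OF has_field_derivative_at_within[OF flat_DERIV]])
  show ?thesis unfolding bump_def[abs_def]
    by (intro continuous_intros f continuous_on_compose2[OF f]) auto
qed

lemma antiderivative_UNIV:
  fixes f :: "real \<Rightarrow> real"
  assumes "continuous_on UNIV f"
  shows "\<exists>F. F 0 = 0 \<and> (\<forall>x. (F has_real_derivative f x) (at x))"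
proof -
  have "\<exists>F. \<forall>x. - \<infinity> < ereal x \<longrightarrow> ereal x < \<infinity> \<longrightarrow> (F has_vector_derivative f x) (at x)"
    by (rule einterval_antiderivative) (use assms in \<open>auto simp: continuous_on_eq_continuous_at\<close>)
  then obtain F where "\<And>x. (F has_real_derivative f x) (at x)" by (auto simp: has_real_derivative_iff_has_vector_derivative)
  then show ?thesis by (intro exI[of _ "\<lambda>x. F x - F 0"]) (auto intro!: derivative_eq_intros)
qed

lemma smooth_step_exists:
  "\<exists>S k. k > 0 \<and> (\<forall>x. (S has_real_derivative k * bump x) (at x)) \<and> (\<forall>x\<le>0. S x = 0) \<and> (\<forall>x\<ge>1. S x = 1) \<and> (\<forall>x. 0 \<le> S x \<and> S x \<le> (1::real))"
proof -
  obtain G where G: "G 0 = 0" "\<And>x. (G has_real_derivative bump x) (at x)"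
    using antiderivative_UNIV[OF continuous_bump] by blast
  have mono: "G x \<le> G y" if "x \<le> y" for x y
    by (rule DERIV_nonneg_imp_nondecreasing[OF that, of G]) (blast intro: G(2) bump_props(1))
  have const: "G x = G y" if "x \<le> y" "\<And>z. x \<le> z \<Longrightarrow> z \<le> y \<Longrightarrow> bump z = 0" for x y
  proof -
    have "G y \<le> G x"
    proof (rule DERIV_nonpos_imp_nonincreasing[OF that(1), of G])
      fix z assume "x \<le> z" "z \<le> y"
      then show "\<exists>w. (G has_real_derivative w) (at z) \<and> w \<le> 0"
        using that(2)[of z] G(2)[of z] by (intro exI[of _ 0]) simp
    qed
    then show ?thesis using mono[of x y] that by simp
  qed
  obtain z where z: "0 < z" "z < 1" "G 1 - G 0 = (1 - 0) * bump z" using MVT2[of 0 1 G bump] G(2) by auto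
  have G1: "G 1 > 0" using z G(1) bump_props(4)[of z] by simp
  have lo: "G x = 0" if "x \<le> 0" for x using const[OF that bump_props(2)] G(1) by simp
  have hi: "G x = G 1" if "x \<ge> 1" for x using const[OF that bump_props(3)] by simp
  have "0 \<le> G x \<and> G x \<le> G 1" for x
    using mono[of 0 x] mono[of x 1] lo[of x] hi[of x] G(1) G1 by linarith
  note range = this
  have der: "((\<lambda>x. G x / G 1) has_real_derivative 1 / G 1 * bump x) (at x)" for x
    using DERIV_cdivide[OF G(2), of "G 1" x] by simp
  show ?thesis
  proof (intro exI[of _ "\<lambda>x. G x / G 1"] exI[of _ "1 / G 1"] conjI allI impI der)
    show "0 < 1 / G 1" using G1 by simp
    show "G x / G 1 = 0" if "x \<le> 0" for x using lo[OF that] by simp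
    show "G x / G 1 = 1" if "1 \<le> x" for x using hi[OF that] G1 by simp
    show "0 \<le> G x / G 1" "G x / G 1 \<le> 1" for x using range[of x] G1 by simp_all
  qed
qed

text \<open>
  The step and the factor that normalizes its derivative depend on each other and are chosen together.
\<close>
definition smooth_step_const :: "(real \<Rightarrow> real) \<times> real" where
  "smooth_step_const = (SOME (S, k). k > 0 \<and> (\<forall>x. (S has_real_derivative k * bump x) (at x)) \<and> (\<forall>x\<le>0. S x = 0) \<and> (\<forall>x\<ge>1. S x = 1) \<and> (\<forall>x. 0 \<le> S x \<and> S x \<le> 1))"

definition smooth_step :: "real \<Rightarrow> real" where "smooth_step = fst smooth_step_const"
definition bump_scale :: real where "bump_scale = snd smooth_step_const"

lemma smooth_step_props:
  "bump_scale > 0" "(smooth_step has_real_derivative bump_scale * bump x) (at x)"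
  "x \<le> 0 \<Longrightarrow> smooth_step x = 0" "1 \<le> x \<Longrightarrow> smooth_step x = 1" "0 \<le> smooth_step x" "smooth_step x \<le> 1"
proof -
  have "\<exists>z. case z of (S, k) \<Rightarrow> k > 0 \<and> (\<forall>x. (S has_real_derivative k * bump x) (at x)) \<and> (\<forall>x\<le>0. S x = 0) \<and> (\<forall>x\<ge>1. S x = 1) \<and> (\<forall>x. 0 \<le> S x \<and> S x \<le> 1)"
    using smooth_step_exists by auto
  from someI_ex[OF this, folded smooth_step_const_def]
  show "bump_scale > 0" "(smooth_step has_real_derivative bump_scale * bump x) (at x)"
  "x \<le> 0 \<Longrightarrow> smooth_step x = 0" "1 \<le> x \<Longrightarrow> smooth_step x = 1" "0 \<le> smooth_step x" "smooth_step x \<le> 1"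
    by (simp_all add: smooth_step_def bump_scale_def case_prod_beta)
qed

definition smooth_ramp :: "real \<Rightarrow> real" where
  "smooth_ramp = (SOME R. R 0 = 0 \<and> (\<forall>x. (R has_real_derivative smooth_step x) (at x)))"

lemma smooth_ramp_DERIV: "smooth_ramp 0 = 0" "(smooth_ramp has_real_derivative smooth_step x) (at x)"
proof -
  have "continuous_on UNIV smooth_step"
    by (rule DERIV_continuous_on[OF has_field_derivative_at_within[OF smooth_step_props(2)]])
  from someI_ex[OF antiderivative_UNIV[OF this], folded smooth_ramp_def]
  show "smooth_ramp 0 = 0" "(smooth_ramp has_real_derivative smooth_step x) (at x)" by auto
qed

lemma smooth_ramp_props:
  "x \<le> 0 \<Longrightarrow> smooth_ramp x = 0" "1 \<le> x \<Longrightarrow> smooth_ramp x = x + (smooth_ramp 1 - 1)"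
  "\<bar>smooth_ramp x - max 0 x\<bar> \<le> 1"
proof -
  let ?R = smooth_ramp
  have mono: "?R x \<le> ?R y" if "x \<le> y" for x y
    by (rule DERIV_nonneg_imp_nondecreasing[OF that, of ?R]) (blast intro: smooth_ramp_DERIV(2) smooth_step_props(5))
  have lip: "?R y - y \<le> ?R x - x" if "x \<le> y" for x y
  proof (rule DERIV_nonpos_imp_nonincreasing[OF that, of "\<lambda>x. ?R x - x"])
    fix z
    have "((\<lambda>y. ?R y - y) has_real_derivative smooth_step z - 1) (at z)"
      by (auto intro!: derivative_eq_intros smooth_ramp_DERIV(2))
    then show "\<exists>y. ((\<lambda>y. ?R y - y) has_real_derivative y) (at z) \<and> y \<le> 0"
      using smooth_step_props(6)[of z] by (intro exI[of _ "smooth_step z - 1"]) auto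
  qed
  have lo: "?R x = 0" if "x \<le> 0" for x
  proof -
    have "?R 0 \<le> ?R x" 
    proof (rule DERIV_nonpos_imp_nonincreasing[OF that, of ?R])
      fix z :: real assume "z \<le> 0"
      then show "\<exists>y. (?R has_real_derivative y) (at z) \<and> y \<le> 0"
        using smooth_step_props(3)[of z] smooth_ramp_DERIV(2)[of z] by (intro exI[of _ 0]) simp
    qed
    then show ?thesis using mono[OF that] smooth_ramp_DERIV(1) by simp
  qed
  have hi: "?R x = x + (?R 1 - 1)" if "1 \<le> x" for x
  proof -
    have "?R 1 - 1 \<le> ?R x - x"
    proof (rule DERIV_nonneg_imp_nondecreasing[OF that, of "\<lambda>x. ?R x - x"])
      fix z :: real assume "1 \<le> z"
      moreover have "((\<lambda>y. ?R y - y) has_real_derivative smooth_step z - 1) (at z)"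
        by (auto intro!: derivative_eq_intros smooth_ramp_DERIV(2))
      ultimately show "\<exists>y. ((\<lambda>y. ?R y - y) has_real_derivative y) (at z) \<and> 0 \<le> y"
        using smooth_step_props(4)[of z] by (intro exI[of _ 0]) auto
    qed
    then show ?thesis using lip[OF that] by simp
  qed
  show "x \<le> 0 \<Longrightarrow> ?R x = 0" by (rule lo)
  show "1 \<le> x \<Longrightarrow> ?R x = x + (?R 1 - 1)" by (rule hi)
  have R1: "0 \<le> ?R 1" "?R 1 \<le> 1" using mono[of 0 1] lip[of 0 1] smooth_ramp_DERIV(1) by auto
  consider "x \<le> 0" | "0 < x" "x < 1" | "1 \<le> x" by linarith
  then show "\<bar>?R x - max 0 x\<bar> \<le> 1"
  proof cases
    case 1 then show ?thesis using lo[of x] by simp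
  next
    case 2
    then show ?thesis using mono[of 0 x] mono[of x 1] R1 smooth_ramp_DERIV(1) by auto
  next
    case 3 then show ?thesis using hi[of x] R1 by simp
  qed
qed

text \<open>
  A class of functions that is closed under differentiation and contains the test functions needed
  below; smoothness of all its members follows from the closure.
\<close>
inductive_set smooth_class :: "(real \<Rightarrow> real) set" where
  flat: "(\<lambda>x. flat j (\<alpha> * x + \<beta>) * flat k (1 - (\<alpha> * x + \<beta>))) \<in> smooth_class"
| step: "(\<lambda>x. smooth_step (\<alpha> * x + \<beta>)) \<in> smooth_class"
| ramp: "(\<lambda>x. smooth_ramp (\<alpha> * x + \<beta>)) \<in> smooth_class"
| add: "f \<in> smooth_class \<Longrightarrow> g \<in> smooth_class \<Longrightarrow> (\<lambda>x. f x + g x) \<in> smooth_class"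
| scale: "f \<in> smooth_class \<Longrightarrow> (\<lambda>x. c * f x) \<in> smooth_class"

lemma smooth_class_DERIV:
  assumes "f \<in> smooth_class"
  shows "\<exists>f'\<in>smooth_class. \<forall>x. (f has_real_derivative f' x) (at x)"
  using assms
proof induction
  case (flat j \<alpha> \<beta> k)
  have aff: "((\<lambda>x. \<alpha> * x + \<beta>) has_real_derivative \<alpha>) (at x)" for x by (auto intro!: derivative_eq_intros)
  have D1: "((\<lambda>x. flat j (\<alpha> * x + \<beta>)) has_real_derivative (- real j * flat (Suc j) (\<alpha> * x + \<beta>) + flat (Suc (Suc j)) (\<alpha> * x + \<beta>)) * \<alpha>) (at x)" for x j
    by (rule DERIV_chain2[OF flat_DERIV aff])
  have aff': "((\<lambda>x. 1 - (\<alpha> * x + \<beta>)) has_real_derivative - \<alpha>) (at x)" for x by (auto intro!: derivative_eq_intros)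
  have D2: "((\<lambda>x. flat j (1 - (\<alpha> * x + \<beta>))) has_real_derivative (- real j * flat (Suc j) (1 - (\<alpha> * x + \<beta>)) + flat (Suc (Suc j)) (1 - (\<alpha> * x + \<beta>))) * - \<alpha>) (at x)" for x j
    by (rule DERIV_chain2[OF flat_DERIV aff'])
  let ?b = "\<lambda>j k x. flat j (\<alpha> * x + \<beta>) * flat k (1 - (\<alpha> * x + \<beta>))"
  let ?f' = "\<lambda>x. ((- \<alpha> * real j) * ?b (Suc j) k x + \<alpha> * ?b (Suc (Suc j)) k x) + ((\<alpha> * real k) * ?b j (Suc k) x + (- \<alpha>) * ?b j (Suc (Suc k)) x)"
  have m1: "?f' \<in> smooth_class" by (intro smooth_class.add smooth_class.scale smooth_class.flat)
  have m2: "(?b j k has_real_derivative ?f' x) (at x)" for x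
    by (rule DERIV_cong[OF DERIV_mult[OF D1 D2]]) (simp add: algebra_simps)
  show ?case by (rule bexI[OF _ m1]) (rule allI, rule m2)
next
  case (step \<alpha> \<beta>)
  have aff: "((\<lambda>x. \<alpha> * x + \<beta>) has_real_derivative \<alpha>) (at x)" for x by (auto intro!: derivative_eq_intros)
  have m1: "(\<lambda>x. (\<alpha> * bump_scale) * (flat 0 (\<alpha> * x + \<beta>) * flat 0 (1 - (\<alpha> * x + \<beta>)))) \<in> smooth_class"
    by (intro smooth_class.scale smooth_class.flat)
  have m2: "((\<lambda>x. smooth_step (\<alpha> * x + \<beta>)) has_real_derivative (\<alpha> * bump_scale) * (flat 0 (\<alpha> * x + \<beta>) * flat 0 (1 - (\<alpha> * x + \<beta>)))) (at x)" for x
    by (rule DERIV_cong[OF DERIV_chain2[OF smooth_step_props(2) aff]]) (simp add: bump_def)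
  show ?case by (rule bexI[OF _ m1]) (rule allI, rule m2)
next
  case (ramp \<alpha> \<beta>)
  have aff: "((\<lambda>x. \<alpha> * x + \<beta>) has_real_derivative \<alpha>) (at x)" for x by (auto intro!: derivative_eq_intros)
  have m1: "(\<lambda>x. \<alpha> * smooth_step (\<alpha> * x + \<beta>)) \<in> smooth_class"
    by (intro smooth_class.scale smooth_class.step)
  have m2: "((\<lambda>x. smooth_ramp (\<alpha> * x + \<beta>)) has_real_derivative \<alpha> * smooth_step (\<alpha> * x + \<beta>)) (at x)" for x
    by (rule DERIV_cong[OF DERIV_chain2[OF smooth_ramp_DERIV(2) aff]]) simp
  show ?case by (rule bexI[OF _ m1]) (rule allI, rule m2)
next
  case (add f g)
  then obtain f' g' where "f' \<in> smooth_class" "\<forall>x. (f has_real_derivative f' x) (at x)"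
     "g' \<in> smooth_class" "\<forall>x. (g has_real_derivative g' x) (at x)" by blast
  then show ?case by (intro bexI[of _ "\<lambda>x. f' x + g' x"] smooth_class.add allI DERIV_add) auto
next
  case (scale f c)
  then obtain f' where "f' \<in> smooth_class" "\<forall>x. (f has_real_derivative f' x) (at x)" by blast
  then show ?case by (intro bexI[of _ "\<lambda>x. c * f' x"] smooth_class.scale allI DERIV_cmult) auto
qed

lemma smooth_class_differentiable:
  assumes "f \<in> smooth_class" shows "(deriv ^^ n) f differentiable (at x)"
proof -
  have "(deriv ^^ n) f \<in> smooth_class"
  proof (induction n)
    case (Suc n)
    then obtain f' where "f' \<in> smooth_class" "\<forall>x. ((deriv ^^ n) f has_real_derivative f' x) (at x)"
      using smooth_class_DERIV by blast
    moreover then have "deriv ((deriv ^^ n) f) = f'" by (auto intro: DERIV_imp_deriv)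
    ultimately show ?case by simp
  qed (use assms in simp)
  then show ?thesis using smooth_class_DERIV real_differentiable_def by blast
qed

section \<open>Weak derivatives on an interval\<close>

text \<open>
  The sets over which the integral vanishes form a Dynkin system that contains the intervals
  \<open>{..x}\<close>, which generate the Borel sets.
\<close>
lemma AE_zero_if_interval_integrals_zero:
  fixes w :: "real \<Rightarrow> 'b::euclidean_space"
  assumes w: "integrable (lebesgue_on {a..b}) w"
    and z: "\<And>x. integral {a..x} w = 0 \<or> x \<notin> {a..b}"
  shows "AE s in lebesgue_on {a..b}. w s = 0"
proof -
  let ?M = "lebesgue_on {a..b}"
  have [measurable]: "w \<in> borel_measurable ?M" using w by simp
  have bm: "B \<inter> {a..b} \<in> sets ?M" if "B \<in> sets borel" for B
    using that by (auto simp: sets_restrict_space)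
  have ind: "(\<lambda>s. indicat_real B s) \<in> borel_measurable ?M" if "B \<in> sets borel" for B
    by (rule measurable_restrict_space1) (use that in \<open>auto intro!: borel_measurable_indicator\<close>)
  have int: "integrable ?M (\<lambda>s. indicat_real B s *\<^sub>R w s)" if B: "B \<in> sets borel" for B
  proof (rule Bochner_Integration.integrable_bound[OF w])
    show "(\<lambda>s. indicat_real B s *\<^sub>R w s) \<in> borel_measurable ?M"
      using ind[OF B] by measurable
  qed (auto simp: indicator_def)
  have Iic: "(LINT s|?M. indicat_real {..x} s *\<^sub>R w s) = 0" for x
  proof -
    have "(LINT s|?M. indicat_real {..x} s *\<^sub>R w s) = integral {a..b} (\<lambda>s. indicat_real {..x} s *\<^sub>R w s)"
      by (rule lebesgue_integral_eq_integral[OF int]) auto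
    also have "\<dots> = integral {a..b} (\<lambda>s. if s \<in> {..x} then w s else 0)"
      by (intro integral_cong) (auto simp: indicator_def)
    also have "\<dots> = integral ({..x} \<inter> {a..b}) w" by (rule integral_restrict_Int)
    also have "{..x} \<inter> {a..b} = {a..min x b}" by auto
    also have "integral {a..min x b} w = 0" using z[of "min x b"] by (cases "a \<le> min x b") auto
    finally show ?thesis .
  qed
  have Q: "(LINT s|?M. indicat_real B s *\<^sub>R w s) = 0" if B: "B \<in> sets borel" for B
  proof -
    have "B \<in> sigma_sets UNIV (range (\<lambda>a. {..a}))" using B borel_eq_atMost by (metis sets_measure_of_conv space_borel top.extremum Pow_UNIV)
    have G: "Int_stable (range (\<lambda>a::real. {..a}))" "range (\<lambda>a::real. {..a}) \<subseteq> Pow UNIV"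
      unfolding Int_stable_def by (auto intro!: image_eqI[of _ _ "min _ _"])
    from G \<open>B \<in> sigma_sets UNIV (range (\<lambda>a. {..a}))\<close> show ?thesis
    proof (induction rule: sigma_sets_induct_disjoint)
      case (basic A)
      then show "(LINT s|?M. indicat_real A s *\<^sub>R w s) = 0" using Iic by auto
    next
      case empty
      show "(LINT s|?M. indicat_real {} s *\<^sub>R w s) = 0" by simp
    next
      case A: (compl A)
      then have "A \<in> sets borel" using borel_eq_atMost by (metis sets_measure_of_conv space_borel top.extremum Pow_UNIV)
      note i = int[OF this]
      have "(LINT s|?M. indicat_real (UNIV - A) s *\<^sub>R w s) = (LINT s|?M. w s - indicat_real A s *\<^sub>R w s)"
        by (rule Bochner_Integration.integral_cong) (auto simp: indicator_def)
      also have "\<dots> = (LINT s|?M. w s)" using w i A(2) by simp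
      also have "\<dots> = (LINT s|?M. indicat_real {..b} s *\<^sub>R w s)"
        by (rule Bochner_Integration.integral_cong) (auto simp: indicator_def space_restrict_space)
      finally show "(LINT s|?M. indicat_real (UNIV - A) s *\<^sub>R w s) = 0" using Iic by simp
    next
      case A: (union A)
      note 0 = A(3)
      have Ab: "A i \<in> sets borel" for i 
        using A(2) borel_eq_atMost by (metis sets_measure_of_conv space_borel top.extremum Pow_UNIV range_subsetD)
      have "(\<lambda>n. LINT s|?M. indicat_real (\<Union>i<n. A i) s *\<^sub>R w s) \<longlonglongrightarrow> (LINT s|?M. indicat_real (\<Union>i. A i) s *\<^sub>R w s)"
      proof (rule integral_dominated_convergence[where w="\<lambda>s. norm (w s)"])
        show "(\<lambda>s. indicat_real (\<Union>i. A i) s *\<^sub>R w s) \<in> borel_measurable ?M" "\<And>n. (\<lambda>s. indicat_real (\<Union>i<n. A i) s *\<^sub>R w s) \<in> borel_measurable ?M"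
          by (rule borel_measurable_integrable, rule int, use Ab in auto)+
        show "integrable ?M (\<lambda>s. norm (w s))" using w by simp
        show "AE s in ?M. (\<lambda>n. indicat_real (\<Union>i<n. A i) s *\<^sub>R w s) \<longlonglongrightarrow> indicat_real (\<Union>i. A i) s *\<^sub>R w s"
          by (intro AE_I2 tendsto_scaleR LIMSEQ_indicator_UN tendsto_const)
        show "\<And>n. AE s in ?M. norm (indicat_real (\<Union>i<n. A i) s *\<^sub>R w s) \<le> norm (w s)"
          by (intro AE_I2) (auto simp: indicator_def)
      qed
      moreover have "(LINT s|?M. indicat_real (\<Union>i<n. A i) s *\<^sub>R w s) = 0" for n
      proof (induction n)
        case (Suc n)
        have "(LINT s|?M. indicat_real (\<Union>i<Suc n. A i) s *\<^sub>R w s) = (LINT s|?M. indicat_real (\<Union>i<n. A i) s *\<^sub>R w s + indicat_real (A n) s *\<^sub>R w s)"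
        proof (rule Bochner_Integration.integral_cong[OF refl])
          fix s
          have "s \<in> A n \<Longrightarrow> i < n \<Longrightarrow> s \<notin> A i" for i
            using A(1) unfolding disjoint_family_on_def by (metis UNIV_I disjoint_iff less_irrefl)
          then show "indicat_real (\<Union>i<Suc n. A i) s *\<^sub>R w s = indicat_real (\<Union>i<n. A i) s *\<^sub>R w s + indicat_real (A n) s *\<^sub>R w s"
            by (auto simp: indicator_def less_Suc_eq)
        qed
        also have "\<dots> = (LINT s|?M. indicat_real (\<Union>i<n. A i) s *\<^sub>R w s) + (LINT s|?M. indicat_real (A n) s *\<^sub>R w s)"
          by (rule Bochner_Integration.integral_add; rule int) (use Ab in auto)
        finally show ?case using Suc 0 by simp
      qed simp
      ultimately show "(LINT s|?M. indicat_real (\<Union>i. A i) s *\<^sub>R w s) = 0" by (simp add: LIMSEQ_const_iff)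
    qed
  qed
  show ?thesis
  proof (rule sigma_finite_measure.density_zero[OF _ w])
    show "sigma_finite_measure ?M" by (rule finite_measure.axioms(1)[OF finite_measure_lebesgue_on_interval])
  next
    fix A assume "A \<in> sets ?M"
    then have AL: "A \<in> sets lebesgue" by (auto simp: sets_restrict_space)
    then obtain S N N' where SN: "A = S \<union> N" "N \<subseteq> N'" "N' \<in> null_sets lborel" "S \<in> sets lborel"
      by (rule sets_completionE)
    have "N' \<in> null_sets lebesgue" using SN(3) by (rule null_sets_completionI)
    then have "AE s in lebesgue. s \<notin> N'" by (rule AE_not_in)
    then have ae: "AE s in ?M. s \<notin> N'" by (subst AE_restrict_space_iff) auto
    have "set_lebesgue_integral ?M A w = (LINT s|?M. indicat_real S s *\<^sub>R w s)"
      unfolding set_lebesgue_integral_def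
    proof (rule integral_cong_AE)
      show "(\<lambda>s. indicat_real S s *\<^sub>R w s) \<in> borel_measurable ?M" 
        using int[of S] SN(4) by auto
      have [measurable]: "(\<lambda>s. indicat_real A s) \<in> borel_measurable ?M"
        by (rule measurable_restrict_space1) (use AL in \<open>auto intro!: borel_measurable_indicator\<close>)
      show "(\<lambda>s. indicat_real A s *\<^sub>R w s) \<in> borel_measurable ?M" by measurable
      show "AE s in ?M. indicat_real A s *\<^sub>R w s = indicat_real S s *\<^sub>R w s"
        using ae by eventually_elim (use SN in \<open>auto simp: indicator_def\<close>)
    qed
    then show "set_lebesgue_integral ?M A w = 0" using Q[of S] SN(4) by simp
  qed
qed


lemma integrable_cutoff_lebesgue_on:
  fixes w :: "real \<Rightarrow> 'b::euclidean_space"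
  assumes "integrable (lebesgue_on {x..y}) w" "a \<le> x" "y \<le> b"
  shows "integrable (lebesgue_on {a..b}) (\<lambda>s. indicat_real {x..y} s *\<^sub>R w s)"
proof -
  have "integrable lebesgue (\<lambda>s. indicat_real {x..y} s *\<^sub>R w s)"
    using assms(1) by (simp add: integrable_restrict_space)
  moreover have "indicat_real {a..b} s *\<^sub>R (indicat_real {x..y} s *\<^sub>R w s) = indicat_real {x..y} s *\<^sub>R w s" for s
    using assms by (auto simp: indicator_def)
  ultimately show ?thesis by (simp add: integrable_restrict_space del: scaleR_scaleR)
qed

lemma smooth_class_continuous:
  assumes "f \<in> smooth_class" shows "continuous_on A f"
proof -
  obtain f' where "\<And>x. (f has_real_derivative f' x) (at x)" using smooth_class_DERIV[OF assms] by blast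
  then have "isCont f x" for x by (rule DERIV_isCont)
  then show ?thesis by (simp add: continuous_at_imp_continuous_on)
qed

lemma test_function_smooth_class:
  assumes "\<phi> \<in> smooth_class" "a < x" "y < b" "\<And>s. s < x \<Longrightarrow> \<phi> s = 0" "\<And>s. y < s \<Longrightarrow> \<phi> s = 0"
  shows "\<phi> \<in> test_functions a b"
proof -
  have "\<phi> s = 0" if "s \<notin> {x..y}" for s using assms(4)[of s] assms(5)[of s] that by (cases "s < x") auto
  then show ?thesis unfolding test_functions_def mem_Collect_eq
    using assms(2,3) smooth_class_differentiable[OF assms(1)] by blast
qed

text \<open>
  Smoothed indicators of an interval \<open>{a..b}\<close> are test functions that converge boundedly to its
  indicator, so that the difference of the two functions has integral zero over \<open>{a..b}\<close>.
\<close>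
lemma test_functions_separate:
  fixes u v :: "real \<Rightarrow> real^'n"
  assumes u: "locally_integrable 0 L u" and v: "locally_integrable 0 L v"
    and eq: "\<And>\<phi>. \<phi> \<in> test_functions 0 L \<Longrightarrow>
      (LINT s|lebesgue_on {0..L}. \<phi> s *\<^sub>R u s) = (LINT s|lebesgue_on {0..L}. \<phi> s *\<^sub>R v s)"
  shows "AE s in lebesgue_on {0..L}. u s = v s"
proof -
  let ?M = "lebesgue_on {0..L}"
  define w where "w s = u s - v s" for s
  have wi: "integrable (lebesgue_on {x..y}) w" if "0 < x" "y < L" for x y
    using u v that unfolding locally_integrable_def w_def by simp
  have zero: "integral {a..b} w = 0" if ab: "0 < a" "a \<le> b" "b < L" for a b
  proof -
    define e where "e = min a (L - b) / 2"
    have e: "e > 0" "0 < a - e" "b + e < L" using ab by (auto simp: e_def min_def field_simps)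
    define J where "J = {a - e..b + e}"
    define W where "W s = indicat_real J s *\<^sub>R w s" for s
    have UV: "integrable ?M (\<lambda>s. indicat_real J s *\<^sub>R u s)" "integrable ?M (\<lambda>s. indicat_real J s *\<^sub>R v s)"
      unfolding J_def by (rule integrable_cutoff_lebesgue_on; use e u v in \<open>auto simp: locally_integrable_def\<close>)+
    have Wi: "integrable ?M W"
      unfolding W_def J_def by (rule integrable_cutoff_lebesgue_on) (use e wi in auto)
    \<comment> \<open>The offset 1 in the first step makes the limit equal to 1 at the end point \<open>a\<close> as well.\<close>
    define \<phi> where "\<phi> n s = smooth_step (real n * s + (1 - real n * a)) + (-1) * smooth_step (real n * s + (- real n * b))" for n s
    have \<phi>c: "\<phi> n \<in> smooth_class" for n
      unfolding \<phi>_def[abs_def] by (intro smooth_class.add smooth_class.scale smooth_class.step)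
    have b1: "\<bar>\<phi> n s\<bar> \<le> 1" for n s
      using smooth_step_props(5,6)[of "real n * s + (1 - real n * a)"] smooth_step_props(5,6)[of "real n * s + (- real n * b)"]
      unfolding \<phi>_def by linarith
    obtain N where N: "N > 0" "1 / real N < e" using e(1) by (metis nat_approx_posE zero_less_Suc)
    have cont: "\<phi> n \<in> borel_measurable ?M" for n
      by (rule continuous_imp_measurable_on_sets_lebesgue[OF smooth_class_continuous[OF \<phi>c]]) auto
    have supp: "\<phi> n s = 0" if n: "n \<ge> N" and s: "s \<notin> {a - e..b + e}" for n s
    proof -
      have n0: "real n > 0" using n N by simp
      have "1 / real n \<le> 1 / real N" using n N by (simp add: frac_le)
      then have "1 / real n < e" using N(2) by linarith
      then have ne: "1 < real n * e" using n0 by (simp add: field_simps)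
      consider "s < a - e" | "s > b + e" using s by force
      then show ?thesis
      proof cases
        case 1
        then have "real n * s \<le> real n * (a - e)" "real n * (a - e) \<le> real n * b" using n0 ab e by (auto intro!: mult_left_mono)
        then have "real n * s + (1 - real n * a) \<le> 0" "real n * s + (- real n * b) \<le> 0" using ne by (simp_all add: algebra_simps)
        then show ?thesis by (simp add: \<phi>_def smooth_step_props)
      next
        case 2
        then have "real n * s \<ge> real n * (b + e)" "real n * b \<ge> real n * a" using n0 ab by (auto intro!: mult_left_mono)
        then have "real n * s + (1 - real n * a) \<ge> 1" "real n * s + (- real n * b) \<ge> 1" using ne by (simp_all add: algebra_simps)
        then show ?thesis by (simp add: \<phi>_def smooth_step_props)
      qed
    qed
    have test: "\<phi> n \<in> test_functions 0 L" if n: "n \<ge> N" for n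
      using test_function_smooth_class[OF \<phi>c e(2,3)] supp[OF n] by simp
    have bi: "integrable ?M (\<lambda>s. \<phi> n s *\<^sub>R f s)" if f: "integrable ?M f" for f :: "real \<Rightarrow> real^'n" and n
    proof (rule Bochner_Integration.integrable_bound[OF f])
      have [measurable]: "f \<in> borel_measurable ?M" using f by simp
      show "(\<lambda>s. \<phi> n s *\<^sub>R f s) \<in> borel_measurable ?M" using cont[of n] by measurable
      show "AE s in ?M. norm (\<phi> n s *\<^sub>R f s) \<le> norm (f s)"
        using b1 by (intro AE_I2) (simp add: mult_left_le_one_le)
    qed
    have z: "(LINT s|?M. \<phi> n s *\<^sub>R W s) = 0" if n: "n \<ge> N" for n
    proof -
      have cut: "\<phi> n s *\<^sub>R f s = \<phi> n s *\<^sub>R indicat_real J s *\<^sub>R f s" for f :: "real \<Rightarrow> real^'n" and s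
        using supp[OF n] by (cases "s \<in> J") (auto simp: J_def)
      have "(LINT s|?M. \<phi> n s *\<^sub>R W s) = (LINT s|?M. \<phi> n s *\<^sub>R indicat_real J s *\<^sub>R u s - \<phi> n s *\<^sub>R indicat_real J s *\<^sub>R v s)"
        by (rule Bochner_Integration.integral_cong) (auto simp: W_def w_def scaleR_right_diff_distrib)
      also have "\<dots> = (LINT s|?M. \<phi> n s *\<^sub>R indicat_real J s *\<^sub>R u s) - (LINT s|?M. \<phi> n s *\<^sub>R indicat_real J s *\<^sub>R v s)"
        by (rule Bochner_Integration.integral_diff[OF bi[OF UV(1)] bi[OF UV(2)]])
      also have "\<dots> = 0" unfolding cut[symmetric] using eq[OF test[OF n]] by simp
      finally show ?thesis .
    qed
    have "(\<lambda>n. LINT s|?M. \<phi> n s *\<^sub>R W s) \<longlonglongrightarrow> (LINT s|?M. indicat_real {a..b} s *\<^sub>R W s)"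
    proof (rule integral_dominated_convergence[where w="\<lambda>s. norm (W s)"])
      show "(\<lambda>s. indicat_real {a..b} s *\<^sub>R W s) \<in> borel_measurable ?M"
        by (rule borel_measurable_integrable, rule LINT_indicator_interval(1)[OF Wi]) (use ab in auto)
      show "\<And>n. (\<lambda>s. \<phi> n s *\<^sub>R W s) \<in> borel_measurable ?M" by (rule borel_measurable_integrable, rule bi[OF Wi])
      show "integrable ?M (\<lambda>s. norm (W s))" using Wi by simp
      show "\<And>n. AE s in ?M. norm (\<phi> n s *\<^sub>R W s) \<le> norm (W s)"
        using b1 by (intro AE_I2) (simp add: mult_left_le_one_le)
      have "(\<lambda>n. \<phi> n s) \<longlonglongrightarrow> indicat_real {a..b} s" for s
      proof -
        have big: "\<forall>\<^sub>F n in sequentially. real n * d \<ge> 1" if "d > 0" for d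
        proof -
          obtain m where "1 / d < real m" using reals_Archimedean2 by blast
          then have "real n * d \<ge> 1" if "n \<ge> m" for n
          proof -
            have "real n \<ge> 1 / d" using that \<open>1 / d < real m\<close> by linarith
            then show ?thesis using \<open>d > 0\<close> by (simp add: field_simps)
          qed
          then show ?thesis unfolding eventually_sequentially by blast
        qed
        consider "s < a" | "a \<le> s" "s \<le> b" | "s > b" by linarith
        then have "\<forall>\<^sub>F n in sequentially. \<phi> n s = indicat_real {a..b} s"
        proof cases
          case 1
          show ?thesis using big[of "a - s", OF diff_gt_0_iff_gt[THEN iffD2, OF 1]]
          proof eventually_elim
            case (elim n)
            have "real n * s \<le> real n * b" using 1 ab by (intro mult_left_mono) auto
            then show ?case using elim 1 by (simp add: \<phi>_def smooth_step_props algebra_simps)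
          qed
        next
          case 2
          have "\<phi> n s = 1" for n
          proof -
            have "real n * a \<le> real n * s" "real n * s \<le> real n * b" using 2 by (auto intro!: mult_left_mono)
            then show ?thesis by (simp add: \<phi>_def smooth_step_props algebra_simps)
          qed
          then show ?thesis using 2 by (intro always_eventually allI) simp
        next
          case 3
          show ?thesis using big[of "s - b", OF diff_gt_0_iff_gt[THEN iffD2, OF 3]]
          proof eventually_elim
            case (elim n)
            have "real n * a \<le> real n * s" using 3 ab by (intro mult_left_mono) auto
            then show ?case using elim 3 by (simp add: \<phi>_def smooth_step_props algebra_simps)
          qed
        qed
        then show ?thesis by (rule tendsto_eventually)
      qed
      then show "AE s in ?M. (\<lambda>n. \<phi> n s *\<^sub>R W s) \<longlonglongrightarrow> indicat_real {a..b} s *\<^sub>R W s"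
        by (intro AE_I2 tendsto_scaleR tendsto_const) auto
    qed
    moreover have "(\<lambda>n. LINT s|?M. \<phi> n s *\<^sub>R W s) \<longlonglongrightarrow> 0"
      by (rule tendsto_eventually) (use z in \<open>auto simp: eventually_sequentially\<close>)
    ultimately have "(LINT s|?M. indicat_real {a..b} s *\<^sub>R W s) = 0" by (rule LIMSEQ_unique)
    moreover have "(LINT s|?M. indicat_real {a..b} s *\<^sub>R W s) = integral {a..b} W"
      by (rule LINT_indicator_interval(2)[OF Wi]) (use ab in auto)
    moreover have "integral {a..b} W = integral {a..b} w"
      by (rule integral_cong) (use e in \<open>auto simp: W_def J_def\<close>)
    ultimately show ?thesis by simp
  qed
  have "AE s in lebesgue. s \<in> {inverse (Suc n)..L - inverse (Suc n)} \<longrightarrow> w s = 0" for n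
  proof -
    have "AE s in lebesgue_on {inverse (Suc n)..L - inverse (Suc n)}. w s = 0"
    proof (rule AE_zero_if_interval_integrals_zero)
      show "integrable (lebesgue_on {inverse (real (Suc n))..L - inverse (real (Suc n))}) w" by (rule wi) auto
      fix x
      show "integral {inverse (real (Suc n))..x} w = 0 \<or> x \<notin> {inverse (real (Suc n))..L - inverse (real (Suc n))}"
      proof (cases "x \<in> {inverse (real (Suc n))..L - inverse (real (Suc n))}")
        case True
        have p: "0 < inverse (real (Suc n))" by simp
        have "x < L" using True p unfolding atLeastAtMost_iff by linarith
        then show ?thesis using zero[OF p, of x] True by auto
      qed simp
    qed
    then show ?thesis by (subst (asm) AE_restrict_space_iff) auto
  qed
  then have all: "AE s in lebesgue. \<forall>n. s \<in> {inverse (Suc n)..L - inverse (Suc n)} \<longrightarrow> w s = 0"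
    by (subst AE_all_countable) blast
  have ne: "AE s in lebesgue. s \<noteq> x" for x :: real
  proof -
    have "AE s in lborel. s \<noteq> x" by (rule AE_lborel_singleton)
    then show ?thesis by (rule AE_completion)
  qed
  have "AE s in lebesgue. s \<in> {0..L} \<longrightarrow> u s = v s"
    using all ne[of 0] ne[of L]
  proof eventually_elim
    case (elim s)
    show ?case
    proof
      assume "s \<in> {0..L}"
      then have "0 < min s (L - s)" using elim by auto
      then obtain n where "inverse (Suc n) < min s (L - s)" using reals_Archimedean by blast
      then show "u s = v s" using elim(1)[rule_format, of n] by (auto simp: w_def)
    qed
  qed
  then show ?thesis by (subst AE_restrict_space_iff) auto
qed


lemma bump_approximate_identity:
  fixes c :: "real \<Rightarrow> 'b::euclidean_space"
  assumes c: "continuous_on {0..L} c" and z: "0 < z" "z < L"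
  shows "(\<lambda>n. LINT s|lebesgue_on {0..L}. (real n * bump_scale * bump (real n * (z - s))) *\<^sub>R c s) \<longlonglongrightarrow> c z"
proof (rule LIMSEQ_I)
  let ?M = "lebesgue_on {0..L}"
  define b where "b n s = real n * bump_scale * bump (real n * (z - s))" for n s
  have cb: "continuous_on A (b n)" for n A
    unfolding b_def by (intro continuous_intros continuous_on_compose2[OF continuous_bump]) auto
  have b0: "0 \<le> b n s" for n s
    unfolding b_def using bump_props(1) smooth_step_props(1) by (intro mult_nonneg_nonneg) (auto simp: less_imp_le)
  have ci: "integrable ?M f" if "continuous_on {0..L} f" for f :: "real \<Rightarrow> 'c::euclidean_space"
    using that by (rule continuous_imp_integrable_lebesgue_on)
  fix e :: real assume e: "e > 0"
  then obtain d where d: "d > 0" "\<And>s. s \<in> {0..L} \<Longrightarrow> dist s z < d \<Longrightarrow> dist (c s) (c z) < e / 2"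
    using c z unfolding continuous_on_iff by (metis atLeastAtMost_iff half_gt_zero less_imp_le)
  obtain N where N: "N > 0" "1 / real N < min d z" using d(1) z(1) by (metis min_less_iff_conj nat_approx_posE zero_less_Suc)
  have "norm ((LINT s|?M. b n s *\<^sub>R c s) - c z) < e" if n: "n \<ge> N" for n
  proof -
    have n0: "real n > 0" using n N by simp
    have "1 / real n \<le> 1 / real N" using n N by (simp add: frac_le)
    then have ne: "1 / real n < d" "1 / real n < z" using N(2) by auto
    have bz: "b n s = 0" if "s < z - 1 / real n \<or> z < s" for s
    proof -
      have "real n * (z - s) \<ge> 1 \<or> real n * (z - s) \<le> 0"
        using that n0 by (auto simp: field_simps mult_le_0_iff)
      then show ?thesis using bump_props(2,3) by (auto simp: b_def)
    qed
    have I1: "(LINT s|?M. b n s) = 1"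
    proof -
      have "(b n has_integral (- smooth_step (real n * (z - L)) - - smooth_step (real n * (z - 0)))) {0..L}"
      proof (rule fundamental_theorem_of_calculus)
        fix x
        have "((\<lambda>s. real n * (z - s)) has_real_derivative - real n) (at x)" by (auto intro!: derivative_eq_intros)
        from DERIV_minus[OF DERIV_chain2[OF smooth_step_props(2) this]]
        have "((\<lambda>s. - smooth_step (real n * (z - s))) has_real_derivative b n x) (at x)" by (simp add: b_def mult_ac)
        then show "((\<lambda>s. - smooth_step (real n * (z - s))) has_vector_derivative b n x) (at x within {0..L})"
          by (simp add: has_real_derivative_iff_has_vector_derivative[symmetric] has_field_derivative_at_within)
      qed (use z in simp)
      moreover have "real n * (z - L) \<le> 0" using z n0 by (simp add: mult_le_0_iff)
      moreover have "real n * (z - 0) \<ge> 1" using ne(2) n0 by (simp add: field_simps)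
      ultimately have "(b n has_integral 1) {0..L}" by (simp add: smooth_step_props)
      then have "integral {0..L} (b n) = 1" by (rule integral_unique)
      then show ?thesis using lebesgue_integral_eq_integral[OF ci[OF cb]] by simp
    qed
    have i1: "integrable ?M (\<lambda>s. b n s *\<^sub>R c s)" by (intro ci continuous_intros c cb)
    have i2: "integrable ?M (\<lambda>s. b n s *\<^sub>R c z)" by (intro ci continuous_intros cb)
    have i3: "integrable ?M (b n)" by (intro ci cb)
    have "(LINT s|?M. b n s *\<^sub>R c s) - c z = (LINT s|?M. b n s *\<^sub>R c s) - (LINT s|?M. b n s *\<^sub>R c z)"
      using i3 I1 by simp
    also have "\<dots> = (LINT s|?M. b n s *\<^sub>R c s - b n s *\<^sub>R c z)" by (simp add: Bochner_Integration.integral_diff[OF i1 i2])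
    finally have eq: "(LINT s|?M. b n s *\<^sub>R c s) - c z = (LINT s|?M. b n s *\<^sub>R c s - b n s *\<^sub>R c z)" .
    have "norm (LINT s|?M. b n s *\<^sub>R c s - b n s *\<^sub>R c z) \<le> (LINT s|?M. b n s * (e / 2))"
    proof (rule Bochner_Integration.integral_norm_bound_integral)
      show "integrable ?M (\<lambda>s. b n s *\<^sub>R c s - b n s *\<^sub>R c z)" using i1 i2 by (rule Bochner_Integration.integrable_diff)
      show "integrable ?M (\<lambda>s. b n s * (e / 2))" using i3 by simp
      fix s assume "s \<in> space ?M"
      then have s: "s \<in> {0..L}" by (simp add: space_restrict_space)
      show "norm (b n s *\<^sub>R c s - b n s *\<^sub>R c z) \<le> b n s * (e / 2)"
      proof (cases "s < z - 1 / real n \<or> z < s")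
        case True
        then show ?thesis using bz[of s] by simp
      next
        case False
        then have "dist s z < d" using ne(1) by (auto simp: dist_real_def)
        then have "norm (c s - c z) \<le> e / 2" using d(2)[OF s] by (simp add: dist_norm)
        then have "b n s * norm (c s - c z) \<le> b n s * (e / 2)" using b0 by (intro mult_left_mono)
        then show ?thesis using b0[of n s] by (simp flip: scaleR_right_diff_distrib)
      qed
    qed
    also have "\<dots> = e / 2" using i3 I1 by simp
    finally show ?thesis unfolding eq using e by linarith
  qed
  then show "\<exists>no. \<forall>n\<ge>no. norm ((LINT s|?M. (real n * bump_scale * bump (real n * (z - s))) *\<^sub>R c s) - c z) < e"
    unfolding b_def by blast
qed

text \<open>
  The test functions are smoothed piecewise linear hats with nodes \<open>a\<close>, \<open>m\<close>, \<open>b\<close>.  Their second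
  derivatives concentrate at the nodes and their values converge to the hat, which is the
  combination of the kernels \<open>(a - s)\<^sup>+\<close>, \<open>(m - s)\<^sup>+\<close>, \<open>(b - s)\<^sup>+\<close> with the same weights.  The
  identity says that \<open>g\<close> is affine.
\<close>
lemma second_weak_derivative_three_points:
  fixes c v :: "real \<Rightarrow> real^'n"
  assumes c: "continuous_on {0..L} c" and v: "integrable (lebesgue_on {0..L}) v"
    and weak: "\<And>\<phi>. \<phi> \<in> test_functions 0 L \<Longrightarrow>
      (LINT s|lebesgue_on {0..L}. deriv (deriv \<phi>) s *\<^sub>R c s) = (LINT s|lebesgue_on {0..L}. \<phi> s *\<^sub>R v s)"
    and abm: "0 < a" "a < m" "m < b" "b < L"
  defines "g \<equiv> \<lambda>t. c t - double_primitive L v t"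
  shows "(b - m) *\<^sub>R g a - (b - a) *\<^sub>R g m + (m - a) *\<^sub>R g b = 0"
proof -
  let ?M = "lebesgue_on {0..L}"
  define r where "r n z s = smooth_ramp ((- real n) * s + real n * z)" for n z s
  define r1 where "r1 n z s = - real n * smooth_step ((- real n) * s + real n * z)" for n z s
  define r2 where "r2 n z s = real n * (real n * bump_scale * bump (real n * (z - s)))" for n z s
  have rd: "(r n z has_real_derivative r1 n z s) (at s)" for n z s
  proof -
    have "((\<lambda>s. (- real n) * s + real n * z) has_real_derivative - real n) (at s)" by (auto intro!: derivative_eq_intros)
    from DERIV_chain2[OF smooth_ramp_DERIV(2) this] show ?thesis unfolding r_def r1_def by (simp only: mult.commute)
  qed
  have r1d: "(r1 n z has_real_derivative r2 n z s) (at s)" for n z s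
  proof -
    have "((\<lambda>s. (- real n) * s + real n * z) has_real_derivative - real n) (at s)" by (auto intro!: derivative_eq_intros)
    from DERIV_cmult[OF DERIV_chain2[OF smooth_step_props(2) this], of "- real n"]
    show ?thesis unfolding r1_def r2_def by (simp add: algebra_simps)
  qed
  define \<phi> where "\<phi> n s = ((b - m) / n) * r n a s + ((- (b - a) / n) * r n m s + ((m - a) / n) * r n b s)" for n :: nat and s
  have \<phi>c: "\<phi> n \<in> smooth_class" for n
    unfolding \<phi>_def[abs_def] r_def by (intro smooth_class.add smooth_class.scale smooth_class.ramp)
  define K where "K s = (b - m) * max 0 (a - s) + (- (b - a) * max 0 (m - s) + (m - a) * max 0 (b - s))" for s
  have rK: "\<bar>r n z s / n - max 0 (z - s)\<bar> \<le> 1 / n" if "n > 0" for n z s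
  proof -
    have "\<bar>r n z s - max 0 (real n * (z - s))\<bar> \<le> 1"
      using smooth_ramp_props(3)[of "(- real n) * s + real n * z"] by (simp add: r_def algebra_simps)
    moreover have "max 0 (real n * (z - s)) = real n * max 0 (z - s)"
      using that by (simp add: max_def mult_le_0_iff zero_le_mult_iff)
    ultimately have "\<bar>r n z s - real n * max 0 (z - s)\<bar> / real n \<le> 1 / real n"
      by (intro divide_right_mono) auto
    moreover have "r n z s / n - max 0 (z - s) = (r n z s - real n * max 0 (z - s)) / real n"
      using that by (simp add: field_simps)
    ultimately show ?thesis by (simp add: abs_divide)
  qed
  have close: "\<bar>\<phi> n s - K s\<bar> \<le> 2 * (b - a) / n" if n: "n > 0" for n s
  proof -
    define x y w where "x = r n a s / n - max 0 (a - s)" and "y = r n m s / n - max 0 (m - s)" and "w = r n b s / n - max 0 (b - s)"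
    have "\<phi> n s - K s = (b - m) * x - (b - a) * y + (m - a) * w"
      by (simp add: \<phi>_def K_def x_def y_def w_def algebra_simps diff_divide_distrib add_divide_distrib)
    also have "\<bar>\<dots>\<bar> \<le> (b - m) * \<bar>x\<bar> + (b - a) * \<bar>y\<bar> + (m - a) * \<bar>w\<bar>"
      using abm abs_triangle_ineq4[of "(b - m) * x" "(b - a) * y"] abs_triangle_ineq[of "(b - m) * x - (b - a) * y" "(m - a) * w"]
      by (simp add: abs_mult)
    also have "\<dots> \<le> (b - m) * (1 / n) + (b - a) * (1 / n) + (m - a) * (1 / n)"
      using abm rK[OF n] unfolding x_def y_def w_def by (intro add_mono mult_left_mono) auto
    also have "\<dots> = 2 * (b - a) / n" using n by (simp add: field_simps)
    finally show ?thesis .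
  qed
  define \<phi>1 where "\<phi>1 n s = ((b - m) / n) * r1 n a s + ((- (b - a) / n) * r1 n m s + ((m - a) / n) * r1 n b s)" for n :: nat and s
  define \<phi>2 where "\<phi>2 n s = ((b - m) / n) * r2 n a s + ((- (b - a) / n) * r2 n m s + ((m - a) / n) * r2 n b s)" for n :: nat and s
  have "(\<phi> n has_real_derivative \<phi>1 n s) (at s)" for n s
    unfolding \<phi>_def[abs_def] \<phi>1_def by (intro DERIV_add DERIV_cmult rd)
  then have D1: "deriv (\<phi> n) = \<phi>1 n" for n by (intro ext DERIV_imp_deriv)
  have D1c: "(\<phi>1 n has_real_derivative \<phi>2 n s) (at s)" for n s
    unfolding \<phi>2_def \<phi>1_def[abs_def] by (intro DERIV_add DERIV_cmult r1d)
  then have D2: "deriv (deriv (\<phi> n)) = \<phi>2 n" for n unfolding D1 by (intro ext DERIV_imp_deriv)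
  obtain N where N: "N > 0" "1 / real N < a" using abm(1) by (metis nat_approx_posE zero_less_Suc)
  have test: "\<phi> n \<in> test_functions 0 L" if n: "n \<ge> N" for n
  proof -
    have n0: "real n > 0" using n N by simp
    have "1 / real n \<le> 1 / real N" using n N by (simp add: frac_le)
    then have na: "1 / real n < a" using N by simp
    show ?thesis
    proof (rule test_function_smooth_class[OF \<phi>c])
      show "0 < a - 1 / real n" using na by simp
      show "b < L" by fact
      show "\<phi> n s = 0" if "b < s" for s
      proof -
        have "(- real n) * s + real n * z \<le> 0" if "z \<le> b" for z
        proof -
          have "real n * z \<le> real n * s" using that \<open>b < s\<close> n0 by (intro mult_left_mono) auto
          then show ?thesis by simp
        qed
        then show ?thesis using abm by (simp add: \<phi>_def r_def smooth_ramp_props(1))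
      qed
      show "\<phi> n s = 0" if "s < a - 1 / real n" for s
      proof -
        have "r n z s = real n * (z - s) + (smooth_ramp 1 - 1)" if "z \<ge> a" for z
        proof -
          have "1 / real n \<le> z - s" using that \<open>s < a - 1 / real n\<close> by simp
          then have "1 \<le> (- real n) * s + real n * z" using n0 by (simp add: field_simps)
          from smooth_ramp_props(2)[OF this] show ?thesis by (simp add: r_def algebra_simps)
        qed
        then have "r n a s = real n * (a - s) + (smooth_ramp 1 - 1)" "r n m s = real n * (m - s) + (smooth_ramp 1 - 1)"
          "r n b s = real n * (b - s) + (smooth_ramp 1 - 1)" using abm by auto
        note rs = this
        \<comment> \<open>The constants \<open>smooth_ramp 1 - 1\<close> cancel because the three weights add up to zero.\<close>
        have "real n * \<phi> n s = (b - m) * r n a s - (b - a) * r n m s + (m - a) * r n b s"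
          using n0 by (simp add: \<phi>_def field_simps)
        also have "\<dots> = 0" unfolding rs by (simp add: algebra_simps)
        finally show ?thesis using n0 by simp
      qed
    qed
  qed
  have cK: "continuous_on {0..L} K" unfolding K_def by (intro continuous_intros)
  have iK: "integrable ?M (\<lambda>s. K s *\<^sub>R v s)" by (rule integrable_continuous_scaleR[OF v cK])
  have i\<phi>: "integrable ?M (\<lambda>s. \<phi> n s *\<^sub>R v s)" for n
    by (rule integrable_continuous_scaleR[OF v smooth_class_continuous[OF \<phi>c]])
  have lim1: "(\<lambda>n. LINT s|?M. \<phi> n s *\<^sub>R v s) \<longlonglongrightarrow> (LINT s|?M. K s *\<^sub>R v s)"
  proof (rule Lim_transform2)
    show "(\<lambda>n. LINT s|?M. K s *\<^sub>R v s) \<longlonglongrightarrow> (LINT s|?M. K s *\<^sub>R v s)" by simp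
    show "(\<lambda>n. (LINT s|?M. K s *\<^sub>R v s) - (LINT s|?M. \<phi> n s *\<^sub>R v s)) \<longlonglongrightarrow> 0"
    proof (rule Lim_null_comparison)
      define V where "V = (LINT s|?M. norm (v s))"
      show "\<forall>\<^sub>F n in sequentially. norm ((LINT s|?M. K s *\<^sub>R v s) - (LINT s|?M. \<phi> n s *\<^sub>R v s)) \<le> (2 * (b - a) * V) * (1 / real n)"
        using eventually_gt_at_top[of 0]
      proof eventually_elim
        case (elim n)
        have "(LINT s|?M. K s *\<^sub>R v s) - (LINT s|?M. \<phi> n s *\<^sub>R v s) = (LINT s|?M. K s *\<^sub>R v s - \<phi> n s *\<^sub>R v s)"
          by (rule Bochner_Integration.integral_diff[OF iK i\<phi>, symmetric])
        moreover have "norm (LINT s|?M. K s *\<^sub>R v s - \<phi> n s *\<^sub>R v s) \<le> (LINT s|?M. 2 * (b - a) / real n * norm (v s))"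
        proof (rule Bochner_Integration.integral_norm_bound_integral)
          show "integrable ?M (\<lambda>s. K s *\<^sub>R v s - \<phi> n s *\<^sub>R v s)" using iK i\<phi> by (rule Bochner_Integration.integrable_diff)
          show "integrable ?M (\<lambda>s. 2 * (b - a) / real n * norm (v s))" using v by simp
          fix s
          have "norm (K s *\<^sub>R v s - \<phi> n s *\<^sub>R v s) = \<bar>\<phi> n s - K s\<bar> * norm (v s)"
            by (simp flip: scaleR_left_diff_distrib add: abs_minus_commute)
          also have "\<dots> \<le> 2 * (b - a) / real n * norm (v s)" using close[OF elim] by (intro mult_right_mono) auto
          finally show "norm (K s *\<^sub>R v s - \<phi> n s *\<^sub>R v s) \<le> 2 * (b - a) / real n * norm (v s)" .
        qed
        moreover have "(LINT s|?M. 2 * (b - a) / real n * norm (v s)) = (2 * (b - a) * V) * (1 / real n)"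
          using v by (simp add: V_def)
        ultimately show ?case by (simp only:)
      qed
      show "(\<lambda>n. (2 * (b - a) * V) * (1 / real n)) \<longlonglongrightarrow> 0" by (intro tendsto_mult_right_zero lim_1_over_n)
    qed
  qed
  define B where "B n z = (LINT s|?M. (real n * bump_scale * bump (real n * (z - s))) *\<^sub>R c s)" for n z
  have ci: "integrable ?M f" if "continuous_on {0..L} f" for f :: "real \<Rightarrow> real^'n"
    using that by (rule continuous_imp_integrable_lebesgue_on)
  have iB: "integrable ?M (\<lambda>s. (real n * bump_scale * bump (real n * (z - s))) *\<^sub>R c s)" for n z
    by (intro ci continuous_intros c continuous_on_compose2[OF continuous_bump]) auto
  have eqB: "(LINT s|?M. \<phi>2 n s *\<^sub>R c s) = (b - m) *\<^sub>R B n a - (b - a) *\<^sub>R B n m + (m - a) *\<^sub>R B n b" if n: "n > 0" for n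
  proof -
    let ?b = "\<lambda>z s. (real n * bump_scale * bump (real n * (z - s))) *\<^sub>R c s"
    have "\<phi>2 n s *\<^sub>R c s = (b - m) *\<^sub>R ?b a s - (b - a) *\<^sub>R ?b m s + (m - a) *\<^sub>R ?b b s" for s
    proof -
      have q: "x / real n * r2 n z s = x * (real n * bump_scale * bump (real n * (z - s)))" for x z
        using n by (simp add: r2_def)
      have "\<phi>2 n s = (b - m) * (real n * bump_scale * bump (real n * (a - s))) - (b - a) * (real n * bump_scale * bump (real n * (m - s)))
        + (m - a) * (real n * bump_scale * bump (real n * (b - s)))" 
        unfolding \<phi>2_def q by (simp only: mult_minus_left diff_conv_add_uminus add.assoc)
      then show ?thesis by (simp add: scaleR_left_distrib scaleR_left_diff_distrib)
    qed
    then have "(LINT s|?M. \<phi>2 n s *\<^sub>R c s) = (LINT s|?M. (b - m) *\<^sub>R ?b a s - (b - a) *\<^sub>R ?b m s + (m - a) *\<^sub>R ?b b s)" by simp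
    also have "\<dots> = (b - m) *\<^sub>R B n a - (b - a) *\<^sub>R B n m + (m - a) *\<^sub>R B n b"
      unfolding B_def using iB[of n a] iB[of n m] iB[of n b] by (simp del: scaleR_scaleR)
    finally show ?thesis .
  qed
  have lim2: "(\<lambda>n. (b - m) *\<^sub>R B n a - (b - a) *\<^sub>R B n m + (m - a) *\<^sub>R B n b) \<longlonglongrightarrow> (b - m) *\<^sub>R c a - (b - a) *\<^sub>R c m + (m - a) *\<^sub>R c b"
    unfolding B_def using abm by (intro tendsto_intros bump_approximate_identity[OF c]) auto
  have "\<forall>\<^sub>F n in sequentially. (b - m) *\<^sub>R B n a - (b - a) *\<^sub>R B n m + (m - a) *\<^sub>R B n b = (LINT s|?M. \<phi> n s *\<^sub>R v s)"
    using eventually_gt_at_top[of 0] eventually_ge_at_top[of N]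
  proof eventually_elim
    case (elim n)
    show ?case using eqB[OF elim(1)] weak[OF test[OF elim(2)]] unfolding D2 by simp
  qed
  from Lim_transform_eventually[OF lim2 this] lim1
  have "(b - m) *\<^sub>R c a - (b - a) *\<^sub>R c m + (m - a) *\<^sub>R c b = (LINT s|?M. K s *\<^sub>R v s)" by (rule LIMSEQ_unique)
  also have "\<dots> = (b - m) *\<^sub>R double_primitive L v a - (b - a) *\<^sub>R double_primitive L v m + (m - a) *\<^sub>R double_primitive L v b"
  proof -
    have i: "integrable ?M (\<lambda>s. max 0 (t - s) *\<^sub>R v s)" for t
      by (intro integrable_continuous_scaleR[OF v] continuous_intros)
    have "K s *\<^sub>R v s = (b - m) *\<^sub>R max 0 (a - s) *\<^sub>R v s - (b - a) *\<^sub>R max 0 (m - s) *\<^sub>R v s + (m - a) *\<^sub>R max 0 (b - s) *\<^sub>R v s" for s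
    proof -
      have "K s = (b - m) * max 0 (a - s) - (b - a) * max 0 (m - s) + (m - a) * max 0 (b - s)"
        unfolding K_def by (simp only: mult_minus_left diff_conv_add_uminus add.assoc)
      then show ?thesis by (simp only: scaleR_left_distrib scaleR_left_diff_distrib scaleR_scaleR)
    qed
    then have "(LINT s|?M. K s *\<^sub>R v s) = (LINT s|?M. (b - m) *\<^sub>R max 0 (a - s) *\<^sub>R v s - (b - a) *\<^sub>R max 0 (m - s) *\<^sub>R v s + (m - a) *\<^sub>R max 0 (b - s) *\<^sub>R v s)" by simp
    then show ?thesis unfolding double_primitive_def using i[of a] i[of m] i[of b] by (simp del: scaleR_scaleR)
  qed
  finally show ?thesis by (simp add: g_def algebra_simps)
qed

lemma second_weak_derivative_imp_double_primitive:
  fixes c v :: "real \<Rightarrow> real^'n"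
  assumes L: "0 < L" and c: "continuous_on {0..L} c" and v: "integrable (lebesgue_on {0..L}) v"
    and weak: "has_weak_derivative 0 L 2 c v"
  shows "\<exists>A B. \<forall>t\<in>{0..L}. c t = A + t *\<^sub>R B + double_primitive L v t"
proof -
  define g where "g t = c t - double_primitive L v t" for t
  have "deriv (deriv \<phi>) = (deriv ^^ 2) \<phi>" for \<phi> :: "real \<Rightarrow> real" by (simp add: numeral_2_eq_2)
  then have three: "(b - m) *\<^sub>R g a - (b - a) *\<^sub>R g m + (m - a) *\<^sub>R g b = 0" if "0 < a" "a < m" "m < b" "b < L" for a m b
    unfolding g_def using weak that
    by (intro second_weak_derivative_three_points[OF c v]) (auto simp: has_weak_derivative_def)
  have gc: "continuous_on {0..L} g"
    unfolding g_def using continuous_on_vector_derivative[OF double_primitive_has_vector_derivative[OF v]]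
    by (intro continuous_intros c) auto
  define a b where "a = L / 3" and "b = 2 * L / 3"
  have ab: "0 < a" "a < b" "b < L" using L by (auto simp: a_def b_def)
  \<comment> \<open>For any order of \<open>x\<close>, \<open>a\<close>, \<open>b\<close> the identity for three points is \<open>h x = 0\<close>.\<close>
  define h where "h x = (b - x) *\<^sub>R g a - (b - a) *\<^sub>R g x + (x - a) *\<^sub>R g b" for x
  have h0: "h x = 0" if "x \<in> {0<..<L}" for x
  proof -
    consider "x < a" | "x = a" | "a < x" "x < b" | "x = b" | "b < x" by linarith
    then show ?thesis
    proof cases
      case 1 then show ?thesis using three[of x a b] that ab by (simp add: h_def algebra_simps)
    next
      case 2 then show ?thesis by (simp add: h_def)
    next
      case 3 then show ?thesis using three[of a x b] that ab by (simp add: h_def)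
    next
      case 4 then show ?thesis by (simp add: h_def algebra_simps)
    next
      case 5 then show ?thesis using three[of a b x] that ab by (simp add: h_def algebra_simps)
    qed
  qed
  have "h x = 0" if "x \<in> {0..L}" for x
  proof (rule continuous_constant_on_closure[of "{0<..<L}" h])
    show "continuous_on (closure {0<..<L}) h" using L gc unfolding h_def by (simp add: closure_greaterThanLessThan) (intro continuous_intros)
    show "x \<in> closure {0<..<L}" using that L by (simp add: closure_greaterThanLessThan)
  qed (use h0 in blast)
  then have "c t = (1 / (b - a)) *\<^sub>R (b *\<^sub>R g a - a *\<^sub>R g b) + t *\<^sub>R ((1 / (b - a)) *\<^sub>R (g b - g a)) + double_primitive L v t" if "t \<in> {0..L}" for t
  proof -
    have "(b - a) *\<^sub>R g t = (b *\<^sub>R g a - a *\<^sub>R g b) + t *\<^sub>R (g b - g a)"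
      using \<open>\<And>x. x \<in> {0..L} \<Longrightarrow> h x = 0\<close>[OF that] by (simp add: h_def algebra_simps)
    then have "(1 / (b - a)) *\<^sub>R ((b - a) *\<^sub>R g t) = (1 / (b - a)) *\<^sub>R ((b *\<^sub>R g a - a *\<^sub>R g b) + t *\<^sub>R (g b - g a))" by simp
    then have "g t = (1 / (b - a)) *\<^sub>R ((b *\<^sub>R g a - a *\<^sub>R g b) + t *\<^sub>R (g b - g a))" using ab by simp
    then show ?thesis by (simp add: g_def scaleR_add_right algebra_simps)
  qed
  then show ?thesis by blast
qed

lemma deriv_test_function: "\<phi> \<in> test_functions a b \<Longrightarrow> deriv \<phi> \<in> test_functions a b"
proof -
  assume \<phi>: "\<phi> \<in> test_functions a b"
  then obtain x y where xy: "a < x" "y < b" "\<And>s. s \<notin> {x..y} \<Longrightarrow> \<phi> s = 0" by (auto simp: test_functions_def)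
  have "(deriv ^^ n) (deriv \<phi>) differentiable (at z)" for n z
  proof -
    have "(deriv ^^ Suc n) \<phi> differentiable (at z)" using \<phi> unfolding test_functions_def by blast
    then show ?thesis by (simp only: funpow_Suc_right o_def)
  qed
  moreover have "deriv \<phi> s = 0" if "s \<notin> {x..y}" for s
  proof -
    have "open (- {x..y})" by (simp add: open_Compl)
    then have "\<forall>\<^sub>F z in nhds s. \<phi> z = 0"
      using eventually_nhds_in_open[of "- {x..y}" s] that xy(3) by (auto elim: eventually_mono)
    then have "deriv \<phi> s = deriv (\<lambda>_. 0) s" by (rule deriv_cong_ev) simp
    then show ?thesis by simp
  qed
  ultimately show ?thesis using xy(1,2) unfolding test_functions_def by blast
qed

lemma locally_integrable_interval:
  fixes f :: "real \<Rightarrow> real^3" shows "integrable (lebesgue_on {0..L}) f \<Longrightarrow> locally_integrable 0 L f"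
  unfolding locally_integrable_def
proof (intro allI impI)
  fix x y :: real assume f: "integrable (lebesgue_on {0..L}) f" and xy: "0 < x" "y < L"
  then have "f absolutely_integrable_on {x..y}" by (intro integrable_subinterval_lebesgue_on(1)[OF f]) auto
  then show "integrable (lebesgue_on {x..y}) f"
    by (simp add: absolutely_integrable_on_def integrable_restrict_space set_integrable_def)
qed

lemma integration_by_parts_test:
  fixes f g :: "real \<Rightarrow> real^3"
  assumes L: "0 < L" and \<phi>: "\<phi> \<in> test_functions 0 L"
    and g: "integrable (lebesgue_on {0..L}) g"
    and f: "\<And>a b. 0 \<le> a \<Longrightarrow> a \<le> b \<Longrightarrow> b \<le> L \<Longrightarrow> f b - f a = integral {a..b} g"
  shows "(LINT s|lebesgue_on {0..L}. deriv \<phi> s *\<^sub>R f s) = - (LINT s|lebesgue_on {0..L}. \<phi> s *\<^sub>R g s)"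
proof -
  have d: "(deriv ^^ n) \<phi> differentiable (at x)" for n x using \<phi> by (auto simp: test_functions_def)
  have "(\<phi> has_real_derivative deriv \<phi> x) (at x)" for x
    using d[of 0 x] by (simp add: DERIV_deriv_iff_real_differentiable)
  then have F: "integral {a..b} (deriv \<phi>) = \<phi> b - \<phi> a" if "a \<le> b" for a b
    by (intro integral_unique fundamental_theorem_of_calculus that)
      (simp add: has_real_derivative_iff_has_vector_derivative[symmetric] has_field_derivative_at_within)
  have "continuous_on {0..L} (deriv \<phi>)"
    using d[of 1] by (intro differentiable_imp_continuous_on) (auto simp: differentiable_on_def intro: differentiable_at_withinI)
  then have i: "integrable (lebesgue_on {0..L}) (deriv \<phi>)"
    by (rule continuous_imp_integrable_lebesgue_on)
  note P = absolutely_continuous_product_rule[OF bounded_bilinear_scaleR i g F[symmetric] f order_refl _ order_refl, simplified]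
  obtain x y where "0 < x" "y < L" "\<forall>s. s \<notin> {x..y} \<longrightarrow> \<phi> s = 0" using \<phi> unfolding test_functions_def by blast
  then have e: "\<phi> 0 = 0" "\<phi> L = 0" by (auto simp del: not_le)
  have "(LINT s|lebesgue_on {0..L}. deriv \<phi> s *\<^sub>R f s) + (LINT s|lebesgue_on {0..L}. \<phi> s *\<^sub>R g s) =
    (LINT s|lebesgue_on {0..L}. deriv \<phi> s *\<^sub>R f s + \<phi> s *\<^sub>R g s)"
    using P(1,2) L by (simp add: less_imp_le)
  also have "\<dots> = integral {0..L} (\<lambda>s. deriv \<phi> s *\<^sub>R f s + \<phi> s *\<^sub>R g s)"
    by (rule lebesgue_integral_eq_integral) (use P(1,2) L in \<open>auto simp: less_imp_le\<close>)
  also have "\<dots> = \<phi> L *\<^sub>R f L - \<phi> 0 *\<^sub>R f 0" using P(3) L by (simp add: less_imp_le)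
  finally show ?thesis using e by (simp add: eq_neg_iff_add_eq_0)
qed

text \<open>
  The representation that is equivalent to \<open>v\<close> being an integrable second weak derivative of \<open>c\<close>.
\<close>
locale curve_with_acceleration =
  fixes c u v :: "real \<Rightarrow> real^3" and A B :: "real^3" and L :: real
  assumes L: "0 < L" and v: "integrable (lebesgue_on {0..L}) v"
    and rep: "\<And>t. t \<in> {0..L} \<Longrightarrow> c t = A + t *\<^sub>R B + double_primitive L v t"
    and u_def: "\<And>t. u t = B + integral {0..t} v"
begin

lemma c_deriv:
  assumes "t \<in> {0..L}" shows "(c has_vector_derivative u t) (at t within {0..L})"
proof -
  have "((\<lambda>t. A + t *\<^sub>R B + double_primitive L v t) has_vector_derivative u t) (at t within {0..L})"
    unfolding u_def by (auto intro!: derivative_eq_intros double_primitive_has_vector_derivative[OF v assms] )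
  then show ?thesis by (rule has_vector_derivative_transform[OF assms, rotated]) (rule rep)
qed

lemma u_diff: "0 \<le> a \<Longrightarrow> a \<le> b \<Longrightarrow> b \<le> L \<Longrightarrow> u b - u a = integral {a..b} v"
  using integral_diff_eq[OF v, of a b] by (simp add: u_def)

lemma u_continuous: "continuous_on {0..L} u"
  unfolding u_def[abs_def] by (intro continuous_intros continuous_on_primitive v)

lemma u_integrable: "integrable (lebesgue_on {0..L}) u"
  using u_continuous by (rule continuous_imp_integrable_lebesgue_on)

lemma c_continuous: "continuous_on {0..L} c"
  by (rule continuous_on_vector_derivative[OF c_deriv])

lemma c_integrable: "integrable (lebesgue_on {0..L}) c"
  using c_continuous by (rule continuous_imp_integrable_lebesgue_on)

lemma c_diff: "0 \<le> a \<Longrightarrow> a \<le> b \<Longrightarrow> b \<le> L \<Longrightarrow> c b - c a = integral {a..b} u"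
  by (rule sym, rule integral_unique, rule fundamental_theorem_of_calculus)
    (auto intro!: has_vector_derivative_within_subset[OF c_deriv])

lemma weak_derivatives: "has_weak_derivative 0 L 1 c u" "has_weak_derivative 0 L 2 c v"
proof -
  show "has_weak_derivative 0 L 1 c u"
    unfolding has_weak_derivative_def
    using integration_by_parts_test[OF L _ u_integrable c_diff] locally_integrable_interval c_integrable u_integrable by simp
  show "has_weak_derivative 0 L 2 c v"
    unfolding has_weak_derivative_def
  proof (intro conjI ballI locally_integrable_interval c_integrable v)
    fix \<phi> assume \<phi>: "\<phi> \<in> test_functions 0 L"
    show "(LINT s|lebesgue_on {0..L}. (deriv ^^ 2) \<phi> s *\<^sub>R c s) = (- 1) ^ 2 *\<^sub>R (LINT s|lebesgue_on {0..L}. \<phi> s *\<^sub>R v s)"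
      using integration_by_parts_test[OF L deriv_test_function[OF \<phi>] u_integrable c_diff]
        integration_by_parts_test[OF L \<phi> v u_diff] by (simp add: numeral_2_eq_2)
  qed
qed

end

lemma weak_derivative_unique:
  assumes "has_weak_derivative 0 L k c v" "has_weak_derivative 0 L k c w"
  shows "AE s in lebesgue_on {0..L}. v s = w s"
proof (rule test_functions_separate)
  show "locally_integrable 0 L v" "locally_integrable 0 L w" using assms by (auto simp: has_weak_derivative_def)
  fix \<phi> assume \<phi>: "\<phi> \<in> test_functions 0 L"
  have "(- 1 :: real) ^ k *\<^sub>R (LINT s|lebesgue_on {0..L}. \<phi> s *\<^sub>R v s) = (- 1) ^ k *\<^sub>R (LINT s|lebesgue_on {0..L}. \<phi> s *\<^sub>R w s)"
    using assms \<phi> by (simp add: has_weak_derivative_def)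
  then show "(LINT s|lebesgue_on {0..L}. \<phi> s *\<^sub>R v s) = (LINT s|lebesgue_on {0..L}. \<phi> s *\<^sub>R w s)"
    by (subst (asm) scaleR_cancel_left) simp
qed

section \<open>The geodesic distance and unit speed curves\<close>

lemma one_minus_cos_le: "1 - cos x \<le> x\<^sup>2 / 2" for x :: real
proof -
  have "1 - cos x = 2 * (sin (x / 2))\<^sup>2" using cos_double_sin[of "x / 2"] by simp
  also have "(sin (x / 2))\<^sup>2 \<le> (x / 2)\<^sup>2" using abs_sin_x_le_abs_x[of "x/2"] by (simp only: abs_le_square_iff)
  finally show ?thesis by (simp add: power_divide)
qed

lemma sin_ge_minus_square: "x - x\<^sup>2 / 2 \<le> sin x" if "0 \<le> x" for x :: real
proof -
  have "(\<lambda>x. x - x\<^sup>2 / 2 - sin x) x \<le> (\<lambda>x. x - x\<^sup>2 / 2 - sin x) 0"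
  proof (rule DERIV_nonpos_imp_nonincreasing[OF that, of "\<lambda>x. x - x\<^sup>2 / 2 - sin x"])
    fix y :: real assume y: "0 \<le> y"
    have "1 - cos y = 2 * (sin (y / 2))\<^sup>2" using cos_double_sin[of "y / 2"] by simp
    also have "(sin (y / 2))\<^sup>2 = \<bar>sin (y / 2)\<bar> * \<bar>sin (y / 2)\<bar>" by (simp add: power2_eq_square)
    also have "\<dots> \<le> \<bar>y / 2\<bar> * 1" using abs_sin_x_le_abs_x[of "y/2"] by (intro mult_mono) auto
    finally have "1 - y - cos y \<le> 0" using y by simp
    moreover have "((\<lambda>x. x - x\<^sup>2 / 2 - sin x) has_real_derivative 1 - y - cos y) (at y)"
      by (auto intro!: derivative_eq_intros)
    ultimately show "\<exists>z. ((\<lambda>x. x - x\<^sup>2 / 2 - sin x) has_real_derivative z) (at y) \<and> z \<le> 0" by blast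
  qed
  then show ?thesis by simp
qed

lemma inner_unit_bounds:
  fixes x y :: "real^3"
  assumes "norm x = 1" "norm y = 1" shows "- 1 \<le> x \<bullet> y" "x \<bullet> y \<le> 1"
  using Cauchy_Schwarz_ineq2[of x y] assms by auto

lemma sphere_dist_props:
  assumes "norm x = 1" "norm y = 1"
  shows "0 \<le> sphere_dist x y" "sphere_dist x y \<le> pi" "cos (sphere_dist x y) = x \<bullet> y"
    "sphere_dist x y = sphere_dist y x"
  using inner_unit_bounds[OF assms] by (auto simp: sphere_dist_def arccos_lbound arccos_ubound inner_commute)

lemma sphere_dist_self: "norm x = 1 \<Longrightarrow> sphere_dist x x = 0"
  by (simp add: sphere_dist_def dot_square_norm)

lemma chord_eq:
  assumes "norm x = 1" "norm y = 1"
  shows "norm (x - y) = 2 * sin (sphere_dist x y / 2)"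
proof -
  have "(norm (x - y))\<^sup>2 = 2 - 2 * (x \<bullet> y)"
  proof -
    have "x \<bullet> x = 1" "y \<bullet> y = 1" using assms by (simp_all add: dot_square_norm)
    then show ?thesis unfolding dot_square_norm[symmetric] by (simp add: inner_diff_left inner_diff_right inner_commute)
  qed
  also have "\<dots> = 2 - 2 * cos (sphere_dist x y)" by (simp only: sphere_dist_props(3)[OF assms])
  also have "\<dots> = (2 * sin (sphere_dist x y / 2))\<^sup>2"
    using cos_double_sin[of "sphere_dist x y / 2"] by (simp add: power_mult_distrib)
  finally have "(norm (x - y))\<^sup>2 = (2 * sin (sphere_dist x y / 2))\<^sup>2" .
  moreover have "0 \<le> 2 * sin (sphere_dist x y / 2)"
    using sphere_dist_props(1,2)[OF assms] sin_ge_zero[of "sphere_dist x y / 2"] by linarith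
  ultimately show ?thesis by (simp only: power2_eq_iff_nonneg norm_ge_zero)
qed

lemma chord_le_sphere_dist:
  assumes "norm x = 1" "norm y = 1"
  shows "norm (x - y) \<le> sphere_dist x y"
  using chord_eq[OF assms] sin_x_le_x[of "sphere_dist x y / 2"] sphere_dist_props[OF assms] by simp

text \<open>
  For short edges chord and arc are comparable up to a factor close to one.
\<close>
lemma chord_ge_sphere_dist:
  assumes "norm x = 1" "norm y = 1"
  shows "sphere_dist x y * (1 - sphere_dist x y / 4) \<le> norm (x - y)"
  using chord_eq[OF assms] sin_ge_minus_square[of "sphere_dist x y / 2"] sphere_dist_props[OF assms]
  by (simp add: algebra_simps power2_eq_square)

text \<open>
  Split \<open>x\<close> and \<open>z\<close> into their components along \<open>y\<close> and orthogonal to it; the addition theorem for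
  the cosine then reduces the claim to the Cauchy-Schwarz inequality for the orthogonal parts.
\<close>
lemma sphere_dist_triangle:
  assumes "norm x = 1" "norm y = 1" "norm z = 1"
  shows "sphere_dist x z \<le> sphere_dist x y + sphere_dist y z"
proof (cases "sphere_dist x y + sphere_dist y z \<le> pi")
  case True
  define a b where "a = sphere_dist x y" and "b = sphere_dist y z"
  have ab: "0 \<le> a" "a \<le> pi" "0 \<le> b" "b \<le> pi" "cos a = x \<bullet> y" "cos b = y \<bullet> z"
    using assms by (auto simp: a_def b_def sphere_dist_props)
  define e f where "e = x - (x \<bullet> y) *\<^sub>R y" and "f = z - (z \<bullet> y) *\<^sub>R y"
  have yy: "y \<bullet> y = 1" "x \<bullet> x = 1" "z \<bullet> z = 1" using assms by (auto simp: dot_square_norm)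
  have ne: "(norm e)\<^sup>2 = (sin a)\<^sup>2"
    unfolding dot_square_norm[symmetric] sin_squared_eq ab e_def
    by (simp add: inner_diff_left inner_diff_right yy inner_commute power2_eq_square)
  have nf: "(norm f)\<^sup>2 = (sin b)\<^sup>2"
    unfolding dot_square_norm[symmetric] sin_squared_eq ab f_def
    by (simp add: inner_diff_left inner_diff_right yy inner_commute power2_eq_square)
  have "norm e = sin a" "norm f = sin b"
    using ne nf ab sin_ge_zero by (auto intro!: power2_eq_imp_eq)
  moreover have "x \<bullet> z = cos a * cos b + e \<bullet> f"
    unfolding ab e_def f_def by (simp add: inner_diff_left inner_diff_right yy inner_commute)
  moreover have "- (norm e * norm f) \<le> e \<bullet> f" using Cauchy_Schwarz_ineq2[of e f] by simp
  ultimately have "cos (a + b) \<le> x \<bullet> z" by (simp add: cos_add)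
  then have "arccos (x \<bullet> z) \<le> arccos (cos (a + b))"
    using inner_unit_bounds[OF assms(1,3)] by (intro arccos_le_arccos) auto
  also have "arccos (cos (a + b)) = a + b" using ab True by (intro arccos_cos) (auto simp: a_def b_def)
  finally show ?thesis by (simp add: sphere_dist_def a_def b_def)
next
  case False
  then show ?thesis using sphere_dist_props(2)[OF assms(1,3)] by linarith
qed

locale unit_speed_curve =
  fixes c :: "real \<Rightarrow> real^3" and L :: real
  assumes L: "0 < L" and c_cont: "continuous_on {0..L} c" and c_sphere: "c ` {0..L} \<subseteq> sphere 0 1"
    and arc: "arc_length_parametrized c L"
begin

lemma c_norm: "t \<in> {0..L} \<Longrightarrow> norm (c t) = 1"
  using c_sphere by (auto simp: image_subset_iff)

lemma sphere_dist_nondegenerate: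
  assumes st: "0 \<le> s" "s < t" "t \<le> L" and ne: "c t \<noteq> c s" "c t \<noteq> - c s"
  shows "sphere_dist (c s) (c t) \<le> t - s"
proof -
  have "inscribed c s t [s, t]" using assms by (auto simp: inscribed_def less_Suc_eq)
  then have "ennreal (polygon_length (map c [s, t])) \<le> curve_length c s t"
    unfolding curve_length_def by (intro SUP_upper) auto
  also have "\<dots> = ennreal (t - s)" using arc st by (auto simp: arc_length_parametrized_def)
  also have "polygon_length (map c [s, t]) = sphere_dist (c s) (c t)"
    by (simp add: polygon_length_def edge_len_def)
  finally show ?thesis using st by (simp add: ennreal_le_iff)
qed

lemma locally_nonantipodal:
  "\<exists>\<eta>>0. \<forall>s t. 0 \<le> s \<longrightarrow> s \<le> t \<longrightarrow> t \<le> L \<longrightarrow> t - s < \<eta> \<longrightarrow> c t \<noteq> - c s"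
proof -
  have "uniformly_continuous_on {0..L} c" using c_cont by (intro compact_uniformly_continuous) auto
  then obtain \<eta> where \<eta>: "\<eta> > 0" "\<And>s t. s \<in> {0..L} \<Longrightarrow> t \<in> {0..L} \<Longrightarrow> dist t s < \<eta> \<Longrightarrow> dist (c t) (c s) < 2"
    unfolding uniformly_continuous_on_def by (meson zero_less_numeral)
  have "c t \<noteq> - c s" if "0 \<le> s" "s \<le> t" "t \<le> L" "t - s < \<eta>" for s t
  proof
    assume a: "c t = - c s"
    have "dist (c t) (c s) = norm (2 *\<^sub>R c s)" by (simp add: a dist_norm scaleR_2 norm_minus_commute)
    also have "\<dots> = 2" using c_norm[of s] that by simp
    finally show False using \<eta>(2)[of s t] that by (auto simp: dist_real_def)
  qed
  then show ?thesis using \<eta>(1) by blast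
qed

text \<open>
  The polygonal with a single edge is inscribed in \<open>c\<close> on \<open>{s..t}\<close> if its end points are neither equal
  nor antipodal.  Antipodal points are excluded for close parameters only, so that the bound is first
  obtained locally and then chained with the triangle inequality.
\<close>
lemma sphere_dist_le:
  assumes st: "0 \<le> s" "s \<le> t" "t \<le> L"
  shows "sphere_dist (c s) (c t) \<le> t - s"
proof -
  obtain \<eta> where \<eta>: "\<eta> > 0" "\<And>s t. 0 \<le> s \<Longrightarrow> s \<le> t \<Longrightarrow> t \<le> L \<Longrightarrow> t - s < \<eta> \<Longrightarrow> c t \<noteq> - c s"
    using locally_nonantipodal by blast
  have loc: "sphere_dist (c a) (c b) \<le> b - a" if "0 \<le> a" "a \<le> b" "b \<le> L" "b - a < \<eta>" for a b
  proof (cases "c b = c a")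
    case True then show ?thesis using that c_norm[of a] by (simp add: sphere_dist_self)
  next
    case False
    then have "a < b" using that by (cases "a = b") auto
    then show ?thesis using sphere_dist_nondegenerate[of a b] \<eta>(2)[of a b] that False by auto
  qed
  obtain n where n: "(t - s) / \<eta> < real n" using reals_Archimedean2 by blast
  have n0: "real n > 0" using n st \<eta>(1) by (smt (verit) divide_nonneg_pos)
  define h where "h = (t - s) / real n"
  have h: "0 \<le> h" "h < \<eta>" "real n * h = t - s" using st n n0 \<eta>(1) by (auto simp: h_def field_simps)
  have rb: "s + real k * h \<le> t" if "k \<le> n" for k
  proof -
    have "real k * h \<le> real n * h" using that h by (intro mult_right_mono) auto
    then show ?thesis using h by simp
  qed
  have kh: "0 \<le> real k * h" for k using h by simp
  have "k \<le> n \<Longrightarrow> sphere_dist (c s) (c (s + real k * h)) \<le> real k * h" for k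
  proof (induction k)
    case 0 then show ?case using c_norm[of s] st by (simp add: sphere_dist_self)
  next
    case (Suc k)
    have s1: "s + real (Suc k) * h = (s + real k * h) + h" by (simp add: algebra_simps)
    have "sphere_dist (c s) (c (s + real (Suc k) * h)) \<le> sphere_dist (c s) (c (s + real k * h)) + sphere_dist (c (s + real k * h)) (c (s + real (Suc k) * h))"
      using rb[of k] rb[of "Suc k"] kh[of k] kh[of "Suc k"] st Suc.prems by (intro sphere_dist_triangle c_norm) auto
    also have "sphere_dist (c (s + real k * h)) (c (s + real (Suc k) * h)) \<le> h"
      using loc[of "s + real k * h" "s + real (Suc k) * h"] rb[of "Suc k"] kh[of k] st Suc.prems h s1 by simp
    finally show ?case using Suc by (simp add: algebra_simps)
  qed
  from this[of n] show ?thesis using h by simp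
qed

lemma c_lipschitz:
  assumes "s \<in> {0..L}" "t \<in> {0..L}" shows "norm (c t - c s) \<le> \<bar>t - s\<bar>"
proof -
  have *: "norm (c t - c s) \<le> t - s" if "0 \<le> s" "s \<le> t" "t \<le> L" for s t
    using chord_le_sphere_dist[of "c s" "c t"] sphere_dist_le[OF that] c_norm[of s] c_norm[of t] that
    by (simp add: norm_minus_commute)
  show ?thesis using *[of s t] *[of t s] assms by (cases "s \<le> t") (auto simp: norm_minus_commute)
qed

text \<open>
  On an interval of constancy no polygonal would be inscribed, and the length would be zero.
\<close>
lemma not_constant:
  assumes ab: "0 \<le> a" "a < b" "b \<le> L"
  shows "\<exists>s\<in>{a..b}. \<exists>t\<in>{a..b}. c s \<noteq> c t"
proof (rule ccontr)
  assume neg: "\<not> ?thesis"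
  have "\<not> inscribed c a b ts" for ts
  proof
    assume i: "inscribed c a b ts"
    then have ne: "ts \<noteq> []" "hd ts = a" "last ts = b" "sorted_wrt (<) ts" by (auto simp: inscribed_def)
    then obtain x xs where ts: "ts = x # xs" by (cases ts) auto
    have "xs \<noteq> []" using ne ab ts by auto
    then obtain y ys where ts: "ts = x # y # ys" using ts by (cases xs) auto
    have x: "x = a" "x < y" using ne ts by auto
    have "y \<le> b" using ne(3,4) ts by (cases "ys = []") (auto dest: last_in_set simp: less_imp_le)
    moreover have "c y \<noteq> c x" using i ts by (auto simp: inscribed_def)
    ultimately show False using neg x ab by auto
  qed
  then have "curve_length c a b = 0" by (simp add: curve_length_def bot_ennreal)
  moreover have "curve_length c a b = ennreal (b - a)" using arc ab by (auto simp: arc_length_parametrized_def)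
  ultimately show False using ab by simp
qed

lemma inscribed_bounds:
  assumes "inscribed c 0 L ts"
  shows "2 \<le> length ts" "ts ! 0 = 0" "ts ! (length ts - 1) = L"
    "\<And>i j. i < j \<Longrightarrow> j < length ts \<Longrightarrow> ts ! i < ts ! j"
    "\<And>i j. i \<le> j \<Longrightarrow> j < length ts \<Longrightarrow> ts ! i \<le> ts ! j"
    "\<And>i. i < length ts \<Longrightarrow> ts ! i \<in> {0..L}"
proof -
  have i: "ts \<noteq> []" "hd ts = 0" "last ts = L" "sorted_wrt (<) ts" using assms by (auto simp: inscribed_def)
  show 0: "ts ! 0 = 0" using i by (simp add: hd_conv_nth)
  show l: "ts ! (length ts - 1) = L" using i by (simp add: last_conv_nth)
  show "2 \<le> length ts" 
  proof (rule ccontr)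
    assume "\<not> ?thesis"
    moreover have "length ts \<noteq> 0" using i(1) by simp
    ultimately have "length ts - 1 = 0" by linarith
    then show False using 0 l L by simp
  qed
  show m: "ts ! i < ts ! j" if "i < j" "j < length ts" for i j using sorted_wrt_nth_less[OF i(4)] that by auto
  show m': "ts ! i \<le> ts ! j" if "i \<le> j" "j < length ts" for i j using m[of i j] that by (cases "i = j") auto
  show "ts ! i \<in> {0..L}" if "i < length ts" for i
    using m'[of 0 i] m'[of i "length ts - 1"] that 0 l by auto
qed

text \<open>
  The curve may pass through a point several times, but it is not constant on any interval.  By
  compactness, its diameter over intervals of length \<open>\<eta>\<close> is bounded below by a positive constant.
\<close>
lemma mesh_small_if_modulus_small:
  assumes "0 < \<eta>"
  shows "\<exists>\<epsilon>>0. \<forall>ts. inscribed c 0 L ts \<longrightarrow> modulus c ts < \<epsilon> \<longrightarrow>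
    (\<forall>i. Suc i < length ts \<longrightarrow> ts ! Suc i - ts ! i < \<eta>)"
proof -
  obtain n where n: "n > 0" "2 * L / \<eta> < real n"
  proof -
    obtain n where "2 * L / \<eta> < real n" using reals_Archimedean2 by blast
    moreover then have "n > 0" using L assms by (cases n) (auto simp: field_simps)
    ultimately show ?thesis using that by blast
  qed
  define h where "h = L / real n"
  have h: "h > 0" "2 * h < \<eta>" "real n * h = L" using L n assms by (auto simp: h_def field_simps)
  have kb: "real (Suc k) * h \<le> L" if "k < n" for k
  proof -
    have "real (Suc k) * h \<le> real n * h" using that h by (intro mult_right_mono) auto
    then show ?thesis using h by simp
  qed
  have "\<exists>st. fst st \<in> {real k * h..real (Suc k) * h} \<and> snd st \<in> {real k * h..real (Suc k) * h} \<and> c (fst st) \<noteq> c (snd st)" if "k < n" for k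
  proof -
    have "0 \<le> real k * h" "real k * h < real (Suc k) * h" using h by simp_all
    from not_constant[OF this kb[OF that]] obtain s t where "s \<in> {real k * h..real (Suc k) * h}"
      "t \<in> {real k * h..real (Suc k) * h}" "c s \<noteq> c t" by blast
    then show ?thesis by (intro exI[of _ "(s, t)"]) (simp only: fst_conv snd_conv simp_thms)
  qed
  then obtain st where st: "\<And>k. k < n \<Longrightarrow> fst (st k) \<in> {real k * h..real (Suc k) * h}"
    "\<And>k. k < n \<Longrightarrow> snd (st k) \<in> {real k * h..real (Suc k) * h}" "\<And>k. k < n \<Longrightarrow> c (fst (st k)) \<noteq> c (snd (st k))"
    by metis
  define D where "D k = norm (c (fst (st k)) - c (snd (st k)))" for k
  \<comment> \<open>Every interval of length \<open>\<eta>\<close> contains a cell of the grid of step \<open>h\<close>, as \<open>2 * h < \<eta>\<close>.\<close>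
  define \<epsilon> where "\<epsilon> = Min (D ` {..<n})"
  have "\<epsilon> \<in> D ` {..<n}" unfolding \<epsilon>_def using n by (intro Min_in) auto
  then have \<epsilon>: "\<epsilon> > 0" using st(3) by (auto simp: D_def)
  show ?thesis
  proof (intro exI[of _ \<epsilon>] conjI \<epsilon> allI impI)
    fix ts i assume ts: "inscribed c 0 L ts" and m: "modulus c ts < \<epsilon>" and i: "Suc i < length ts"
    note B = inscribed_bounds[OF ts]
    show "ts ! Suc i - ts ! i < \<eta>"
    proof (rule ccontr)
      assume neg: "\<not> ?thesis"
      define a b where "a = ts ! i" and "b = ts ! Suc i"
      have ab: "0 \<le> a" "b \<le> L" "\<eta> \<le> b - a" using neg B(6)[of i] B(6)[of "Suc i"] i by (auto simp: a_def b_def)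
      define k where "k = nat \<lceil>a / h\<rceil>"
      have "0 \<le> a / h" using ab h(1) by simp
      then have c0: "0 \<le> (of_int \<lceil>a / h\<rceil> :: real)" using ceiling_correct[of "a / h"] by (meson order_trans)
      then have "0 \<le> \<lceil>a / h\<rceil>" unfolding of_int_0_le_iff .
      then have rk: "real k = of_int \<lceil>a / h\<rceil>" unfolding k_def by (rule of_nat_nat)
      have k1: "a / h \<le> real k" and k2: "real k < a / h + 1"
        unfolding rk using ceiling_correct[of "a / h"] by (simp_all only: diff_less_eq simp_thms)
      have "a / h * h \<le> real k * h" by (rule mult_right_mono[OF k1 less_imp_le[OF h(1)]])
      moreover have "real k * h < (a / h + 1) * h" by (rule mult_strict_right_mono[OF k2 h(1)])
      moreover have "a / h * h = a" using h(1) by simp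
      ultimately have k: "a \<le> real k * h" "real k * h < a + h" by (simp_all only: distrib_right mult_1)
      have kn: "k < n"
      proof (rule ccontr)
        assume "\<not> k < n"
        then have "real n * h \<le> real k * h" using h by (intro mult_right_mono) auto
        then show False using k h ab by linarith
      qed
      have "real (Suc k) * h = real k * h + h" by (simp add: distrib_right)
      then have kb: "real (Suc k) * h \<le> b" using k h ab by linarith
      have sub: "{real k * h..real (Suc k) * h} \<subseteq> {a..b}" using k kb by auto
      define S where "S = {sphere_dist x y |x y. x \<in> c ` {a..b} \<and> y \<in> c ` {a..b}}"
      have un: "norm (c x) = 1" if "x \<in> {a..b}" for x using c_norm[of x] that ab by auto
      have bdd: "bdd_above S"
        unfolding S_def by (rule bdd_aboveI[of _ pi]) (auto simp: un sphere_dist_props)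
      have "sphere_dist (c (fst (st k))) (c (snd (st k))) \<in> S" unfolding S_def using st(1,2)[OF kn] sub by blast
      then have "sphere_dist (c (fst (st k))) (c (snd (st k))) \<le> sphere_diameter (c ` {a..b})"
        unfolding sphere_diameter_def S_def[symmetric] using bdd by (rule cSup_upper)
      also have "\<dots> \<le> modulus c ts"
        unfolding modulus_def a_def b_def by (rule Max_ge) (use i in auto)
      also have "\<dots> < \<epsilon>" by (rule m)
      also have "\<epsilon> \<le> D k" unfolding \<epsilon>_def using kn by (intro Min_le) auto
      also have "D k \<le> sphere_dist (c (fst (st k))) (c (snd (st k)))"
        unfolding D_def by (rule chord_le_sphere_dist; rule un; use st(1,2)[OF kn] sub in blast)
      finally show False by simp
    qed
  qed
qed

text \<open>
  Choose a polygonal \<open>Q\<close> whose length is nearly \<open>L\<close>.  If the mesh of \<open>P\<close> is small compared with the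
  number of edges of \<open>Q\<close>, then moving each vertex of \<open>Q\<close> to the preceding vertex of \<open>P\<close> changes the
  length by little, and the polygonal through the moved vertices is not longer than \<open>P\<close>.
\<close>
lemma polygon_length_converges:
  assumes \<epsilon>: "0 < \<epsilon>"
  shows "\<exists>\<eta>>0. \<forall>ts. inscribed c 0 L ts \<longrightarrow> (\<forall>i. Suc i < length ts \<longrightarrow> ts ! Suc i - ts ! i < \<eta>) \<longrightarrow>
    L - \<epsilon> < polygon_length (map c ts)"
proof -
  have "ennreal (L - \<epsilon> / 2) < ennreal L" using \<epsilon> L by (simp add: ennreal_less_iff ennreal_lessI)
  also have "ennreal L = curve_length c 0 L" using arc L by (auto simp: arc_length_parametrized_def)
  finally obtain qs where qs: "inscribed c 0 L qs" "ennreal (L - \<epsilon> / 2) < ennreal (polygon_length (map c qs))"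
    unfolding curve_length_def less_SUP_iff by auto
  then have ql: "L - \<epsilon> / 2 < polygon_length (map c qs)" 
    by (metis ennreal_leI not_le)
  note Q = inscribed_bounds[OF qs(1)]
  define N where "N = length qs - 1"
  define \<eta> where "\<eta> = \<epsilon> / (4 * real N + 4)"
  have \<eta>: "\<eta> > 0" using \<epsilon> by (simp add: \<eta>_def add_nonneg_pos)
  show ?thesis
  proof (intro exI[of _ \<eta>] conjI \<eta> allI impI)
    fix ts assume ts: "inscribed c 0 L ts" and mesh: "\<forall>i. Suc i < length ts \<longrightarrow> ts ! Suc i - ts ! i < \<eta>"
    note P = inscribed_bounds[OF ts]
    define n where "n = length ts - 1"
    define \<sigma> where "\<sigma> k = (\<Sum>j<k. sphere_dist (c (ts ! j)) (c (ts ! Suc j)))" for k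
    have len: "polygon_length (map c ts) = \<sigma> n"
      unfolding polygon_length_def \<sigma>_def n_def length_map edge_len_def by (rule sum.cong) auto
    have \<sigma>d: "sphere_dist (c (ts ! i)) (c (ts ! (i + k))) \<le> \<sigma> (i + k) - \<sigma> i" if "i + k \<le> n" for i k
      using that
    proof (induction k)
      case 0
      then show ?case using c_norm[OF P(6)[of i]] P(1) by (simp add: sphere_dist_self n_def)
    next
      case (Suc k)
      have "sphere_dist (c (ts ! i)) (c (ts ! (i + Suc k))) \<le> sphere_dist (c (ts ! i)) (c (ts ! (i + k))) + sphere_dist (c (ts ! (i + k))) (c (ts ! (i + Suc k)))"
        using Suc.prems P(1) by (intro sphere_dist_triangle c_norm P(6)) (auto simp: n_def)
      then show ?case using Suc by (simp add: \<sigma>_def)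
    qed
    \<comment> \<open>The last vertex of the fine polygonal that is not after \<open>q\<close>.\<close>
    define a where "a q = Max {i. i \<le> n \<and> ts ! i \<le> q}" for q
    have fin: "finite {i. i \<le> n \<and> ts ! i \<le> q}" for q by (rule finite_subset[of _ "{..n}"]) auto
    have ain: "a q \<le> n \<and> ts ! a q \<le> q" if "0 \<le> q" for q
      using Max_in[OF fin[of q]] that P(2) by (fastforce simp: a_def)
    have amono: "a q \<le> a q'" if "0 \<le> q" "q \<le> q'" for q q'
      unfolding a_def[of q'] using ain[OF that(1)] that by (intro Max_ge fin) auto
    have anear: "q - ts ! a q < \<eta>" if "0 \<le> q" "q \<le> L" for q
    proof (cases "a q = n")
      case True
      then show ?thesis using P(3) that \<eta> by (simp add: n_def)
    next
      case False
      then have l: "Suc (a q) \<le> n" using ain[OF that(1)] by auto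
      then have "\<not> ts ! Suc (a q) \<le> q"
        using Max_ge[OF fin[of q], of "Suc (a q)"] unfolding a_def[symmetric] by fastforce
      moreover have "Suc (a q) < length ts" using l P(1) unfolding n_def by linarith
      then have "ts ! Suc (a q) - ts ! a q < \<eta>" using mesh by blast
      ultimately show ?thesis by linarith
    qed
    have aL: "norm (c (ts ! a q)) = 1" "sphere_dist (c (ts ! a q)) (c q) < \<eta>" if "0 \<le> q" "q \<le> L" for q
    proof -
      have in0: "ts ! a q \<in> {0..L}" using ain[OF that(1)] P(1) by (intro P(6)) (auto simp: n_def)
      then show "norm (c (ts ! a q)) = 1" by (rule c_norm)
      show "sphere_dist (c (ts ! a q)) (c q) < \<eta>"
        using sphere_dist_le[of "ts ! a q" q] in0 ain[OF that(1)] anear[OF that] that by auto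
    qed
    have "polygon_length (map c qs) = (\<Sum>j<N. sphere_dist (c (qs ! j)) (c (qs ! Suc j)))"
      unfolding polygon_length_def N_def length_map edge_len_def by (rule sum.cong) auto
    also have "\<dots> \<le> (\<Sum>j<N. 2 * \<eta> + (\<sigma> (a (qs ! Suc j)) - \<sigma> (a (qs ! j))))"
    proof (rule sum_mono)
      fix j assume "j \<in> {..<N}"
      then have j: "Suc j < length qs" by (auto simp: N_def)
      have q: "0 \<le> qs ! j" "qs ! j \<le> L" "0 \<le> qs ! Suc j" "qs ! Suc j \<le> L" "qs ! j \<le> qs ! Suc j"
        using Q(6)[of j] Q(6)[of "Suc j"] Q(5)[of j "Suc j"] j by auto
      note aq = aL[OF q(1,2)] aL[OF q(3,4)]
      have nq: "norm (c (qs ! j)) = 1" "norm (c (qs ! Suc j)) = 1" using q by (auto intro!: c_norm)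
      have "sphere_dist (c (qs ! j)) (c (qs ! Suc j)) \<le> sphere_dist (c (qs ! j)) (c (ts ! a (qs ! j))) +
         (sphere_dist (c (ts ! a (qs ! j))) (c (ts ! a (qs ! Suc j))) + sphere_dist (c (ts ! a (qs ! Suc j))) (c (qs ! Suc j)))"
        by (rule order_trans[OF sphere_dist_triangle[of _ "c (ts ! a (qs ! j))"]])
          (use aq nq in \<open>auto intro!: sphere_dist_triangle\<close>)
      moreover have "sphere_dist (c (qs ! j)) (c (ts ! a (qs ! j))) < \<eta>"
        using aq(2) sphere_dist_props(4)[OF nq(1) aq(1)] by simp
      moreover have "sphere_dist (c (ts ! a (qs ! j))) (c (ts ! a (qs ! Suc j))) \<le> \<sigma> (a (qs ! Suc j)) - \<sigma> (a (qs ! j))"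
        using \<sigma>d[of "a (qs ! j)" "a (qs ! Suc j) - a (qs ! j)"] amono[OF q(1) q(5)] ain[OF q(3)] by simp
      ultimately show "sphere_dist (c (qs ! j)) (c (qs ! Suc j)) \<le> 2 * \<eta> + (\<sigma> (a (qs ! Suc j)) - \<sigma> (a (qs ! j)))"
        using aq(4) by linarith
    qed
    also have "\<dots> = real N * (2 * \<eta>) + (\<sigma> (a (qs ! N)) - \<sigma> (a (qs ! 0)))"
      by (simp add: sum.distrib sum_lessThan_telescope[of "\<lambda>j. \<sigma> (a (qs ! j))"] del: sum_subtractf)
    also have "\<dots> \<le> \<epsilon> / 2 + \<sigma> n"
    proof -
      have s0: "0 \<le> \<sigma> k - \<sigma> i" if "i \<le> k" "k \<le> n" for i k
      proof -
        have e: "i + (k - i) = k" using that by simp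
        have "0 \<le> sphere_dist (c (ts ! i)) (c (ts ! k))"
          using that P(1) by (intro sphere_dist_props c_norm P(6)) (auto simp: n_def)
        also have "\<dots> \<le> \<sigma> k - \<sigma> i" using \<sigma>d[of i "k - i"] that unfolding e by simp
        finally show ?thesis .
      qed
      have qN: "0 \<le> qs ! N" "0 \<le> qs ! 0" using Q(2,3) L unfolding N_def by linarith+
      have "\<sigma> (a (qs ! N)) \<le> \<sigma> n" "0 \<le> \<sigma> (a (qs ! 0))"
        using s0[of "a (qs ! N)" n] s0[of 0 "a (qs ! 0)"] ain[OF qN(1)] ain[OF qN(2)] by (auto simp: \<sigma>_def)
      moreover have "real N * (2 * \<eta>) \<le> \<epsilon> / 2"
        using \<epsilon> by (simp add: \<eta>_def field_simps)
      ultimately show ?thesis by linarith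
    qed
    finally show "L - \<epsilon> < polygon_length (map c ts)" using ql len by linarith
  qed
qed

end

section \<open>Corners of spherical polygons\<close>

text \<open>
  The energy of the smoothing arc at a corner of length \<open>l\<close> and turning angle \<open>\<theta>\<close>.
\<close>
definition corner_energy :: "real \<Rightarrow> real \<Rightarrow> real \<Rightarrow> real" where
  "corner_energy p l \<theta> =
    (let \<Psi> = sqrt ((sin (l / 2))\<^sup>2 + (sin (\<theta> / 2))\<^sup>2 * (cos (l / 2))\<^sup>2)
     in 2 * arctan (\<Psi> / (cos (\<theta> / 2) * cos (l / 2))) * (1 / \<Psi>) *
        (sin (\<theta> / 2) powr p / (cos (\<theta> / 2) * sin (l / 2)) powr (p - 1)))"

text \<open>
  The number \<open>\<Psi>\<close> is the sine of the angle whose tangent appears in the corner energy; hence the ratio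
  of the arc tangent to \<open>\<Psi>\<close> has the form \<open>y / sin y\<close>.
\<close>
lemma sin_arctan_corner:
  fixes s k S C :: real
  assumes "s\<^sup>2 + k\<^sup>2 = 1" "S\<^sup>2 + C\<^sup>2 = 1" "0 < s" "0 < k" "0 < C"
  defines "\<Psi> \<equiv> sqrt (s\<^sup>2 + S\<^sup>2 * k\<^sup>2)"
  shows "sin (arctan (\<Psi> / (C * k))) = \<Psi>"
proof -
  have P2: "\<Psi>\<^sup>2 = s\<^sup>2 + S\<^sup>2 * k\<^sup>2" by (simp add: \<Psi>_def)
  have "(C * k)\<^sup>2 + \<Psi>\<^sup>2 = (C\<^sup>2 + S\<^sup>2) * k\<^sup>2 + s\<^sup>2" unfolding P2 by (simp add: power_mult_distrib algebra_simps)
  also have "\<dots> = 1" using assms(1,2) by (simp add: add.commute)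
  finally have e: "(C * k)\<^sup>2 + \<Psi>\<^sup>2 = 1" .
  have Ck: "C * k > 0" using assms by simp
  have "1 + (\<Psi> / (C * k))\<^sup>2 = ((C * k)\<^sup>2 + \<Psi>\<^sup>2) / (C * k)\<^sup>2"
    using assms(4,5) by (simp add: power_divide add_divide_distrib)
  also have "\<dots> = (1 / (C * k))\<^sup>2" unfolding e by (simp add: power_divide)
  finally have "sqrt (1 + (\<Psi> / (C * k))\<^sup>2) = 1 / (C * k)"
    using Ck by (simp add: real_sqrt_unique)
  then show ?thesis unfolding sin_arctan using assms(4,5) by simp
qed

lemma corner_trig:
  assumes "0 < l" "l < pi" "0 \<le> \<theta>" "\<theta> < pi"
  shows "0 < sin (l / 2)" "0 < cos (l / 2)" "0 < cos (\<theta> / 2)" "0 \<le> sin (\<theta> / 2)"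
proof -
  have "0 < l / 2" "l / 2 < pi" "l / 2 < pi / 2" "0 \<le> \<theta> / 2" "\<theta> / 2 < pi / 2" "\<theta> / 2 \<le> pi"
    using assms by auto
  then show "0 < sin (l / 2)" "0 < cos (l / 2)" "0 < cos (\<theta> / 2)" "0 \<le> sin (\<theta> / 2)"
    using sin_gt_zero[of "l / 2"] cos_gt_zero[of "l / 2"] cos_gt_zero_pi[of "\<theta> / 2"] sin_ge_zero[of "\<theta> / 2"] by auto
qed

lemma powr_corner_scaling:
  fixes S l p :: real
  assumes "0 \<le> S" "0 < l"
  shows "2 * (S powr p / (l / 2) powr (p - 1)) = (2 * S) powr p / l powr (p - 1)"
proof -
  have "(2 * S) powr p = 2 powr p * S powr p" using assms by (simp add: powr_mult)
  moreover have "(l / 2) powr (p - 1) = l powr (p - 1) / 2 powr (p - 1)" using assms by (simp add: powr_divide)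
  moreover have "(2::real) powr p = 2 * 2 powr (p - 1)" by (simp add: powr_diff)
  ultimately show ?thesis by simp
qed

text \<open>
  Use \<open>sin y \<le> y\<close>, \<open>cos (\<theta>/2) \<le> 1\<close> and \<open>sin (l/2) \<le> l/2\<close>.
\<close>
lemma corner_energy_lower:
  assumes l: "0 < l" "l < pi" and \<theta>: "0 \<le> \<theta>" "\<theta> < pi" and p: "1 < p"
  shows "(2 * sin (\<theta> / 2)) powr p / l powr (p - 1) \<le> corner_energy p l \<theta>"
proof -
  define s k S C where "s = sin (l / 2)" and "k = cos (l / 2)" and "S = sin (\<theta> / 2)" and "C = cos (\<theta> / 2)"
  define \<Psi> where "\<Psi> = sqrt (s\<^sup>2 + S\<^sup>2 * k\<^sup>2)"
  define y where "y = arctan (\<Psi> / (C * k))"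
  have pos: "s > 0" "k > 0" "C > 0" "S \<ge> 0" using corner_trig[OF l \<theta>] by (auto simp: s_def k_def S_def C_def)
  have \<Psi>: "\<Psi> > 0" using pos by (simp add: \<Psi>_def add_pos_nonneg)
  have sy: "sin y = \<Psi>" unfolding y_def \<Psi>_def
    by (rule sin_arctan_corner) (use pos in \<open>simp_all add: s_def k_def S_def C_def\<close>)
  have y: "y \<ge> 0" using \<Psi> pos by (simp add: y_def)
  have yP: "1 \<le> y / \<Psi>" using sin_x_le_x[OF y] sy \<Psi> by simp
  have Cs: "C * s \<le> l / 2"
  proof -
    have "C * s \<le> 1 * s" using pos by (intro mult_right_mono) (auto simp: C_def)
    also have "s \<le> l / 2" unfolding s_def using l by (intro sin_x_le_x) auto
    finally show ?thesis by simp
  qed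
  have "(2 * S) powr p / l powr (p - 1) = 2 * (S powr p / (l / 2) powr (p - 1))"
    using powr_corner_scaling[OF pos(4) l(1)] by simp
  also have "\<dots> \<le> 2 * (S powr p / (C * s) powr (p - 1))"
    using pos p Cs l by (intro mult_left_mono divide_left_mono powr_mono2) auto
  also have "\<dots> = 1 * (2 * (S powr p / (C * s) powr (p - 1)))" by simp
  also have "\<dots> \<le> (y / \<Psi>) * (2 * (S powr p / (C * s) powr (p - 1)))"
    by (intro mult_right_mono yP) auto
  also have "\<dots> = corner_energy p l \<theta>"
    unfolding corner_energy_def Let_def y_def \<Psi>_def s_def k_def S_def C_def by simp
  finally show ?thesis by (simp add: S_def)
qed

text \<open>
  The inequalities behind the lower bound become equalities in the limit of small corners.
\<close>
lemma corner_energy_upper: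
  assumes p: "1 < p" and \<epsilon>: "0 < \<epsilon>"
  shows "\<exists>\<eta>>0. \<eta> < 1 \<and> (\<forall>l \<theta>. 0 < l \<longrightarrow> l < \<eta> \<longrightarrow> 0 \<le> \<theta> \<longrightarrow> \<theta> < pi \<longrightarrow> 2 * sin (\<theta> / 2) < \<eta> \<longrightarrow>
    corner_energy p l \<theta> \<le> (1 + \<epsilon>) * ((2 * sin (\<theta> / 2)) powr p / l powr (p - 1)))"
proof -
  have "((\<lambda>x. (1 - x) powr (- (2 * p - 1))) \<longlongrightarrow> (1 - 0) powr (- (2 * p - 1))) (at_right 0)"
    by (intro tendsto_intros) auto
  then have "\<forall>\<^sub>F x in at_right 0. (1 - x) powr (- (2 * p - 1)) < 1 + \<epsilon>"
    using \<epsilon> by (intro order_tendstoD(2)) auto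
  moreover have "\<forall>\<^sub>F x::real in at_right 0. x \<in> {0<..<1 / 2}" by (rule eventually_at_right_real) simp
  ultimately have "\<forall>\<^sub>F x in at_right 0. (1 - x) powr (- (2 * p - 1)) < 1 + \<epsilon> \<and> x < 1 / 2 \<and> 0 < x"
    by eventually_elim auto
  then obtain \<kappa> :: real where \<kappa>: "(1 - \<kappa>) powr (- (2 * p - 1)) < 1 + \<epsilon>" "\<kappa> < 1 / 2" "0 < \<kappa>"
    using eventually_happens[of _ "at_right (0::real)"] by force
  show ?thesis
  proof (intro exI[of _ "\<kappa> / 2"] conjI allI impI)
    show "0 < \<kappa> / 2" "\<kappa> / 2 < 1" using \<kappa> by auto
    fix l \<theta> :: real assume l: "0 < l" "l < \<kappa> / 2" and \<theta>: "0 \<le> \<theta>" "\<theta> < pi" "2 * sin (\<theta> / 2) < \<kappa> / 2"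
    have lpi: "l < pi" using l \<kappa> pi_gt3 by linarith
    define s k S C where "s = sin (l / 2)" and "k = cos (l / 2)" and "S = sin (\<theta> / 2)" and "C = cos (\<theta> / 2)"
    define \<Psi> where "\<Psi> = sqrt (s\<^sup>2 + S\<^sup>2 * k\<^sup>2)"
    define y where "y = arctan (\<Psi> / (C * k))"
    have pos: "s > 0" "k > 0" "C > 0" "S \<ge> 0" using corner_trig[OF l(1) lpi \<theta>(1,2)] by (auto simp: s_def k_def S_def C_def)
    have \<Psi>: "\<Psi> > 0" using pos by (simp add: \<Psi>_def add_pos_nonneg)
    have sy: "sin y = \<Psi>" unfolding y_def \<Psi>_def
      by (rule sin_arctan_corner) (use pos in \<open>simp_all add: s_def k_def S_def C_def\<close>)
    have y: "y > 0" using \<Psi> pos by (simp add: y_def)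
    have S: "2 * S < \<kappa> / 2" using \<theta> by (simp add: S_def)
    have SC: "S\<^sup>2 + C\<^sup>2 = 1" by (simp add: S_def C_def)
    have C1: "1 - S \<le> C"
    proof -
      have "S * S \<le> S * 1" using pos S \<kappa> by (intro mult_left_mono) auto
      moreover have "C * C \<le> C * 1" using pos by (intro mult_left_mono) (auto simp: C_def)
      ultimately show ?thesis using SC by (simp add: power2_eq_square)
    qed
    then have C: "1 - \<kappa> \<le> C" "1 / 2 \<le> C" using S \<kappa> by auto
    have k: "1 / 2 \<le> k"
    proof -
      have "(l / 2)\<^sup>2 \<le> 1" using l \<kappa> by (intro power_le_one) auto
      then show ?thesis using one_minus_cos_le[of "l / 2"] by (simp add: k_def)
    qed
    have s: "(1 - \<kappa>) * (l / 2) \<le> s"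
    proof -
      have "(1 - \<kappa>) * (l / 2) \<le> (1 - l / 4) * (l / 2)" using l \<kappa> by (intro mult_right_mono) auto
      also have "\<dots> = l / 2 - (l / 2)\<^sup>2 / 2" by (simp add: power2_eq_square algebra_simps)
      also have "\<dots> \<le> s" unfolding s_def using l by (intro sin_ge_minus_square) auto
      finally show ?thesis .
    qed
    have "\<Psi> \<le> s + S"
    proof -
      have "k \<le> 1" by (simp add: k_def)
      then have "S * k \<le> S * 1" using pos by (intro mult_left_mono) auto
      then have Sk: "S * k \<le> S" by simp
      have "\<Psi> \<le> sqrt (s\<^sup>2) + sqrt ((S * k)\<^sup>2)" unfolding \<Psi>_def power_mult_distrib[symmetric] 
        by (rule sqrt_add_le_add_sqrt) auto
      also have "\<dots> = s + S * k" using pos by simp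
      finally show ?thesis using Sk by simp
    qed
    moreover have "s \<le> l / 2" unfolding s_def using l by (intro sin_x_le_x) auto
    ultimately have \<Psi>le: "\<Psi> \<le> \<kappa> / 2" using l S by linarith
    have yk: "y \<le> 2 * \<kappa>"
    proof -
      have "y \<le> \<Psi> / (C * k)" unfolding y_def using \<Psi> pos by (intro arctan_le_self) auto
      also have "\<dots> \<le> \<Psi> / (1 / 2 * (1 / 2))" using C k \<Psi> by (intro divide_left_mono mult_mono) auto
      also have "\<dots> \<le> 2 * \<kappa>" using \<Psi>le by simp
      finally show ?thesis .
    qed
    have "y * (1 - \<kappa>) \<le> y * (1 - y / 2)" using yk y by (intro mult_left_mono) auto
    also have "\<dots> = y - y\<^sup>2 / 2" by (simp add: power2_eq_square algebra_simps)
    also have "\<dots> \<le> \<Psi>" using sin_ge_minus_square[of y] y sy by simp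
    finally have yP: "y / \<Psi> \<le> 1 / (1 - \<kappa>)" using \<Psi> \<kappa> by (simp add: field_simps)
    have "(1 - \<kappa>) * ((1 - \<kappa>) * (l / 2)) \<le> C * s"
      using C s \<kappa> l pos by (intro mult_mono) auto
    then have Cs: "(1 - \<kappa>)\<^sup>2 * (l / 2) \<le> C * s" by (simp add: power2_eq_square mult.assoc)
    have q: "((1 - \<kappa>)\<^sup>2 * (l / 2)) powr (p - 1) = (1 - \<kappa>) powr (2 * (p - 1)) * (l / 2) powr (p - 1)"
    proof -
      have "(1 - \<kappa>)\<^sup>2 = (1 - \<kappa>) powr 2" using \<kappa> by simp
      then show ?thesis using \<kappa> l by (simp only: powr_mult powr_powr)
    qed
    have "corner_energy p l \<theta> = (y / \<Psi>) * (2 * (S powr p / (C * s) powr (p - 1)))"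
      unfolding corner_energy_def Let_def y_def \<Psi>_def s_def k_def S_def C_def by simp
    also have "\<dots> \<le> (1 / (1 - \<kappa>)) * (2 * (S powr p / ((1 - \<kappa>)\<^sup>2 * (l / 2)) powr (p - 1)))"
    proof (rule mult_mono[OF yP])
      define m where "m = (1 - \<kappa>)\<^sup>2 * (l / 2)"
      have m: "0 < m" "m \<le> C * s" using Cs l \<kappa> by (simp_all add: m_def)
      have "m powr (p - 1) \<le> (C * s) powr (p - 1)" by (rule powr_mono2) (use m p in auto)
      then have "S powr p / (C * s) powr (p - 1) \<le> S powr p / m powr (p - 1)"
        by (rule divide_left_mono) (use m pos in auto)
      then show "2 * (S powr p / (C * s) powr (p - 1)) \<le> 2 * (S powr p / m powr (p - 1))" by simp
    qed (use \<kappa> in auto)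
    also have "\<dots> = (1 - \<kappa>) powr (- (2 * p - 1)) * (2 * (S powr p / (l / 2) powr (p - 1)))"
    proof -
      have "(1 - \<kappa>) powr (- (2 * p - 1)) = 1 / ((1 - \<kappa>) * (1 - \<kappa>) powr (2 * (p - 1)))"
      proof -
        have "(1 - \<kappa>) * (1 - \<kappa>) powr (2 * (p - 1)) = (1 - \<kappa>) powr 1 * (1 - \<kappa>) powr (2 * (p - 1))" using \<kappa> by simp
        also have "\<dots> = (1 - \<kappa>) powr (1 + 2 * (p - 1))" by (rule powr_add[symmetric])
        also have "1 + 2 * (p - 1) = 2 * p - 1" by simp
        finally show ?thesis by (simp only: powr_minus_divide)
      qed
      then show ?thesis unfolding q by simp
    qed
    also have "\<dots> = (1 - \<kappa>) powr (- (2 * p - 1)) * ((2 * S) powr p / l powr (p - 1))"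
      unfolding powr_corner_scaling[OF pos(4) l(1)] ..
    also have "\<dots> \<le> (1 + \<epsilon>) * ((2 * S) powr p / l powr (p - 1))"
      using \<kappa> by (intro mult_right_mono) auto
    finally show "corner_energy p l \<theta> \<le> (1 + \<epsilon>) * ((2 * sin (\<theta> / 2)) powr p / l powr (p - 1))" by (simp add: S_def)
  qed
qed

locale spherical_polygon =
  fixes V :: "(real^3) list"
  assumes len: "2 \<le> length V" and unit: "\<And>j. j < length V \<Longrightarrow> norm (V ! j) = 1"
    and nondeg: "\<And>j. Suc j < length V \<Longrightarrow> V ! Suc j \<noteq> V ! j \<and> V ! Suc j \<noteq> - V ! j"
begin

definition "tangent_out i = geod_dir (V ! i) (V ! Suc i)"
definition "tangent_in i = edge_tangent V (i - 1) (edge_len V (i - 1))"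
definition "jump i = tangent_out i - tangent_in i"

lemma tangent_out_props:
  assumes "Suc i < length V"
  shows "norm (tangent_out i) = 1" "V ! i \<bullet> tangent_out i = 0"
    "V ! Suc i = cos (edge_len V i) *\<^sub>R V ! i + sin (edge_len V i) *\<^sub>R tangent_out i"
    "0 < edge_len V i" "edge_len V i < pi"
proof -
  have "norm (V ! i) = 1" "norm (V ! Suc i) = 1" "V ! Suc i \<noteq> V ! i" "V ! Suc i \<noteq> - V ! i"
    using assms unit nondeg by auto
  from geod_dir_props[OF this] show "norm (tangent_out i) = 1" "V ! i \<bullet> tangent_out i = 0"
    "V ! Suc i = cos (edge_len V i) *\<^sub>R V ! i + sin (edge_len V i) *\<^sub>R tangent_out i"
    "0 < edge_len V i" "edge_len V i < pi"
    by (simp_all add: tangent_out_def edge_len_def)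
qed

lemma tangent_in_Suc:
  "tangent_in (Suc i) = - sin (edge_len V i) *\<^sub>R V ! i + cos (edge_len V i) *\<^sub>R tangent_out i"
  by (simp add: tangent_in_def edge_eq tangent_out_def)

lemma tangent_in_props:
  assumes "Suc i < length V"
  shows "norm (tangent_in (Suc i)) = 1" "V ! Suc i \<bullet> tangent_in (Suc i) = 0"
    "V ! i = cos (edge_len V i) *\<^sub>R V ! Suc i - sin (edge_len V i) *\<^sub>R tangent_in (Suc i)"
proof -
  define d t v where "d = edge_len V i" and "t = tangent_out i" and "v = V ! i"
  note T = tangent_out_props[OF assms, folded d_def t_def v_def]
  have kk: "v \<bullet> v = 1" "t \<bullet> t = 1" "v \<bullet> t = 0" "t \<bullet> v = 0"
    using T unit[of i] assms by (simp_all add: dot_square_norm inner_commute v_def)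
  have u: "tangent_in (Suc i) = - sin d *\<^sub>R v + cos d *\<^sub>R t" by (simp add: tangent_in_Suc d_def t_def v_def)
  have sc: "sin d * sin d + cos d * cos d = 1" using sin_cos_squared_add3[of d] by linarith
  have "tangent_in (Suc i) \<bullet> tangent_in (Suc i) = 1"
    using sc by (simp add: u inner_add_left inner_add_right inner_diff_left inner_diff_right kk algebra_simps)
  then show "norm (tangent_in (Suc i)) = 1" by (simp add: norm_eq_1)
  show "V ! Suc i \<bullet> tangent_in (Suc i) = 0"
    by (simp add: u T(3) inner_add_left inner_add_right inner_diff_left inner_diff_right kk algebra_simps)
  have "cos d *\<^sub>R V ! Suc i - sin d *\<^sub>R tangent_in (Suc i) = (sin d * sin d) *\<^sub>R v + (cos d * cos d) *\<^sub>R v"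
    by (simp add: u T(3) scaleR_add_right scaleR_diff_right algebra_simps)
  also have "\<dots> = (sin d * sin d + cos d * cos d) *\<^sub>R v" by (rule scaleR_left_distrib[symmetric])
  finally have "cos d *\<^sub>R V ! Suc i - sin d *\<^sub>R tangent_in (Suc i) = (sin d * sin d + cos d * cos d) *\<^sub>R v" .
  then show "V ! i = cos (edge_len V i) *\<^sub>R V ! Suc i - sin (edge_len V i) *\<^sub>R tangent_in (Suc i)"
    using sc by (simp add: d_def v_def)
qed

text \<open>
  Along an edge the unit tangent changes by the integral of minus the position, as for a solution of
  \<open>g'' = - g\<close>.
\<close>
lemma tangent_turn_along_edge:
  "tangent_in (Suc i) - tangent_out i = (cos (edge_len V i) - 1) *\<^sub>R tangent_out i - sin (edge_len V i) *\<^sub>R V ! i"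
  by (simp add: tangent_in_Suc algebra_simps)

lemma chord_vector_near_tangent:
  assumes "Suc i < length V"
  shows "norm (V ! Suc i - V ! i - edge_len V i *\<^sub>R tangent_out i) \<le> (edge_len V i)\<^sup>2"
proof -
  define d t v where "d = edge_len V i" and "t = tangent_out i" and "v = V ! i"
  note T = tangent_out_props[OF assms, folded d_def t_def v_def]
  have e: "V ! Suc i - v - d *\<^sub>R t = (cos d - 1) *\<^sub>R v + (sin d - d) *\<^sub>R t" by (simp add: T(3) algebra_simps)
  have "norm ((cos d - 1) *\<^sub>R v + (sin d - d) *\<^sub>R t) \<le> \<bar>cos d - 1\<bar> + \<bar>sin d - d\<bar>"
    using norm_triangle_ineq[of "(cos d - 1) *\<^sub>R v" "(sin d - d) *\<^sub>R t"] T(1) unit[of i] assms by (simp add: v_def)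
  also have "\<bar>cos d - 1\<bar> \<le> d\<^sup>2 / 2" using one_minus_cos_le[of d] cos_le_one[of d] by simp
  also have "\<bar>sin d - d\<bar> \<le> d\<^sup>2 / 2" using sin_ge_minus_square[of d] sin_x_le_x[of d] T(4) by simp
  finally have "norm (V ! Suc i - v - d *\<^sub>R t) \<le> d\<^sup>2" unfolding e by simp
  then show ?thesis by (simp only: d_def t_def v_def)
qed

lemma vertex_cases: "1 \<le> i \<Longrightarrow> i < length V - 1 \<Longrightarrow> \<exists>k. i = Suc k \<and> Suc k < length V \<and> Suc (Suc k) < length V"
  by (cases i) auto

lemma turning_angle_props:
  assumes i: "1 \<le> i" "i < length V - 1"
  shows "0 \<le> turning_angle V i" "turning_angle V i \<le> pi" "norm (jump i) = 2 * sin (turning_angle V i / 2)"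
proof -
  obtain k where k: "i = Suc k" "Suc k < length V" "Suc (Suc k) < length V" using vertex_cases[OF i] by blast
  have e: "edge_tangent V i 0 = tangent_out i" by (simp add: edge_eq tangent_out_def)
  have n: "norm (tangent_in i) = 1" "norm (tangent_out i) = 1"
    using tangent_in_props(1)[OF k(2)] tangent_out_props(1)[of i] k by auto
  have \<theta>: "turning_angle V i = sphere_dist (tangent_in i) (tangent_out i)"
    unfolding turning_angle_def e sphere_dist_def tangent_in_def ..
  show "0 \<le> turning_angle V i" "turning_angle V i \<le> pi" unfolding \<theta> using sphere_dist_props[OF n] by auto
  show "norm (jump i) = 2 * sin (turning_angle V i / 2)"
    unfolding \<theta> chord_eq[OF n, symmetric] jump_def by (rule norm_minus_commute)
qed

lemma corner_len_props:
  assumes i: "1 \<le> i" "i < length V - 1"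
  shows "0 < corner_len V i" "corner_len V i < pi" "corner_len V i \<le> edge_len V (i - 1)" "corner_len V i \<le> edge_len V i"
  using vertex_cases[OF i] tangent_out_props(4,5)[of "i - 1"] tangent_out_props(4,5)[of i] by (auto simp: corner_len_def)

lemma p_rotation_corner_energy:
  "p_rotation p V = (\<Sum>i = 1..<length V - 1. if turning_angle V i = pi then \<infinity>
    else ennreal (corner_energy p (corner_len V i) (turning_angle V i)))"
  using p_rotation_eq[OF len unit nondeg, of p] by (simp only: corner_energy_def Let_def)

lemma p_rotation_lower:
  assumes p: "1 < p"
  shows "ennreal (\<Sum>i = 1..<length V - 1. norm (jump i) powr p / corner_len V i powr (p - 1)) \<le> p_rotation p V"
proof -
  have "ennreal (\<Sum>i = 1..<length V - 1. norm (jump i) powr p / corner_len V i powr (p - 1)) =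
    (\<Sum>i = 1..<length V - 1. ennreal (norm (jump i) powr p / corner_len V i powr (p - 1)))"
    by (rule sum_ennreal[symmetric]) simp
  also have "\<dots> \<le> p_rotation p V" unfolding p_rotation_corner_energy
  proof (rule sum_mono)
    fix i assume "i \<in> {1..<length V - 1}"
    then have i: "1 \<le> i" "i < length V - 1" by auto
    show "ennreal (norm (jump i) powr p / corner_len V i powr (p - 1)) \<le>
      (if turning_angle V i = pi then \<infinity> else ennreal (corner_energy p (corner_len V i) (turning_angle V i)))"
      using corner_energy_lower[OF corner_len_props(1,2)[OF i] turning_angle_props(1)[OF i] _ p] turning_angle_props[OF i]
      by (auto intro!: ennreal_leI simp: less_le)
  qed
  finally show ?thesis .
qed

text \<open>
  The second difference at a vertex has tangential part \<open>sin \<alpha> a - sin \<beta> b\<close>, where \<open>a\<close>, \<open>b\<close> are the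
  outgoing and incoming unit tangents and \<open>\<alpha>\<close>, \<open>\<beta>\<close> the edge lengths.  Its squared norm is
  \<open>(sin \<alpha> - sin \<beta>)\<^sup>2 + sin \<alpha> sin \<beta> |a - b|\<^sup>2\<close>, so that unequal edges only increase it.
\<close>
lemma jump_le_second_difference:
  assumes i: "1 \<le> i" "i < length V - 1"
  shows "sin (edge_len V (i - 1)) * sin (edge_len V i) * (norm (jump i))\<^sup>2 \<le>
    (norm (tangent_proj (V ! i) (V ! (i + 1) - 2 *\<^sub>R V ! i + V ! (i - 1))))\<^sup>2"
proof -
  obtain k where k: "i = Suc k" "Suc k < length V" "Suc (Suc k) < length V" using vertex_cases[OF i] by blast
  define v a b \<alpha> \<beta> where "v = V ! i" and "a = tangent_out i" and "b = tangent_in i"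
    and "\<alpha> = edge_len V i" and "\<beta> = edge_len V (i - 1)"
  have v: "v \<bullet> v = 1" using unit[of i] k by (simp add: v_def dot_square_norm)
  have A: "norm a = 1" "v \<bullet> a = 0" "V ! (i + 1) = cos \<alpha> *\<^sub>R v + sin \<alpha> *\<^sub>R a" "0 < \<alpha>" "\<alpha> < pi"
    using tangent_out_props[of i] k by (auto simp: v_def a_def \<alpha>_def)
  have B: "norm b = 1" "v \<bullet> b = 0" "V ! (i - 1) = cos \<beta> *\<^sub>R v - sin \<beta> *\<^sub>R b"
    using tangent_in_props[OF k(2)] k(1) by (auto simp: v_def b_def \<beta>_def)
  have \<beta>: "0 < \<beta>" "\<beta> < pi" using tangent_out_props[OF k(2)] k(1) by (auto simp: \<beta>_def)
  have "tangent_proj v (V ! (i + 1) - 2 *\<^sub>R v + V ! (i - 1)) = sin \<alpha> *\<^sub>R a - sin \<beta> *\<^sub>R b"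
    using A(2) B(2) v unfolding tangent_proj_def A(3) B(3)
    by (simp add: inner_add_left inner_diff_left inner_commute algebra_simps)
  moreover have "(norm (sin \<alpha> *\<^sub>R a - sin \<beta> *\<^sub>R b))\<^sup>2 = (sin \<alpha> - sin \<beta>)\<^sup>2 + sin \<alpha> * sin \<beta> * (norm (a - b))\<^sup>2"
  proof -
    have n: "a \<bullet> a = 1" "b \<bullet> b = 1" using A B by (simp_all add: dot_square_norm)
    show ?thesis unfolding dot_square_norm[symmetric]
      by (simp add: inner_diff_left inner_diff_right n inner_commute power2_eq_square algebra_simps)
  qed
  ultimately show ?thesis unfolding jump_def v_def a_def b_def \<alpha>_def \<beta>_def by (simp add: mult.commute)
qed

end

section \<open>Polygons of bounded rotation and the lower bound\<close>

lemma step_function: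
  fixes t :: "nat \<Rightarrow> real" and a :: "nat \<Rightarrow> 'b::euclidean_space" and p :: real
  assumes t: "\<And>j. j < n \<Longrightarrow> t j < t (Suc j)" "\<And>j. j \<le> n \<Longrightarrow> 0 \<le> t j \<and> t j \<le> L"
  defines "f \<equiv> \<lambda>s. \<Sum>j<n. indicat_real {t j..<t (Suc j)} s *\<^sub>R a j"
  shows "integrable (lebesgue_on {0..L}) f"
    and "\<And>j s. j < n \<Longrightarrow> s \<in> {t j..t (Suc j)} \<Longrightarrow> integral {t j..s} f = (s - t j) *\<^sub>R a j"
    and "integrable (lebesgue_on {0..L}) (\<lambda>s. norm (f s) powr p)"
    and "(LINT s|lebesgue_on {0..L}. norm (f s) powr p) = (\<Sum>j<n. (t (Suc j) - t j) * norm (a j) powr p)"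
proof -
  let ?M = "lebesgue_on {0..L}"
  have mono: "t i \<le> t j" if "i \<le> j" "j \<le> n" for i j
    using that
  proof (induction j)
    case (Suc j)
    then show ?case using t(1)[of j] by (cases "i = Suc j") (auto intro: order_trans less_imp_le)
  qed simp
  have ind: "integrable ?M (\<lambda>s. indicat_real {t j..<t (Suc j)} s *\<^sub>R x)" and
    val: "(LINT s|?M. indicat_real {t j..<t (Suc j)} s *\<^sub>R x) = (t (Suc j) - t j) *\<^sub>R x"
    if j: "j < n" for j and x :: "'c::euclidean_space"
  proof -
    have J: "{t j..<t (Suc j)} \<subseteq> {0..L}" using t(2)[of j] t(2)[of "Suc j"] j by auto
    have s: "{t j..<t (Suc j)} \<in> sets ?M" using J by (auto simp: sets_restrict_space intro!: image_eqI[of _ _ "{t j..<t (Suc j)}"])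
    have e: "emeasure ?M {t j..<t (Suc j)} = ennreal (t (Suc j) - t j)"
      using J t(1)[OF j] by (simp add: emeasure_restrict_space)
    have i: "integrable ?M (indicat_real {t j..<t (Suc j)})"
      using s e by (intro integrable_real_indicator) auto
    then show "integrable ?M (\<lambda>s. indicat_real {t j..<t (Suc j)} s *\<^sub>R x)" by simp
    have "(LINT s|?M. indicat_real {t j..<t (Suc j)} s) = t (Suc j) - t j"
      using J e t(1)[OF j] by (simp add: measure_def space_restrict_space Int_absorb1 Int_absorb2)
    then show "(LINT s|?M. indicat_real {t j..<t (Suc j)} s *\<^sub>R x) = (t (Suc j) - t j) *\<^sub>R x"
      using i by simp
  qed
  have fv: "(\<Sum>i<n. indicat_real {t i..<t (Suc i)} s *\<^sub>R g i) = g j" if j: "j < n" and s: "s \<in> {t j..<t (Suc j)}"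
    for j s and g :: "nat \<Rightarrow> 'c::real_vector"
  proof -
    have "(\<Sum>i<n. indicat_real {t i..<t (Suc i)} s *\<^sub>R g i) = (\<Sum>i\<in>{j}. indicat_real {t i..<t (Suc i)} s *\<^sub>R g i)"
    proof (rule sum.mono_neutral_right)
      show "\<forall>i\<in>{..<n} - {j}. indicat_real {t i..<t (Suc i)} s *\<^sub>R g i = 0"
      proof
        fix i assume i: "i \<in> {..<n} - {j}"
        have "s \<notin> {t i..<t (Suc i)}"
        proof (cases "i < j")
          case True
          then have "t (Suc i) \<le> t j" using j by (intro mono) auto
          then show ?thesis using s by auto
        next
          case False
          then have "t (Suc j) \<le> t i" using i by (intro mono) auto
          then show ?thesis using s by auto
        qed
        then show "indicat_real {t i..<t (Suc i)} s *\<^sub>R g i = 0" by simp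
      qed
    qed (use j in auto)
    also have "\<dots> = indicat_real {t j..<t (Suc j)} s *\<^sub>R g j"
      by (simp only: sum.insert finite.emptyI empty_iff not_False_eq_True sum.empty add_0_right)
    finally show ?thesis using s by simp
  qed
  show fi: "integrable ?M f" unfolding f_def by (intro Bochner_Integration.integrable_sum ind) auto
  show "integral {t j..s} f = (s - t j) *\<^sub>R a j" if j: "j < n" and s: "s \<in> {t j..t (Suc j)}" for j s
  proof -
    have "integral {t j..s} f = integral {t j..s} (\<lambda>_. a j)"
    proof (rule integral_spike[of "{s}"])
      fix x assume "x \<in> {t j..s} - {s}"
      then have "x \<in> {t j..<t (Suc j)}" using s by auto
      then show "a j = f x" unfolding f_def by (rule fv[OF j, symmetric])
    qed simp
    then show ?thesis using s by simp
  qed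
  have pw: "norm (f s) powr p = (\<Sum>j<n. indicat_real {t j..<t (Suc j)} s *\<^sub>R (norm (a j) powr p))" for s
  proof (cases "\<exists>j<n. s \<in> {t j..<t (Suc j)}")
    case True
    then obtain j where j: "j < n" "s \<in> {t j..<t (Suc j)}" by blast
    show ?thesis unfolding f_def fv[OF j] ..
  next
    case False
    then have "indicat_real {t j..<t (Suc j)} s = 0" if "j < n" for j using that by (auto simp: indicator_def)
    then show ?thesis unfolding f_def by simp
  qed
  show "integrable ?M (\<lambda>s. norm (f s) powr p)" unfolding pw by (intro Bochner_Integration.integrable_sum ind) auto
  have "(LINT s|?M. norm (f s) powr p) = (\<Sum>j<n. LINT s|?M. indicat_real {t j..<t (Suc j)} s *\<^sub>R (norm (a j) powr p))"
    unfolding pw by (intro Bochner_Integration.integral_sum ind) auto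
  also have "\<dots> = (\<Sum>j<n. (t (Suc j) - t j) *\<^sub>R (norm (a j) powr p))"
    by (rule sum.cong[OF refl val]) auto
  finally show "(LINT s|?M. norm (f s) powr p) = (\<Sum>j<n. (t (Suc j) - t j) * norm (a j) powr p)" by simp
qed

context unit_speed_curve
begin

lemma polygon_inscribed:
  assumes ts: "inscribed c 0 L ts" shows "spherical_polygon (map c ts)"
proof
  note B = inscribed_bounds[OF ts]
  show "2 \<le> length (map c ts)" using B(1) by simp
  show "norm (map c ts ! j) = 1" if "j < length (map c ts)" for j using that c_norm[OF B(6)[of j]] by simp
  show "map c ts ! Suc j \<noteq> map c ts ! j \<and> map c ts ! Suc j \<noteq> - map c ts ! j" if "Suc j < length (map c ts)" for j
    using ts that by (auto simp: inscribed_def)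
qed

lemma c_integrable_on: "integrable (lebesgue_on {0..L}) c"
  using c_cont by (rule continuous_imp_integrable_lebesgue_on)

lemma c_integral_near:
  assumes "0 \<le> a" "a \<le> b" "b \<le> L"
  shows "norm ((b - a) *\<^sub>R c a - integral {a..b} c) \<le> (b - a) * (b - a)" "norm (integral {a..b} c) \<le> b - a"
proof -
  have ci: "c integrable_on {a..b}" by (rule integrable_subinterval_lebesgue_on(2)[OF c_integrable_on]) (use assms in auto)
  have "(b - a) *\<^sub>R c a - integral {a..b} c = integral {a..b} (\<lambda>_. c a) - integral {a..b} c" using assms by simp
  also have "\<dots> = integral {a..b} (\<lambda>s. c a - c s)"
    by (rule Henstock_Kurzweil_Integration.integral_diff[OF _ ci, symmetric]) auto
  finally have e: "(b - a) *\<^sub>R c a - integral {a..b} c = integral {a..b} (\<lambda>s. c a - c s)" .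
  have "norm (integral {a..b} (\<lambda>s. c a - c s)) \<le> integral {a..b} (\<lambda>_. b - a)"
  proof (rule Henstock_Kurzweil_Integration.integral_norm_bound_integral)
    show "(\<lambda>s. c a - c s) integrable_on {a..b}" by (rule Henstock_Kurzweil_Integration.integrable_diff[OF _ ci]) auto
    fix s assume "s \<in> {a..b}"
    then show "norm (c a - c s) \<le> b - a" using c_lipschitz[of s a] assms by auto
  qed auto
  then show "norm ((b - a) *\<^sub>R c a - integral {a..b} c) \<le> (b - a) * (b - a)" unfolding e using assms by simp
  have "norm (integral {a..b} c) \<le> integral {a..b} (\<lambda>_. 1)"
    by (rule Henstock_Kurzweil_Integration.integral_norm_bound_integral[OF ci]) (use c_norm assms in auto)
  then show "norm (integral {a..b} c) \<le> b - a" using assms by simp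
qed

text \<open>
  The estimate has three stages: the derivative \<open>z\<close> of the approximant follows the edge tangents,
  first at the vertices (\<open>zT\<close>) and then along the edges (\<open>zs\<close>); therefore the approximant \<open>Z\<close> itself
  follows the vertices (\<open>cZ\<close>).  The defect \<open>L\<close> minus the length of the polygonal enters through the
  differences between parameter intervals and edge lengths, and \<open>\<rho>\<close> bounds the jumps.
\<close>
lemma polygon_approximant:
  assumes ts: "inscribed c 0 L ts" and p: "1 < p" and K: "0 \<le> K"
    and en: "p_rotation p (map c ts) \<le> ennreal K"
    and \<eta>: "0 < \<eta>" and mesh: "\<And>i. Suc i < length ts \<Longrightarrow> ts ! Suc i - ts ! i < \<eta>"
    and long: "L - \<eta> < polygon_length (map c ts)"
  defines "\<rho> \<equiv> (K * \<eta> powr (p - 1)) powr (1 / p)"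
  defines "e2 \<equiv> \<eta> + 2 * L * \<eta> + \<rho> + \<eta>"
  shows "\<exists>f B. integrable (lebesgue_on {0..L}) f \<and> integrable (lebesgue_on {0..L}) (\<lambda>s. norm (f s) powr p) \<and>
    (LINT s|lebesgue_on {0..L}. norm (f s) powr p) \<le> K \<and>
    (\<forall>t\<in>{0..L}. norm (c t - (c 0 + t *\<^sub>R B + double_primitive L (\<lambda>s. f s - c s) t)) \<le> L * e2 + \<eta> + L * \<eta> + \<eta> + \<eta> * (1 + e2))"
proof -
  let ?M = "lebesgue_on {0..L}"
  interpret spherical_polygon "map c ts" by (rule polygon_inscribed[OF ts])
  define n where "n = length ts - 1"
  define t where "t i = ts ! i" for i
  define T where "T i = tangent_out i" for i
  define J where "J i = jump i" for i
  define d where "d i = edge_len (map c ts) i" for i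
  define \<delta> where "\<delta> i = t (Suc i) - t i" for i
  note Bd = inscribed_bounds[OF ts]
  have n1: "1 \<le> n" and ln: "length ts = Suc n" using Bd(1) by (auto simp: n_def)
  have t0: "t 0 = 0" and tn: "t n = L" using Bd(2,3) by (auto simp: t_def n_def)
  have tin: "t i \<in> {0..L}" if "i \<le> n" for i using Bd(6)[of i] that ln by (simp add: t_def)
  have tlt: "t i < t (Suc i)" if "i < n" for i using Bd(4)[of i "Suc i"] that ln by (simp add: t_def)
  have \<delta>: "0 < \<delta> i" "\<delta> i < \<eta>" if "i < n" for i
    using tlt[OF that] mesh[of i] that ln by (auto simp: \<delta>_def t_def)
  have Vi: "map c ts ! i = c (t i)" if "i \<le> n" for i using that ln by (simp add: t_def)
  have d: "0 < d i" "d i \<le> \<delta> i" "d i < pi" if "i < n" for i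
  proof -
    show "0 < d i" "d i < pi" using tangent_out_props(4,5)[of i] that ln by (auto simp: d_def)
    show "d i \<le> \<delta> i" using sphere_dist_le[of "t i" "t (Suc i)"] tin[of i] tin[of "Suc i"] tlt[OF that] that ln
      by (auto simp: d_def \<delta>_def edge_len_def t_def)
  qed
  have Tn: "norm (T i) = 1" if "i < n" for i using tangent_out_props(1)[of i] that ln by (auto simp: T_def)
  have sumd: "(\<Sum>j<i. \<delta> j - d j) < \<eta>" if "i \<le> n" for i
  proof -
    have "(\<Sum>j<i. \<delta> j - d j) \<le> (\<Sum>j<n. \<delta> j - d j)"
      using that d by (intro sum_mono2) auto
    also have "\<dots> = (\<Sum>j<n. \<delta> j) - (\<Sum>j<n. d j)" by (rule sum_subtractf)
    also have "(\<Sum>j<n. \<delta> j) = L" unfolding \<delta>_def using sum_lessThan_telescope[of t n] t0 tn by simp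
    also have "(\<Sum>j<n. d j) = polygon_length (map c ts)" by (simp add: polygon_length_def d_def n_def)
    finally show ?thesis using long by simp
  qed
  have sum\<delta>: "(\<Sum>j<i. \<delta> j) \<le> L" if "i \<le> n" for i
    unfolding \<delta>_def using sum_lessThan_telescope[of t i] t0 tin[OF that] by simp
  define S where "S = (\<Sum>i = 1..<n. norm (J i) powr p / corner_len (map c ts) i powr (p - 1))"
  have SK: "S \<le> K"
  proof -
    have "ennreal S \<le> ennreal K" using p_rotation_lower[OF p] en unfolding S_def J_def n_def by simp
    then show ?thesis using K by (simp add: ennreal_le_iff)
  qed
  have cl: "0 < corner_len (map c ts) i" "corner_len (map c ts) i \<le> d (i - 1)" if "1 \<le> i" "i < n" for i
    using corner_len_props[of i] that by (auto simp: d_def n_def)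
  have J\<rho>: "norm (J i) \<le> \<rho>" if i: "1 \<le> i" "i < n" for i
  proof -
    define l where "l = corner_len (map c ts) i"
    have i1: "i - 1 < n" using i by linarith
    have l: "0 < l" "l < \<eta>" using cl[OF i] d(2)[OF i1] \<delta>(2)[OF i1] unfolding l_def by linarith+
    have "norm (J i) powr p / l powr (p - 1) \<le> S" unfolding S_def l_def
      by (rule member_le_sum[of i "{1..<n}" "\<lambda>i. norm (J i) powr p / corner_len (map c ts) i powr (p - 1)"]) (use i in auto)
    then have "norm (J i) powr p \<le> K * l powr (p - 1)" using SK l by (simp add: divide_le_eq mult_right_mono order_trans)
    also have "\<dots> \<le> K * \<eta> powr (p - 1)" using l K p by (intro mult_left_mono powr_mono2) auto
    finally have "(norm (J i) powr p) powr (1 / p) \<le> \<rho>" unfolding \<rho>_def using p by (intro powr_mono2) auto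
    then show ?thesis using p by (simp add: powr_powr)
  qed
  \<comment> \<open>The jump at vertex \<open>j + 1\<close> is spread over the edge \<open>j\<close> before it; no jump follows the last edge.\<close>
  define a where "a j = (if Suc j < n then (1 / \<delta> j) *\<^sub>R J (Suc j) else 0)" for j
  define f where "f s = (\<Sum>j<n. indicat_real {t j..<t (Suc j)} s *\<^sub>R a j)" for s
  have t01: "0 \<le> t j \<and> t j \<le> L" if "j \<le> n" for j using tin[OF that] by simp
  have fi: "integrable ?M f" unfolding f_def by (rule step_function(1)[where t=t and n=n and L=L and a=a, OF tlt t01])
  have fint: "integral {t j..s} f = (s - t j) *\<^sub>R a j" if "j < n" "s \<in> {t j..t (Suc j)}" for j s
    unfolding f_def by (rule step_function(2)[where t=t and n=n and L=L and a=a, OF tlt t01]) (use that in auto)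
  have fp: "integrable ?M (\<lambda>s. norm (f s) powr p)" unfolding f_def by (rule step_function(3)[where t=t and n=n and L=L and a=a, OF tlt t01])
  have "(LINT s|?M. norm (f s) powr p) = (\<Sum>j<n. \<delta> j * norm (a j) powr p)"
    unfolding f_def \<delta>_def by (rule step_function(4)[where t=t and n=n and L=L and a=a, OF tlt t01])
  also have "\<dots> = (\<Sum>j<n - 1. \<delta> j * norm (a j) powr p)"
    by (rule sum.mono_neutral_right) (auto simp: a_def)
  also have "\<dots> \<le> (\<Sum>j<n - 1. norm (J (Suc j)) powr p / corner_len (map c ts) (Suc j) powr (p - 1))"
  proof (rule sum_mono)
    fix j assume "j \<in> {..<n - 1}"
    then have j: "Suc j < n" by auto
    have \<delta>j: "0 < \<delta> j" using \<delta>(1)[of j] j by simp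
    have "\<delta> j * norm (a j) powr p = \<delta> j * (norm (J (Suc j)) powr p / \<delta> j powr p)"
      using j \<delta>j by (simp add: a_def powr_divide)
    also have "\<dots> = norm (J (Suc j)) powr p / \<delta> j powr (p - 1)" using \<delta>j by (simp add: powr_diff)
    also have "\<dots> \<le> norm (J (Suc j)) powr p / corner_len (map c ts) (Suc j) powr (p - 1)"
    proof (rule divide_left_mono)
      show "corner_len (map c ts) (Suc j) powr (p - 1) \<le> \<delta> j powr (p - 1)"
        using cl[of "Suc j"] d(2)[of j] j p by (intro powr_mono2) auto
    qed (use cl[of "Suc j"] \<delta>j j in auto)
    finally show "\<delta> j * norm (a j) powr p \<le> norm (J (Suc j)) powr p / corner_len (map c ts) (Suc j) powr (p - 1)" .
  qed
  also have "\<dots> = S" unfolding S_def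
    by (rule sum.reindex_bij_witness[of _ "\<lambda>i. i - 1" Suc]) auto
  finally have fK: "(LINT s|?M. norm (f s) powr p) \<le> K" using SK by simp
  define B where "B = T 0"
  define Z where "Z s = c 0 + s *\<^sub>R B + double_primitive L (\<lambda>s. f s - c s) s" for s
  define z where "z s = B + integral {0..s} (\<lambda>s. f s - c s)" for s
  have gi: "integrable ?M (\<lambda>s. f s - c s)" using fi c_integrable_on by (rule Bochner_Integration.integrable_diff)
  interpret Z: curve_with_acceleration Z z "\<lambda>s. f s - c s" "c 0" B L
    by unfold_locales (use L gi in \<open>auto simp: Z_def z_def\<close>)
  have zd: "z s - z r = integral {r..s} f - integral {r..s} c" if "0 \<le> r" "r \<le> s" "s \<le> L" for r s
    unfolding Z.u_diff[OF that]
    by (rule Henstock_Kurzweil_Integration.integral_diff; rule integrable_subinterval_lebesgue_on(2)[of L])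
      (use fi c_integrable_on that in auto)
  have zT: "norm (z (t i) - T i) \<le> (\<Sum>j<i. (\<delta> j - d j) + 2 * (\<delta> j * \<eta>))" if "i < n" for i
    using that
  proof (induction i)
    case 0
    then show ?case using Z.u_def[of 0] by (simp add: t0 z_def B_def)
  next
    case (Suc i)
    then have i: "i < n" "Suc i < length (map c ts)" using ln by auto
    have tt: "0 \<le> t i" "t i \<le> t (Suc i)" "t (Suc i) \<le> L" using t01[of i] t01[of "Suc i"] tlt[OF i(1)] i by auto
    have f1: "integral {t i..t (Suc i)} f = J (Suc i)"
      using fint[OF i(1), of "t (Suc i)"] tt(2) Suc.prems \<delta>(1)[OF i(1)] by (simp add: a_def \<delta>_def)
    have Td: "T (Suc i) - T i = J (Suc i) + ((cos (d i) - 1) *\<^sub>R T i - sin (d i) *\<^sub>R c (t i))"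
      using tangent_turn_along_edge[of i] Vi[of i] i unfolding J_def jump_def T_def d_def by (simp add: algebra_simps)
    define I where "I = integral {t i..t (Suc i)} c"
    define X where "X = ((\<delta> i *\<^sub>R c (t i) - I) - (\<delta> i - sin (d i)) *\<^sub>R c (t i)) + (1 - cos (d i)) *\<^sub>R T i"
    have eq: "z (t (Suc i)) - T (Suc i) = (z (t i) - T i) + X"
    proof -
      have a: "z (t (Suc i)) = z (t i) + (J (Suc i) - I)" using zd[OF tt] unfolding f1 I_def[symmetric] by (simp add: algebra_simps)
      have b: "T (Suc i) = T i + (J (Suc i) + ((cos (d i) - 1) *\<^sub>R T i - sin (d i) *\<^sub>R c (t i)))" unfolding Td[symmetric] by simp
      show ?thesis unfolding a b X_def by (simp add: algebra_simps)
    qed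
    have "norm X \<le> \<delta> i * \<delta> i + (\<delta> i - sin (d i)) + (1 - cos (d i))"
      unfolding X_def
    proof (intro norm_triangle_mono norm_diff_mono)
      show "norm (\<delta> i *\<^sub>R c (t i) - I) \<le> \<delta> i * \<delta> i" using c_integral_near(1)[OF tt] by (simp add: I_def \<delta>_def)
      have "sin (d i) \<le> \<delta> i" using sin_x_le_x[of "d i"] d[OF i(1)] by linarith
      then show "norm ((\<delta> i - sin (d i)) *\<^sub>R c (t i)) \<le> \<delta> i - sin (d i)" using c_norm[OF tin[of i]] i by simp
      show "norm ((1 - cos (d i)) *\<^sub>R T i) \<le> 1 - cos (d i)" using Tn[OF i(1)] by simp
    qed
    also have "\<dots> \<le> (\<delta> i - d i) + 2 * (\<delta> i * \<eta>)"
    proof -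
      have "(d i)\<^sup>2 \<le> \<delta> i * \<delta> i" unfolding power2_eq_square using d[OF i(1)] by (intro mult_mono) auto
      moreover have "\<delta> i * \<delta> i \<le> \<delta> i * \<eta>" using \<delta>[OF i(1)] by (intro mult_left_mono) auto
      moreover have "d i - (d i)\<^sup>2 / 2 \<le> sin (d i)" using sin_ge_minus_square[of "d i"] d[OF i(1)] by simp
      moreover have "1 - cos (d i) \<le> (d i)\<^sup>2 / 2" by (rule one_minus_cos_le)
      ultimately show ?thesis by linarith
    qed
    finally have "norm (z (t (Suc i)) - T (Suc i)) \<le> norm (z (t i) - T i) + ((\<delta> i - d i) + 2 * (\<delta> i * \<eta>))"
      unfolding eq using norm_triangle_ineq[of "z (t i) - T i" X] by linarith
    then show ?case using Suc by simp
  qed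
  have \<rho>0: "0 \<le> \<rho>" by (simp add: \<rho>_def)
  have sum\<delta>\<eta>: "(\<Sum>j<i. \<delta> j * \<eta>) \<le> L * \<eta>" if "i \<le> n" for i
    using sum\<delta>[OF that] \<eta> by (simp add: sum_distrib_right[symmetric] mult_right_mono)
  have zs: "norm (z s - T i) \<le> e2" if i: "i < n" and s: "s \<in> {t i..t (Suc i)}" for i s
  proof -
    have tt: "0 \<le> t i" "t i \<le> s" "s \<le> L" using t01[of i] t01[of "Suc i"] s i by auto
    have "norm (z (t i) - T i) \<le> (\<Sum>j<i. \<delta> j - d j) + 2 * (\<Sum>j<i. \<delta> j * \<eta>)"
      using zT[OF i] by (simp only: sum.distrib sum_distrib_left)
    also have "\<dots> \<le> \<eta> + 2 * (L * \<eta>)" using sumd[of i] sum\<delta>\<eta>[of i] i by linarith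
    finally have 1: "norm (z (t i) - T i) \<le> \<eta> + 2 * (L * \<eta>)" .
    have 2: "norm (integral {t i..s} f) \<le> \<rho>"
    proof (cases "Suc i < n")
      case True
      have "norm (integral {t i..s} f) = (s - t i) * (norm (J (Suc i)) / \<delta> i)"
        unfolding fint[OF i s] using True s \<delta>(1)[OF i] by (simp add: a_def)
      also have "\<dots> \<le> \<delta> i * (norm (J (Suc i)) / \<delta> i)" using s \<delta>(1)[OF i] by (intro mult_right_mono) (auto simp: \<delta>_def)
      also have "\<dots> \<le> \<rho>" using \<delta>(1)[OF i] J\<rho>[of "Suc i"] True by simp
      finally show ?thesis .
    qed (use fint[OF i s] \<rho>0 in \<open>simp add: a_def\<close>)
    have 3: "norm (integral {t i..s} c) \<le> \<eta>"
      using c_integral_near(2)[OF tt] s \<delta>(2)[OF i] by (auto simp: \<delta>_def)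
    have "z s - T i = (z (t i) - T i) + (integral {t i..s} f - integral {t i..s} c)" using zd[OF tt] by (simp add: algebra_simps)
    also have "norm \<dots> \<le> (\<eta> + 2 * (L * \<eta>)) + (\<rho> + \<eta>)"
      by (intro norm_triangle_mono norm_diff_mono 1 2 3)
    finally show ?thesis by (simp add: e2_def)
  qed
  have e20: "0 \<le> e2" using \<eta> L \<rho>0 by (simp add: e2_def)
  have zi: "norm (Z s - Z (t i) - (s - t i) *\<^sub>R T i) \<le> (s - t i) * e2" if i: "i < n" and s: "s \<in> {t i..t (Suc i)}" for i s
  proof -
    have tt: "0 \<le> t i" "t i \<le> s" "s \<le> L" using t01[of i] t01[of "Suc i"] s i by auto
    have zint: "z integrable_on {t i..s}" by (rule integrable_subinterval_lebesgue_on(2)[OF Z.u_integrable]) (use tt in auto)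
    have "Z s - Z (t i) - (s - t i) *\<^sub>R T i = integral {t i..s} z - integral {t i..s} (\<lambda>_. T i)" using Z.c_diff[OF tt] tt by simp
    also have "\<dots> = integral {t i..s} (\<lambda>r. z r - T i)" by (rule Henstock_Kurzweil_Integration.integral_diff[OF zint, symmetric]) auto
    finally have e: "Z s - Z (t i) - (s - t i) *\<^sub>R T i = integral {t i..s} (\<lambda>r. z r - T i)" .
    have "norm (integral {t i..s} (\<lambda>r. z r - T i)) \<le> integral {t i..s} (\<lambda>_. e2)"
    proof (rule Henstock_Kurzweil_Integration.integral_norm_bound_integral)
      show "(\<lambda>r. z r - T i) integrable_on {t i..s}" by (rule Henstock_Kurzweil_Integration.integrable_diff[OF zint]) auto
      show "norm (z r - T i) \<le> e2" if "r \<in> {t i..s}" for r using zs[OF i, of r] that s by auto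
    qed auto
    then show ?thesis unfolding e using tt by simp
  qed
  have cZ: "norm (c (t i) - Z (t i)) \<le> (\<Sum>j<i. \<delta> j * e2 + ((\<delta> j - d j) + \<delta> j * \<eta>))" if "i \<le> n" for i
    using that
  proof (induction i)
    case 0
    then show ?case by (simp add: t0 Z_def double_primitive_0)
  next
    case (Suc i)
    then have i: "i < n" "Suc i < length (map c ts)" using ln by auto
    have 1: "norm (Z (t (Suc i)) - Z (t i) - \<delta> i *\<^sub>R T i) \<le> \<delta> i * e2" using zi[OF i(1), of "t (Suc i)"] tlt[OF i(1)] by (simp add: \<delta>_def)
    have "(d i)\<^sup>2 \<le> \<delta> i * \<eta>" unfolding power2_eq_square using d[OF i(1)] \<delta>[OF i(1)] by (intro mult_mono) auto
    then have 2: "norm (c (t (Suc i)) - c (t i) - d i *\<^sub>R T i) \<le> \<delta> i * \<eta>"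
      using chord_vector_near_tangent[OF i(2)] Vi[of i] Vi[of "Suc i"] i(1) by (simp add: T_def d_def)
    have 3: "norm ((\<delta> i - d i) *\<^sub>R T i) \<le> \<delta> i - d i" using Tn[OF i(1)] d(2)[OF i(1)] by simp
    have "c (t (Suc i)) - Z (t (Suc i)) = (c (t i) - Z (t i)) +
      ((c (t (Suc i)) - c (t i) - d i *\<^sub>R T i) - (Z (t (Suc i)) - Z (t i) - \<delta> i *\<^sub>R T i) - (\<delta> i - d i) *\<^sub>R T i)"
      by (simp add: algebra_simps)
    also have "norm \<dots> \<le> (\<Sum>j<i. \<delta> j * e2 + ((\<delta> j - d j) + \<delta> j * \<eta>)) + ((\<delta> i * \<eta> + \<delta> i * e2) + (\<delta> i - d i))"
      using Suc by (intro norm_triangle_mono norm_diff_mono 1 2 3) auto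
    finally show ?case by simp
  qed
  have final: "norm (c s - Z s) \<le> L * e2 + \<eta> + L * \<eta> + \<eta> + \<eta> * (1 + e2)" if s: "s \<in> {0..L}" for s
  proof -
    have "\<exists>i<n. s \<in> {t i..t (Suc i)}"
    proof (rule ccontr)
      assume neg: "\<not> ?thesis"
      have "i \<le> n \<Longrightarrow> t i \<le> s" for i
      proof (induction i)
        case (Suc i)
        then show ?case using neg by (metis Suc_le_lessD atLeastAtMost_iff less_imp_le linear)
      qed (use s t0 in simp)
      from this[of "n - 1"] neg n1 s tn show False by (metis One_nat_def Suc_le_lessD Suc_pred atLeastAtMost_iff diff_le_self lessI)
    qed
    then obtain i where i: "i < n" "s \<in> {t i..t (Suc i)}" by blast
    have tt: "0 \<le> t i" "t i \<le> s" "s \<le> L" using t01[of i] t01[of "Suc i"] i by auto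
    have sl: "s - t i \<le> \<eta>" using i \<delta>(2)[OF i(1)] by (auto simp: \<delta>_def)
    have "norm (c (t i) - Z (t i)) \<le> (\<Sum>j<i. \<delta> j) * e2 + ((\<Sum>j<i. \<delta> j - d j) + (\<Sum>j<i. \<delta> j * \<eta>))"
      using cZ[of i] i by (simp only: sum.distrib sum_distrib_right less_imp_le)
    also have "\<dots> \<le> L * e2 + (\<eta> + L * \<eta>)"
      using sum\<delta>[of i] sumd[of i] sum\<delta>\<eta>[of i] i e20 by (intro add_mono mult_right_mono) auto
    finally have 1: "norm (c (t i) - Z (t i)) \<le> L * e2 + (\<eta> + L * \<eta>)" .
    have 2: "norm (c s - c (t i)) \<le> \<eta>" using c_lipschitz[of "t i" s] tt sl by auto
    have "norm (Z s - Z (t i)) \<le> norm (Z s - Z (t i) - (s - t i) *\<^sub>R T i) + norm ((s - t i) *\<^sub>R T i)"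
      using norm_triangle_ineq[of "Z s - Z (t i) - (s - t i) *\<^sub>R T i" "(s - t i) *\<^sub>R T i"] by simp
    also have "\<dots> \<le> (s - t i) * e2 + (s - t i)" using zi[OF i] Tn[OF i(1)] tt by simp
    also have "\<dots> = (s - t i) * (1 + e2)" by (simp add: algebra_simps)
    also have "\<dots> \<le> \<eta> * (1 + e2)" using sl e20 by (intro mult_right_mono) auto
    finally have 3: "norm (Z s - Z (t i)) \<le> \<eta> * (1 + e2)" .
    have "c s - Z s = (c (t i) - Z (t i)) + ((c s - c (t i)) - (Z s - Z (t i)))" by simp
    also have "norm \<dots> \<le> (L * e2 + (\<eta> + L * \<eta>)) + (\<eta> + \<eta> * (1 + e2))"
      by (intro norm_triangle_mono norm_diff_mono 1 2 3)
    finally show ?thesis by simp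
  qed
  show ?thesis
    using fi fp fK final unfolding Z_def by blast
qed

lemma polygon_approximants_exist:
  assumes p: "1 < p" and K: "0 \<le> K"
    and H: "\<And>\<epsilon>. 0 < \<epsilon> \<Longrightarrow> \<exists>ts. inscribed c 0 L ts \<and> modulus c ts < \<epsilon> \<and> p_rotation p (map c ts) \<le> ennreal K"
    and \<omega>: "0 < \<omega>"
  shows "\<exists>f B. integrable (lebesgue_on {0..L}) f \<and> integrable (lebesgue_on {0..L}) (\<lambda>s. norm (f s) powr p) \<and>
    (LINT s|lebesgue_on {0..L}. norm (f s) powr p) \<le> K \<and>
    (\<forall>t\<in>{0..L}. norm (c t - (c 0 + t *\<^sub>R B + double_primitive L (\<lambda>s. f s - c s) t)) \<le> \<omega>)"
proof -
  define \<rho> where "\<rho> \<eta> = (K * \<eta> powr (p - 1)) powr (1 / p)" for \<eta>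
  define e2 where "e2 \<eta> = \<eta> + 2 * L * \<eta> + \<rho> \<eta> + \<eta>" for \<eta>
  define err where "err \<eta> = L * e2 \<eta> + \<eta> + L * \<eta> + \<eta> + \<eta> * (1 + e2 \<eta>)" for \<eta>
  have id: "((\<lambda>\<eta>::real. \<eta>) \<longlongrightarrow> 0) (at_right 0)" by (simp add: tendsto_ident_at)
  have pos: "\<forall>\<^sub>F \<eta>::real in at_right 0. 0 < \<eta>" by (rule eventually_at_right_less)
  have "((\<lambda>\<eta>. \<eta> powr (p - 1)) \<longlongrightarrow> 0) (at_right 0)"
    by (rule tendsto_zero_powrI[OF id tendsto_const]) (use p pos in \<open>auto elim: eventually_mono\<close>)
  then have "((\<lambda>\<eta>. K * \<eta> powr (p - 1)) \<longlongrightarrow> 0) (at_right 0)" by (rule tendsto_mult_right_zero)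
  then have r0: "(\<rho> \<longlongrightarrow> 0) (at_right 0)" unfolding \<rho>_def[abs_def]
    by (rule tendsto_zero_powrI[OF _ tendsto_const]) (use p K in auto)
  have "(e2 \<longlongrightarrow> 0 + 2 * L * 0 + 0 + 0) (at_right 0)" unfolding e2_def[abs_def] by (intro tendsto_intros id r0)
  then have e0: "(e2 \<longlongrightarrow> 0) (at_right 0)" by simp
  have "(err \<longlongrightarrow> L * 0 + 0 + L * 0 + 0 + 0 * (1 + 0)) (at_right 0)" unfolding err_def[abs_def] by (intro tendsto_intros id e0)
  then have "(err \<longlongrightarrow> 0) (at_right 0)" by simp
  then have "\<forall>\<^sub>F \<eta> in at_right 0. err \<eta> < \<omega>" using \<omega> by (rule order_tendstoD(2))
  with pos have "\<forall>\<^sub>F \<eta> in at_right 0. 0 < \<eta> \<and> err \<eta> < \<omega>" by (rule eventually_conj)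
  then obtain \<eta> where \<eta>: "0 < \<eta>" "err \<eta> < \<omega>" using eventually_happens[of _ "at_right (0::real)"] by force
  obtain \<eta>1 where \<eta>1: "\<eta>1 > 0" "\<And>ts. inscribed c 0 L ts \<Longrightarrow> (\<forall>i. Suc i < length ts \<longrightarrow> ts ! Suc i - ts ! i < \<eta>1) \<Longrightarrow> L - \<eta> < polygon_length (map c ts)"
    using polygon_length_converges[OF \<eta>(1)] by blast
  have "0 < min \<eta> \<eta>1" using \<eta> \<eta>1 by simp
  from mesh_small_if_modulus_small[OF this] obtain \<epsilon> where \<epsilon>: "\<epsilon> > 0"
    "\<And>ts. inscribed c 0 L ts \<Longrightarrow> modulus c ts < \<epsilon> \<Longrightarrow> \<forall>i. Suc i < length ts \<longrightarrow> ts ! Suc i - ts ! i < min \<eta> \<eta>1" by blast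
  obtain ts where ts: "inscribed c 0 L ts" "modulus c ts < \<epsilon>" "p_rotation p (map c ts) \<le> ennreal K" using H[OF \<epsilon>(1)] by blast
  have m: "\<forall>i. Suc i < length ts \<longrightarrow> ts ! Suc i - ts ! i < min \<eta> \<eta>1" by (rule \<epsilon>(2)[OF ts(1,2)])
  have "\<exists>f B. integrable (lebesgue_on {0..L}) f \<and> integrable (lebesgue_on {0..L}) (\<lambda>s. norm (f s) powr p) \<and>
    (LINT s|lebesgue_on {0..L}. norm (f s) powr p) \<le> K \<and>
    (\<forall>t\<in>{0..L}. norm (c t - (c 0 + t *\<^sub>R B + double_primitive L (\<lambda>s. f s - c s) t)) \<le> err \<eta>)"
    unfolding err_def e2_def \<rho>_def
    by (rule polygon_approximant[OF ts(1) p K ts(3) \<eta>(1)]) (use m \<eta>1(2)[OF ts(1)] in auto)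
  then obtain f B where fB: "integrable (lebesgue_on {0..L}) f" "integrable (lebesgue_on {0..L}) (\<lambda>s. norm (f s) powr p)"
    "(LINT s|lebesgue_on {0..L}. norm (f s) powr p) \<le> K"
    "\<And>t. t \<in> {0..L} \<Longrightarrow> norm (c t - (c 0 + t *\<^sub>R B + double_primitive L (\<lambda>s. f s - c s) t)) \<le> err \<eta>" by blast
  have "norm (c t - (c 0 + t *\<^sub>R B + double_primitive L (\<lambda>s. f s - c s) t)) \<le> \<omega>" if "t \<in> {0..L}" for t
    using fB(4)[OF that] \<eta>(2) by linarith
  then show ?thesis using fB(1-3) by blast
qed

text \<open>
  The set \<open>A n\<close> consists of the candidates for the tangential acceleration that reproduce \<open>c\<close> up to
  an error \<open>1/(n + 1)\<close>.
\<close>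
lemma second_derivative_from_polygons:
  assumes p: "1 < p" and K: "0 \<le> K"
    and H: "\<And>\<epsilon>. 0 < \<epsilon> \<Longrightarrow> \<exists>ts. inscribed c 0 L ts \<and> modulus c ts < \<epsilon> \<and> p_rotation p (map c ts) \<le> ennreal K"
  shows "\<exists>A B v. integrable (lebesgue_on {0..L}) v \<and> (\<forall>t\<in>{0..L}. c t = A + t *\<^sub>R B + double_primitive L v t) \<and>
    integrable (lebesgue_on {0..L}) (\<lambda>s. norm (v s + c s) powr p) \<and> (LINT s|lebesgue_on {0..L}. norm (v s + c s) powr p) \<le> K"
proof -
  let ?M = "lebesgue_on {0..L}"
  define R where "R f B t = c t - (c 0 + t *\<^sub>R B + double_primitive L (\<lambda>s. f s - c s) t)" for f B t
  define A where "A n = {f. integrable ?M f \<and> integrable ?M (\<lambda>s. norm (f s) powr p) \<and> (LINT s|?M. norm (f s) powr p) \<le> K \<and>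
    (\<exists>B. \<forall>t\<in>{0..L}. norm (R f B t) \<le> inverse (real (Suc n)))}" for n
  have ne: "A n \<noteq> {}" for n
    using polygon_approximants_exist[OF p K H, of "inverse (real (Suc n))"] unfolding A_def R_def by auto
  have dec: "A (Suc n) \<subseteq> A n" for n
  proof
    fix f assume f: "f \<in> A (Suc n)"
    have "inverse (real (Suc (Suc n))) \<le> inverse (real (Suc n))" by (rule le_imp_inverse_le) auto
    then show "f \<in> A n" using f unfolding A_def mem_Collect_eq by (meson order_trans)
  qed
  have conv: "(\<lambda>s. (1/2) *\<^sub>R (f s + g s)) \<in> A n" if f: "f \<in> A n" and g: "g \<in> A n" for n f g
  proof -
    obtain Bf where Bf: "integrable ?M f" "integrable ?M (\<lambda>s. norm (f s) powr p)" "(LINT s|?M. norm (f s) powr p) \<le> K"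
      "\<And>t. t \<in> {0..L} \<Longrightarrow> norm (R f Bf t) \<le> inverse (real (Suc n))" using f unfolding A_def by blast
    obtain Bg where Bg: "integrable ?M g" "integrable ?M (\<lambda>s. norm (g s) powr p)" "(LINT s|?M. norm (g s) powr p) \<le> K"
      "\<And>t. t \<in> {0..L} \<Longrightarrow> norm (R g Bg t) \<le> inverse (real (Suc n))" using g unfolding A_def by blast
    define h where "h s = (1/2) *\<^sub>R (f s + g s)" for s
    have h: "integrable ?M h" unfolding h_def using Bf(1) Bg(1) by simp
    have hp: "norm (h s) powr p \<le> (norm (f s) powr p + norm (g s) powr p) / 2" for s
    proof -
      have "norm (h s) \<le> (norm (f s) + norm (g s)) / 2" unfolding h_def using norm_triangle_ineq[of "f s" "g s"] by simp
      then have "norm (h s) powr p \<le> ((norm (f s) + norm (g s)) / 2) powr p" using p by (intro powr_mono2) auto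
      also have "\<dots> \<le> (norm (f s) powr p + norm (g s) powr p) / 2" using p by (intro midpoint_powr_le) auto
      finally show ?thesis .
    qed
    have i2: "integrable ?M (\<lambda>s. (norm (f s) powr p + norm (g s) powr p) / 2)" using Bf(2) Bg(2) by simp
    have hm: "(\<lambda>s. norm (h s) powr p) \<in> borel_measurable ?M" using h by measurable
    have hi: "integrable ?M (\<lambda>s. norm (h s) powr p)"
      by (rule Bochner_Integration.integrable_bound[OF i2 hm]) (use hp in \<open>auto intro!: AE_I2\<close>)
    have "(LINT s|?M. norm (h s) powr p) \<le> (LINT s|?M. (norm (f s) powr p + norm (g s) powr p) / 2)"
      by (rule integral_mono[OF hi i2 hp])
    also have "\<dots> \<le> K" using Bf(2,3) Bg(2,3) by simp
    finally have hK: "(LINT s|?M. norm (h s) powr p) \<le> K" .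
    have Rh: "R h ((1/2) *\<^sub>R (Bf + Bg)) t = (1/2) *\<^sub>R (R f Bf t + R g Bg t)" for t
    proof -
      have "(\<lambda>s. h s - c s) = (\<lambda>s. (1/2) *\<^sub>R ((f s - c s) + (g s - c s)))"
      proof
        fix s
        have "(1/2) *\<^sub>R ((f s - c s) + (g s - c s)) = (1/2) *\<^sub>R (f s + g s) - (1/2) *\<^sub>R (c s + c s)"
          by (simp only: scaleR_diff_right[symmetric] add_diff_add)
        also have "(1/2) *\<^sub>R (c s + c s) = c s" by (simp flip: scaleR_2)
        finally show "h s - c s = (1/2) *\<^sub>R ((f s - c s) + (g s - c s))" by (simp only: h_def)
      qed
      then have "double_primitive L (\<lambda>s. h s - c s) t = (1/2) *\<^sub>R (double_primitive L (\<lambda>s. f s - c s) t + double_primitive L (\<lambda>s. g s - c s) t)"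
        using double_primitive_add[OF Bochner_Integration.integrable_diff[OF Bf(1) c_integrable_on] Bochner_Integration.integrable_diff[OF Bg(1) c_integrable_on], of t]
        by (simp add: double_primitive_scaleR)
      moreover have "c t = (1/2) *\<^sub>R (c t + c t)" "c 0 = (1/2) *\<^sub>R (c 0 + c 0)" by (simp_all flip: scaleR_2)
      ultimately show ?thesis unfolding R_def by (simp add: algebra_simps)
    qed
    have "norm (R h ((1/2) *\<^sub>R (Bf + Bg)) t) \<le> inverse (real (Suc n))" if "t \<in> {0..L}" for t
      unfolding Rh using norm_triangle_ineq[of "R f Bf t" "R g Bg t"] Bf(4)[OF that] Bg(4)[OF that] by simp
    then show ?thesis unfolding A_def h_def[symmetric] using h hi hK by blast
  qed
  obtain F w where F: "\<And>n. F n \<in> A n" and w: "integrable ?M w" "(\<lambda>n. LINT s|?M. norm (F n s - w s)) \<longlonglongrightarrow> 0"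
    "integrable ?M (\<lambda>s. norm (w s) powr p)" "(LINT s|?M. norm (w s) powr p) \<le> K"
    by (rule L1_limit_of_near_minimizers[where M="?M" and A=A and p=p and K=K, OF finite_measure_lebesgue_on_interval p ne dec conv])
      (auto simp: A_def)
  have Fi: "integrable ?M (F n)" for n using F[of n] by (simp add: A_def)
  have "\<exists>B. \<forall>t\<in>{0..L}. norm (R (F n) B t) \<le> inverse (real (Suc n))" for n using F[of n] by (simp add: A_def)
  then obtain b where b: "\<And>n t. t \<in> {0..L} \<Longrightarrow> norm (R (F n) (b n) t) \<le> inverse (real (Suc n))" by metis
  have wc: "integrable ?M (\<lambda>s. w s - c s)" using w(1) c_integrable_on by (rule Bochner_Integration.integrable_diff)
  have Fc: "integrable ?M (\<lambda>s. F n s - c s)" for n using Fi c_integrable_on by (rule Bochner_Integration.integrable_diff)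
  have P: "(\<lambda>n. double_primitive L (\<lambda>s. F n s - c s) t) \<longlonglongrightarrow> double_primitive L (\<lambda>s. w s - c s) t" if t: "t \<in> {0..L}" for t
  proof (rule LIM_zero_cancel, rule Lim_null_comparison)
    show "\<forall>\<^sub>F n in sequentially. norm (double_primitive L (\<lambda>s. F n s - c s) t - double_primitive L (\<lambda>s. w s - c s) t) \<le> L * (LINT s|?M. norm (F n s - w s))"
      using double_primitive_diff_le[OF Fc wc, of t] t by (intro always_eventually allI) auto
    show "(\<lambda>n. L * (LINT s|?M. norm (F n s - w s))) \<longlonglongrightarrow> 0" by (rule tendsto_mult_right_zero[OF w(2)])
  qed
  have R0: "(\<lambda>n. R (F n) (b n) t) \<longlonglongrightarrow> 0" if t: "t \<in> {0..L}" for t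
    by (rule Lim_null_comparison[OF _ LIMSEQ_inverse_real_of_nat]) (use b[OF t] in auto)
  have tb: "(\<lambda>n. t *\<^sub>R b n) \<longlonglongrightarrow> c t - c 0 - double_primitive L (\<lambda>s. w s - c s) t" if t: "t \<in> {0..L}" for t
  proof -
    have "(\<lambda>n. c t - c 0 - double_primitive L (\<lambda>s. F n s - c s) t - R (F n) (b n) t) \<longlonglongrightarrow> c t - c 0 - double_primitive L (\<lambda>s. w s - c s) t - 0"
      by (intro tendsto_intros P R0 t)
    then show ?thesis by (simp add: R_def)
  qed
  \<comment> \<open>The initial velocities \<open>b n\<close> have no a priori bound; their limit is read off at \<open>t = L\<close>.\<close>
  define B where "B = (1 / L) *\<^sub>R (c L - c 0 - double_primitive L (\<lambda>s. w s - c s) L)"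
  have "(\<lambda>n. (1 / L) *\<^sub>R (L *\<^sub>R b n)) \<longlonglongrightarrow> B" unfolding B_def using L by (intro tendsto_scaleR tendsto_const tb) auto
  then have bB: "b \<longlonglongrightarrow> B" using L by simp
  have "c t = c 0 + t *\<^sub>R B + double_primitive L (\<lambda>s. w s - c s) t" if t: "t \<in> {0..L}" for t
  proof -
    have "(\<lambda>n. t *\<^sub>R b n) \<longlonglongrightarrow> t *\<^sub>R B" by (intro tendsto_intros bB)
    from LIMSEQ_unique[OF this tb[OF t]] show ?thesis by (simp add: algebra_simps)
  qed
  then have rep: "\<forall>t\<in>{0..L}. c t = c 0 + t *\<^sub>R B + double_primitive L (\<lambda>s. w s - c s) t" by blast
  show ?thesis
    by (rule exI[of _ "c 0"], rule exI[of _ B], rule exI[of _ "\<lambda>s. w s - c s"], intro conjI wc rep)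
      (simp_all only: diff_add_cancel w(3,4))
qed

end

section \<open>Curves with integrable acceleration\<close>

text \<open>
  A convex function lies above its tangents.
\<close>
lemma tangent_line_powr:
  assumes "0 \<le> (x::real)" "0 \<le> a" "1 < p"
  shows "a powr p + p * a powr (p - 1) * (x - a) \<le> x powr p"
proof (cases "a = 0 \<or> x = 0")
  case True
  have "a powr p = a powr (p - 1) * a"
    using assms by (cases "a = 0") (simp_all add: powr_diff)
  moreover have "0 \<le> a powr (p - 1) * a" using assms by simp
  ultimately show ?thesis using True assms
    by (cases "a = 0") (auto simp: algebra_simps mult_le_cancel_right1)
next
  case False
  have "p * a powr (p - 1) * (x - a) \<le> x powr p - a powr p"
  proof (rule convex_on_imp_above_tangent[where A="{0<..}" and f="\<lambda>x. x powr p"])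
    show "convex_on {0<..} (\<lambda>x. x powr p)" using assms by (intro powr_convex) auto
    show "((\<lambda>x. x powr p) has_real_derivative p * a powr (p - 1)) (at a within {0<..})"
      by (rule has_field_derivative_at_within[OF has_real_derivative_powr]) (use False assms in auto)
    show "a \<in> interior {0<..}" using False assms by (simp add: interior_open)
  qed (use False assms in auto)
  then show ?thesis by simp
qed

lemma norm_tangent_proj_le:
  assumes "norm x = 1" shows "norm (tangent_proj x y) \<le> norm y"
proof -
  have "x \<bullet> x = 1" using assms by (simp add: dot_square_norm)
  then have "(norm (tangent_proj x y))\<^sup>2 = (norm y)\<^sup>2 - (y \<bullet> x)\<^sup>2"
    unfolding dot_square_norm[symmetric] tangent_proj_def
    by (simp add: inner_diff_left inner_diff_right inner_commute power2_eq_square)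
  then have "(norm (tangent_proj x y))\<^sup>2 \<le> (norm y)\<^sup>2" by simp
  then show ?thesis by (rule power2_le_imp_le) simp
qed

lemma bounded_linear_tangent_proj: "bounded_linear (tangent_proj x)"
  unfolding tangent_proj_def[abs_def]
  by (intro bounded_linear_sub bounded_linear_ident bounded_linear_scaleR_const bounded_linear_inner_left)

definition hat :: "real \<Rightarrow> real \<Rightarrow> real \<Rightarrow> real" where "hat d t s = max 0 (d - \<bar>s - t\<bar>)"

text \<open>
  At most two of the hats are nonzero at a given point, and neighbouring hats add up to \<open>d\<close> between
  their nodes.
\<close>
lemma hat_sum_le:
  assumes d: "0 < d" and fin: "finite I"
  shows "(\<Sum>i\<in>I. hat d (real i * d) s) \<le> d"
proof -
  have z: "hat d (real i * d) s = 0" if "real i \<le> s / d - 1 \<or> s / d + 1 \<le> real i" for i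
    using that d by (auto simp: hat_def field_simps)
  define j where "j = nat \<lfloor>s / d\<rfloor>"
  define I' where "I' = I \<inter> {j, Suc j}"
  have jj: "hat d (real i * d) s = 0" if "i \<notin> {j, Suc j}" for i
  proof (cases "s < 0")
    case True
    then have sd: "s / d < 0" using d by (simp add: divide_neg_pos)
    then have "j = 0" by (simp add: j_def)
    then have "i \<ge> 2" using that by auto
    then show ?thesis using sd by (intro z) auto
  next
    case False
    then have "0 \<le> s / d" using d by simp
    then have j: "real j \<le> s / d" "s / d < real j + 1" unfolding j_def by (simp_all add: of_nat_floor) 
    have "i < j \<or> Suc (Suc j) \<le> i" using that by auto
    then have "real i + 1 \<le> real j \<or> real j + 2 \<le> real i" by linarith
    then show ?thesis using j by (intro z) linarith
  qed
  have "(\<Sum>i\<in>I. hat d (real i * d) s) = (\<Sum>i\<in>I'. hat d (real i * d) s)"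
    using fin jj by (intro sum.mono_neutral_right) (auto simp: I'_def)
  also have "\<dots> \<le> (\<Sum>i\<in>{j, Suc j}. hat d (real i * d) s)" by (rule sum_mono2) (auto simp: I'_def hat_def)
  also have "\<dots> = hat d (real j * d) s + hat d (real j * d + d) s" by (simp add: algebra_simps)
  also have "\<dots> \<le> d" using d unfolding hat_def by linarith
  finally show ?thesis .
qed

lemma hat_integral:
  assumes d: "0 < d" and t: "d \<le> t" "t + d \<le> L"
  shows "integrable (lebesgue_on {0..L}) (hat d t)" "(LINT s|lebesgue_on {0..L}. hat d t s) = d\<^sup>2"
proof -
  have c1: "integrable (lebesgue_on {0..L}) (\<lambda>s. 1 :: real)"
    using finite_measure.integrable_const[OF finite_measure_lebesgue_on_interval] .
  from double_primitive_kernel_integrable[OF c1] have i: "integrable (lebesgue_on {0..L}) (\<lambda>s. max 0 (t - s) :: real)" for t by simp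
  have ch: "continuous_on {0..L} (hat d t)" unfolding hat_def[abs_def] by (intro continuous_intros)
  from integrable_continuous_scaleR[OF c1 this] show "integrable (lebesgue_on {0..L}) (hat d t)" by simp
  have P: "double_primitive L (\<lambda>_. 1 :: real) x = x\<^sup>2 / 2" if x: "0 \<le> x" "x \<le> L" for x
  proof -
    have "(double_primitive L (\<lambda>_. 1 :: real) has_vector_derivative y) (at y within {0..x})" if "y \<in> {0..x}" for y
    proof -
      have "(double_primitive L (\<lambda>_. 1 :: real) has_vector_derivative y) (at y within {0..L})"
        using double_primitive_has_vector_derivative[OF c1, of y] that x by simp
      then show ?thesis by (rule has_vector_derivative_within_subset) (use x in auto)
    qed
    then have "((\<lambda>y. y) has_integral (double_primitive L (\<lambda>_. 1) x - double_primitive L (\<lambda>_. 1) 0)) {0..x}"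
      using x by (intro fundamental_theorem_of_calculus) auto
    moreover have "((\<lambda>y. y) has_integral (x\<^sup>2 / 2 - 0\<^sup>2 / 2)) {0..x}" using ident_has_integral[OF x(1)] by simp
    ultimately have "double_primitive L (\<lambda>_. 1) x - double_primitive L (\<lambda>_. 1) 0 = x\<^sup>2 / 2 - 0\<^sup>2 / 2" by (rule has_integral_unique)
    then show ?thesis by (simp add: double_primitive_0)
  qed
  have "(LINT s|lebesgue_on {0..L}. hat d t s) = double_primitive L (\<lambda>_. 1) (t + d) - 2 *\<^sub>R double_primitive L (\<lambda>_. 1) t + double_primitive L (\<lambda>_. 1) (t - d)"
    using double_primitive_second_difference[OF c1, of d t] d by (simp add: hat_def)
  also have "\<dots> = d\<^sup>2" using P[of "t + d"] P[of t] P[of "t - d"] d t by (simp add: power2_eq_square algebra_simps)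
  finally show "(LINT s|lebesgue_on {0..L}. hat d t s) = d\<^sup>2" .
qed

text \<open>
  Jensen's inequality for the measure with density \<open>hat d t\<close> and total mass \<open>d\<^sup>2\<close>: integrate the tangent
  of the \<open>p\<close>-th power at the mean value \<open>m / d\<^sup>2\<close>.
\<close>
lemma hat_jensen:
  assumes p: "1 < p" and d: "0 < d" and t: "d \<le> t" "t + d \<le> L"
    and g: "integrable (lebesgue_on {0..L}) g" "integrable (lebesgue_on {0..L}) (\<lambda>s. g s powr p)" "\<And>s. 0 \<le> (g s :: real)"
  defines "m \<equiv> LINT s|lebesgue_on {0..L}. hat d t s * g s"
  shows "0 \<le> m" "(m / d) powr p / d powr (p - 1) \<le> (LINT s|lebesgue_on {0..L}. hat d t s * g s powr p) / d"
proof -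
  let ?M = "lebesgue_on {0..L}"
  have ch: "continuous_on {0..L} (hat d t)" unfolding hat_def[abs_def] by (intro continuous_intros)
  have h0: "0 \<le> hat d t s" for s by (simp add: hat_def)
  have i1: "integrable ?M (\<lambda>s. hat d t s * g s)" using integrable_continuous_scaleR[OF g(1) ch] by simp
  have i2: "integrable ?M (\<lambda>s. hat d t s * g s powr p)" using integrable_continuous_scaleR[OF g(2) ch] by simp
  note H = hat_integral[OF d t]
  show m0: "0 \<le> m" unfolding m_def using h0 g(3) by (intro integral_nonneg_AE AE_I2) auto
  define a where "a = m / d\<^sup>2"
  have a0: "0 \<le> a" using m0 by (simp add: a_def)
  have "a powr p * d\<^sup>2 = (LINT s|?M. (a powr p - p * a powr (p - 1) * a) * hat d t s + p * a powr (p - 1) * (hat d t s * g s))"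
  proof -
    have lin: "(LINT s|?M. \<alpha> * hat d t s + \<beta> * (hat d t s * g s)) = \<alpha> * d\<^sup>2 + \<beta> * m" for \<alpha> \<beta>
      using i1 H by (simp add: m_def)
    have "m = a * d\<^sup>2" using d by (simp add: a_def)
    then show ?thesis unfolding lin by (simp add: algebra_simps)
  qed
  also have "\<dots> \<le> (LINT s|?M. hat d t s * g s powr p)"
  proof (rule integral_mono[OF _ i2])
    show "integrable ?M (\<lambda>s. (a powr p - p * a powr (p - 1) * a) * hat d t s + p * a powr (p - 1) * (hat d t s * g s))"
      using i1 H(1) by simp
    fix s
    have "hat d t s * (a powr p + p * a powr (p - 1) * (g s - a)) \<le> hat d t s * g s powr p"
      by (intro mult_left_mono tangent_line_powr g(3) a0 p h0)
    then show "(a powr p - p * a powr (p - 1) * a) * hat d t s + p * a powr (p - 1) * (hat d t s * g s) \<le> hat d t s * g s powr p"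
      by (simp add: algebra_simps)
  qed
  finally have J: "a powr p * d\<^sup>2 \<le> (LINT s|?M. hat d t s * g s powr p)" .
  have "(m / d) powr p / d powr (p - 1) = a powr p * d"
  proof -
    have "m / d = a * d" using d by (simp add: a_def power2_eq_square)
    then have "(m / d) powr p = a powr p * d powr p" using a0 d by (simp add: powr_mult)
    moreover have "d powr p = d powr (p - 1) * d" using d by (simp add: powr_diff)
    ultimately show ?thesis using d by simp
  qed
  also have "\<dots> = a powr p * d\<^sup>2 / d" using d by (simp add: power2_eq_square)
  also have "\<dots> \<le> (LINT s|?M. hat d t s * g s powr p) / d" using J d by (intro divide_right_mono) auto
  finally show "(m / d) powr p / d powr (p - 1) \<le> (LINT s|?M. hat d t s * g s powr p) / d" .
qed

locale regular_curve = unit_speed_curve c L + sc: curve_with_acceleration c u v A B L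
  for c u v :: "real \<Rightarrow> real^3" and A B :: "real^3" and L :: real
begin

text \<open>
  This is the mean value inequality for \<open>c - t w\<close>.
\<close>
lemma chord_near_velocity:
  assumes "0 \<le> a" "a \<le> b" "b \<le> L" and close: "\<And>s. s \<in> {a..b} \<Longrightarrow> norm (u s - w) \<le> \<kappa>"
  shows "norm (c b - c a - (b - a) *\<^sub>R w) \<le> \<kappa> * (b - a)"
proof -
  have ui: "u integrable_on {a..b}" by (rule integrable_subinterval_lebesgue_on(2)[OF sc.u_integrable]) (use assms in auto)
  have "c b - c a - (b - a) *\<^sub>R w = integral {a..b} u - integral {a..b} (\<lambda>_. w)" using sc.c_diff[OF assms(1-3)] assms by simp
  also have "\<dots> = integral {a..b} (\<lambda>s. u s - w)" by (rule Henstock_Kurzweil_Integration.integral_diff[OF ui, symmetric]) auto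
  finally have e: "c b - c a - (b - a) *\<^sub>R w = integral {a..b} (\<lambda>s. u s - w)" .
  have "norm (integral {a..b} (\<lambda>s. u s - w)) \<le> integral {a..b} (\<lambda>_. \<kappa>)"
    by (rule Henstock_Kurzweil_Integration.integral_norm_bound_integral)
      (use close in \<open>auto intro!: Henstock_Kurzweil_Integration.integrable_diff[OF ui]\<close>)
  then show ?thesis unfolding e using assms by (simp add: mult.commute)
qed

lemma velocity_nearby:
  assumes t: "t \<in> {0..L}" and \<eta>: "0 < \<eta>"
  shows "\<exists>a b. 0 \<le> a \<and> a < b \<and> b \<le> L \<and> b - a \<le> \<eta> \<and> (\<forall>s\<in>{a..b}. norm (u s - u t) \<le> \<eta>)"
proof -
  obtain d where d: "d > 0" "\<And>s. s \<in> {0..L} \<Longrightarrow> dist s t < d \<Longrightarrow> dist (u s) (u t) < \<eta>"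
    using sc.u_continuous t \<eta> unfolding continuous_on_iff by meson
  define r where "r = min (d / 2) (\<eta> / 2)"
  have r: "0 < r" "r < d" "2 * r \<le> \<eta>" using d \<eta> by (auto simp: r_def min_def)
  define a b where "a = max 0 (t - r)" and "b = min L (t + r)"
  have ab: "0 \<le> a" "a < b" "b \<le> L" "b - a \<le> \<eta>" using t r L by (auto simp: a_def b_def)
  have "norm (u s - u t) \<le> \<eta>" if "s \<in> {a..b}" for s
  proof -
    have "s \<in> {0..L}" "dist s t < d" using that r by (auto simp: a_def b_def dist_real_def)
    from d(2)[OF this] show ?thesis by (simp add: dist_norm)
  qed
  then show ?thesis using ab by blast
qed

text \<open>
  If the speed at a point were greater than 1, a short chord would be longer than its parameter
  interval; if it were smaller than 1, all inscribed polygonals near the point would be shorter than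
  the parameter interval by a fixed factor.
\<close>
lemma unit_velocity:
  assumes t: "t \<in> {0..L}" shows "norm (u t) = 1"
proof (rule ccontr)
  assume ne: "norm (u t) \<noteq> 1"
  define \<eta> where "\<eta> = \<bar>norm (u t) - 1\<bar> / 2"
  have \<eta>: "0 < \<eta>" using ne by (simp add: \<eta>_def)
  obtain a b where ab: "0 \<le> a" "a < b" "b \<le> L" "b - a \<le> \<eta>" "\<And>s. s \<in> {a..b} \<Longrightarrow> norm (u s - u t) \<le> \<eta>"
    using velocity_nearby[OF t \<eta>] by blast
  have chord: "norm (c y - c x - (y - x) *\<^sub>R u t) \<le> \<eta> * (y - x)" if "a \<le> x" "x \<le> y" "y \<le> b" for x y
    by (rule chord_near_velocity) (use that ab in auto)
  show False
  proof (cases "norm (u t) > 1")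
    case True
    have "norm ((b - a) *\<^sub>R u t) \<le> norm (c b - c a) + norm (c b - c a - (b - a) *\<^sub>R u t)"
      by (metis norm_minus_commute norm_triangle_sub)
    also have "\<dots> \<le> (b - a) + \<eta> * (b - a)"
      using chord[of a b] c_lipschitz[of a b] ab by (intro add_mono) auto
    also have "(b - a) + \<eta> * (b - a) = (b - a) * (1 + \<eta>)" by (simp add: algebra_simps)
    finally have "norm ((b - a) *\<^sub>R u t) \<le> (b - a) * (1 + \<eta>)" .
    moreover have "norm ((b - a) *\<^sub>R u t) = (b - a) * norm (u t)" using ab by simp
    ultimately have "(b - a) * norm (u t) \<le> (b - a) * (1 + \<eta>)" by (simp only:)
    then have "norm (u t) \<le> 1 + \<eta>" using ab by simp
    moreover have "2 * \<eta> = norm (u t) - 1" using True by (simp add: \<eta>_def)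
    ultimately show False using True by linarith
  next
    case False
    then have "2 * \<eta> = 1 - norm (u t)" using ne by (simp add: \<eta>_def)
    then have u1: "norm (u t) = 1 - 2 * \<eta>" by linarith
    then have \<eta>2: "2 * \<eta> \<le> 1" using norm_ge_zero[of "u t"] by linarith
    \<comment> \<open>Chords are shorter than \<open>(1 - \<eta>)\<close> times the parameter; passing to arcs costs the factor \<open>1 - \<eta>/4\<close>.\<close>
    define q where "q = (1 - \<eta>) / (1 - \<eta> / 4)"
    have q: "0 \<le> q" "q < 1" using \<eta> \<eta>2 by (auto simp: q_def field_simps)
    have sd: "sphere_dist (c x) (c y) \<le> q * (y - x)" if xy: "a \<le> x" "x \<le> y" "y \<le> b" for x y
    proof -
      define s where "s = sphere_dist (c x) (c y)"
      have n: "norm (c x) = 1" "norm (c y) = 1" using xy ab by (auto intro!: c_norm)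
      have s: "0 \<le> s" "s \<le> y - x" using sphere_dist_props(1)[OF n] sphere_dist_le[of x y] xy ab by (auto simp: s_def)
      have "norm (c y - c x) \<le> norm (c y - c x - (y - x) *\<^sub>R u t) + norm ((y - x) *\<^sub>R u t)"
        using norm_triangle_ineq[of "c y - c x - (y - x) *\<^sub>R u t" "(y - x) *\<^sub>R u t"] by simp
      also have "\<dots> \<le> \<eta> * (y - x) + (y - x) * (1 - 2 * \<eta>)" using chord[OF xy] u1 xy by simp
      finally have "norm (c y - c x) \<le> (1 - \<eta>) * (y - x)" by (simp add: algebra_simps)
      moreover have "s * (1 - s / 4) \<le> norm (c x - c y)" using chord_ge_sphere_dist[OF n] by (simp add: s_def)
      moreover have "s * (1 - \<eta> / 4) \<le> s * (1 - s / 4)" using s xy ab by (intro mult_left_mono) auto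
      ultimately have "s * (1 - \<eta> / 4) \<le> (1 - \<eta>) * (y - x)" by (simp add: norm_minus_commute)
      then show ?thesis using \<eta>2 by (simp add: q_def s_def field_simps)
    qed
    have "polygon_length (map c ts) \<le> q * (b - a)" if ts: "inscribed c a b ts" for ts
    proof -
      have i: "ts \<noteq> []" "hd ts = a" "last ts = b" "sorted_wrt (<) ts" using ts by (auto simp: inscribed_def)
      have m: "ts ! i \<le> ts ! j" if "i \<le> j" "j < length ts" for i j
        using sorted_wrt_nth_less[OF i(4), of i j] that by (cases "i = j") auto
      have e: "ts ! 0 = a" "ts ! (length ts - 1) = b" using i by (simp_all add: hd_conv_nth last_conv_nth)
      have "polygon_length (map c ts) = (\<Sum>i<length ts - 1. sphere_dist (c (ts ! i)) (c (ts ! Suc i)))"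
        unfolding polygon_length_def length_map edge_len_def by (rule sum.cong) auto
      also have "\<dots> \<le> (\<Sum>i<length ts - 1. q * (ts ! Suc i - ts ! i))"
      proof (rule sum_mono)
        fix i assume "i \<in> {..<length ts - 1}"
        then have "Suc i < length ts" by auto
        then show "sphere_dist (c (ts ! i)) (c (ts ! Suc i)) \<le> q * (ts ! Suc i - ts ! i)"
          using m[of 0 i] m[of i "Suc i"] m[of "Suc i" "length ts - 1"] e by (intro sd) auto
      qed
      also have "\<dots> = q * (b - a)" unfolding sum_distrib_left[symmetric] sum_lessThan_telescope e ..
      finally show ?thesis .
    qed
    then have "curve_length c a b \<le> ennreal (q * (b - a))"
      unfolding curve_length_def by (intro SUP_least ennreal_leI) auto
    moreover have "curve_length c a b = ennreal (b - a)" using arc ab by (auto simp: arc_length_parametrized_def)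
    ultimately have "b - a \<le> q * (b - a)" using q ab by (simp add: ennreal_le_iff)
    then show False using q ab by (simp add: mult_le_cancel_right1 mult_less_cancel_right2)
  qed
qed

lemma velocity_orthogonal:
  assumes t: "t \<in> {0..L}" shows "c t \<bullet> u t = 0"
proof -
  have "((\<lambda>s. c s \<bullet> c s) has_vector_derivative (c t \<bullet> u t + u t \<bullet> c t)) (at t within {0..L})"
    by (rule bounded_bilinear.has_vector_derivative[OF bounded_bilinear_inner sc.c_deriv[OF t] sc.c_deriv[OF t]])
  moreover have "((\<lambda>s. c s \<bullet> c s) has_vector_derivative 0) (at t within {0..L})"
    by (rule has_vector_derivative_transform[OF t _ has_vector_derivative_const[of 1]]) (simp add: dot_square_norm c_norm)
  ultimately have "c t \<bullet> u t + u t \<bullet> c t = 0"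
    using t L by (intro vector_derivative_unique_within_closed_interval[of 0 L t "\<lambda>s. c s \<bullet> c s"]) auto
  then show ?thesis by (simp add: inner_commute)
qed

text \<open>
  Differentiate the constants \<open>c' \<bullet> c = 0\<close> and \<open>c' \<bullet> c' = 1\<close> with the product rule.
\<close>
lemma acceleration_ae:
  "AE s in lebesgue_on {0..L}. v s \<bullet> c s = - 1 \<and> v s \<bullet> u s = 0"
proof -
  have uu: "u s \<bullet> u s = 1" if "s \<in> {0..L}" for s using unit_velocity[OF that] by (simp add: dot_square_norm)
  have L0: "0 \<le> L" using L by simp
  have P1: "integrable (lebesgue_on {0..L}) (\<lambda>s. v s \<bullet> c s)" "integrable (lebesgue_on {0..L}) (\<lambda>s. u s \<bullet> u s)"
    by (rule absolutely_continuous_product_rule(1,2)[OF bounded_bilinear_inner sc.v sc.u_integrable sc.u_diff sc.c_diff order_refl order_refl L0]; assumption)+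
  have P1': "u x \<bullet> c x - u 0 \<bullet> c 0 = integral {0..x} (\<lambda>s. v s \<bullet> c s + u s \<bullet> u s)" if "0 \<le> x" "x \<le> L" for x
    by (rule absolutely_continuous_product_rule(3)[OF bounded_bilinear_inner sc.v sc.u_integrable sc.u_diff sc.c_diff order_refl that]; assumption)
  have P2: "integrable (lebesgue_on {0..L}) (\<lambda>s. v s \<bullet> u s)" "integrable (lebesgue_on {0..L}) (\<lambda>s. u s \<bullet> v s)"
    by (rule absolutely_continuous_product_rule(1,2)[OF bounded_bilinear_inner sc.v sc.v sc.u_diff sc.u_diff order_refl order_refl L0]; assumption)+
  have P2': "u x \<bullet> u x - u 0 \<bullet> u 0 = integral {0..x} (\<lambda>s. v s \<bullet> u s + u s \<bullet> v s)" if "0 \<le> x" "x \<le> L" for x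
    by (rule absolutely_continuous_product_rule(3)[OF bounded_bilinear_inner sc.v sc.v sc.u_diff sc.u_diff order_refl that]; assumption)
  have "AE s in lebesgue_on {0..L}. v s \<bullet> c s + u s \<bullet> u s = 0"
  proof (rule AE_zero_if_interval_integrals_zero)
    show "integrable (lebesgue_on {0..L}) (\<lambda>s. v s \<bullet> c s + u s \<bullet> u s)"
      using P1 by (rule Bochner_Integration.integrable_add)
    fix x
    have "integral {0..x} (\<lambda>s. v s \<bullet> c s + u s \<bullet> u s) = 0" if x: "x \<in> {0..L}"
      using P1'[of x] x velocity_orthogonal[of x] velocity_orthogonal[of 0] L by (simp add: inner_commute)
    then show "integral {0..x} (\<lambda>s. v s \<bullet> c s + u s \<bullet> u s) = 0 \<or> x \<notin> {0..L}" by blast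
  qed
  moreover have "AE s in lebesgue_on {0..L}. v s \<bullet> u s + u s \<bullet> v s = 0"
  proof (rule AE_zero_if_interval_integrals_zero)
    show "integrable (lebesgue_on {0..L}) (\<lambda>s. v s \<bullet> u s + u s \<bullet> v s)"
      using P2 by (rule Bochner_Integration.integrable_add)
    fix x
    have "integral {0..x} (\<lambda>s. v s \<bullet> u s + u s \<bullet> v s) = 0" if x: "x \<in> {0..L}"
      using P2'[of x] x uu[of x] uu[of 0] L by simp
    then show "integral {0..x} (\<lambda>s. v s \<bullet> u s + u s \<bullet> v s) = 0 \<or> x \<notin> {0..L}" by blast
  qed
  moreover have "AE s in lebesgue_on {0..L}. s \<in> {0..L}" by (intro AE_I2) (simp add: space_restrict_space)
  ultimately show ?thesis by eventually_elim (auto simp: uu inner_commute)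
qed

text \<open>
  The vector \<open>v + c\<close> is orthogonal to \<open>c\<close> and \<open>c'\<close>, hence a multiple of the unit conormal.
\<close>
lemma curvature_ae:
  "AE s in lebesgue_on {0..L}. tangent_proj (c s) (v s) = v s + c s \<and> \<bar>geod_curv (c s) (u s) (v s)\<bar> = norm (v s + c s)"
proof -
  have "AE s in lebesgue_on {0..L}. s \<in> {0..L}" by (intro AE_I2) (simp add: space_restrict_space)
  with acceleration_ae show ?thesis
  proof eventually_elim
    case (elim s)
    define n where "n = c s \<times> u s"
    have f: "norm (c s) = 1" "norm (u s) = 1" "c s \<bullet> u s = 0"
      using elim(2) c_norm unit_velocity velocity_orthogonal by auto
    have nn: "norm n = 1" "c s \<bullet> n = 0" unfolding n_def using cross_frame[OF f] by auto
    have "(v s + c s) \<times> n = ((v s + c s) \<bullet> u s) *\<^sub>R c s - ((v s + c s) \<bullet> c s) *\<^sub>R u s"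
      unfolding n_def by (rule Lagrange)
    also have "\<dots> = 0" using elim(1) f by (simp add: inner_add_left dot_square_norm)
    finally have "(v s + c s) \<times> n = 0" .
    with norm_cross_dot[of "v s + c s" n] have "((v s + c s) \<bullet> n)\<^sup>2 = (norm (v s + c s))\<^sup>2" using nn by simp
    then have "\<bar>(v s + c s) \<bullet> n\<bar>\<^sup>2 = (norm (v s + c s))\<^sup>2" by simp
    then have "\<bar>(v s + c s) \<bullet> n\<bar> = norm (v s + c s)" by (rule power2_eq_imp_eq) simp_all
    then show ?case using elim(1) nn by (simp add: geod_curv_def n_def[symmetric] inner_add_left tangent_proj_def)
  qed
qed

definition "subdivision N = map (\<lambda>i. real i * (L / real N)) [0..<Suc N]"

lemma subdivision_nth: "i \<le> N \<Longrightarrow> subdivision N ! i = real i * (L / real N)" and length_subdivision: "length (subdivision N) = Suc N"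
  by (auto simp: subdivision_def simp del: upt_Suc)

text \<open>
  The tangential projection at \<open>c t\<close> instead of \<open>c s\<close> costs at most \<open>|c s - c t| \<le> d\<close>, because \<open>v\<close> and
  \<open>v + c\<close> differ by \<open>c\<close>, whose projection at \<open>c t\<close> is small.
\<close>
lemma second_difference_bound:
  assumes d: "0 < d" and t: "d \<le> t" "t + d \<le> L"
  shows "norm (tangent_proj (c t) (c (t + d) - 2 *\<^sub>R c t + c (t - d))) \<le>
    (LINT s|lebesgue_on {0..L}. hat d t s * (norm (v s + c s) + d))"
proof -
  let ?M = "lebesgue_on {0..L}"
  have ch: "continuous_on {0..L} (hat d t)" unfolding hat_def[abs_def] by (intro continuous_intros)
  have tin: "t \<in> {0..L}" "t + d \<in> {0..L}" "t - d \<in> {0..L}" using d t by auto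
  have "c (t + d) - 2 *\<^sub>R c t + c (t - d) = double_primitive L v (t + d) - 2 *\<^sub>R double_primitive L v t + double_primitive L v (t - d)"
    unfolding sc.rep[OF tin(1)] sc.rep[OF tin(2)] sc.rep[OF tin(3)] scaleR_2 scaleR_left_distrib scaleR_left_diff_distrib by simp
  also have "\<dots> = (LINT s|?M. hat d t s *\<^sub>R v s)" using double_primitive_second_difference[OF sc.v, of d t] d by (simp add: hat_def)
  finally have e: "c (t + d) - 2 *\<^sub>R c t + c (t - d) = (LINT s|?M. hat d t s *\<^sub>R v s)" .
  have hv: "integrable ?M (\<lambda>s. hat d t s *\<^sub>R v s)" by (rule integrable_continuous_scaleR[OF sc.v ch])
  have e2: "tangent_proj (c t) (LINT s|?M. hat d t s *\<^sub>R v s) = (LINT s|?M. tangent_proj (c t) (hat d t s *\<^sub>R v s))"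
    by (rule integral_bounded_linear[OF bounded_linear_tangent_proj hv, symmetric])
  have ip: "integrable ?M (\<lambda>s. tangent_proj (c t) (hat d t s *\<^sub>R v s))"
    by (rule integrable_bounded_linear[OF bounded_linear_tangent_proj hv])
  have k: "integrable ?M (\<lambda>s. v s + c s)" using sc.v c_integrable_on by (rule Bochner_Integration.integrable_add)
  have kd: "integrable ?M (\<lambda>s. norm (v s + c s) + d)"
    using integrable_norm[OF k] finite_measure.integrable_const[OF finite_measure_lebesgue_on_interval]
    by (rule Bochner_Integration.integrable_add)
  have ik: "integrable ?M (\<lambda>s. hat d t s * (norm (v s + c s) + d))"
    using integrable_continuous_scaleR[OF kd ch] by simp
  show ?thesis unfolding e e2
  proof (rule Bochner_Integration.integral_norm_bound_integral[OF ip ik])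
    fix s assume "s \<in> space ?M"
    then have s: "s \<in> {0..L}" by (simp add: space_restrict_space)
    interpret T: bounded_linear "tangent_proj (c t)" by (rule bounded_linear_tangent_proj)
    note nt = norm_tangent_proj_le[OF c_norm[OF tin(1)]]
    show "norm (tangent_proj (c t) (hat d t s *\<^sub>R v s)) \<le> hat d t s * (norm (v s + c s) + d)"
    proof (cases "\<bar>s - t\<bar> < d")
      case True
      have "tangent_proj (c t) (c t) = 0" using c_norm[OF tin(1)] by (simp add: tangent_proj_def dot_square_norm)
      then have "tangent_proj (c t) (v s) = tangent_proj (c t) (v s + c s) - tangent_proj (c t) (c s - c t)"
        by (simp add: T.add T.diff)
      also have "norm \<dots> \<le> norm (v s + c s) + d"
        using nt[of "v s + c s"] nt[of "c s - c t"] c_lipschitz[OF tin(1) s] True by (intro norm_diff_mono) auto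
      finally show ?thesis unfolding T.scaleR norm_scaleR by (simp add: hat_def mult_left_mono)
    qed (simp add: hat_def T.zero)
  qed
qed

end

section \<open>Uniform subdivisions and the upper bound\<close>

context regular_curve
begin

lemma curvature_powr_integrable:
  assumes p: "1 < p" and kp: "integrable (lebesgue_on {0..L}) (\<lambda>s. norm (v s + c s) powr p)"
    and d: "0 \<le> d" "d \<le> 1"
  shows "integrable (lebesgue_on {0..L}) (\<lambda>s. (norm (v s + c s) + d) powr p)"
proof -
  let ?M = "lebesgue_on {0..L}"
  have k: "integrable ?M (\<lambda>s. v s + c s)" using sc.v c_integrable_on by (rule Bochner_Integration.integrable_add)
  have one: "integrable ?M (\<lambda>s. 1 :: real)"
    by (rule finite_measure.integrable_const[OF finite_measure_lebesgue_on_interval])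
  have b: "integrable ?M (\<lambda>s. 2 powr p * (1 + norm (v s + c s) powr p))"
    by (intro Bochner_Integration.integrable_mult_right Bochner_Integration.integrable_add one kp)
  have [measurable]: "(\<lambda>s. v s + c s) \<in> borel_measurable ?M" using k by (rule borel_measurable_integrable)
  show ?thesis
  proof (rule Bochner_Integration.integrable_bound[OF b])
    show "(\<lambda>s. (norm (v s + c s) + d) powr p) \<in> borel_measurable ?M" by measurable
    show "AE s in ?M. norm ((norm (v s + c s) + d) powr p) \<le> norm (2 powr p * (1 + norm (v s + c s) powr p))"
    proof (rule AE_I2)
      fix s
      have "(norm (v s + c s) + d) powr p \<le> (1 + norm (v s + c s)) powr p" using d p by (intro powr_mono2) auto
      also have "\<dots> \<le> 2 powr p * (1 + norm (v s + c s) powr p)" using p by (intro powr_1_plus_le) auto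
      finally show "norm ((norm (v s + c s) + d) powr p) \<le> norm (2 powr p * (1 + norm (v s + c s) powr p))" by simp
    qed
  qed
qed

lemma chord_nearly_isometric:
  assumes \<kappa>: "0 < \<kappa>"
  shows "\<exists>\<delta>>0. \<forall>a b. 0 \<le> a \<longrightarrow> a \<le> b \<longrightarrow> b \<le> L \<longrightarrow> b - a < \<delta> \<longrightarrow> (1 - \<kappa>) * (b - a) \<le> norm (c b - c a)"
proof -
  have "uniformly_continuous_on {0..L} u" using sc.u_continuous by (intro compact_uniformly_continuous) auto
  then obtain \<delta> where \<delta>: "\<delta> > 0" "\<And>s t. s \<in> {0..L} \<Longrightarrow> t \<in> {0..L} \<Longrightarrow> dist t s < \<delta> \<Longrightarrow> dist (u t) (u s) < \<kappa>"
    using \<kappa> unfolding uniformly_continuous_on_def by meson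
  have "(1 - \<kappa>) * (b - a) \<le> norm (c b - c a)" if ab: "0 \<le> a" "a \<le> b" "b \<le> L" "b - a < \<delta>" for a b
  proof -
    have "norm (u s - u a) \<le> \<kappa>" if "s \<in> {a..b}" for s
    proof -
      have "dist (u s) (u a) < \<kappa>" using that ab by (intro \<delta>(2)) (auto simp: dist_real_def)
      then show ?thesis by (simp add: dist_norm)
    qed
    from chord_near_velocity[OF ab(1-3) this]
    have "norm (c b - c a - (b - a) *\<^sub>R u a) \<le> \<kappa> * (b - a)" .
    moreover have "norm ((b - a) *\<^sub>R u a) = b - a" using unit_velocity[of a] ab by simp
    moreover have "norm ((b - a) *\<^sub>R u a) \<le> norm (c b - c a) + norm (c b - c a - (b - a) *\<^sub>R u a)"
      using norm_triangle_sub[of "(b - a) *\<^sub>R u a" "c b - c a"] by (simp only: norm_minus_commute)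
    ultimately show ?thesis by (simp only: left_diff_distrib mult_1)
  qed
  then show ?thesis using \<delta>(1) by blast
qed

lemma subdivision_inscribed:
  assumes N: "N > 0" and ne: "\<And>a b. 0 \<le> a \<Longrightarrow> a < b \<Longrightarrow> b \<le> L \<Longrightarrow> b - a \<le> L / real N \<Longrightarrow> c b \<noteq> c a \<and> c b \<noteq> - c a"
  shows "inscribed c 0 L (subdivision N)" "0 \<le> modulus c (subdivision N)" "modulus c (subdivision N) \<le> L / real N"
proof -
  define d where "d = L / real N"
  have d: "0 < d" "real N * d = L" using N L by (auto simp: d_def)
  note nth = subdivision_nth[of _ N, folded d_def] and len = length_subdivision[of N]
  have ne0: "subdivision N \<noteq> []" using len by (metis list.size(3) nat.distinct(1))
  have tb: "real i * d \<le> L" if "i \<le> N" for i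
    using mult_right_mono[of "real i" "real N" d] that d by simp
  have step: "real (Suc i) * d = real i * d + d" for i by (simp add: distrib_right)
  show ins: "inscribed c 0 L (subdivision N)" unfolding inscribed_def
  proof (intro conjI allI impI ne0)
    show "hd (subdivision N) = 0" unfolding hd_conv_nth[OF ne0] using nth[of 0] by simp
    show "last (subdivision N) = L" unfolding last_conv_nth[OF ne0] len using nth[of N] d by simp
    show "sorted_wrt (<) (subdivision N)"
      unfolding sorted_wrt_iff_nth_less
    proof (intro allI impI)
      fix i j assume "i < j" "j < length (subdivision N)"
      then show "subdivision N ! i < subdivision N ! j" using nth[of i] nth[of j] d by (simp add: len)
    qed
    fix i assume "Suc i < length (subdivision N)"
    then have i: "Suc i \<le> N" "i \<le> N" by (auto simp: len)
    have "c (real (Suc i) * d) \<noteq> c (real i * d) \<and> c (real (Suc i) * d) \<noteq> - c (real i * d)"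
    proof (rule ne)
      show "0 \<le> real i * d" using d by simp
      show "real i * d < real (Suc i) * d" unfolding step using d by simp
      show "real (Suc i) * d \<le> L" by (rule tb[OF i(1)])
      show "real (Suc i) * d - real i * d \<le> L / real N" unfolding step d_def[symmetric] by simp
    qed
    then show "c (subdivision N ! Suc i) \<noteq> c (subdivision N ! i)" "c (subdivision N ! Suc i) \<noteq> - c (subdivision N ! i)"
      unfolding nth[OF i(1)] nth[OF i(2)] by auto
  qed
  have diam: "0 \<le> sphere_diameter (c ` {subdivision N ! i..subdivision N ! Suc i})"
    "sphere_diameter (c ` {subdivision N ! i..subdivision N ! Suc i}) \<le> d" if "i < N" for i
  proof -
    have i: "Suc i \<le> N" "i \<le> N" using that by auto
    define a b where "a = real i * d" and "b = real (Suc i) * d"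
    have ab: "0 \<le> a" "a \<le> b" "b \<le> L" "b - a = d" using d tb[OF i(1)] step[of i] by (auto simp: a_def b_def)
    define S where "S = {sphere_dist x y |x y. x \<in> c ` {a..b} \<and> y \<in> c ` {a..b}}"
    have Sb: "x \<le> d" if xS: "x \<in> S" for x
    proof -
      obtain s t where st: "s \<in> {a..b}" "t \<in> {a..b}" "x = sphere_dist (c s) (c t)" using xS unfolding S_def by blast
      have n: "norm (c s) = 1" "norm (c t) = 1" using st ab by (auto intro!: c_norm)
      show ?thesis
      proof (cases "s \<le> t")
        case True
        then show ?thesis using sphere_dist_le[of s t] st ab by auto
      next
        case False
        then show ?thesis using sphere_dist_le[of t s] st ab sphere_dist_props(4)[OF n] by auto
      qed
    qed
    have "c a \<in> c ` {a..b}" using ab by simp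
    then have "sphere_dist (c a) (c a) \<in> S" unfolding S_def by blast
    then have S0: "0 \<in> S" using sphere_dist_self[OF c_norm[of a]] ab by simp
    have "0 \<le> Sup S" by (rule cSup_upper[OF S0 bdd_aboveI[of S d]]) (rule Sb)
    moreover have "Sup S \<le> d" by (rule cSup_least) (use S0 Sb in auto)
    ultimately show "0 \<le> sphere_diameter (c ` {subdivision N ! i..subdivision N ! Suc i})"
      "sphere_diameter (c ` {subdivision N ! i..subdivision N ! Suc i}) \<le> d"
      unfolding nth[OF i(1)] nth[OF i(2)] sphere_diameter_def a_def[symmetric] b_def[symmetric] S_def[symmetric] by auto
  qed
  have m: "modulus c (subdivision N) = Max ((\<lambda>i. sphere_diameter (c ` {subdivision N ! i..subdivision N ! Suc i})) ` {..<N})"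
    by (simp add: modulus_def len)
  show "0 \<le> modulus c (subdivision N)" unfolding m
    by (rule order_trans[OF diam(1)[of 0] Max_ge]) (use N in auto)
  show "modulus c (subdivision N) \<le> L / real N" unfolding m d_def[symmetric]
    by (rule Max.boundedI) (use N diam(2) in auto)
qed

text \<open>
  The constant \<open>\<kappa>\<close> measures how far the edges are from having length \<open>d\<close>, and the last smallness
  assumption makes all jumps smaller than \<open>\<eta>\<close>, so that the asymptotic form of the corner energy
  applies.  The bound on \<open>m / d\<close> that this needs follows from Jensen's inequality, as each hat is at
  most \<open>d\<close>.
\<close>
lemma subdivision_p_rotation_le:
  assumes p: "1 < p" and kp: "integrable (lebesgue_on {0..L}) (\<lambda>s. norm (v s + c s) powr p)"
    and N: "N > 0" and \<kappa>: "0 < \<kappa>" "\<kappa> < 1 / 2" and \<epsilon>: "0 < \<epsilon>" "(1 - \<kappa>) powr (- (3 * p - 1)) \<le> 1 + \<epsilon>"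
    and \<eta>: "0 < \<eta>" "\<eta> < 1" and corner: "\<And>l \<theta>. 0 < l \<Longrightarrow> l < \<eta> \<Longrightarrow> 0 \<le> \<theta> \<Longrightarrow> \<theta> < pi \<Longrightarrow> 2 * sin (\<theta> / 2) < \<eta> \<Longrightarrow>
      corner_energy p l \<theta> \<le> (1 + \<epsilon>) * ((2 * sin (\<theta> / 2)) powr p / l powr (p - 1))"
    and ins: "inscribed c 0 L (subdivision N)"
    and chord: "\<And>a b. 0 \<le> a \<Longrightarrow> a \<le> b \<Longrightarrow> b \<le> L \<Longrightarrow> b - a \<le> L / real N \<Longrightarrow> (1 - \<kappa>) * (b - a) \<le> norm (c b - c a)"
    and small: "L / real N < \<eta>" "L / real N \<le> 2 * \<kappa>"
      "((L / real N) powr (p - 1) * (LINT s|lebesgue_on {0..L}. (norm (v s + c s) + 1) powr p)) powr (1 / p) / (1 - \<kappa>)\<^sup>2 < \<eta>"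
  shows "p_rotation p (map c (subdivision N)) \<le>
    ennreal ((1 + \<epsilon>) * (1 + \<epsilon>) * (LINT s|lebesgue_on {0..L}. (norm (v s + c s) + L / real N) powr p))"
proof -
  let ?M = "lebesgue_on {0..L}"
  define d where "d = L / real N"
  have "0 < d" "real N * d = L" using N L by (simp_all add: d_def)
  moreover have "d < \<eta>" "d \<le> 2 * \<kappa>" using small(1,2) by (simp_all only: d_def)
  ultimately have d: "0 < d" "real N * d = L" "d < \<eta>" "d \<le> 2 * \<kappa>" "d \<le> 1" using \<eta> by simp_all
  define V where "V = map c (subdivision N)"
  interpret spherical_polygon V unfolding V_def by (rule polygon_inscribed[OF ins])
  have lenV: "length V = Suc N" by (simp add: V_def length_subdivision)
  have Vi: "V ! i = c (real i * d)" if "i \<le> N" for i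
    using that subdivision_nth[OF that] by (simp add: V_def d_def length_subdivision)
  have step: "real (Suc i) * d = real i * d + d" for i by (simp add: distrib_right)
  have tb: "real i * d \<le> L" if "i \<le> N" for i using mult_right_mono[of "real i" "real N" d] that d by simp
  define k1 where "k1 = 1 - \<kappa>"
  have k1: "0 < k1" "k1 < 1" using \<kappa> by (auto simp: k1_def)
  have el: "k1 * d \<le> edge_len V i" "edge_len V i \<le> d" "k1\<^sup>2 * d \<le> sin (edge_len V i)" if i: "i < N" for i
  proof -
    have i': "i \<le> N" "Suc i \<le> N" using i by auto
    define a where "a = real i * d"
    have a: "0 \<le> a" "a + d \<le> L" using d tb[OF i'(2)] step[of i] by (auto simp: a_def)
    have E: "edge_len V i = sphere_dist (c a) (c (a + d))"
      unfolding edge_len_def Vi[OF i'(1)] Vi[OF i'(2)] step a_def ..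
    have n: "norm (c a) = 1" "norm (c (a + d)) = 1" using a d by (auto intro!: c_norm)
    have "k1 * d \<le> norm (c (a + d) - c a)" using chord[of a "a + d"] a d by (simp add: k1_def d_def)
    also have "\<dots> \<le> edge_len V i" unfolding E using chord_le_sphere_dist[OF n] by (simp add: norm_minus_commute)
    finally show e1: "k1 * d \<le> edge_len V i" .
    show e2: "edge_len V i \<le> d" unfolding E using sphere_dist_le[of a "a + d"] a d by simp
    have e0: "0 \<le> edge_len V i" using e1 k1 d by (meson mult_nonneg_nonneg order_trans less_imp_le)
    have "k1\<^sup>2 * d = k1 * (k1 * d)" by (simp add: power2_eq_square)
    also have "\<dots> \<le> (1 - edge_len V i / 2) * edge_len V i"
      by (rule mult_mono) (use e1 e2 d k1 in \<open>auto simp: k1_def\<close>)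
    also have "\<dots> = edge_len V i - (edge_len V i)\<^sup>2 / 2" by (simp add: power2_eq_square algebra_simps)
    also have "\<dots> \<le> sin (edge_len V i)" by (rule sin_ge_minus_square[OF e0])
    finally show "k1\<^sup>2 * d \<le> sin (edge_len V i)" .
  qed
  define g where "g s = norm (v s + c s) + d" for s
  have k: "integrable ?M (\<lambda>s. v s + c s)" using sc.v c_integrable_on by (rule Bochner_Integration.integrable_add)
  have gi: "integrable ?M g" unfolding g_def
    using integrable_norm[OF k] finite_measure.integrable_const[OF finite_measure_lebesgue_on_interval]
    by (rule Bochner_Integration.integrable_add)
  have gp: "integrable ?M (\<lambda>s. g s powr p)" unfolding g_def by (rule curvature_powr_integrable[OF p kp]) (use d in auto)
  have g0: "0 \<le> g s" for s using d by (simp add: g_def)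
  define G where "G = (LINT s|?M. (norm (v s + c s) + 1) powr p)"
  have gG: "(LINT s|?M. g s powr p) \<le> G" unfolding G_def
  proof (rule integral_mono[OF gp])
    show "integrable ?M (\<lambda>s. (norm (v s + c s) + 1) powr p)" by (rule curvature_powr_integrable[OF p kp]) auto
    show "g s powr p \<le> (norm (v s + c s) + 1) powr p" for s unfolding g_def using d p by (intro powr_mono2) auto
  qed
  define J where "J i = (LINT s|?M. hat d (real i * d) s * g s powr p) / d" for i
  have ch: "continuous_on {0..L} (hat d t)" for t unfolding hat_def[abs_def] by (intro continuous_intros)
  have hi: "integrable ?M (\<lambda>s. hat d t s * g s powr p)" for t using integrable_continuous_scaleR[OF gp ch] by simp
  have corner_le: "(if turning_angle V i = pi then \<infinity> else ennreal (corner_energy p (corner_len V i) (turning_angle V i))) \<le>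
      ennreal ((1 + \<epsilon>) * (1 + \<epsilon>) * J i)" if "i \<in> {1..<length V - 1}" for i
  proof -
    have i: "1 \<le> i" "i < length V - 1" using that by auto
    then have iN: "i < N" "i - 1 < N" "Suc i \<le> N" "i - 1 \<le> N" "i \<le> N" by (auto simp: lenV)
    define t where "t = real i * d"
    have t: "d \<le> t" "t + d \<le> L" 
      using mult_right_mono[of 1 "real i" d] i d tb[OF iN(3)] step[of i] by (auto simp: t_def)
    have V1: "V ! (i + 1) = c (t + d)" "V ! i = c t" "V ! (i - 1) = c (t - d)"
    proof -
      show "V ! (i + 1) = c (t + d)" using Vi[OF iN(3)] step[of i] by (simp add: t_def)
      show "V ! i = c t" using Vi[OF iN(5)] by (simp add: t_def)
      have "real (i - 1) * d = t - d" using i step[of "i - 1"] by (simp add: t_def)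
      then show "V ! (i - 1) = c (t - d)" using Vi[OF iN(4)] by simp
    qed
    define m where "m = (LINT s|?M. hat d t s * g s)"
    note HJ = hat_jensen[OF p d(1) t gi gp g0, folded m_def]
    have m0: "0 \<le> m" by (rule HJ(1))
    have Jm: "(m / d) powr p / d powr (p - 1) \<le> J i" using HJ(2) by (simp add: J_def t_def)
    have sd: "norm (tangent_proj (V ! i) (V ! (i + 1) - 2 *\<^sub>R V ! i + V ! (i - 1))) \<le> m"
      unfolding V1 m_def g_def by (rule second_difference_bound[OF d(1) t])
    define j where "j = norm (jump i)"
    have j0: "0 \<le> j" by (simp add: j_def)
    have "(k1\<^sup>2 * d * j)\<^sup>2 = (k1\<^sup>2 * d) * (k1\<^sup>2 * d) * j\<^sup>2" by (simp add: power2_eq_square)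
    also have "\<dots> \<le> sin (edge_len V (i - 1)) * sin (edge_len V i) * j\<^sup>2"
    proof (rule mult_right_mono[OF mult_mono])
      show "k1\<^sup>2 * d \<le> sin (edge_len V (i - 1))" by (rule el(3)[OF iN(2)])
      show "k1\<^sup>2 * d \<le> sin (edge_len V i)" by (rule el(3)[OF iN(1)])
      show "0 \<le> sin (edge_len V (i - 1))" using el(3)[OF iN(2)] d k1 by (meson mult_nonneg_nonneg order_trans less_imp_le zero_le_power2)
      show "0 \<le> k1\<^sup>2 * d" "0 \<le> j\<^sup>2" using d by auto
    qed
    also have "\<dots> \<le> (norm (tangent_proj (V ! i) (V ! (i + 1) - 2 *\<^sub>R V ! i + V ! (i - 1))))\<^sup>2"
      unfolding j_def by (rule jump_le_second_difference[OF i])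
    also have "\<dots> \<le> m\<^sup>2" by (rule power_mono[OF sd]) simp
    finally have "k1\<^sup>2 * d * j \<le> m" by (rule power2_le_imp_le[OF _ m0])
    then have "j * (k1\<^sup>2 * d) \<le> m" by (simp only: mult.commute)
    then have "j \<le> m / (k1\<^sup>2 * d)" using d k1 by (subst pos_le_divide_eq) auto
    then have jm: "j \<le> (m / d) / k1\<^sup>2" by (simp add: mult.commute)
    have "J i \<le> (LINT s|?M. g s powr p)"
    proof -
      have "(LINT s|?M. hat d (real i * d) s * g s powr p) \<le> (LINT s|?M. d * g s powr p)"
      proof (rule integral_mono[OF hi])
        show "integrable ?M (\<lambda>s. d * g s powr p)" using gp by simp
        show "hat d (real i * d) s * g s powr p \<le> d * g s powr p" for s
          by (rule mult_right_mono) (use d in \<open>auto simp: hat_def\<close>)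
      qed
      then have "(LINT s|?M. hat d (real i * d) s * g s powr p) / d \<le> (LINT s|?M. d * g s powr p) / d"
        using d by (intro divide_right_mono) auto
      then show ?thesis using d by (simp add: J_def)
    qed
    then have "(m / d) powr p / d powr (p - 1) \<le> G" using Jm gG by linarith
    then have "(m / d) powr p \<le> d powr (p - 1) * G" using d by (simp add: pos_divide_le_eq mult.commute)
    then have "((m / d) powr p) powr (1 / p) \<le> (d powr (p - 1) * G) powr (1 / p)" using p by (intro powr_mono2) auto
    then have "m / d \<le> (d powr (p - 1) * G) powr (1 / p)" using p m0 d by (simp add: powr_powr)
    then have "(m / d) / k1\<^sup>2 \<le> (d powr (p - 1) * G) powr (1 / p) / k1\<^sup>2" by (rule divide_right_mono) simp
    also have "\<dots> < \<eta>" using small(3) by (simp only: d_def G_def k1_def)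
    finally have j\<eta>: "j < \<eta>" using jm by linarith
    define \<theta> where "\<theta> = turning_angle V i"
    note th = turning_angle_props[OF i, folded \<theta>_def j_def]
    have "\<theta> \<noteq> pi" using th(3) j\<eta> \<eta> by auto
    then have \<theta>: "0 \<le> \<theta>" "\<theta> < pi" using th by auto
    define l where "l = corner_len V i"
    have l: "0 < l" "k1 * d \<le> l" "l < \<eta>"
    proof -
      show "0 < l" using corner_len_props[OF i] by (simp add: l_def)
      show "k1 * d \<le> l" using el(1)[OF iN(1)] el(1)[OF iN(2)] by (simp add: l_def corner_len_def)
      show "l < \<eta>" using corner_len_props(4)[OF i] el(2)[OF iN(1)] d by (simp add: l_def)
    qed
    have "corner_energy p l \<theta> \<le> (1 + \<epsilon>) * (j powr p / l powr (p - 1))"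
      using corner[OF l(1,3) \<theta>] th(3) j\<eta> by simp
    also have "\<dots> \<le> (1 + \<epsilon>) * (((m / d) / k1\<^sup>2) powr p / (k1 * d) powr (p - 1))"
    proof (rule mult_left_mono[OF frac_le])
      show "j powr p \<le> ((m / d) / k1\<^sup>2) powr p" using jm j0 p by (intro powr_mono2) auto
      show "(k1 * d) powr (p - 1) \<le> l powr (p - 1)" using l k1 d p by (intro powr_mono2) auto
    qed (use k1 d \<epsilon> in auto)
    also have "((m / d) / k1\<^sup>2) powr p / (k1 * d) powr (p - 1) = k1 powr (- (3 * p - 1)) * ((m / d) powr p / d powr (p - 1))"
    proof -
      have a: "((m / d) / k1\<^sup>2) powr p = (m / d) powr p / k1 powr (2 * p)"
      proof -
        have "((m / d) / k1\<^sup>2) powr p = (m / d) powr p / (k1\<^sup>2) powr p" by (rule powr_divide)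
        moreover have "k1\<^sup>2 = k1 powr 2" using k1 by simp
        ultimately show ?thesis by (simp only: powr_powr)
      qed
      have b: "(k1 * d) powr (p - 1) = k1 powr (p - 1) * d powr (p - 1)" by (rule powr_mult)
      have "k1 powr (2 * p) * k1 powr (p - 1) = k1 powr (3 * p - 1)" by (simp add: powr_add[symmetric])
      then have "k1 powr (- (3 * p - 1)) = 1 / (k1 powr (2 * p) * k1 powr (p - 1))" by (simp only: powr_minus_divide)
      then show ?thesis unfolding a b by simp
    qed
    also have "(1 + \<epsilon>) * (k1 powr (- (3 * p - 1)) * ((m / d) powr p / d powr (p - 1))) \<le> (1 + \<epsilon>) * ((1 + \<epsilon>) * J i)"
    proof (intro mult_left_mono mult_mono)
      show "k1 powr (- (3 * p - 1)) \<le> 1 + \<epsilon>" using \<epsilon>(2) by (simp only: k1_def)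
    qed (use \<epsilon> Jm in auto)
    finally have "corner_energy p l \<theta> \<le> (1 + \<epsilon>) * (1 + \<epsilon>) * J i" by (simp only: mult.assoc)
    then show ?thesis using \<theta> unfolding \<theta>_def[symmetric] l_def[symmetric] by (simp add: ennreal_leI)
  qed
  have J0: "0 \<le> J i" for i unfolding J_def using d
    by (intro divide_nonneg_pos integral_nonneg_AE AE_I2 mult_nonneg_nonneg) (auto simp: hat_def)
  have "p_rotation p V \<le> (\<Sum>i = 1..<length V - 1. ennreal ((1 + \<epsilon>) * (1 + \<epsilon>) * J i))"
    unfolding p_rotation_corner_energy by (rule sum_mono) (rule corner_le)
  also have "\<dots> = ennreal (\<Sum>i = 1..<length V - 1. (1 + \<epsilon>) * (1 + \<epsilon>) * J i)"
    using J0 \<epsilon> by (intro sum_ennreal) auto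
  also have "\<dots> \<le> ennreal ((1 + \<epsilon>) * (1 + \<epsilon>) * (LINT s|?M. g s powr p))"
  proof (rule ennreal_leI)
    have "(\<Sum>i = 1..<length V - 1. J i) = (LINT s|?M. (\<Sum>i = 1..<length V - 1. hat d (real i * d) s * g s powr p)) / d"
      unfolding J_def sum_divide_distrib[symmetric] by (subst Bochner_Integration.integral_sum) (auto intro: hi)
    also have "\<dots> \<le> (LINT s|?M. d * g s powr p) / d"
    proof (rule divide_right_mono[OF integral_mono])
      show "integrable ?M (\<lambda>s. \<Sum>i = 1..<length V - 1. hat d (real i * d) s * g s powr p)"
        by (intro Bochner_Integration.integrable_sum hi)
      show "integrable ?M (\<lambda>s. d * g s powr p)" using gp by simp
      show "(\<Sum>i = 1..<length V - 1. hat d (real i * d) s * g s powr p) \<le> d * g s powr p" for s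
        unfolding sum_distrib_right[symmetric] by (rule mult_right_mono[OF hat_sum_le[OF d(1)]]) auto
    qed (use d in auto)
    also have "\<dots> = (LINT s|?M. g s powr p)" using d by simp
    finally have "(\<Sum>i = 1..<length V - 1. J i) \<le> (LINT s|?M. g s powr p)" .
    then show "(\<Sum>i = 1..<length V - 1. (1 + \<epsilon>) * (1 + \<epsilon>) * J i) \<le> (1 + \<epsilon>) * (1 + \<epsilon>) * (LINT s|?M. g s powr p)"
      unfolding sum_distrib_left[symmetric] using \<epsilon> by (intro mult_left_mono) auto
  qed
  finally show ?thesis unfolding V_def g_def d_def .
qed

lemma subdivision_eventually:
  assumes p: "1 < p" and kp: "integrable (lebesgue_on {0..L}) (\<lambda>s. norm (v s + c s) powr p)" and \<epsilon>: "0 < \<epsilon>"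
  shows "\<forall>\<^sub>F N in sequentially. inscribed c 0 L (subdivision N) \<and> 0 \<le> modulus c (subdivision N) \<and>
    modulus c (subdivision N) \<le> L / real N \<and>
    p_rotation p (map c (subdivision N)) \<le>
      ennreal ((1 + \<epsilon>) * (1 + \<epsilon>) * (LINT s|lebesgue_on {0..L}. (norm (v s + c s) + L / real N) powr p))"
proof -
  obtain \<eta> where \<eta>: "0 < \<eta>" "\<eta> < 1" and corner: "\<And>l \<theta>. 0 < l \<Longrightarrow> l < \<eta> \<Longrightarrow> 0 \<le> \<theta> \<Longrightarrow> \<theta> < pi \<Longrightarrow> 2 * sin (\<theta> / 2) < \<eta> \<Longrightarrow>
      corner_energy p l \<theta> \<le> (1 + \<epsilon>) * ((2 * sin (\<theta> / 2)) powr p / l powr (p - 1))"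
    using corner_energy_upper[OF p \<epsilon>] by blast
  have "((\<lambda>x. (1 - x) powr (- (3 * p - 1))) \<longlongrightarrow> (1 - 0) powr (- (3 * p - 1))) (at_right 0)"
    by (intro tendsto_intros) auto
  then have "\<forall>\<^sub>F x in at_right 0. (1 - x) powr (- (3 * p - 1)) < 1 + \<epsilon>"
    using \<epsilon> by (intro order_tendstoD(2)) auto
  moreover have "\<forall>\<^sub>F x::real in at_right 0. x \<in> {0<..<1 / 2}" by (rule eventually_at_right_real) simp
  ultimately have "\<forall>\<^sub>F x in at_right 0. (1 - x) powr (- (3 * p - 1)) < 1 + \<epsilon> \<and> x \<in> {0<..<1 / 2}"
    by (rule eventually_conj)
  then obtain \<kappa> :: real where \<kappa>: "(1 - \<kappa>) powr (- (3 * p - 1)) < 1 + \<epsilon>" "\<kappa> < 1 / 2" "0 < \<kappa>"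
    using eventually_happens[of _ "at_right (0::real)"] by force
  obtain \<delta>1 where \<delta>1: "\<delta>1 > 0" "\<And>a b. 0 \<le> a \<Longrightarrow> a \<le> b \<Longrightarrow> b \<le> L \<Longrightarrow> b - a < \<delta>1 \<Longrightarrow> (1 - \<kappa>) * (b - a) \<le> norm (c b - c a)"
    using chord_nearly_isometric[OF \<kappa>(3)] by blast
  obtain \<delta>2 where \<delta>2: "\<delta>2 > 0" "\<And>s t. 0 \<le> s \<Longrightarrow> s \<le> t \<Longrightarrow> t \<le> L \<Longrightarrow> t - s < \<delta>2 \<Longrightarrow> c t \<noteq> - c s"
    using locally_nonantipodal by blast
  define G where "G = (LINT s|lebesgue_on {0..L}. (norm (v s + c s) + 1) powr p)"
  have G0: "0 \<le> G" unfolding G_def by (intro integral_nonneg_AE AE_I2) auto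
  have dl: "(\<lambda>N. L / real N) \<longlonglongrightarrow> 0" by (rule lim_const_over_n)
  have "(\<lambda>N. (L / real N) powr (p - 1)) \<longlonglongrightarrow> 0"
    by (rule tendsto_zero_powrI[OF dl tendsto_const]) (use p L in auto)
  then have "(\<lambda>N. (L / real N) powr (p - 1) * G) \<longlonglongrightarrow> 0" by (rule tendsto_mult_left_zero)
  then have "(\<lambda>N. ((L / real N) powr (p - 1) * G) powr (1 / p)) \<longlonglongrightarrow> 0"
    by (rule tendsto_zero_powrI[OF _ tendsto_const]) (use p G0 in auto)
  then have "(\<lambda>N. ((L / real N) powr (p - 1) * G) powr (1 / p) / (1 - \<kappa>)\<^sup>2) \<longlonglongrightarrow> 0 / (1 - \<kappa>)\<^sup>2"
    by (intro tendsto_divide tendsto_const) (use \<kappa> in auto)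
  then have e1: "\<forall>\<^sub>F N in sequentially. ((L / real N) powr (p - 1) * G) powr (1 / p) / (1 - \<kappa>)\<^sup>2 < \<eta>"
    using \<eta> by (intro order_tendstoD(2)) auto
  have "0 < min (min \<delta>1 \<delta>2) (min \<eta> (2 * \<kappa>))" using \<delta>1 \<delta>2 \<eta> \<kappa> by auto
  with dl have e2: "\<forall>\<^sub>F N in sequentially. L / real N < min (min \<delta>1 \<delta>2) (min \<eta> (2 * \<kappa>))" by (rule order_tendstoD(2))
  show ?thesis using e1 e2 eventually_gt_at_top[of 0]
  proof eventually_elim
    case (elim N)
    have lt: "L / real N < \<delta>1" "L / real N < \<delta>2" "L / real N < \<eta>" "L / real N < 2 * \<kappa>" using elim(2) by auto
    have ch: "(1 - \<kappa>) * (b - a) \<le> norm (c b - c a)" if "0 \<le> a" "a \<le> b" "b \<le> L" "b - a \<le> L / real N" for a b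
      by (rule \<delta>1(2)) (use that lt in auto)
    have ne: "c b \<noteq> c a \<and> c b \<noteq> - c a" if ab: "0 \<le> a" "a < b" "b \<le> L" "b - a \<le> L / real N" for a b
    proof
      have "0 < (1 - \<kappa>) * (b - a)" using \<kappa> ab by simp
      then have "0 < norm (c b - c a)" using ch[of a b] ab by linarith
      then show "c b \<noteq> c a" by auto
      show "c b \<noteq> - c a" by (rule \<delta>2(2)) (use ab lt in auto)
    qed
    note I = subdivision_inscribed[OF elim(3) ne]
    have "p_rotation p (map c (subdivision N)) \<le>
      ennreal ((1 + \<epsilon>) * (1 + \<epsilon>) * (LINT s|lebesgue_on {0..L}. (norm (v s + c s) + L / real N) powr p))"
      by (rule subdivision_p_rotation_le[OF p kp elim(3) \<kappa>(3,2) \<epsilon> less_imp_le[OF \<kappa>(1)] \<eta> corner I(1) ch lt(3) less_imp_le[OF lt(4)] elim(1)[unfolded G_def]])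
    then show ?case using I by blast
  qed
qed

text \<open>
  The shift by \<open>d\<close> in \<open>(|k| + d)\<^sup>p\<close> disappears in the limit by dominated convergence.
\<close>
lemma p_curvature_upper:
  assumes p: "1 < p" and kp: "integrable (lebesgue_on {0..L}) (\<lambda>s. norm (v s + c s) powr p)"
  shows "p_curvature p c L \<le> ennreal (LINT s|lebesgue_on {0..L}. norm (v s + c s) powr p)"
proof (rule ennreal_le_epsilon)
  let ?M = "lebesgue_on {0..L}"
  define E where "E = (LINT s|?M. norm (v s + c s) powr p)"
  have E0: "0 \<le> E" unfolding E_def by (intro integral_nonneg_AE AE_I2) auto
  fix \<omega> :: real assume \<omega>: "0 < \<omega>"
  have "((\<lambda>x. (1 + x) * (1 + x) * (E + x)) \<longlongrightarrow> (1 + 0) * (1 + 0) * (E + 0)) (at_right 0)"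
    by (intro tendsto_intros)
  then have "\<forall>\<^sub>F x in at_right 0. (1 + x) * (1 + x) * (E + x) < E + \<omega>" using \<omega> by (intro order_tendstoD(2)) auto
  with eventually_at_right_less[of "0::real"] have "\<forall>\<^sub>F x in at_right 0. 0 < x \<and> (1 + x) * (1 + x) * (E + x) < E + \<omega>"
    by (rule eventually_conj)
  then obtain \<epsilon> where \<epsilon>: "0 < \<epsilon>" "(1 + \<epsilon>) * (1 + \<epsilon>) * (E + \<epsilon>) < E + \<omega>"
    using eventually_happens[of _ "at_right (0::real)"] by force
  \<comment> \<open>From \<open>N1\<close> on the step is at most 1, so that \<open>(|k| + 1)\<^sup>p\<close> dominates.\<close>
  obtain N1 where N1: "L < real N1" using reals_Archimedean2 by blast
  have small: "L / real (n + N1) \<le> 1" "0 \<le> L / real (n + N1)" for n using N1 L by (auto simp: divide_le_eq)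
  have "(\<lambda>n. LINT s|?M. (norm (v s + c s) + L / real (n + N1)) powr p) \<longlonglongrightarrow> E"
    unfolding E_def
  proof (rule integral_dominated_convergence[where w="\<lambda>s. (norm (v s + c s) + 1) powr p"])
    show "(\<lambda>s. norm (v s + c s) powr p) \<in> borel_measurable ?M" using kp by (rule borel_measurable_integrable)
    show "(\<lambda>s. (norm (v s + c s) + L / real (n + N1)) powr p) \<in> borel_measurable ?M" for n
      by (rule borel_measurable_integrable[OF curvature_powr_integrable[OF p kp small(2,1)]])
    show "integrable ?M (\<lambda>s. (norm (v s + c s) + 1) powr p)" by (rule curvature_powr_integrable[OF p kp]) auto
    show "AE s in ?M. norm ((norm (v s + c s) + L / real (n + N1)) powr p) \<le> (norm (v s + c s) + 1) powr p" for n
    proof (rule AE_I2)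
      fix s
      have "(norm (v s + c s) + L / real (n + N1)) powr p \<le> (norm (v s + c s) + 1) powr p"
        by (rule powr_mono2) (use p small[of n] in \<open>auto intro: add_nonneg_nonneg\<close>)
      then show "norm ((norm (v s + c s) + L / real (n + N1)) powr p) \<le> (norm (v s + c s) + 1) powr p" by simp
    qed
    show "AE s in ?M. (\<lambda>n. (norm (v s + c s) + L / real (n + N1)) powr p) \<longlonglongrightarrow> norm (v s + c s) powr p"
    proof (rule AE_I2)
      fix s
      have "(\<lambda>n. L / real (n + N1)) \<longlonglongrightarrow> 0" using LIMSEQ_ignore_initial_segment[OF lim_const_over_n[of L], of N1] by simp
      then have "(\<lambda>n. norm (v s + c s) + L / real (n + N1)) \<longlonglongrightarrow> norm (v s + c s) + 0" by (intro tendsto_intros)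
      then have "(\<lambda>n. norm (v s + c s) + L / real (n + N1)) \<longlonglongrightarrow> norm (v s + c s)" by simp
      then show "(\<lambda>n. (norm (v s + c s) + L / real (n + N1)) powr p) \<longlonglongrightarrow> norm (v s + c s) powr p"
        by (rule tendsto_powr'[OF _ tendsto_const]) (use p small in \<open>auto intro!: always_eventually add_nonneg_nonneg\<close>)
    qed
  qed
  then have lim: "(\<lambda>n. LINT s|?M. (norm (v s + c s) + L / real n) powr p) \<longlonglongrightarrow> E" by (rule LIMSEQ_offset)
  have "\<forall>\<^sub>F n in sequentially. (LINT s|?M. (norm (v s + c s) + L / real n) powr p) < E + \<epsilon>"
    using lim \<epsilon> by (intro order_tendstoD(2)) auto
  with subdivision_eventually[OF p kp \<epsilon>(1)]
  have "\<forall>\<^sub>F N in sequentially. inscribed c 0 L (subdivision N) \<and> 0 \<le> modulus c (subdivision N) \<and>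
    modulus c (subdivision N) \<le> L / real N \<and> p_rotation p (map c (subdivision N)) \<le> ennreal (E + \<omega>)"
  proof eventually_elim
    case (elim N)
    have "(1 + \<epsilon>) * (1 + \<epsilon>) * (LINT s|?M. (norm (v s + c s) + L / real N) powr p) \<le> (1 + \<epsilon>) * (1 + \<epsilon>) * (E + \<epsilon>)"
      using elim(2) \<epsilon> by (intro mult_left_mono) auto
    also have "\<dots> \<le> E + \<omega>" using \<epsilon> by simp
    finally have "ennreal ((1 + \<epsilon>) * (1 + \<epsilon>) * (LINT s|?M. (norm (v s + c s) + L / real N) powr p)) \<le> ennreal (E + \<omega>)"
      by (rule ennreal_leI)
    then show ?case using elim(1) order_trans by blast
  qed
  then obtain N0 where N0: "\<And>N. N \<ge> N0 \<Longrightarrow> inscribed c 0 L (subdivision N) \<and> 0 \<le> modulus c (subdivision N) \<and>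
    modulus c (subdivision N) \<le> L / real N \<and> p_rotation p (map c (subdivision N)) \<le> ennreal (E + \<omega>)"
    unfolding eventually_sequentially by blast
  define P where "P h = subdivision (h + N0)" for h
  have P: "inscribed c 0 L (P h)" "0 \<le> modulus c (P h)" "modulus c (P h) \<le> L / real (h + N0)"
    "p_rotation p (map c (P h)) \<le> ennreal (E + \<omega>)" for h
    using N0[of "h + N0"] unfolding P_def by (simp_all only: le_add2 simp_thms)
  have "(\<lambda>h. modulus c (P h)) \<longlonglongrightarrow> 0"
  proof (rule tendsto_sandwich)
    show "\<forall>\<^sub>F h in sequentially. 0 \<le> modulus c (P h)" by (intro always_eventually allI P)
    show "\<forall>\<^sub>F h in sequentially. modulus c (P h) \<le> L / real (h + N0)" by (intro always_eventually allI P)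
    show "(\<lambda>h. L / real (h + N0)) \<longlonglongrightarrow> 0" by (rule LIMSEQ_ignore_initial_segment[OF lim_const_over_n])
  qed simp
  then have "P \<in> {P. (\<forall>h. inscribed c 0 L (P h)) \<and> (\<lambda>h. modulus c (P h)) \<longlonglongrightarrow> 0}" using P(1) by blast
  then have "p_curvature p c L \<le> liminf (\<lambda>h. p_rotation p (map c (P h)))" unfolding p_curvature_def by (rule INF_lower)
  also have "\<dots> \<le> ennreal (E + \<omega>)" by (rule Liminf_le) (simp, intro always_eventually allI P)
  also have "\<dots> = ennreal E + ennreal \<omega>" using E0 \<omega> by simp
  finally show "p_curvature p c L \<le> ennreal E + ennreal \<omega>" .
qed

end

section \<open>The p-curvature functional and the Sobolev class\<close>

lemma Lp_imp_integrable:
  assumes p: "1 < p" and v: "v \<in> Lp_space p a b"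
  shows "integrable (lebesgue_on {a..b}) v"
proof -
  have vm: "v \<in> borel_measurable (lebesgue_on {a..b})" and vp: "integrable (lebesgue_on {a..b}) (\<lambda>s. norm (v s) powr p)"
    using v by (auto simp: Lp_space_def)
  have one: "integrable (lebesgue_on {a..b}) (\<lambda>s. 1 :: real)"
    by (rule finite_measure.integrable_const[OF finite_measure_lebesgue_on_interval])
  show ?thesis
  proof (rule Bochner_Integration.integrable_bound[OF Bochner_Integration.integrable_add[OF one vp] vm], rule AE_I2)
    fix s
    have "norm (v s) \<le> 1 + norm (v s) powr p"
    proof (cases "norm (v s) \<le> 1")
      case False
      then have "norm (v s) powr 1 \<le> norm (v s) powr p" using p by (intro powr_mono) auto
      then show ?thesis using False by simp
    qed (simp add: add_increasing2)
    then show "norm (v s) \<le> norm (1 + norm (v s) powr p)" by simp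
  qed
qed

lemma powr_norm_add_unit_integrable:
  fixes v w :: "real \<Rightarrow> real^3"
  assumes p: "1 < p" and v: "integrable (lebesgue_on {a..b}) v" "integrable (lebesgue_on {a..b}) (\<lambda>s. norm (v s) powr p)"
    and w: "w \<in> borel_measurable (lebesgue_on {a..b})" "\<And>s. s \<in> {a..b} \<Longrightarrow> norm (w s) \<le> 1"
  shows "integrable (lebesgue_on {a..b}) (\<lambda>s. norm (v s + w s) powr p)"
proof -
  have one: "integrable (lebesgue_on {a..b}) (\<lambda>s. 1 :: real)"
    by (rule finite_measure.integrable_const[OF finite_measure_lebesgue_on_interval])
  have i: "integrable (lebesgue_on {a..b}) (\<lambda>s. 2 powr p * (1 + norm (v s) powr p))"
    by (intro Bochner_Integration.integrable_mult_right Bochner_Integration.integrable_add one v)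
  have [measurable]: "v \<in> borel_measurable (lebesgue_on {a..b})" using v(1) by (rule borel_measurable_integrable)
  note w(1)[measurable]
  show ?thesis
  proof (rule Bochner_Integration.integrable_bound[OF i])
    show "(\<lambda>s. norm (v s + w s) powr p) \<in> borel_measurable (lebesgue_on {a..b})" by measurable
    show "AE s in lebesgue_on {a..b}. norm (norm (v s + w s) powr p) \<le> norm (2 powr p * (1 + norm (v s) powr p))"
    proof (rule AE_I2)
      fix s assume "s \<in> space (lebesgue_on {a..b})"
      then have "norm (w s) \<le> 1" by (intro w(2)) (simp add: space_restrict_space)
      then have "norm (v s + w s) \<le> 1 + norm (v s)" using norm_triangle_ineq[of "v s" "w s"] by linarith
      then have "norm (v s + w s) powr p \<le> (1 + norm (v s)) powr p" using p by (intro powr_mono2) auto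
      also have "\<dots> \<le> 2 powr p * (1 + norm (v s) powr p)" using p by (intro powr_1_plus_le) auto
      finally show "norm (norm (v s + w s) powr p) \<le> norm (2 powr p * (1 + norm (v s) powr p))" by simp
    qed
  qed
qed

context unit_speed_curve
begin

lemma c_measurable: "c \<in> borel_measurable (lebesgue_on {0..L})"
  using c_integrable_on by (rule borel_measurable_integrable)

text \<open>
  A limes inferior below \<open>K\<close> provides polygonals of rotation at most \<open>K\<close> and arbitrarily small
  modulus.
\<close>
lemma finite_p_curvature_imp_acceleration:
  assumes p: "1 < p" and fin: "p_curvature p c L < ennreal K" and K: "0 \<le> K"
  shows "\<exists>A B v. integrable (lebesgue_on {0..L}) v \<and> (\<forall>t\<in>{0..L}. c t = A + t *\<^sub>R B + double_primitive L v t) \<and>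
    integrable (lebesgue_on {0..L}) (\<lambda>s. norm (v s + c s) powr p) \<and> (LINT s|lebesgue_on {0..L}. norm (v s + c s) powr p) \<le> K"
proof (rule second_derivative_from_polygons[OF p K])
  obtain P where P: "\<And>h. inscribed c 0 L (P h)" "(\<lambda>h. modulus c (P h)) \<longlonglongrightarrow> 0"
    "liminf (\<lambda>h. p_rotation p (map c (P h))) < ennreal K"
    using fin unfolding p_curvature_def INF_less_iff by blast
  fix \<epsilon> :: real assume "0 < \<epsilon>"
  with P(2) have m: "\<forall>\<^sub>F h in sequentially. modulus c (P h) < \<epsilon>" by (rule order_tendstoD(2))
  have "\<not> (\<forall>\<^sub>F h in sequentially. ennreal K < p_rotation p (map c (P h)))"
  proof
    assume "\<forall>\<^sub>F h in sequentially. ennreal K < p_rotation p (map c (P h))"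
    then have "\<forall>\<^sub>F h in sequentially. ennreal K \<le> p_rotation p (map c (P h))" by eventually_elim (rule less_imp_le)
    then have "ennreal K \<le> liminf (\<lambda>h. p_rotation p (map c (P h)))" by (rule Liminf_bounded)
    then show False using P(3) by simp
  qed
  then have "\<exists>\<^sub>F h in sequentially. p_rotation p (map c (P h)) \<le> ennreal K" by (simp add: frequently_def not_le)
  then have "\<exists>\<^sub>F h in sequentially. modulus c (P h) < \<epsilon> \<and> p_rotation p (map c (P h)) \<le> ennreal K"
    using m by (rule frequently_eventually_conj)
  then obtain h where "modulus c (P h) < \<epsilon> \<and> p_rotation p (map c (P h)) \<le> ennreal K" by (rule frequentlyE)
  then show "\<exists>ts. inscribed c 0 L ts \<and> modulus c ts < \<epsilon> \<and> p_rotation p (map c ts) \<le> ennreal K" using P(1) by blast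
qed

lemma Sobolev_sphere_imp_acceleration:
  assumes p: "1 < p" and W: "c \<in> Sobolev_sphere 2 p 0 L"
  shows "\<exists>A B v. integrable (lebesgue_on {0..L}) v \<and> (\<forall>t\<in>{0..L}. c t = A + t *\<^sub>R B + double_primitive L v t) \<and>
    integrable (lebesgue_on {0..L}) (\<lambda>s. norm (v s + c s) powr p)"
proof -
  obtain v where v: "v \<in> Lp_space p 0 L" "has_weak_derivative 0 L 2 c v"
  proof -
    have "\<forall>j\<in>{1..2::nat}. \<exists>v\<in>Lp_space p 0 L. has_weak_derivative 0 L j c v"
      using W unfolding Sobolev_sphere_def Sobolev_def by blast
    from bspec[OF this, of 2] show ?thesis using that by auto
  qed
  have vi: "integrable (lebesgue_on {0..L}) v" by (rule Lp_imp_integrable[OF p v(1)])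
  have vp: "integrable (lebesgue_on {0..L}) (\<lambda>s. norm (v s) powr p)" using v(1) by (simp add: Lp_space_def)
  have "integrable (lebesgue_on {0..L}) (\<lambda>s. norm (v s + c s) powr p)"
    by (rule powr_norm_add_unit_integrable[OF p vi vp c_measurable]) (simp add: c_norm)
  then show ?thesis using second_weak_derivative_imp_double_primitive[OF L c_cont vi v(2)] vi by blast
qed

lemma acceleration_imp_Sobolev_sphere:
  assumes p: "1 < p" and v: "integrable (lebesgue_on {0..L}) v" and rep: "\<forall>t\<in>{0..L}. c t = A + t *\<^sub>R B + double_primitive L v t"
    and vc: "integrable (lebesgue_on {0..L}) (\<lambda>s. norm (v s + c s) powr p)"
  shows "c \<in> Sobolev_sphere 2 p 0 L"
proof -
  define u where "u t = B + integral {0..t} v" for t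
  interpret R: regular_curve c u v A B L
    by unfold_locales (use L v rep in \<open>auto simp: u_def\<close>)
  have unit_Lp: "w \<in> Lp_space p 0 L" if w: "integrable (lebesgue_on {0..L}) w" "\<And>s. s \<in> {0..L} \<Longrightarrow> norm (w s) = 1" for w :: "real \<Rightarrow> real^3"
  proof -
    have "integrable (lebesgue_on {0..L}) (\<lambda>s. norm (w s) powr p) \<longleftrightarrow> integrable (lebesgue_on {0..L}) (\<lambda>s. 1 :: real)"
      by (rule Bochner_Integration.integrable_cong) (auto simp: space_restrict_space w(2))
    then show ?thesis using w(1) finite_measure.integrable_const[OF finite_measure_lebesgue_on_interval]
      by (auto simp: Lp_space_def)
  qed
  have cL: "c \<in> Lp_space p 0 L" by (rule unit_Lp[OF c_integrable_on c_norm])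
  have uL: "u \<in> Lp_space p 0 L" by (rule unit_Lp[OF R.sc.u_integrable R.unit_velocity])
  have "integrable (lebesgue_on {0..L}) (\<lambda>s. norm ((v s + c s) + - c s) powr p)"
  proof (rule powr_norm_add_unit_integrable[OF p _ vc])
    show "integrable (lebesgue_on {0..L}) (\<lambda>s. v s + c s)" using v c_integrable_on by (rule Bochner_Integration.integrable_add)
    show "(\<lambda>s. - c s) \<in> borel_measurable (lebesgue_on {0..L})" using c_measurable by measurable
  qed (simp add: c_norm)
  then have vL: "v \<in> Lp_space p 0 L" using borel_measurable_integrable[OF v] by (simp add: Lp_space_def)
  have "\<exists>w\<in>Lp_space p 0 L. has_weak_derivative 0 L j c w" if "j \<in> {1..2}" for j :: nat
  proof -
    have "j = 1 \<or> j = 2" using that by auto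
    then show ?thesis using R.sc.weak_derivatives uL vL by blast
  qed
  moreover have "AE s in lebesgue_on {0..L}. norm (c s) = 1" by (intro AE_I2) (simp add: space_restrict_space c_norm)
  ultimately show ?thesis using cL by (simp add: Sobolev_sphere_def Sobolev_def)
qed

end

theorem theorem1p1:
  fixes c :: "real \<Rightarrow> real^3" and L p :: real
  assumes "0 < L" and "1 < p"
    and "continuous_on {0..L} c" and "c ` {0..L} \<subseteq> sphere 0 1"
    and "rectifiable c 0 L"
    and "c 0 \<noteq> c L"
    and "arc_length_parametrized c L"
  shows "(p_curvature p c L < \<infinity> \<longleftrightarrow> c \<in> Sobolev_sphere 2 p 0 L) \<and>
    (c \<in> Sobolev_sphere 2 p 0 L \<longrightarrow>
      (\<forall>c' c''. has_weak_derivative 0 L 1 c c' \<longrightarrow> has_weak_derivative 0 L 2 c c'' \<longrightarrow>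
        p_curvature p c L =
          (\<integral>\<^sup>+ s. ennreal (\<bar>geod_curv (c s) (c' s) (c'' s)\<bar> powr p) \<partial>lebesgue_on {0..L}) \<and>
        p_curvature p c L =
          (\<integral>\<^sup>+ s. ennreal (norm (tangent_proj (c s) (c'' s)) powr p) \<partial>lebesgue_on {0..L})))"
proof -
  let ?M = "lebesgue_on {0..L}"
  note p = \<open>1 < p\<close>
  interpret unit_speed_curve c L using assms by unfold_locales
  have fwd: "c \<in> Sobolev_sphere 2 p 0 L" if fin: "p_curvature p c L < \<infinity>"
  proof -
    obtain K where K: "0 \<le> K" "p_curvature p c L < ennreal K"
    proof (cases "p_curvature p c L")
      case (real r)
      then have "p_curvature p c L < ennreal (r + 1)" by (simp add: ennreal_less_iff)
      then show ?thesis using that[of "r + 1"] real by simp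
    qed (use fin in simp)
    from finite_p_curvature_imp_acceleration[OF p K(2,1)] obtain A B v where
      "integrable ?M v" "\<forall>t\<in>{0..L}. c t = A + t *\<^sub>R B + double_primitive L v t" "integrable ?M (\<lambda>s. norm (v s + c s) powr p)" by blast
    then show ?thesis by (rule acceleration_imp_Sobolev_sphere[OF p])
  qed
  have main: "p_curvature p c L < \<infinity> \<and> (\<forall>c' c''. has_weak_derivative 0 L 1 c c' \<longrightarrow> has_weak_derivative 0 L 2 c c'' \<longrightarrow>
        p_curvature p c L = (\<integral>\<^sup>+ s. ennreal (\<bar>geod_curv (c s) (c' s) (c'' s)\<bar> powr p) \<partial>?M) \<and>
        p_curvature p c L = (\<integral>\<^sup>+ s. ennreal (norm (tangent_proj (c s) (c'' s)) powr p) \<partial>?M))"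
    if W: "c \<in> Sobolev_sphere 2 p 0 L"
  proof -
    from Sobolev_sphere_imp_acceleration[OF p W] obtain A B v where
      v: "integrable ?M v" "\<forall>t\<in>{0..L}. c t = A + t *\<^sub>R B + double_primitive L v t" "integrable ?M (\<lambda>s. norm (v s + c s) powr p)" by blast
    define u where "u t = B + integral {0..t} v" for t
    interpret R: regular_curve c u v A B L
      by unfold_locales (use L v in \<open>auto simp: u_def\<close>)
    define E where "E = (LINT s|?M. norm (v s + c s) powr p)"
    have up: "p_curvature p c L \<le> ennreal E" unfolding E_def by (rule R.p_curvature_upper[OF p v(3)])
    have low: "ennreal E \<le> p_curvature p c L"
    proof (rule ccontr)
      assume "\<not> ?thesis"
      then have "p_curvature p c L < ennreal E" by simp
      then obtain x where x: "p_curvature p c L < x" "x < ennreal E" using dense by blast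
      obtain K where K: "0 \<le> K" "x = ennreal K" using x(2) by (cases x) auto
      have KE: "K < E" using x(2) K by (simp add: ennreal_less_iff)
      from finite_p_curvature_imp_acceleration[OF p x(1)[unfolded K(2)] K(1)] obtain A' B' w where
        w: "integrable ?M w" "\<forall>t\<in>{0..L}. c t = A' + t *\<^sub>R B' + double_primitive L w t" "(LINT s|?M. norm (w s + c s) powr p) \<le> K" by blast
      interpret S: curve_with_acceleration c "\<lambda>t. B' + integral {0..t} w" w A' B' L
        by unfold_locales (use L w in auto)
      have ae: "AE s in ?M. v s = w s" by (rule weak_derivative_unique[OF R.sc.weak_derivatives(2) S.weak_derivatives(2)])
      have vm: "v \<in> borel_measurable ?M" "w \<in> borel_measurable ?M"
        using borel_measurable_integrable[OF v(1)] borel_measurable_integrable[OF w(1)] by auto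
      note [measurable] = vm c_measurable
      have "E = (LINT s|?M. norm (w s + c s) powr p)" unfolding E_def
      proof (rule integral_cong_AE)
        show "AE s in ?M. norm (v s + c s) powr p = norm (w s + c s) powr p" using ae by eventually_elim simp
      qed measurable
      then show False using w(3) KE by simp
    qed
    have eq: "p_curvature p c L = ennreal E" using up low by (rule antisym)
    have nn: "(\<integral>\<^sup>+ s. ennreal (norm (v s + c s) powr p) \<partial>?M) = ennreal E"
      unfolding E_def by (rule nn_integral_eq_integral[OF v(3)]) simp
    have "p_curvature p c L = (\<integral>\<^sup>+ s. ennreal (\<bar>geod_curv (c s) (c' s) (c'' s)\<bar> powr p) \<partial>?M) \<and>
        p_curvature p c L = (\<integral>\<^sup>+ s. ennreal (norm (tangent_proj (c s) (c'' s)) powr p) \<partial>?M)"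
      if c': "has_weak_derivative 0 L 1 c c'" and c'': "has_weak_derivative 0 L 2 c c''" for c' c''
    proof -
      have a1: "AE s in ?M. c' s = u s" by (rule weak_derivative_unique[OF c' R.sc.weak_derivatives(1)])
      have a2: "AE s in ?M. c'' s = v s" by (rule weak_derivative_unique[OF c'' R.sc.weak_derivatives(2)])
      have "(\<integral>\<^sup>+ s. ennreal (\<bar>geod_curv (c s) (c' s) (c'' s)\<bar> powr p) \<partial>?M) = ennreal E"
        unfolding nn[symmetric] by (rule nn_integral_cong_AE) (use a1 a2 R.curvature_ae in eventually_elim, simp)
      moreover have "(\<integral>\<^sup>+ s. ennreal (norm (tangent_proj (c s) (c'' s)) powr p) \<partial>?M) = ennreal E"
        unfolding nn[symmetric] by (rule nn_integral_cong_AE) (use a2 R.curvature_ae in eventually_elim, simp)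
      ultimately show ?thesis unfolding eq by simp
    qed
    moreover have "p_curvature p c L < \<infinity>" unfolding eq by simp
    ultimately show ?thesis by blast
  qed
  show ?thesis using fwd main by blast
qed

end
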